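(* Let $d\ge 3$, let $\Omega=\{x\in\mathbb{R}^d:|x|<1\}$, let $x^0\in\Omega$ and $\Omega_0=\Omega\setminus\{x^0\}$. Let $G$, $\gamma_0,\dots,\gamma_d$, $W^2_{2,\gamma}(\Omega_0)$ and $B_M$ be as defined in the context. Let $K:L_2(\Omega)\to W^2_{2,\gamma}(\Omega_0)$ be any linear operator which is continuous in the following sense: if $\|h_n\|_{L_2(\Omega)}\to0$ as $n\to\infty$, then $\gamma_j(Kh_n)\to0$ as $n\to\infty$ for every $j=0,1,\dots,d$. Then for every $f\in L_2(\Omega)$ the problem of pointwise perturbation $$B_Mu(x)=f(x),\quad x\in\Omega_0,\qquad u|_{\partial\Omega}=0,\qquad \gamma_j(u)=\gamma_j(KB_Mu),\quad j=0,1,\dots,d,$$ has a unique solution in $W^2_{2,\gamma}(\Omega_0)$, and it is represented as $$u(x)=\int_\Omega G(x,\xi)f(\xi)\,d\xi+\gamma_0(Kf)\,G(x,x^0)+\sum_{i=1}^d\gamma_i(Kf)\,\frac{\partial G(x,x^0)}{\partial\xi_i}.$$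
   Context: Functions are complex-valued. $W_2^2$ denotes the $L_2$-based Sobolev space of order 2, and $W^2_{2,loc}(\Omega_0)$ its local version on $\Omega_0$. Green function: with $C_d=-\frac{1}{(d-2)\sigma_d}$, where $\sigma_d$ is the surface area of the unit sphere in $\mathbb{R}^d$, $$G(x,\xi)=C_d\Big(|x-\xi|^{2-d}-|\xi|^{2-d}\,\big|x-\tfrac{\xi}{|\xi|^2}\big|^{2-d}\Big),$$ where for $\xi=0$ the second term is replaced by its limit $1$. It is the Green function of the Dirichlet problem $\Delta w=f$ in $\Omega$, $w|_{\partial\Omega}=0$. The symbol $\frac{\partial G(x,x^0)}{\partial \xi_i}$ denotes the partial derivative of $G(x,\xi)$ in the $i$-th component of the second argument $\xi$, evaluated at $\xi=x^0$. Functionals: for small $\delta>0$ let $\Pi^0_\delta=\{x:|x-x^0|\le\delta\}$, and let $\nu_t$ be the unit normal to $\partial\Pi_\delta^0$ at $t$ pointing towards $x^0$ (outward with respect to $\Omega\setminus\Pi^0_\delta$). Put $$\gamma_0(h)=-\lim_{\delta\to0+}\int_{\partial\Pi^0_\delta}\frac{\partial h}{\partial\nu_t}(t)\,dS_t,\qquad \gamma_s(h)=-d\lim_{\delta\to0+}\int_{\partial\Pi^0_\delta}\frac{t_s-x^0_s}{|t-x^0|}h(t)\,dS_t,\quad s=1,\dots,d,$$ whenever these limits exist and are finite. Space and maximal operator: $W^2_{2,\gamma}(\Omega_0)=D(B_M)$ is the set of all $u\in W^2_{2,loc}(\Omega_0)$ such that $\gamma_0(u),\dots,\gamma_d(u)$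 exist and are finite, $u|_{\partial\Omega}=0$, and $$u-\gamma_0(u)G(\cdot,x^0)-\sum_{s=1}^d\gamma_s(u)\frac{\partial G(\cdot,x^0)}{\partial\xi_s}\in W_2^2(\Omega).$$ On this domain $$B_Mu=\Delta\Big(u-\gamma_0(u)G(\cdot,x^0)-\sum_{s=1}^d\gamma_s(u)\frac{\partial G(\cdot,x^0)}{\partial\xi_s}\Big)\in L_2(\Omega).$$ *)

theory Defs
  imports "HOL-Analysis.Analysis"
begin

text \<open>Elements of \<open>L\<^sub>2\<close> and of the Sobolev spaces are represented by functions on the whole
  space, of which only the restriction to the domain \<open>U\<close>, up to null sets, is relevant:
  membership, weak derivatives, traces and the functionals below do not depend on the choice of
  representative.\<close>

definition L2 :: "'a measure \<Rightarrow> ('a \<Rightarrow> complex) set" where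
  "L2 M = {f \<in> borel_measurable M. integrable M (\<lambda>x. (norm (f x))\<^sup>2)}"

definition L2_norm :: "'a measure \<Rightarrow> ('a \<Rightarrow> complex) \<Rightarrow> real" where
  "L2_norm M f = sqrt (\<integral>x. (norm (f x))\<^sup>2 \<partial>M)"


section \<open>Weak derivatives and Sobolev spaces\<close>

definition part_deriv :: "'n \<Rightarrow> (real^'n \<Rightarrow> real) \<Rightarrow> real^'n \<Rightarrow> real" where
  "part_deriv i \<phi> x = deriv (\<lambda>t. \<phi> (x + t *\<^sub>R axis i 1)) 0"

primrec Ck :: "nat \<Rightarrow> (real^'n \<Rightarrow> real) \<Rightarrow> bool" where
  "Ck 0 \<phi> \<longleftrightarrow> continuous_on UNIV \<phi>"
| "Ck (Suc k) \<phi> \<longleftrightarrow> (\<forall>x. \<phi> differentiable (at x)) \<and> (\<forall>i. Ck k (part_deriv i \<phi>))"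

definition test_functions :: "(real^'n) set \<Rightarrow> (real^'n \<Rightarrow> real) set" where
  "test_functions U = {\<phi>. (\<forall>k. Ck k \<phi>) \<and>
     compact (closure {x. \<phi> x \<noteq> 0}) \<and> closure {x. \<phi> x \<noteq> 0} \<subseteq> U}"

definition locally_integrable :: "(real^'n) set \<Rightarrow> (real^'n \<Rightarrow> complex) \<Rightarrow> bool" where
  "locally_integrable U u \<longleftrightarrow> (\<forall>C. compact C \<and> C \<subseteq> U \<longrightarrow> u absolutely_integrable_on C)"

definition has_weak_deriv ::
  "(real^'n) set \<Rightarrow> 'n \<Rightarrow> (real^'n \<Rightarrow> complex) \<Rightarrow> (real^'n \<Rightarrow> complex) \<Rightarrow> bool" where
  "has_weak_deriv U i u v \<longleftrightarrow> locally_integrable U u \<and> locally_integrable U v \<and>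
     (\<forall>\<phi> \<in> test_functions U.
        (\<integral>x. part_deriv i \<phi> x *\<^sub>R u x \<partial>lebesgue_on U) = - (\<integral>x. \<phi> x *\<^sub>R v x \<partial>lebesgue_on U))"

text \<open>A representative; if a weak derivative exists, it is unique almost everywhere on an open
  set \<open>U\<close>.\<close>

definition weak_deriv ::
  "(real^'n) set \<Rightarrow> 'n \<Rightarrow> (real^'n \<Rightarrow> complex) \<Rightarrow> real^'n \<Rightarrow> complex" where
  "weak_deriv U i u = (SOME v. has_weak_deriv U i u v)"

definition weak_laplace :: "(real^'n) set \<Rightarrow> (real^'n \<Rightarrow> complex) \<Rightarrow> real^'n \<Rightarrow> complex" where
  "weak_laplace U u = (\<lambda>x. \<Sum>i\<in>UNIV. weak_deriv U i (weak_deriv U i u) x)"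

text \<open>\<open>W2 k U\<close> is the space \<open>W\<^sub>2\<^sup>k(U)\<close>: all iterated weak derivatives up to order \<open>k\<close> are in
  \<open>L\<^sub>2(U)\<close>.\<close>

primrec W2 :: "nat \<Rightarrow> (real^'n) set \<Rightarrow> (real^'n \<Rightarrow> complex) set" where
  "W2 0 U = L2 (lebesgue_on U)"
| "W2 (Suc k) U = {u \<in> L2 (lebesgue_on U). \<forall>i. \<exists>v \<in> W2 k U. has_weak_deriv U i u v}"

definition W2_loc :: "nat \<Rightarrow> (real^'n) set \<Rightarrow> (real^'n \<Rightarrow> complex) set" where
  "W2_loc k U = {u. \<forall>V. open V \<and> compact (closure V) \<and> closure V \<subseteq> U \<longrightarrow> u \<in> W2 k V}"

definition W21_norm :: "(real^'n) set \<Rightarrow> (real^'n \<Rightarrow> complex) \<Rightarrow> real" where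
  "W21_norm U u = sqrt ((L2_norm (lebesgue_on U) u)\<^sup>2 +
     (\<Sum>i\<in>UNIV. (L2_norm (lebesgue_on U) (weak_deriv U i u))\<^sup>2))"


section \<open>Surface measure and traces on spheres\<close>

text \<open>Surface measure on \<open>sphere a r\<close> for \<open>r > 0\<close>, via cones: on the unit sphere it assigns to a
  set \<open>E\<close> the value \<open>d\<close> times the volume of the cone over \<open>E\<close> in the unit ball.\<close>

definition sphere_measure :: "real^'n \<Rightarrow> real \<Rightarrow> (real^'n) measure" where
  "sphere_measure a r =
     density
       (distr (restrict_space lborel (ball 0 1 - {0})) (restrict_space borel (sphere a r))
          (\<lambda>x. a + (r / norm x) *\<^sub>R x))
       (\<lambda>_. ennreal (real CARD('n) * r ^ (CARD('n) - 1)))"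

text \<open>\<open>T\<close> is the trace on \<open>sphere a r\<close> of the function \<open>g\<close>, which is of class \<open>W\<^sub>2\<^sup>1\<close> in \<open>U\<close> near that
  sphere: the trace is the extension by continuity of the restriction map from
  \<open>W\<^sub>2\<^sup>1 \<inter> C(closure)\<close>. Only a neighbourhood \<open>V\<close> of the sphere matters, so that functions which are
  singular elsewhere in \<open>U\<close> are covered.\<close>

definition has_trace ::
  "(real^'n) set \<Rightarrow> real^'n \<Rightarrow> real \<Rightarrow> (real^'n \<Rightarrow> complex) \<Rightarrow> (real^'n \<Rightarrow> complex) \<Rightarrow> bool" where
  "has_trace U a r g T \<longleftrightarrow>
     sphere a r \<subseteq> frontier U \<and> T \<in> L2 (sphere_measure a r) \<and>
     (\<exists>V \<phi>. open V \<and> sphere a r \<subseteq> V \<and> g \<in> W2 1 (U \<inter> V) \<and>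
        (\<forall>n. \<phi> n \<in> W2 1 (U \<inter> V) \<and> continuous_on (closure (U \<inter> V)) (\<phi> n)) \<and>
        (\<lambda>n. W21_norm (U \<inter> V) (\<lambda>x. \<phi> n x - g x)) \<longlonglongrightarrow> 0 \<and>
        (\<lambda>n. L2_norm (sphere_measure a r) (\<lambda>t. \<phi> n t - T t)) \<longlonglongrightarrow> 0)"

definition sphere_trace ::
  "(real^'n) set \<Rightarrow> real^'n \<Rightarrow> real \<Rightarrow> (real^'n \<Rightarrow> complex) \<Rightarrow> real^'n \<Rightarrow> complex" where
  "sphere_trace U a r g = (SOME T. has_trace U a r g T)"


section \<open>The Green function of the unit ball\<close>

definition C_dim :: "'n::finite itself \<Rightarrow> real" where
  "C_dim _ = - 1 / ((real CARD('n) - 2) * measure (sphere_measure (0::real^'n) 1) (sphere 0 1))"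

text \<open>On the diagonal \<open>x = \<xi>\<close> the value is irrelevant (\<open>0 powr a = 0\<close>).\<close>

definition G :: "real^'n \<Rightarrow> real^'n \<Rightarrow> real" where
  "G x \<xi> = C_dim TYPE('n) *
     (norm (x - \<xi>) powr (2 - real CARD('n)) -
      (if \<xi> = 0 then 1
       else norm \<xi> powr (2 - real CARD('n)) *
            norm (x - (1 / (norm \<xi>)\<^sup>2) *\<^sub>R \<xi>) powr (2 - real CARD('n))))"

definition dG :: "'n \<Rightarrow> real^'n \<Rightarrow> real^'n \<Rightarrow> real" where
  "dG i x \<xi> = part_deriv i (\<lambda>\<eta>. G x \<eta>) \<xi>"


section \<open>The functionals, the space and the maximal operator\<close>

abbreviation Om :: "(real^'n) set" where
  "Om \<equiv> ball 0 1"

abbreviation Om0 :: "real^'n \<Rightarrow> (real^'n) set" where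
  "Om0 x0 \<equiv> Om - {x0}"

text \<open>Integral over \<open>sphere x0 \<delta>\<close> of the normal derivative of \<open>h\<close>, the normal pointing towards
  \<open>x0\<close>.\<close>

definition normal_flux :: "real^'n \<Rightarrow> (real^'n \<Rightarrow> complex) \<Rightarrow> real \<Rightarrow> complex" where
  "normal_flux x0 h \<delta> =
     (\<integral>t. (\<Sum>i\<in>UNIV. ((x0 $ i - t $ i) / norm (t - x0)) *\<^sub>R
              sphere_trace (Om - cball x0 \<delta>) x0 \<delta> (weak_deriv (Om0 x0) i h) t)
        \<partial>sphere_measure x0 \<delta>)"

definition sphere_moment :: "real^'n \<Rightarrow> 'n \<Rightarrow> (real^'n \<Rightarrow> complex) \<Rightarrow> real \<Rightarrow> complex" where
  "sphere_moment x0 s h \<delta> =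
     (\<integral>t. ((t $ s - x0 $ s) / norm (t - x0)) *\<^sub>R sphere_trace (Om - cball x0 \<delta>) x0 \<delta> h t
        \<partial>sphere_measure x0 \<delta>)"

text \<open>The values of \<open>gamma0\<close> and \<open>gamma\<close> are meaningful only if the limits exist, as required by
  \<open>gammas_exist\<close>.\<close>

definition gamma0 :: "real^'n \<Rightarrow> (real^'n \<Rightarrow> complex) \<Rightarrow> complex" where
  "gamma0 x0 h = - Lim (at_right 0) (normal_flux x0 h)"

definition gamma :: "real^'n \<Rightarrow> 'n \<Rightarrow> (real^'n \<Rightarrow> complex) \<Rightarrow> complex" where
  "gamma x0 s h = - of_nat CARD('n) * Lim (at_right 0) (sphere_moment x0 s h)"

definition gammas_exist :: "real^'n \<Rightarrow> (real^'n \<Rightarrow> complex) \<Rightarrow> bool" where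
  "gammas_exist x0 h \<longleftrightarrow> (\<exists>l. (normal_flux x0 h \<longlongrightarrow> l) (at_right 0)) \<and>
     (\<forall>s. \<exists>l. (sphere_moment x0 s h \<longlongrightarrow> l) (at_right 0))"

definition regular_part :: "real^'n \<Rightarrow> (real^'n \<Rightarrow> complex) \<Rightarrow> real^'n \<Rightarrow> complex" where
  "regular_part x0 u = (\<lambda>x. u x - gamma0 x0 u * of_real (G x x0)
     - (\<Sum>s\<in>UNIV. gamma x0 s u * of_real (dG s x x0)))"

definition W22_gamma :: "real^'n \<Rightarrow> (real^'n \<Rightarrow> complex) set" where
  "W22_gamma x0 = {u \<in> W2_loc 2 (Om0 x0). gammas_exist x0 u \<and>
     has_trace (Om0 x0) 0 1 u (\<lambda>_. 0) \<and> regular_part x0 u \<in> W2 2 Om}"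

definition B_M :: "real^'n \<Rightarrow> (real^'n \<Rightarrow> complex) \<Rightarrow> real^'n \<Rightarrow> complex" where
  "B_M x0 u = weak_laplace Om (regular_part x0 u)"

text \<open>A linear operator from \<open>L\<^sub>2(\<Omega>)\<close> to \<open>W22_gamma x0\<close>; the second condition says that it is well
  defined on classes modulo equality almost everywhere.\<close>

definition linear_L2_W22_gamma ::
  "real^'n \<Rightarrow> ((real^'n \<Rightarrow> complex) \<Rightarrow> (real^'n \<Rightarrow> complex)) \<Rightarrow> bool" where
  "linear_L2_W22_gamma x0 K \<longleftrightarrow>
     (\<forall>h \<in> L2 (lebesgue_on Om). K h \<in> W22_gamma x0) \<and>
     (\<forall>g \<in> L2 (lebesgue_on Om). \<forall>h \<in> L2 (lebesgue_on Om).
        (AE x in lebesgue_on Om. g x = h x) \<longrightarrow> (AE x in lebesgue_on Om. K g x = K h x)) \<and>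
     (\<forall>g \<in> L2 (lebesgue_on Om). \<forall>h \<in> L2 (lebesgue_on Om).
        AE x in lebesgue_on Om. K (\<lambda>y. g y + h y) x = K g x + K h x) \<and>
     (\<forall>c. \<forall>h \<in> L2 (lebesgue_on Om). AE x in lebesgue_on Om. K (\<lambda>y. c * h y) x = c * K h x)"

definition gamma_continuous ::
  "real^'n \<Rightarrow> ((real^'n \<Rightarrow> complex) \<Rightarrow> (real^'n \<Rightarrow> complex)) \<Rightarrow> bool" where
  "gamma_continuous x0 K \<longleftrightarrow>
     (\<forall>h. (\<forall>n. h n \<in> L2 (lebesgue_on Om)) \<and> (\<lambda>n::nat. L2_norm (lebesgue_on Om) (h n)) \<longlonglongrightarrow> 0 \<longrightarrow>
        (\<lambda>n. gamma0 x0 (K (h n))) \<longlonglongrightarrow> 0 \<and> (\<forall>s. (\<lambda>n. gamma x0 s (K (h n))) \<longlonglongrightarrow> 0))"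

text \<open>The boundary condition on the unit sphere is part of the membership in \<open>W22_gamma x0\<close>; it is
  repeated here because it belongs to the boundary value problem.\<close>

definition solves_problem ::
  "real^'n \<Rightarrow> ((real^'n \<Rightarrow> complex) \<Rightarrow> (real^'n \<Rightarrow> complex)) \<Rightarrow> (real^'n \<Rightarrow> complex) \<Rightarrow>
   (real^'n \<Rightarrow> complex) \<Rightarrow> bool" where
  "solves_problem x0 K f u \<longleftrightarrow>
     u \<in> W22_gamma x0 \<and>
     (AE x in lebesgue_on (Om0 x0). B_M x0 u x = f x) \<and>
     has_trace (Om0 x0) 0 1 u (\<lambda>_. 0) \<and>
     gamma0 x0 u = gamma0 x0 (K (B_M x0 u)) \<and>
     (\<forall>s. gamma x0 s u = gamma x0 s (K (B_M x0 u)))"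

end

theory Submission
 imports Defs
begin

text \<open>Every \<open>u\<close> in the space is \<open>w + \<gamma>\<^sub>0 G + \<Sum>\<^sub>s \<gamma>\<^sub>s \<partial>G/\<partial>\<xi>\<^sub>s\<close> with \<open>w\<close> of class \<open>W\<^sub>2\<^sup>2\<close> and of zero trace, and
 \<open>B\<^sub>M u = \<Delta> w\<close>. For existence, \<open>q \<mapsto> \<Delta>((1 - |x|^2) q)\<close> maps the polynomials onto themselves and
 \<open>\<parallel>D\<^sup>2 p\<parallel> \<le> \<parallel>\<Delta> p\<parallel>\<close> for \<open>p = (1 - |x|^2) q\<close>, so \<open>\<Delta> w = f\<close> is solved by approximating \<open>f\<close> with polynomials.
 For the representation, \<open>p(x) = \<integral> G(x, y) \<Delta> p(y) dy\<close> and Green's formula, tested with all such \<open>p\<close>,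
 give \<open>w = \<integral> G f\<close>. On small spheres around \<open>x\<^sup>0\<close> the regular part contributes to the functionals only
 integrals over shrinking balls, while the singular part contributes constants; so \<open>\<gamma>\<^sub>j\<close> reads off the
 coefficients of \<open>w + c\<^sub>0 G + \<Sum>\<^sub>s c\<^sub>s \<partial>G/\<partial>\<xi>\<^sub>s\<close>, and the problem forces and admits \<open>c\<^sub>j = \<gamma>\<^sub>j(K f)\<close>.\<close>

text \<open>The objects of the problem are given by a choice operator: weak derivatives and traces
  on small spheres are arbitrary representatives. What is needed about them is therefore extracted
  from integral identities valid for every admissible choice, so the surface integrals in the
  functionals are evaluated without uniqueness of traces. The unit ball enters through the fact that
  a polynomial right-hand side has a polynomial solution of the Dirichlet problem; this gives
  existence, and the same surjectivity supplies enough test functions to identify \<open>w\<close>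
  with the Green potential. Boundary terms need a divergence theorem for the surface measure defined
  by cones; it rests on translation invariance of Lebesgue measure. Kernels are regularized by
  adding \<open>e\<close> to the squared distance, both at the pole and at its image, so that
  boundary values stay exactly zero. As for signs and constants, \<open>C_dim\<close> gives the
  singular part of the Green function outward flux 1, and the derivative with index \<open>s\<close>
  has first moment \<open>-1/d\<close>; the minus sign of \<open>gamma0\<close> with the inward
  normal and the factor \<open>-d\<close> of \<open>gamma\<close> invert these numbers.\<close>

abbreviation (input) pd :: "'n \<Rightarrow> (real^'n \<Rightarrow> real) \<Rightarrow> real^'n \<Rightarrow> real" where
 "pd \<equiv> part_deriv"

abbreviation (input) leb :: "'a::euclidean_space set \<Rightarrow> 'a measure" where
 "leb \<equiv> lebesgue_on"

section \<open>Elementary smooth functions\<close>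

text \<open>The powers of \<open>1/s\<close> are carried along so that the family is closed under
  differentiation; \<open>flat 0\<close> is the classical smooth function that vanishes to infinite
  order at 0.\<close>

definition flat :: "nat \<Rightarrow> real \<Rightarrow> real" where
 "flat m s = (if s > 0 then exp (- 1 / s) / s ^ m else 0)"

lemma flat_tendsto_0: "(flat m \<longlongrightarrow> 0) (at 0)"
proof (subst filterlim_at_split, intro conjI)
 have "eventually (\<lambda>s. flat m s = 0) (at_left (0::real))"
  by (auto simp: flat_def eventually_at_filter)
 then show "(flat m \<longlongrightarrow> 0) (at_left 0)"
  by (rule tendsto_eventually)
 have "((\<lambda>s::real. inverse s ^ m / exp (inverse s)) \<longlongrightarrow> 0) (at_right 0)"
  by (rule filterlim_compose[OF tendsto_power_div_exp_0 filterlim_inverse_at_top_right])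
 moreover have "eventually (\<lambda>s. inverse s ^ m / exp (inverse s) = flat m s) (at_right (0::real))"
  by (auto simp: flat_def eventually_at_filter exp_minus field_simps power_inverse)
 ultimately show "(flat m \<longlongrightarrow> 0) (at_right 0)"
  by (rule Lim_transform_eventually)
qed

lemma DERIV_flat: "(flat m has_real_derivative (flat (m+2) s - real m * flat (m+1) s)) (at s)"
proof -
 consider "s > 0" | "s < 0" | "s = 0" by linarith
 then show ?thesis
 proof cases
  case 1
  have "((\<lambda>s. exp (- 1 / s) / s ^ m) has_real_derivative (flat (m+2) s - real m * flat (m+1) s)) (at s)"
  proof (cases m)
   case (Suc k)
   have "s ^ k = (if k = 0 then 1 else s * s ^ (k - Suc 0))" by (cases k) auto
   with 1 Suc show ?thesis
    by (auto intro!: derivative_eq_intros simp: flat_def field_simps power2_eq_square)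
  qed (use 1 in \<open>auto intro!: derivative_eq_intros simp: flat_def field_simps power2_eq_square\<close>)
  moreover have "eventually (\<lambda>s. exp (- 1 / s) / s ^ m = flat m s) (nhds s)"
   using eventually_nhds_in_open[of "{0<..}" s] 1
   by (auto simp: flat_def elim!: eventually_mono)
  ultimately show ?thesis
   using DERIV_cong_ev[OF refl, of "\<lambda>s. exp (- 1 / s) / s ^ m" "flat m" s] by blast
 next
  case 2
  have "eventually (\<lambda>s. 0 = flat m s) (nhds s)"
   using eventually_nhds_in_open[of "{..<0}" s] 2
   by (auto simp: flat_def elim!: eventually_mono)
  then show ?thesis
   using DERIV_cong_ev[OF refl, of "\<lambda>s. 0" "flat m" s 0 0] 2 by (simp add: flat_def[of _ s])
 next
  case 3
  \<comment> \<open>The difference quotient of \<open>flat m\<close> at 0 is literally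
    \<open>flat (m + 1)\<close>, so differentiability at 0 is the limit shown before; the claimed
    derivative is 0 there because both of its terms vanish.\<close>
  have "(\<lambda>y. (flat m y - flat m 0) / (y - 0)) = flat (m+1)"
   by (auto simp: flat_def fun_eq_iff)
  then show ?thesis
   using flat_tendsto_0[of "m+1"] 3 by (simp add: has_field_derivative_iff) (simp add: flat_def)
 qed
qed

lemma continuous_on_flat: "continuous_on A (flat m)"
 by (intro continuous_at_imp_continuous_on ballI DERIV_isCont[OF DERIV_flat])

lemma flat_nonneg: "flat m s \<ge> 0"
 by (simp add: flat_def)

lemma flat_pos_iff: "flat m s > 0 \<longleftrightarrow> s > 0"
 by (simp add: flat_def)

text \<open>A class of smooth functions, closed under partial derivatives, that contains cutoff functions
 (built from \<open>flat\<close>) as well as the powers of positive functions occurring in \<open>G\<close>.\<close>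

inductive elementary :: "(real^'n) set \<Rightarrow> (real^'n \<Rightarrow> real) \<Rightarrow> bool" for U where
 const: "elementary U (\<lambda>x. c)"
| coord: "elementary U (\<lambda>x. x $ i)"
| add: "elementary U f \<Longrightarrow> elementary U g \<Longrightarrow> elementary U (\<lambda>x. f x + g x)"
| mult: "elementary U f \<Longrightarrow> elementary U g \<Longrightarrow> elementary U (\<lambda>x. f x * g x)"
| pow: "elementary U f \<Longrightarrow> (\<And>x. x \<in> U \<Longrightarrow> 0 < f x) \<Longrightarrow> elementary U (\<lambda>x. f x powr b)"
| flat: "elementary U f \<Longrightarrow> elementary U (\<lambda>x. flat m (f x))"
| cong: "elementary U f \<Longrightarrow> (\<And>x. x \<in> U \<Longrightarrow> f x = g x) \<Longrightarrow> elementary U g"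

abbreviation (input) elem :: "(real^'n \<Rightarrow> real) \<Rightarrow> bool" where
 "elem \<equiv> elementary UNIV"

lemmas elem_intros = elementary.const elementary.coord elementary.add elementary.mult elementary.flat

lemma elem_cmult: "elementary U f \<Longrightarrow> elementary U (\<lambda>x. c * f x)"
 by (intro elem_intros)

lemma elem_minus: "elementary U f \<Longrightarrow> elementary U (\<lambda>x. - f x)"
 using elem_cmult[of U f "-1"] by simp

lemma elem_diff: "elementary U f \<Longrightarrow> elementary U g \<Longrightarrow> elementary U (\<lambda>x. f x - g x)"
 using elementary.add[OF _ elem_minus[of U g], of f] by simp

lemma elem_power: "elementary U f \<Longrightarrow> elementary U (\<lambda>x. f x ^ k)"
 by (induction k) (auto intro: elem_intros)

lemma elem_sum: "(\<And>i. i \<in> I \<Longrightarrow> elementary U (f i)) \<Longrightarrow> elementary U (\<lambda>x. \<Sum>i\<in>I. f i x)"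
 by (induction I rule: infinite_finite_induct) (auto intro: elem_intros)

lemma elem_divide: "elementary U f \<Longrightarrow> elementary U (\<lambda>x. f x / c)"
 using elem_cmult[of U f "1/c"] by simp

lemma norm_pow2_vec: "(norm (x::real^'n))^2 = (\<Sum>i\<in>UNIV. (x $ i)^2)"
 by (simp add: norm_vec_def L2_set_def sum_nonneg)

lemma elem_norm2: "elementary U (\<lambda>x. (norm (x - a))^2)"
 unfolding norm_pow2_vec by (intro elem_sum elem_power) (auto intro: elem_diff elem_intros)

lemma elem_norm2_0: "elementary U (\<lambda>x. (norm x)^2)"
 using elem_norm2[of U 0] by simp

lemma elem_inner: "elementary U (\<lambda>x. a \<bullet> x)"
 unfolding inner_vec_def by (intro elem_sum) (auto intro: elem_intros)

lemmas elem_simps = elem_intros elem_cmult elem_minus elem_diff elem_power elem_sum elem_divide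
 elem_norm2 elem_norm2_0 elem_inner

lemma sum_axis_mult: "(\<Sum>j\<in>UNIV. axis i 1 $ j * g j) = (g i::real)"
proof -
 have "axis i 1 $ j * g j = (if j = i then g j else 0)" for j by (simp add: axis_def)
 then show ?thesis by simp
qed

text \<open>The gradient is built along the derivation as a witness \<open>D\<close> inside the
  class; its identification with \<open>part_deriv\<close> has to wait until differentiability is
  known. Iterating gives smoothness of all orders.\<close>

lemma elementary_deriv_ex:
 fixes f :: "real^'n \<Rightarrow> real"
 assumes "elementary U f"
 shows "\<exists>D. (\<forall>i. elementary U (D i)) \<and>
  (open U \<longrightarrow> (\<forall>x\<in>U. (f has_derivative (\<lambda>h. \<Sum>i\<in>UNIV. h $ i * D i x)) (at x)))"
 using assms
proof induction
 case (const c)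
 then show ?case by (intro exI[of _ "\<lambda>i x. 0"]) (auto intro: elem_intros)
next
 case (coord j)
 have "h $ i * (if i = j then 1 else 0) = (if i = j then h $ i else 0)" for h :: "real^'n" and i by simp
 then have *: "(\<lambda>h. \<Sum>i\<in>UNIV. h $ i * (if i = j then 1 else 0)) = (\<lambda>h::real^'n. h $ j)"
  by simp
 have "((\<lambda>x. x $ j) has_derivative (\<lambda>h. \<Sum>i\<in>UNIV. h $ i * (if i = j then 1 else 0))) (at x)"
  for x :: "real^'n"
  unfolding * by (intro bounded_linear_imp_has_derivative bounded_linear_vec_nth)
 then show ?case
  by (intro exI[of _ "\<lambda>i x. if i = j then 1 else 0"] conjI allI impI ballI elementary.const)
next
 case (add f g)
 from add.IH(1) obtain D where D: "\<forall>i. elementary U (D i)"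
  "open U \<longrightarrow> (\<forall>x\<in>U. (f has_derivative (\<lambda>h. \<Sum>i\<in>UNIV. h $ i * D i x)) (at x))" by (elim exE conjE)
 from add.IH(2) obtain E where E: "\<forall>i. elementary U (E i)"
  "open U \<longrightarrow> (\<forall>x\<in>U. (g has_derivative (\<lambda>h. \<Sum>i\<in>UNIV. h $ i * E i x)) (at x))" by (elim exE conjE)
 note e = D(1)[rule_format] E(1)[rule_format] and d = D(2)[rule_format] E(2)[rule_format]
 have "((\<lambda>x. f x + g x) has_derivative (\<lambda>h. \<Sum>i\<in>UNIV. h $ i * (D i x + E i x))) (at x)"
  if "open U" "x \<in> U" for x
  using has_derivative_add[OF d(1)[OF that] d(2)[OF that]] by (simp add: distrib_left sum.distrib)
 then show ?case
  using e by (intro exI[of _ "\<lambda>i x. D i x + E i x"]) (auto intro!: elem_intros)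
next
 case (mult f g)
 from mult.IH(1) obtain D where D: "\<forall>i. elementary U (D i)"
  "open U \<longrightarrow> (\<forall>x\<in>U. (f has_derivative (\<lambda>h. \<Sum>i\<in>UNIV. h $ i * D i x)) (at x))" by (elim exE conjE)
 from mult.IH(2) obtain E where E: "\<forall>i. elementary U (E i)"
  "open U \<longrightarrow> (\<forall>x\<in>U. (g has_derivative (\<lambda>h. \<Sum>i\<in>UNIV. h $ i * E i x)) (at x))" by (elim exE conjE)
 note e = D(1)[rule_format] E(1)[rule_format] and d = D(2)[rule_format] E(2)[rule_format]
 have "((\<lambda>x. f x * g x) has_derivative (\<lambda>h. \<Sum>i\<in>UNIV. h $ i * (f x * E i x + D i x * g x))) (at x)"
  if "open U" "x \<in> U" for x
 proof -
  have eq: "(\<lambda>h. f x * (\<Sum>i\<in>UNIV. h $ i * E i x) + (\<Sum>i\<in>UNIV. h $ i * D i x) * g x) =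
   (\<lambda>h. \<Sum>i\<in>UNIV. h $ i * (f x * E i x + D i x * g x))"
   by (simp add: sum_distrib_left sum_distrib_right sum.distrib[symmetric] distrib_left mult_ac)
  from has_derivative_mult[OF d(1)[OF that] d(2)[OF that], unfolded eq] show ?thesis .
 qed
 then show ?case
  using e mult.hyps by (intro exI[of _ "\<lambda>i x. f x * E i x + D i x * g x"]) (auto intro!: elem_intros)
next
 case (pow f b)
 from pow.IH obtain D where D: "\<forall>i. elementary U (D i)"
  "open U \<longrightarrow> (\<forall>x\<in>U. (f has_derivative (\<lambda>h. \<Sum>i\<in>UNIV. h $ i * D i x)) (at x))" by (elim exE conjE)
 note e = D(1)[rule_format] and d = D(2)[rule_format]
 have "((\<lambda>x. f x powr b) has_derivative (\<lambda>h. \<Sum>i\<in>UNIV. h $ i * (b * f x powr (b-1) * D i x))) (at x)"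
  if "open U" "x \<in> U" for x
 proof -
  have "((\<lambda>z. z powr b) has_derivative (*) (b * f x powr (b - 1))) (at (f x))"
   using has_real_derivative_powr[OF pow.hyps(2)[OF \<open>x \<in> U\<close>], of b]
   unfolding has_field_derivative_def .
  from has_derivative_compose[OF d[OF that] this]
  show ?thesis by (simp add: sum_distrib_left mult_ac)
 qed
 then show ?case
  by (intro exI[of _ "\<lambda>i x. b * f x powr (b-1) * D i x"] conjI allI impI ballI
    elementary.mult[OF elementary.mult[OF elementary.const elementary.pow[OF pow.hyps]] e]) auto
next
 case (flat f m)
 from flat.IH obtain D where D: "\<forall>i. elementary U (D i)"
  "open U \<longrightarrow> (\<forall>x\<in>U. (f has_derivative (\<lambda>h. \<Sum>i\<in>UNIV. h $ i * D i x)) (at x))" by (elim exE conjE)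
 note e = D(1)[rule_format] and d = D(2)[rule_format]
 have "((\<lambda>x. flat m (f x)) has_derivative (\<lambda>h. \<Sum>i\<in>UNIV. h $ i * ((flat (m+2) (f x) - real m * flat (m+1) (f x)) * D i x))) (at x)"
  if "open U" "x \<in> U" for x
  using has_derivative_compose[OF d[OF that] DERIV_flat[of m "f x", unfolded has_field_derivative_def]]
  by (simp add: sum_distrib_left sum_distrib_right mult_ac)
 then show ?case
  by (intro exI[of _ "\<lambda>i x. (flat (m+2) (f x) - real m * flat (m+1) (f x)) * D i x"] conjI allI impI ballI
    elementary.mult[OF elem_diff[OF elementary.flat[OF flat.hyps] elem_cmult[OF elementary.flat[OF flat.hyps]]] e]) auto
next
 case (cong f g)
 from cong.IH obtain D where D: "\<forall>i. elementary U (D i)"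
  "open U \<longrightarrow> (\<forall>x\<in>U. (f has_derivative (\<lambda>h. \<Sum>i\<in>UNIV. h $ i * D i x)) (at x))" by (elim exE conjE)
 note e = D(1)[rule_format] and d = D(2)[rule_format]
 have "(g has_derivative (\<lambda>h. \<Sum>i\<in>UNIV. h $ i * D i x)) (at x)" if "open U" "x \<in> U" for x
  by (rule has_derivative_transform_within_open[OF d[OF that] that]) (use cong in auto)
 then show ?case using e by blast
qed

text \<open>The bridge from the total derivative to the difference quotient along a coordinate axis;
  the rules for sums, products and compositions below are read off the corresponding rules for
  \<open>has_derivative\<close>.\<close>

lemma part_deriv_eq:
 assumes "(f has_derivative D) (at x)"
 shows "pd i f x = D (axis i 1)"
proof -
 have "((\<lambda>t::real. x + t *\<^sub>R axis i 1) has_derivative (\<lambda>t. t *\<^sub>R axis i 1)) (at 0)"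
  by (auto intro!: derivative_eq_intros)
 from has_derivative_compose[OF this, of f D] assms
 have "((\<lambda>t. f (x + t *\<^sub>R axis i 1)) has_derivative (\<lambda>t. D (t *\<^sub>R axis i 1))) (at 0)" by simp
 moreover have "(\<lambda>t. D (t *\<^sub>R axis i 1)) = (*) (D (axis i 1))"
  using has_derivative_linear[OF assms] by (auto simp: linear_cmul)
 ultimately have "((\<lambda>t. f (x + t *\<^sub>R axis i 1)) has_field_derivative D (axis i 1)) (at 0)"
  by (simp add: has_field_derivative_def)
 then show ?thesis by (simp add: part_deriv_def DERIV_imp_deriv)
qed

lemma vec_sum_axis: "(h::real^'n) = (\<Sum>i\<in>UNIV. (h $ i) *\<^sub>R axis i 1)"
 by (simp add: vec_eq_iff axis_def if_distrib cong: if_cong)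

lemma has_derivative_part_deriv:
 fixes f :: "real^'n \<Rightarrow> real"
 assumes "f differentiable (at x)"
 shows "(f has_derivative (\<lambda>h. \<Sum>i\<in>UNIV. h $ i * pd i f x)) (at x)"
proof -
 obtain D where D: "(f has_derivative D) (at x)" using assms by (auto simp: differentiable_def)
 have lin: "linear D" using has_derivative_linear[OF D] .
 have "D h = (\<Sum>i\<in>UNIV. h $ i * pd i f x)" for h
  by (subst vec_sum_axis[of h]) (simp add: linear_sum[OF lin] linear_cmul[OF lin] part_deriv_eq[OF D])
 then have "D = (\<lambda>h. \<Sum>i\<in>UNIV. h $ i * pd i f x)" by auto
 then show ?thesis using D by simp
qed

lemma elem_differentiable:
 "elementary U f \<Longrightarrow> open U \<Longrightarrow> x \<in> U \<Longrightarrow> f differentiable (at x)"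
 using elementary_deriv_ex[of U f] by (auto simp: differentiable_def)

lemma elem_part_deriv:
 fixes f :: "real^'n \<Rightarrow> real"
 assumes "elementary U f" "open U"
 shows "elementary U (pd i f)"
proof -
 obtain D where e: "\<And>i. elementary U (D i)"
  and d: "\<And>x. x \<in> U \<Longrightarrow> (f has_derivative (\<lambda>h. \<Sum>i\<in>UNIV. h $ i * D i x)) (at x)"
  using elementary_deriv_ex[OF assms(1)] assms(2) by metis
 have "D i x = pd i f x" if "x \<in> U" for x
  by (simp add: part_deriv_eq[OF d[OF that]] sum_axis_mult)
 with e show ?thesis by (rule elementary.cong)
qed

lemma elem_continuous_on: "elementary U f \<Longrightarrow> open U \<Longrightarrow> continuous_on U f"
 by (intro continuous_at_imp_continuous_on ballI differentiable_imp_continuous_within elem_differentiable)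

section \<open>Rules for partial derivatives\<close>

lemma part_deriv_const: "pd i (\<lambda>x. c) x = 0"
 by (simp add: part_deriv_def)

lemma part_deriv_coord: "pd i (\<lambda>x. x $ j) x = (if i = j then 1 else 0)"
proof -
 have "((\<lambda>x. x $ j) has_derivative (\<lambda>h. h $ j)) (at x)"
  by (intro bounded_linear_imp_has_derivative bounded_linear_vec_nth)
 from part_deriv_eq[OF this] show ?thesis by (simp add: axis_def)
qed

lemma part_deriv_add:
 fixes f :: "real^'n \<Rightarrow> real"
 assumes "f differentiable (at x)" "g differentiable (at x)"
 shows "pd i (\<lambda>x. f x + g x) x = pd i f x + pd i g x"
proof -
 obtain D E where *: "(f has_derivative D) (at x)" "(g has_derivative E) (at x)"
  using assms by (auto simp: differentiable_def)
 show ?thesis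
  by (simp add: part_deriv_eq[OF *(1)] part_deriv_eq[OF *(2)] part_deriv_eq[OF has_derivative_add[OF *]])
qed

lemma part_deriv_mult:
 fixes f :: "real^'n \<Rightarrow> real"
 assumes "f differentiable (at x)" "g differentiable (at x)"
 shows "pd i (\<lambda>x. f x * g x) x = pd i f x * g x + f x * pd i g x"
proof -
 obtain D E where *: "(f has_derivative D) (at x)" "(g has_derivative E) (at x)"
  using assms by (auto simp: differentiable_def)
 show ?thesis
  by (simp add: part_deriv_eq[OF *(1)] part_deriv_eq[OF *(2)] part_deriv_eq[OF has_derivative_mult[OF *]])
qed

lemma part_deriv_cmult:
 fixes f :: "real^'n \<Rightarrow> real"
 assumes "f differentiable (at x)"
 shows "pd i (\<lambda>x. c * f x) x = c * pd i f x"
 using part_deriv_mult[OF differentiable_const assms] by (simp add: part_deriv_const)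

lemma part_deriv_diff:
 fixes f :: "real^'n \<Rightarrow> real"
 assumes "f differentiable (at x)" "g differentiable (at x)"
 shows "pd i (\<lambda>x. f x - g x) x = pd i f x - pd i g x"
proof -
 obtain D E where *: "(f has_derivative D) (at x)" "(g has_derivative E) (at x)"
  using assms by (auto simp: differentiable_def)
 show ?thesis
  by (simp add: part_deriv_eq[OF *(1)] part_deriv_eq[OF *(2)] part_deriv_eq[OF has_derivative_diff[OF *]])
qed

lemma part_deriv_chain:
 fixes f :: "real^'n \<Rightarrow> real"
 assumes "f differentiable (at x)" "(\<phi> has_real_derivative \<phi>') (at (f x))"
 shows "pd i (\<lambda>x. \<phi> (f x)) x = \<phi>' * pd i f x"
proof -
 obtain D where *: "(f has_derivative D) (at x)"
  using assms by (auto simp: differentiable_def)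
 show ?thesis
  using part_deriv_eq[OF has_derivative_compose[OF * assms(2)[unfolded has_field_derivative_def]]]
  by (simp add: part_deriv_eq[OF *(1)])
qed

lemma part_deriv_powr:
 fixes f :: "real^'n \<Rightarrow> real"
 assumes "f differentiable (at x)" "f x > 0"
 shows "pd i (\<lambda>x. f x powr b) x = b * f x powr (b - 1) * pd i f x"
 by (rule part_deriv_chain[OF assms(1) has_real_derivative_powr[OF assms(2)]])

text \<open>A short piece of the coordinate line through \<open>x\<close> stays in the open set, so
  a partial derivative is a local quantity. This is used wherever a cutoff equals 1 or 0 near a
  point.\<close>

lemma part_deriv_cong:
 assumes "open U" "x \<in> U" "\<And>y. y \<in> U \<Longrightarrow> f y = g y"
 shows "pd i f x = pd i g x"
proof -
 have c: "((\<lambda>t::real. x + t *\<^sub>R axis i 1) \<longlongrightarrow> x + 0 *\<^sub>R axis i 1) (nhds 0)"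
  by (intro tendsto_intros filterlim_ident)
 have "eventually (\<lambda>t::real. x + t *\<^sub>R axis i 1 \<in> U) (nhds 0)"
  using topological_tendstoD[OF c assms(1)] assms(2) by simp
 then have "eventually (\<lambda>t. f (x + t *\<^sub>R axis i 1) = g (x + t *\<^sub>R axis i 1)) (nhds 0)"
  by eventually_elim (use assms(3) in auto)
 then show ?thesis unfolding part_deriv_def by (rule deriv_cong_ev) simp
qed

lemma part_deriv_norm2: "pd i (\<lambda>x. (norm (x - a))^2) x = 2 * (x $ i - a $ i)"
proof -
 have "((\<lambda>x. (norm (x - a))^2) has_derivative (\<lambda>h. 2 * (h \<bullet> (x - a)))) (at x)"
  unfolding power2_norm_eq_inner
  by (auto intro!: derivative_eq_intros simp: inner_commute)
 from part_deriv_eq[OF this] show ?thesis by (simp add: inner_axis')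
qed

lemma part_deriv_norm2_0: "pd i (\<lambda>x. (norm x)^2) x = 2 * x $ i"
 using part_deriv_norm2[of i 0 x] by simp

lemma part_deriv_inner: "pd i (\<lambda>x. a \<bullet> x) x = a $ i"
proof -
 have "((\<lambda>x. a \<bullet> x) has_derivative (\<lambda>h. a \<bullet> h)) (at x)"
  by (auto intro!: derivative_eq_intros)
 from part_deriv_eq[OF this] show ?thesis by (simp add: inner_axis)
qed

lemma elem_UNIV_differentiable: "elem f \<Longrightarrow> f differentiable (at x)"
 by (simp add: elem_differentiable)

lemma elem_UNIV_part_deriv:
 fixes f :: "real^'n \<Rightarrow> real" shows "elem f \<Longrightarrow> elem (pd i f)"
 by (simp add: elem_part_deriv)

lemma elem_UNIV_continuous: "elem f \<Longrightarrow> continuous_on A f"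
 by (rule continuous_on_subset[OF elem_continuous_on[OF _ open_UNIV] subset_UNIV])

lemma elem_UNIV_borel: "elem f \<Longrightarrow> f \<in> borel_measurable borel"
 by (intro borel_measurable_continuous_onI elem_UNIV_continuous)

lemma elem_subset: "elementary U f \<Longrightarrow> V \<subseteq> U \<Longrightarrow> elementary V f"
proof (induction rule: elementary.induct)
 case (pow f b)
 then show ?case by (intro elementary.pow) auto
next
 case (cong f g)
 then show ?case by (intro elementary.cong[of V f g]) auto
qed (blast intro: elem_intros)+

lemma elem_Ck: "elem f \<Longrightarrow> Ck k f"
 by (induction k arbitrary: f) (auto simp: elem_UNIV_continuous elem_UNIV_differentiable elem_UNIV_part_deriv)

section \<open>Test functions and cutoffs\<close>

lemma test_functionI:
 assumes "elem \<phi>" "compact K" "K \<subseteq> U" "\<And>x. \<phi> x \<noteq> 0 \<Longrightarrow> x \<in> K"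
 shows "\<phi> \<in> test_functions U"
proof -
 have "closure {x. \<phi> x \<noteq> 0} \<subseteq> K"
  by (intro closure_minimal) (use assms(4) compact_imp_closed[OF assms(2)] in auto)
 moreover from this have "compact (closure {x. \<phi> x \<noteq> 0})"
  using assms(2) bounded_subset by (auto simp: compact_eq_bounded_closed)
 ultimately show ?thesis using assms by (auto simp: test_functions_def elem_Ck)
qed

text \<open>A quotient in disguise: the factor \<open>powr (- 1)\<close> of a positive sum keeps the
  function inside the class \<open>elementary\<close>. It is the smooth transition from 0 for
  \<open>t <= 1\<close> to 1 for \<open>t >= 2\<close>.\<close>

definition step :: "real \<Rightarrow> real" where
 "step t = flat 0 (t - 1) * (flat 0 (t - 1) + flat 0 (2 - t)) powr (- 1)"

lemma step_pos: "flat 0 (t - 1) + flat 0 (2 - t) > 0"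
 using flat_nonneg[of 0 "t-1"] flat_nonneg[of 0 "2-t"] flat_pos_iff[of 0 "t-1"] flat_pos_iff[of 0 "2-t"]
 by linarith

lemma step_eq: "step t = flat 0 (t - 1) / (flat 0 (t - 1) + flat 0 (2 - t))"
 using step_pos[of t] by (simp add: step_def powr_minus_divide)

lemma step_0: "t \<le> 1 \<Longrightarrow> step t = 0"
 by (simp add: step_def flat_def)

lemma step_1: "t \<ge> 2 \<Longrightarrow> step t = 1"
 using step_pos[of t] by (simp add: step_eq flat_def)

lemma step_range: "0 \<le> step t" "step t \<le> 1"
 using step_pos[of t] flat_nonneg[of 0 "t-1"] flat_nonneg[of 0 "2-t"] by (auto simp: step_eq)

lemma elem_step: "elementary U f \<Longrightarrow> elementary U (\<lambda>x. step (f x))"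
 unfolding step_def
 by (intro elementary.mult elementary.pow elementary.add elementary.flat elem_diff elementary.const step_pos)

text \<open>A bounded derivative living on \<open>[1, 2]\<close> is what gives a cutoff of width
  \<epsilon> a gradient of size \<open>1/\<epsilon>\<close> on a shell of thickness comparable to
  \<epsilon>, with constants independent of \<epsilon>.\<close>

lemma step_deriv_ex:
 obtains s' M where "\<And>t. (step has_real_derivative s' t) (at t)" "\<And>t. \<bar>s' t\<bar> \<le> M"
  "\<And>t. t < 1 \<or> t > 2 \<Longrightarrow> s' t = 0" "M > 0" "continuous_on UNIV s'"
proof -
 define A where "A t = flat 0 (t - 1)" for t :: real
 define B where "B t = flat 0 (2 - t)" for t :: real
 define A' where "A' t = flat 2 (t - 1)" for t :: real
 define B' where "B' t = - flat 2 (2 - t)" for t :: real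
 define s' where "s' t = (A' t * (A t + B t) - A t * (A' t + B' t)) / (A t + B t)^2" for t
 have pos: "A t + B t > 0" for t unfolding A_def B_def by (rule step_pos)
 have df: "(flat 0 has_real_derivative flat 2 s) (at s)" for s
  using DERIV_flat[of 0 s] by (simp add: numeral_2_eq_2)
 have dA: "(A has_real_derivative A' t) (at t)" for t
  unfolding A_def A'_def
  by (rule DERIV_cong[OF DERIV_chain2[where g="\<lambda>t. t-1" and Db=1, OF df]]) (auto intro!: derivative_eq_intros)
 have dB: "(B has_real_derivative B' t) (at t)" for t
  unfolding B_def B'_def
  by (rule DERIV_cong[OF DERIV_chain2[where g="\<lambda>t. 2-t" and Db="-1", OF df]]) (auto intro!: derivative_eq_intros)
 have st: "step = (\<lambda>t. A t / (A t + B t))" by (auto simp: step_eq A_def B_def)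
 have d: "(step has_real_derivative s' t) (at t)" for t
  unfolding st s'_def using pos[of t] by (auto intro!: derivative_eq_intros dA dB simp: power2_eq_square)
 have cf: "continuous_on UNIV (\<lambda>t. flat m (g t))" if "continuous_on UNIV g" for m g
  using continuous_on_compose2[OF continuous_on_flat that, of UNIV] by auto
 have c: "continuous_on UNIV s'"
  unfolding s'_def
  by (intro continuous_intros) (use pos in \<open>auto simp: A_def B_def A'_def B'_def less_imp_neq[symmetric] intro!: cf continuous_intros\<close>)
 have z: "s' t = 0" if "t < 1 \<or> t > 2" for t
  using that by (auto simp: s'_def A_def B_def A'_def B'_def flat_def)
 have "bounded (s' ` {1..2})"
  by (intro compact_imp_bounded compact_continuous_image continuous_on_subset[OF c]) auto
 then obtain M where M: "M > 0" "\<And>t. t \<in> {1..2} \<Longrightarrow> \<bar>s' t\<bar> \<le> M"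
  unfolding bounded_pos by auto
 have "\<bar>s' t\<bar> \<le> M" for t
  using M z[of t] by (cases "t \<in> {1..2}") auto
 then show ?thesis using that d z M(1) c by blast
qed

section \<open>Integrals of derivatives of compactly supported functions\<close>

lemma has_part_deriv:
 fixes f :: "real^'n \<Rightarrow> real"
 assumes "f differentiable (at x)"
 shows "((\<lambda>t. f (x + t *\<^sub>R axis i 1)) has_real_derivative pd i f x) (at 0)"
proof -
 obtain D where D: "(f has_derivative D) (at x)" using assms by (auto simp: differentiable_def)
 have "((\<lambda>t::real. x + t *\<^sub>R axis i 1) has_derivative (\<lambda>t. t *\<^sub>R axis i 1)) (at 0)"
  by (auto intro!: derivative_eq_intros)
 from has_derivative_compose[OF this, of f D] D
 have "((\<lambda>t. f (x + t *\<^sub>R axis i 1)) has_derivative (\<lambda>t. D (t *\<^sub>R axis i 1))) (at 0)" by simp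
 moreover have "(\<lambda>t. D (t *\<^sub>R axis i 1)) = (*) (D (axis i 1))"
  using has_derivative_linear[OF D] by (auto simp: linear_cmul)
 ultimately show ?thesis
  by (simp add: has_field_derivative_def part_deriv_eq[OF D])
qed

lemma borel_imp_lebesgue_on: "f \<in> borel_measurable borel \<Longrightarrow> f \<in> borel_measurable (leb S)"
 by (intro measurable_restrict_space1 measurable_completion) simp

lemma elem_UNIV_lebesgue_on: "elem f \<Longrightarrow> f \<in> borel_measurable (leb S)"
 by (intro borel_imp_lebesgue_on elem_UNIV_borel)

lemma integrable_bounded_on:
 fixes f :: "'a::euclidean_space \<Rightarrow> 'b::{banach, second_countable_topology}"
 assumes "S \<in> lmeasurable" "f \<in> borel_measurable (leb S)" "\<And>x. x \<in> S \<Longrightarrow> norm (f x) \<le> B"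
 shows "integrable (leb S) f"
 using assms by (intro finite_measure.integrable_const_bound[OF finite_measure_lebesgue_on, of _ _ B]) auto

lemmas bochner_cong = Bochner_Integration.integral_cong
 and bochner_diff = Bochner_Integration.integral_diff
 and bochner_bound = Bochner_Integration.integrable_bound

lemma integrable_lebesgue_supp:
 fixes f :: "'a::euclidean_space \<Rightarrow> 'b::{banach, second_countable_topology}"
 assumes "f \<in> borel_measurable lebesgue" "\<And>x. norm (f x) \<le> B" "\<And>x. norm x > R \<Longrightarrow> f x = 0"
 shows "integrable lebesgue f"
proof (rule bochner_bound[of _ "\<lambda>x. B * indicator (cball 0 R) x"])
 have "integrable lebesgue (indicator (cball 0 R) :: 'a \<Rightarrow> real)"
  using lmeasurable_cball[of 0 R] by (intro integrable_real_indicator) (auto simp: fmeasurable_def)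
 then show "integrable lebesgue (\<lambda>x::'a. B * indicator (cball 0 R) x)" by simp
 show "AE x in lebesgue. norm (f x) \<le> norm (B * indicator (cball 0 R) x)"
 proof (intro AE_I2)
  fix x
  have "B \<ge> 0" using assms(2)[of x] norm_ge_zero order_trans by blast
  then show "norm (f x) \<le> norm (B * indicator (cball 0 R) x)"
   using assms(2)[of x] assms(3)[of x] by (cases "norm x > R") (auto simp: indicator_def)
 qed
qed (use assms in auto)

lemma integral_lebesgue_translate:
 fixes f :: "'a::euclidean_space \<Rightarrow> real"
 assumes "f \<in> borel_measurable borel"
 shows "(\<integral>x. f (x + c) \<partial>lebesgue) = (\<integral>x. f x \<partial>lebesgue)"
proof -
 have "(\<integral>x. f x \<partial>lborel) = (\<integral>x. f x \<partial>distr lborel borel ((+) c))"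
  by (simp add: lborel_distr_plus)
 also have "\<dots> = (\<integral>x. f (x + c) \<partial>lborel)"
  using assms by (subst integral_distr) (auto simp: add.commute)
 finally show ?thesis
  using assms by (simp add: integral_completion)
qed

lemma integral_line_deriv_zero:
 fixes \<psi> :: "real^'n \<Rightarrow> real"
 assumes lip: "\<And>x y. \<bar>\<psi> x - \<psi> y\<bar> \<le> L * norm (x - y)"
  and supp: "\<And>x. norm x > R \<Longrightarrow> \<psi> x = 0"
  and g: "g \<in> borel_measurable lebesgue"
  and ae: "AE x in lebesgue. ((\<lambda>t. \<psi> (x + t *\<^sub>R axis i 1)) has_real_derivative g x) (at 0)"
 shows "integrable lebesgue g" "(\<integral>x. g x \<partial>lebesgue) = 0"
proof -
 have L0: "L \<ge> 0"
  using lip[of "axis i 1" 0] by (auto simp: norm_axis_1)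
 have cont: "continuous_on UNIV \<psi>"
  using lip by (intro Lipschitz.lipschitz_on_continuous_on[of L] lipschitz_onI)
   (auto simp: dist_norm L0)
 then have bor: "\<psi> \<in> borel_measurable borel" by (rule borel_measurable_continuous_onI)
 define B where "B = \<bar>\<psi> 0\<bar> + L * \<bar>R\<bar>"
 have bound: "norm (\<psi> x) \<le> B" for x
 proof (cases "norm x > R")
  case True
  then show ?thesis using supp L0 by (simp add: B_def)
 next
  case False
  have "\<bar>\<psi> x\<bar> \<le> \<bar>\<psi> 0\<bar> + L * norm x" using lip[of x 0] by simp
  also have "L * norm x \<le> L * \<bar>R\<bar>" using False L0 by (intro mult_left_mono) auto
  finally show ?thesis by (simp add: B_def)
 qed
 define h where "h n x = (\<psi> (x + inverse (real (Suc n)) *\<^sub>R axis i 1) - \<psi> x) * real (Suc n)" for n x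
 have int\<psi>: "integrable lebesgue \<psi>"
  using bor bound supp by (intro integrable_lebesgue_supp[of _ B R]) (auto intro: measurable_completion)
 have tr: "(\<lambda>x. \<psi> (x + c)) \<in> borel_measurable borel" for c
  using bor by simp
 have hint0: "(\<integral>x. h n x \<partial>lebesgue) = 0" for n
 proof -
  have "integrable lebesgue (\<lambda>x. \<psi> (x + inverse (real (Suc n)) *\<^sub>R axis i 1))"
  proof (rule integrable_lebesgue_supp[of _ B "R+1"])
   show "(\<lambda>x. \<psi> (x + inverse (real (Suc n)) *\<^sub>R axis i 1)) \<in> borel_measurable lebesgue"
    using tr by (intro measurable_completion) simp
   fix x :: "real^'n" assume "norm x > R + 1"
   moreover have "norm x \<le> norm (x + inverse (real (Suc n)) *\<^sub>R axis i 1) + norm (inverse (real (Suc n)) *\<^sub>R axis i (1::real) :: real^'n)"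
    using norm_triangle_ineq4[of "x + inverse (real (Suc n)) *\<^sub>R axis i 1" "inverse (real (Suc n)) *\<^sub>R axis i 1"] by simp
   moreover have "norm (inverse (real (Suc n)) *\<^sub>R axis i (1::real) :: real^'n) \<le> 1"
    by (simp add: norm_axis_1 field_simps)
   ultimately show "\<psi> (x + inverse (real (Suc n)) *\<^sub>R axis i 1) = 0"
    by (intro supp) linarith
  qed (use bound in auto)
  then show ?thesis
   unfolding h_def using int\<psi> integral_lebesgue_translate[OF bor]
   by (simp add: bochner_diff)
 qed
 \<comment> \<open>The increments are at most 1, so all quotients vanish outside
   \<open>cball 0 (R + 1)\<close>; a multiple of its indicator is the integrable majorant.\<close>
 have hb: "norm (h n x) \<le> L * indicator (cball 0 (R+1)) x" for n x
 proof (cases "norm x > R + 1")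
  case True
  have "norm x \<le> norm (x + inverse (real (Suc n)) *\<^sub>R axis i 1) + norm (inverse (real (Suc n)) *\<^sub>R axis i (1::real) :: real^'n)"
   using norm_triangle_ineq4[of "x + inverse (real (Suc n)) *\<^sub>R axis i 1" "inverse (real (Suc n)) *\<^sub>R axis i 1"] by simp
  moreover have "norm (inverse (real (Suc n)) *\<^sub>R axis i (1::real) :: real^'n) \<le> 1"
   by (simp add: norm_axis_1 field_simps)
  ultimately have "\<psi> (x + inverse (real (Suc n)) *\<^sub>R axis i 1) = 0"
   using True by (intro supp) linarith
  then show ?thesis using supp[of x] True by (simp add: h_def)
 next
  case False
  have "\<bar>\<psi> (x + inverse (real (Suc n)) *\<^sub>R axis i 1) - \<psi> x\<bar> \<le> L * inverse (real (Suc n))"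
   using lip[of "x + inverse (real (Suc n)) *\<^sub>R axis i 1" x] by (simp add: norm_axis_1)
  then have "\<bar>\<psi> (x + inverse (real (Suc n)) *\<^sub>R axis i 1) - \<psi> x\<bar> * real (Suc n) \<le> L * inverse (real (Suc n)) * real (Suc n)"
   by (intro mult_right_mono) auto
  also have "\<dots> = L" by simp
  finally show ?thesis using False by (simp add: h_def abs_mult)
 qed
 have hl: "AE x in lebesgue. (\<lambda>n. h n x) \<longlonglongrightarrow> g x"
  using ae
 proof eventually_elim
  case (elim x)
  then have "((\<lambda>t. (\<psi> (x + t *\<^sub>R axis i 1) - \<psi> x) / t) \<longlongrightarrow> g x) (at 0)"
   by (simp add: has_field_derivative_iff)
  moreover have "filterlim (\<lambda>n. inverse (real (Suc n))) (at 0) sequentially"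
   unfolding filterlim_at using LIMSEQ_inverse_real_of_nat by auto
  ultimately have "(\<lambda>n. (\<psi> (x + inverse (real (Suc n)) *\<^sub>R axis i 1) - \<psi> x) / inverse (real (Suc n))) \<longlonglongrightarrow> g x"
   by (rule filterlim_compose)
  then show ?case by (simp add: h_def[abs_def] divide_inverse)
 qed
 have hm: "h n \<in> borel_measurable lebesgue" for n
  unfolding h_def using bor by (intro measurable_completion) (simp, measurable)
 have wi: "integrable lebesgue (\<lambda>x::real^'n. L * indicator (cball 0 (R+1)) x)"
  using lmeasurable_cball[of "0::real^'n" "R+1"]
  by (intro integrable_mult_right integrable_real_indicator) (auto simp: fmeasurable_def)
 note dc = integral_dominated_convergence[OF g hm wi hl] integrable_dominated_convergence[OF g hm wi hl]
 show "integrable lebesgue g" using dc(2) hb by auto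
 have "(\<lambda>n. \<integral>x. h n x \<partial>lebesgue) \<longlonglongrightarrow> (\<integral>x. g x \<partial>lebesgue)" using dc(1) hb by auto
 then show "(\<integral>x. g x \<partial>lebesgue) = 0"
  by (simp add: hint0 LIMSEQ_const_iff)
qed

text \<open>The mean value inequality with a crude operator norm: each component of the increment is
  estimated by its norm, hence the factor \<open>CARD('n)\<close>.\<close>

lemma lipschitz_of_part_derivs:
 fixes \<psi> :: "real^'n \<Rightarrow> real"
 assumes d: "\<And>x. \<psi> differentiable (at x)" and b: "\<And>x j. \<bar>pd j \<psi> x\<bar> \<le> M"
 shows "\<bar>\<psi> x - \<psi> y\<bar> \<le> real CARD('n) * M * norm (x - y)"
proof -
 have M0: "M \<ge> 0" using b[of undefined undefined] by linarith
 have "norm (\<psi> x - \<psi> y) \<le> real CARD('n) * M * norm (x - y)"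
 proof (rule differentiable_bound[of UNIV])
  fix z :: "real^'n"
  show "(\<psi> has_derivative (\<lambda>h. \<Sum>i\<in>UNIV. h $ i * pd i \<psi> z)) (at z within UNIV)"
   using has_derivative_part_deriv[OF d] by simp
  show "onorm (\<lambda>h. \<Sum>i\<in>UNIV. h $ i * pd i \<psi> z) \<le> real CARD('n) * M"
  proof (rule onorm_bound)
   fix h :: "real^'n"
   have "\<bar>\<Sum>i\<in>UNIV. h $ i * pd i \<psi> z\<bar> \<le> (\<Sum>i\<in>(UNIV::'n set). norm h * M)"
   proof (rule order_trans[OF sum_abs], rule sum_mono)
    fix i
    show "\<bar>h $ i * pd i \<psi> z\<bar> \<le> norm h * M"
     unfolding abs_mult using component_le_norm_cart[of h i] b[of i z] by (intro mult_mono) auto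
   qed
   then show "norm (\<Sum>i\<in>UNIV. h $ i * pd i \<psi> z) \<le> real CARD('n) * M * norm h"
    by (simp add: mult_ac)
  qed (use M0 in auto)
 qed auto
 then show ?thesis by simp
qed

lemma part_deriv_outside:
 fixes \<psi> :: "real^'n \<Rightarrow> real"
 assumes "\<And>x. norm x > R \<Longrightarrow> \<psi> x = 0" "norm x > R"
 shows "pd i \<psi> x = 0"
proof -
 have "open {y::real^'n. norm y > R}"
  by (intro open_Collect_less continuous_intros)
 then show ?thesis
  using part_deriv_cong[of "{y. norm y > R}" x \<psi> "\<lambda>x. 0" i] assms by (simp add: part_deriv_const)
qed

lemma bounded_supp:
 fixes g :: "real^'n \<Rightarrow> real"
 assumes "continuous_on UNIV g" "\<And>x. norm x > R \<Longrightarrow> g x = 0"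
 obtains M where "\<And>x. \<bar>g x\<bar> \<le> M" "M \<ge> 0"
proof -
 have "bounded (g ` cball 0 R)"
  by (intro compact_imp_bounded compact_continuous_image continuous_on_subset[OF assms(1)]) auto
 then obtain M where M: "M > 0" "\<And>x. x \<in> cball 0 R \<Longrightarrow> \<bar>g x\<bar> \<le> M"
  unfolding bounded_pos by auto
 have "\<bar>g x\<bar> \<le> M" for x using M assms(2)[of x] by (cases "norm x > R") auto
 then show ?thesis using that M(1) by (meson less_imp_le)
qed

lemma part_derivs_bounded_supp:
 fixes \<psi> :: "real^'n \<Rightarrow> real"
 assumes c: "\<And>j. continuous_on UNIV (pd j \<psi>)" and supp: "\<And>x. norm x > R \<Longrightarrow> \<psi> x = 0"
 obtains M where "\<And>x j. \<bar>pd j \<psi> x\<bar> \<le> M" "M \<ge> 0"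
proof -
 have "\<exists>M. \<forall>x. \<bar>pd j \<psi> x\<bar> \<le> M" for j
 proof -
  have "pd j \<psi> x = 0" if "norm x > R" for x
   using part_deriv_outside[of R \<psi> x j] supp that by blast
  from bounded_supp[OF c this] show ?thesis by metis
 qed
 then obtain M where M: "\<And>j x. \<bar>pd j \<psi> x\<bar> \<le> M j" by metis
 have "\<bar>pd j \<psi> x\<bar> \<le> (\<Sum>j\<in>UNIV. \<bar>M j\<bar>)" for x j
  using M[of j x] member_le_sum[of j UNIV "\<lambda>j. \<bar>M j\<bar>"] by auto
 then show ?thesis using that[of "\<Sum>j\<in>UNIV. \<bar>M j\<bar>"] by (simp add: sum_nonneg)
qed

lemma integral_part_deriv_zero:
 fixes \<psi> :: "real^'n \<Rightarrow> real"
 assumes d: "\<And>x. \<psi> differentiable (at x)" and c: "\<And>j. continuous_on UNIV (pd j \<psi>)"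
  and supp: "\<And>x. norm x > R \<Longrightarrow> \<psi> x = 0"
 shows "integrable lebesgue (pd i \<psi>)" "(\<integral>x. pd i \<psi> x \<partial>lebesgue) = 0"
proof -
 obtain M where M: "\<And>x j. \<bar>pd j \<psi> x\<bar> \<le> M" "M \<ge> 0"
  using part_derivs_bounded_supp[OF c supp] by blast
 have "pd i \<psi> \<in> borel_measurable lebesgue"
  using borel_measurable_continuous_onI[OF c] by (intro measurable_completion) simp
 note * = integral_line_deriv_zero[OF lipschitz_of_part_derivs[OF d M(1)] supp this AE_I2[OF has_part_deriv[OF d]]]
 show "integrable lebesgue (pd i \<psi>)" "(\<integral>x. pd i \<psi> x \<partial>lebesgue) = 0" using * by auto
qed

section \<open>The divergence theorem on balls\<close>

lemma lebesgue_on_indicator: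
 fixes f :: "'a::euclidean_space \<Rightarrow> 'b::{banach, second_countable_topology}"
 assumes "S \<in> sets lebesgue"
 shows "(\<integral>x. f x \<partial>leb S) = (\<integral>x. indicator S x *\<^sub>R f x \<partial>lebesgue)"
  "integrable (leb S) f \<longleftrightarrow> integrable lebesgue (\<lambda>x. indicator S x *\<^sub>R f x)"
 using assms by (simp_all add: integral_restrict_space integrable_restrict_space)

lemma integral_ball_affine:
 fixes f :: "'a::euclidean_space \<Rightarrow> 'b::{banach, second_countable_topology}"
 assumes f: "f \<in> borel_measurable borel" and r: "r > 0"
 shows "(\<integral>x. f x \<partial>leb (ball a r)) = r ^ DIM('a) *\<^sub>R (\<integral>x. f (a + r *\<^sub>R x) \<partial>leb (ball 0 1))"
proof -
 define h where "h x = indicator (ball a r) x *\<^sub>R f x" for x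
 note f [measurable]
 have [measurable]: "ball a r \<in> sets borel" by simp
 have hb [measurable]: "h \<in> borel_measurable borel" unfolding h_def by measurable
 have "(\<integral>x. f x \<partial>leb (ball a r)) = (\<integral>x. h x \<partial>lborel)"
  by (subst lebesgue_on_indicator) (use hb in \<open>auto simp: h_def[symmetric] integral_completion\<close>)
 also have "\<dots> = (\<integral>x. h x \<partial>density (distr lborel borel (\<lambda>x. a + r *\<^sub>R x)) (\<lambda>_. \<bar>r\<bar>^DIM('a)))"
  using lborel_affine[of r a] r by simp
 also have "\<dots> = (\<integral>x. r ^ DIM('a) *\<^sub>R h (a + r *\<^sub>R x) \<partial>lborel)"
  using r hb by (subst integral_density) (auto simp: integral_distr ennreal_power)
 also have "\<dots> = r ^ DIM('a) *\<^sub>R (\<integral>x. h (a + r *\<^sub>R x) \<partial>lborel)" by simp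
 also have "(\<lambda>x. h (a + r *\<^sub>R x)) = (\<lambda>x. indicator (ball 0 1) x *\<^sub>R f (a + r *\<^sub>R x))"
  using r by (auto simp: h_def indicator_def dist_norm norm_minus_commute)
 also have "(\<integral>x. indicator (ball 0 1) x *\<^sub>R f (a + r *\<^sub>R x) \<partial>lborel) = (\<integral>x. f (a + r *\<^sub>R x) \<partial>leb (ball 0 1))"
 proof -
  have [measurable]: "ball (0::'a) 1 \<in> sets borel" by simp
  have "(\<lambda>x. indicator (ball 0 1) x *\<^sub>R f (a + r *\<^sub>R x)) \<in> borel_measurable lborel" by measurable
  from integral_completion[OF this] show ?thesis by (subst lebesgue_on_indicator) auto
 qed
 finally show ?thesis .
qed

lemma elem_affine:
 assumes "elem F"
 shows "elem (\<lambda>y. F (a + r *\<^sub>R y))"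
 using assms
proof (induction rule: elementary.induct)
 case (coord i)
 show ?case by (simp, intro elem_intros)
next
 case (pow f b) then show ?case by (intro elementary.pow) auto
next
 case (cong f g) then have "f = g" by auto with cong show ?case by simp
qed (auto intro: elem_intros)

lemma part_deriv_affine:
 assumes "F differentiable (at (a + r *\<^sub>R y))"
 shows "pd i (\<lambda>y. F (a + r *\<^sub>R y)) y = r * pd i F (a + r *\<^sub>R y)"
proof -
 obtain D where D: "(F has_derivative D) (at (a + r *\<^sub>R y))" using assms by (auto simp: differentiable_def)
 have "((\<lambda>y. a + r *\<^sub>R y) has_derivative (\<lambda>h. r *\<^sub>R h)) (at y)"
  by (auto intro!: derivative_eq_intros)
 from part_deriv_eq[OF has_derivative_compose[OF this D]] has_derivative_linear[OF D]
 show ?thesis by (simp add: part_deriv_eq[OF D] linear_cmul)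
qed

text \<open>A radial cutoff where \<open>s\<close> is the square of the outer radius. Using the
  squared distance keeps it smooth at the centre \<open>a\<close>; it passes from 1 to 0 while the
  squared distance runs from \<open>s - 2 * \<epsilon>\<close> to
  \<open>s - \<epsilon>\<close>.\<close>

definition rcut :: "real^'n \<Rightarrow> real \<Rightarrow> real \<Rightarrow> real^'n \<Rightarrow> real" where
 "rcut a s \<epsilon> x = step ((s - (norm (x - a))^2) / \<epsilon>)"

lemma rcut_elem: "elementary U (rcut a s \<epsilon>)"
 unfolding rcut_def[abs_def] by (intro elem_step elem_divide elem_diff elementary.const elem_norm2)

lemma rcut_1: "\<epsilon> > 0 \<Longrightarrow> (norm (x - a))^2 \<le> s - 2 * \<epsilon> \<Longrightarrow> rcut a s \<epsilon> x = 1"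
 unfolding rcut_def by (intro step_1) (simp add: field_simps)

lemma rcut_0: "\<epsilon> > 0 \<Longrightarrow> (norm (x - a))^2 \<ge> s - \<epsilon> \<Longrightarrow> rcut a s \<epsilon> x = 0"
 unfolding rcut_def by (intro step_0) (simp add: field_simps)

lemma elem_supp_bounds:
 fixes F :: "real^'n \<Rightarrow> real"
 assumes "elem F" "\<And>x. norm x > R \<Longrightarrow> F x = 0"
 obtains L where "\<And>x y. \<bar>F x - F y\<bar> \<le> L * norm (x - y)" "L \<ge> 0"
proof -
 obtain M where "\<And>x j. \<bar>pd j F x\<bar> \<le> M" "M \<ge> 0"
  using part_derivs_bounded_supp[of F R] elem_UNIV_continuous[OF elem_UNIV_part_deriv[OF assms(1)]] assms(2) by blast
 then show ?thesis
  using that[of "real CARD('n) * M"] lipschitz_of_part_derivs[OF elem_UNIV_differentiable[OF assms(1)]] by auto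
qed

text \<open>This is the derivative of the \<open>k\<close>-th power at 1, approached from below. It
  converts the volume fraction of a thin shell, divided by the thickness, into the dimension factor
  of the surface measure.\<close>

lemma scale_power_limit:
 "(\<lambda>n. real (Suc n) * (1 - (1 - 1 / real (Suc n)) ^ k)) \<longlonglongrightarrow> real k"
proof -
 have "((\<lambda>z. z ^ k) has_real_derivative real k) (at (1::real))"
  by (auto intro!: derivative_eq_intros)
 then have "((\<lambda>h. ((1 + h) ^ k - 1) / h) \<longlongrightarrow> real k) (at 0)"
  by (simp add: DERIV_def)
 moreover have "filterlim (\<lambda>n. - inverse (real (Suc n))) (at 0) sequentially"
  unfolding filterlim_at using tendsto_minus[OF LIMSEQ_inverse_real_of_nat] by auto
 ultimately have "(\<lambda>n. ((1 + - inverse (real (Suc n))) ^ k - 1) / - inverse (real (Suc n))) \<longlonglongrightarrow> real k"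
  by (rule filterlim_compose)
 moreover have "(z - 1) / - inverse m = m * (1 - z)" if "m \<noteq> 0" for m z :: real
  using that by (simp add: field_simps)
 ultimately show ?thesis by (simp add: inverse_eq_divide del: of_nat_Suc)
qed

lemma part_deriv_norm:
 fixes x :: "real^'n"
 assumes "x \<noteq> 0"
 shows "norm differentiable (at x)" "pd i norm x = x $ i / norm x"
proof -
 have D: "(norm has_derivative (\<lambda>h. h \<bullet> sgn x)) (at x)"
  using has_derivative_norm[OF assms] by simp
 then show "norm differentiable (at x)" by (auto simp: differentiable_def)
 show "pd i norm x = x $ i / norm x"
  unfolding part_deriv_eq[OF D] by (simp add: inner_axis' sgn_div_norm divide_inverse)
qed

text \<open>The right-hand side is the integral of \<open>\<nu>\<^sub>i F\<close> with respect to the cone measure on the unit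
 sphere. The cutoff \<open>c\<close> decreases linearly from 1 to 0 in a shell of width \<open>1 / Suc n\<close>, so that
 \<open>- \<partial>\<^sub>i c\<close> averages over the shell; there \<open>F x\<close> may be replaced by \<open>F (x / |x|)\<close>, and the integral of a
 function homogeneous of degree 0 over a shell is computed by scaling.\<close>

lemma divergence_unit_ball:
 fixes F :: "real^'n \<Rightarrow> real"
 assumes F: "elem F"
 shows "(\<integral>x. pd i F x \<partial>leb (ball 0 1)) =
  real CARD('n) * (\<integral>x. x $ i / norm x * F ((1 / norm x) *\<^sub>R x) \<partial>leb (ball 0 1))"
proof -
 \<comment> \<open>\<open>H\<close> equals \<open>F\<close> up to radius \<open>sqrt 2\<close>,
   hence near the closed unit ball, and has compact support, which makes it bounded and Lipschitz on
   the whole space.\<close>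
 define H where "H x = rcut 0 4 1 x * F x" for x
 have H: "elem H" unfolding H_def[abs_def] by (intro elementary.mult rcut_elem F)
 have Hsupp: "H x = 0" if "norm x > 2" for x
  using that power_mono[of 2 "norm x" 2] by (simp add: H_def rcut_0)
 have HF: "H x = F x" if "norm x \<le> sqrt 2" for x
  using that power_mono[of "norm x" "sqrt 2" 2] by (simp add: H_def rcut_1)
 have sq2: "1 < sqrt (2::real)" by simp
 have pHF: "pd i H x = pd i F x" if "norm x < sqrt 2" for x
  by (rule part_deriv_cong[of "ball 0 (sqrt 2)"]) (use that HF in auto)
 obtain L where L: "\<And>x y. \<bar>H x - H y\<bar> \<le> L * norm (x - y)" "L \<ge> 0"
  using elem_supp_bounds[OF H Hsupp] by blast
 obtain M where M: "\<And>x. \<bar>H x\<bar> \<le> M" "M \<ge> 0"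
  using bounded_supp[OF elem_UNIV_continuous[OF H] Hsupp] by blast
 have pHc: "continuous_on UNIV (pd i H)"
  by (intro elem_UNIV_continuous elem_UNIV_part_deriv H)
 obtain M' where M': "\<And>x. \<bar>pd i H x\<bar> \<le> M'" "M' \<ge> 0"
 proof -
  have "pd i H x = 0" if "norm x > 2" for x
   using part_deriv_outside[of 2 H x i] Hsupp that by blast
  from bounded_supp[OF pHc this] show ?thesis using that by blast
 qed
 define N where "N n = real (Suc n)" for n
 have N1: "N n \<ge> 1" for n by (simp add: N_def)
 define cf where "cf n x = max 0 (min 1 (N n * (1 - norm x)))" for n and x :: "real^'n"
 define Q where "Q x = x $ i / norm x * H x" for x :: "real^'n"
 define sh where "sh n = {x::real^'n. 1 - 1 / N n < norm x \<and> norm x < 1}" for n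
 have sh_meas [measurable]: "sh n \<in> sets borel" for n unfolding sh_def by measurable
 \<comment> \<open>The derivative of \<open>cf n * H\<close> in direction \<open>i\<close> away from
   the two bounding spheres and the centre: in the shell the cutoff has slope \<open>N n\<close>
   along the inward radius.\<close>
 define g where "g n x = cf n x * pd i H x - N n * (indicator (sh n) x * Q x)" for n and x
 have cflip: "\<bar>cf n x - cf n y\<bar> \<le> N n * norm (x - y)" for n x y
 proof -
  have "\<bar>cf n x - cf n y\<bar> \<le> \<bar>N n * (1 - norm x) - N n * (1 - norm y)\<bar>" by (auto simp: cf_def)
  also have "\<dots> = N n * \<bar>norm y - norm x\<bar>"
   using N1[of n] by (subst right_diff_distrib[symmetric]) (simp add: abs_mult)
  also have "\<dots> \<le> N n * norm (x - y)"
   using N1[of n] norm_triangle_ineq3[of y x] by (intro mult_left_mono) (auto simp: norm_minus_commute)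
  finally show ?thesis .
 qed
 have cfr: "0 \<le> cf n x" "cf n x \<le> 1" for n x by (auto simp: cf_def)
 have lip: "\<bar>cf n x * H x - cf n y * H y\<bar> \<le> (N n * M + L) * norm (x - y)" for n x y
 proof -
  have "cf n x * H x - cf n y * H y = (cf n x - cf n y) * H x + cf n y * (H x - H y)"
   by (simp add: algebra_simps)
  also have "\<bar>\<dots>\<bar> \<le> \<bar>cf n x - cf n y\<bar> * \<bar>H x\<bar> + \<bar>cf n y\<bar> * \<bar>H x - H y\<bar>"
   by (metis abs_mult abs_triangle_ineq)
  also have "\<dots> \<le> (N n * norm (x - y)) * M + 1 * (L * norm (x - y))"
   using cflip M(1) cfr N1[of n] L by (intro add_mono mult_mono) auto
  finally show ?thesis by (simp add: algebra_simps)
 qed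
 have cf0: "cf n x = 0" if "norm x \<ge> 1" for n x
 proof -
  have "N n * (1 - norm x) \<le> 0" using that N1[of n] by (intro mult_nonneg_nonpos) auto
  then show ?thesis by (simp add: cf_def)
 qed
 have gm: "g n \<in> borel_measurable borel" for n
  unfolding g_def Q_def cf_def using elem_UNIV_borel[OF H] elem_UNIV_borel[OF elem_UNIV_part_deriv[OF H]] by measurable
 have neg: "negligible (sphere (0::real^'n) 1 \<union> sphere 0 (1 - 1 / N n) \<union> {0})" for n
  by (intro negligible_Un negligible_sphere) auto
 have ae: "((\<lambda>t. cf n (x + t *\<^sub>R axis i 1) * H (x + t *\<^sub>R axis i 1)) has_real_derivative g n x) (at 0)"
  if x: "x \<notin> sphere 0 1 \<union> sphere 0 (1 - 1 / N n) \<union> {0}" for n x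
 proof -
  have tr: "((\<lambda>t. cf n (x + t *\<^sub>R axis i 1) * H (x + t *\<^sub>R axis i 1)) has_real_derivative pd i f x) (at 0)"
   if S: "open S" "x \<in> S" "\<And>y. y \<in> S \<Longrightarrow> f y = cf n y * H y" "f differentiable (at x)" for S f
  proof -
   obtain D where D: "(f has_derivative D) (at x)" using S(4) by (auto simp: differentiable_def)
   have D': "((\<lambda>y. cf n y * H y) has_derivative D) (at x)"
    by (rule has_derivative_transform_within_open[OF D S(1,2)]) (use S(3) in auto)
   then have "(\<lambda>y. cf n y * H y) differentiable (at x)" by (auto simp: differentiable_def)
   from has_part_deriv[OF this, of i] show ?thesis
    by (simp add: part_deriv_eq[OF D] part_deriv_eq[OF D'])
  qed
  have Hd: "H differentiable (at x)" by (rule elem_UNIV_differentiable[OF H])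
  consider "norm x < 1 - 1 / N n" | "1 - 1 / N n < norm x" "norm x < 1" | "norm x > 1"
   using x by force
  then show ?thesis
  proof cases
   case 1
   have e: "cf n y = 1" if "norm y < 1 - 1 / N n" for y
   proof -
    have "N n * (1 - norm y) \<ge> N n * (1 / N n)" using that N1[of n] by (intro mult_left_mono) auto
    then show ?thesis using N1[of n] by (simp add: cf_def)
   qed
   have "g n x = pd i H x" using 1 by (simp add: g_def Q_def sh_def e)
   then show ?thesis using tr[of "ball 0 (1 - 1 / N n)" H] 1 e Hd by auto
  next
   case 2
   have e: "cf n y = N n * (1 - norm y)" if "1 - 1 / N n < norm y" "norm y < 1" for y
   proof -
    have "N n * (1 - norm y) \<le> N n * (1 / N n)" using that N1[of n] by (intro mult_left_mono) auto
    then show ?thesis using N1[of n] that by (simp add: cf_def)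
   qed
   have x0: "x \<noteq> 0" using x by auto
   have d1: "(\<lambda>y. N n * (1 - norm y)) differentiable (at x)"
    by (intro derivative_intros part_deriv_norm x0)
   have "pd i (\<lambda>y. N n * (1 - norm y)) x = - N n * (x $ i / norm x)"
    using part_deriv_norm[OF x0]
    by (subst part_deriv_cmult, simp, subst part_deriv_diff) (auto simp: part_deriv_const)
   then have "pd i (\<lambda>y. N n * (1 - norm y) * H y) x = g n x"
    using 2 by (subst part_deriv_mult[OF d1 Hd]) (simp add: g_def Q_def sh_def e)
   moreover have "open (sh n)" unfolding sh_def
    by (intro open_Collect_conj open_Collect_less continuous_intros)
   ultimately show ?thesis
    using tr[of "sh n" "\<lambda>y. N n * (1 - norm y) * H y"] 2 e d1 Hd by (auto simp: sh_def)
  next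
   case 3
   have "open {y::real^'n. norm y > 1}" by (intro open_Collect_less continuous_intros)
   moreover have "g n x = pd i (\<lambda>y. 0) x" using 3 cf0[of x n] by (simp add: g_def Q_def sh_def part_deriv_const)
   ultimately show ?thesis using tr[of "{y. norm y > 1}" "\<lambda>y. 0"] 3 cf0 by auto
  qed
 qed
 have zero: "(\<integral>x. g n x \<partial>lebesgue) = 0" for n
 proof (rule integral_line_deriv_zero[OF lip])
  show "cf n x * H x = 0" if "norm x > 1" for x using that cf0[of x n] by simp
  show "g n \<in> borel_measurable lebesgue" using gm by (intro measurable_completion) simp
  show "AE x in lebesgue. ((\<lambda>t. cf n (x + t *\<^sub>R axis i 1) * H (x + t *\<^sub>R axis i 1)) has_real_derivative g n x) (at 0)"
  proof -
   have "AE x in lebesgue. x \<notin> sphere (0::real^'n) 1 \<union> sphere 0 (1 - 1 / N n) \<union> {0}"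
    using neg[of n] unfolding negligible_iff_null_sets by (rule AE_not_in)
   then show ?thesis by eventually_elim (rule ae)
  qed
 qed
 define B where "B = ball (0::real^'n) 1"
 have Bm: "B \<in> lmeasurable" by (simp add: B_def)
 \<comment> \<open>\<open>K\<close> is \<open>Q\<close> with \<open>H\<close> evaluated at the
   radial projection to the unit sphere. It is homogeneous of degree 0, so its integral over a
   concentric ball of radius \<open>r\<close> is \<open>r ^ CARD('n)\<close> times that over the
   unit ball.\<close>
 define K where "K x = x $ i / norm x * H ((1 / norm x) *\<^sub>R x)" for x
 have u: "\<bar>x $ i / norm x\<bar> \<le> 1" for x :: "real^'n"
  using component_le_norm_cart[of x i] by (cases "x = 0") (auto simp: field_simps)
 have K_bd: "\<bar>K x\<bar> \<le> M" for x
  unfolding K_def abs_mult using mult_mono[OF u M(1)] by simp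
 have Km: "K \<in> borel_measurable borel" unfolding K_def[abs_def] using elem_UNIV_borel[OF H] by measurable
 have KF: "K x = x $ i / norm x * F ((1 / norm x) *\<^sub>R x)" for x
  using HF[of "(1 / norm x) *\<^sub>R x"] sq2 unfolding K_def by (cases "x = 0") auto
 have i1: "integrable (leb B) (\<lambda>x. cf n x * pd i H x)" for n
 proof (rule integrable_bounded_on[OF Bm])
  show "(\<lambda>x. cf n x * pd i H x) \<in> borel_measurable (leb B)"
   unfolding cf_def using elem_UNIV_borel[OF elem_UNIV_part_deriv[OF H]]
   by (intro borel_imp_lebesgue_on) measurable
  show "norm (cf n x * pd i H x) \<le> 1 * M'" for x
   unfolding real_norm_def abs_mult using cfr M' by (intro mult_mono) auto
 qed
 have iK: "integrable (leb B) (\<lambda>x. indicator (sh n) x * K x)" for n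
 proof (rule integrable_bounded_on[OF Bm])
  show "(\<lambda>x. indicator (sh n) x * K x) \<in> borel_measurable (leb B)"
   using Km by (intro borel_imp_lebesgue_on) measurable
  show "norm (indicator (sh n) x * K x) \<le> M" for x
   using K_bd[of x] M(2) by (auto simp: indicator_def)
 qed
 have i2: "integrable (leb B) (\<lambda>x. indicator (sh n) x * Q x)" for n
 proof (rule integrable_bounded_on[OF Bm])
  show "(\<lambda>x. indicator (sh n) x * Q x) \<in> borel_measurable (leb B)"
   using elem_UNIV_borel[OF H] unfolding Q_def by (intro borel_imp_lebesgue_on) measurable
  show "norm (indicator (sh n) x * Q x) \<le> M" for x
   using mult_mono[OF u M(1), of x] M(2) by (auto simp: Q_def indicator_def abs_mult)
 qed
 define JQ where "JQ n = (\<integral>x. indicator (sh n) x * Q x \<partial>leb B)" for n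
 define JK where "JK n = (\<integral>x. indicator (sh n) x * K x \<partial>leb B)" for n
 have eq: "(\<integral>x. cf n x * pd i H x \<partial>leb B) =
   N n * JQ n" for n
 proof -
  have "0 = (\<integral>x. indicator B x *\<^sub>R g n x \<partial>lebesgue)"
   unfolding zero[of n, symmetric] by (intro bochner_cong)
    (auto simp: B_def indicator_def g_def Q_def sh_def cf0)
  also have "\<dots> = (\<integral>x. g n x \<partial>leb B)"
   using Bm by (subst lebesgue_on_indicator) (auto simp: fmeasurableD)
  also have "\<dots> = (\<integral>x. cf n x * pd i H x \<partial>leb B) -
   N n * JQ n"
   unfolding g_def JQ_def
   by (simp only: bochner_diff[OF i1 integrable_mult_right[OF i2]] integral_mult_right_zero)
  finally show ?thesis by simp
 qed
 have lim1: "(\<lambda>n. \<integral>x. cf n x * pd i H x \<partial>leb B) \<longlonglongrightarrow> (\<integral>x. pd i H x \<partial>leb B)"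
 proof (rule integral_dominated_convergence[where w="\<lambda>_. M'"])
  show "integrable (leb B) (\<lambda>_. M')" by (rule integrable_bounded_on[OF Bm]) auto
  show "AE x in leb B. (\<lambda>n. cf n x * pd i H x) \<longlonglongrightarrow> pd i H x"
  proof (rule AE_I2)
   fix x assume "x \<in> space (leb B)"
   then have x: "norm x < 1" by (simp add: B_def)
   have "eventually (\<lambda>n. cf n x = 1) sequentially"
   proof -
    obtain n0 :: nat where n0: "1 / (1 - norm x) < real n0" using reals_Archimedean2 by blast
    have "cf n x = 1" if "n \<ge> n0" for n
    proof -
     have "1 / (1 - norm x) \<le> N n" using n0 that by (simp add: N_def)
     then show ?thesis using x by (simp add: cf_def field_simps)
    qed
    then show ?thesis by (auto simp: eventually_sequentially)
   qed
   then have "eventually (\<lambda>n. cf n x * pd i H x = pd i H x) sequentially"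
    by eventually_elim simp
   then show "(\<lambda>n. cf n x * pd i H x) \<longlonglongrightarrow> pd i H x" by (rule tendsto_eventually)
  qed
  show "AE x in leb B. norm (cf n x * pd i H x) \<le> M'" for n
   using mult_mono[OF cfr(2) M'(1)] cfr(1) by (auto simp: abs_mult)
 qed (use i1 elem_UNIV_lebesgue_on[OF elem_UNIV_part_deriv[OF H]] in auto)
 define IK where "IK = (\<integral>x. K x \<partial>leb B)"
 have hom: "JK n = (1 - (1 - 1 / N n) ^ CARD('n)) * IK" for n
 proof (cases "n = 0")
  case True
  have "JK n = IK"
   unfolding JK_def IK_def using True
   by (intro bochner_cong) (auto simp: sh_def N_def B_def indicator_def K_def)
  then show ?thesis using True by (simp add: N_def)
 next
  case False
  define r where "r = 1 - 1 / N n"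
  note Km [measurable]
  have [measurable]: "ball (0::real^'n) r \<in> sets borel" by simp
  have r: "0 < r" "r < 1" using False by (auto simp: r_def N_def field_simps)
  have "(\<integral>x. K x \<partial>leb (ball 0 r)) = r ^ CARD('n) * IK"
  proof -
   have "K (0 + r *\<^sub>R x) = K x" for x using r by (simp add: K_def)
   then show ?thesis using integral_ball_affine[OF Km r(1), of 0] by (simp add: IK_def B_def)
  qed
  moreover have "(\<integral>x. K x \<partial>leb (ball 0 r)) = (\<integral>x. indicator (ball 0 r) x * K x \<partial>leb B)"
  proof -
   have e: "(\<lambda>x. indicator (ball 0 r) x *\<^sub>R K x) = (\<lambda>x. indicator B x *\<^sub>R (indicator (ball 0 r) x * K x))"
    using r by (auto simp: indicator_def B_def)
   show ?thesis
    by (simp only: lebesgue_on_indicator(1)[OF fmeasurableD[OF lmeasurable_ball]]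
      lebesgue_on_indicator(1)[OF fmeasurableD[OF Bm]] e)
  qed
  moreover have "JK n = (\<integral>x. K x - indicator (ball 0 r) x * K x \<partial>leb B)"
   unfolding JK_def
  proof (rule integral_cong_AE)
   have "AE x in lebesgue. x \<notin> sphere (0::real^'n) r"
    using negligible_sphere unfolding negligible_iff_null_sets by (rule AE_not_in)
   then have "AE x in leb B. x \<notin> sphere (0::real^'n) r"
    using Bm by (subst AE_restrict_space_iff) (auto simp: fmeasurableD)
   then show "AE x in leb B. indicator (sh n) x * K x = K x - indicator (ball 0 r) x * K x"
    using AE_space by eventually_elim (auto simp: indicator_def sh_def r_def[symmetric] B_def)
  qed (use Km in \<open>(intro borel_imp_lebesgue_on; measurable)+\<close>)
  moreover have "integrable (leb B) K"
   by (rule integrable_bounded_on[OF Bm borel_imp_lebesgue_on[OF Km], of M]) (use K_bd in auto)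
  moreover have "integrable (leb B) (\<lambda>x. indicator (ball 0 r) x * K x)"
  proof (rule integrable_bounded_on[OF Bm])
   show "(\<lambda>x. indicator (ball 0 r) x * K x) \<in> borel_measurable (leb B)"
    using Km by (intro borel_imp_lebesgue_on) measurable
   show "norm (indicator (ball 0 r) x * K x) \<le> M" for x
    using K_bd[of x] M(2) by (auto simp: indicator_def)
  qed
  ultimately show ?thesis by (simp add: IK_def r_def algebra_simps)
 qed
 have lim2: "(\<lambda>n. N n * JK n) \<longlonglongrightarrow> real CARD('n) * IK"
  using tendsto_mult_right[OF scale_power_limit[of "CARD('n)"], of IK] by (simp add: hom N_def mult.assoc)
 \<comment> \<open>On the shell \<open>Q\<close> and \<open>K\<close> differ by at most
   \<open>L / N n\<close>, which cancels the factor \<open>N n\<close>; what remains is the measure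
   of the shell, and this tends to 0.\<close>
 have lim3: "(\<lambda>n. N n * JQ n -
   N n * JK n) \<longlonglongrightarrow> 0"
 proof (rule Lim_null_comparison)
  have ish: "integrable (leb B) (indicator (sh n) :: real^'n \<Rightarrow> real)" for n
   by (rule integrable_bounded_on[OF Bm borel_imp_lebesgue_on, of _ 1]) (auto simp: indicator_def)
  show "\<forall>\<^sub>F n in sequentially. norm (N n * JQ n -
   N n * JK n) \<le> L * (\<integral>x. indicator (sh n) x \<partial>leb B)"
  proof (intro always_eventually allI)
   fix n
   have pt: "\<bar>indicator (sh n) x * Q x - indicator (sh n) x * K x\<bar> \<le> L / N n * indicator (sh n) x" for x
   proof (cases "x \<in> sh n")
    case True
    then have x: "1 - 1 / N n < norm x" "norm x < 1" by (auto simp: sh_def)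
    have x0: "x \<noteq> 0" using x N1[of n] by (auto simp: field_simps)
    have "x - (1 / norm x) *\<^sub>R x = (1 - 1 / norm x) *\<^sub>R x" by (simp add: algebra_simps)
    then have "norm (x - (1 / norm x) *\<^sub>R x) = \<bar>1 - 1 / norm x\<bar> * norm x" by simp
    also have "\<dots> = 1 - norm x" using x x0 by (simp add: abs_if field_simps)
    finally have "\<bar>H x - H ((1 / norm x) *\<^sub>R x)\<bar> \<le> L * (1 - norm x)" using L(1) by metis
    also have "\<dots> \<le> L * (1 / N n)" using x L by (intro mult_left_mono) auto
    finally have "\<bar>x $ i / norm x\<bar> * \<bar>H x - H ((1 / norm x) *\<^sub>R x)\<bar> \<le> 1 * (L * (1 / N n))"
     using u[of x] by (intro mult_mono) auto
    moreover have "indicator (sh n) x * Q x - indicator (sh n) x * K x =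
     x $ i / norm x * (H x - H ((1 / norm x) *\<^sub>R x))"
     using True by (simp add: K_def Q_def right_diff_distrib)
    ultimately show ?thesis using True by (simp only: abs_mult) simp
   qed simp
   have "\<bar>(\<integral>x. indicator (sh n) x * Q x - indicator (sh n) x * K x \<partial>leb B)\<bar>
     \<le> (\<integral>x. L / N n * indicator (sh n) x \<partial>leb B)"
    using pt ish i2 iK by (intro integral_abs_bound[THEN order_trans] integral_mono) auto
   then have "N n * \<bar>(\<integral>x. indicator (sh n) x * Q x - indicator (sh n) x * K x \<partial>leb B)\<bar>
     \<le> N n * (L / N n * (\<integral>x. indicator (sh n) x \<partial>leb B))"
    using N1[of n] ish by (intro mult_left_mono) auto
   also have "\<dots> = L * (\<integral>x. indicator (sh n) x \<partial>leb B)" using N1[of n] by simp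
   finally have "N n * \<bar>\<integral>x. indicator (sh n) x * Q x - indicator (sh n) x * K x \<partial>leb B\<bar> \<le> L * (\<integral>x. indicator (sh n) x \<partial>leb B)" .
   moreover have "norm (N n * JQ n - N n * JK n) = N n * \<bar>\<integral>x. indicator (sh n) x * Q x - indicator (sh n) x * K x \<partial>leb B\<bar>"
    unfolding JQ_def JK_def right_diff_distrib[symmetric, of "N n"] bochner_diff[OF i2[of n] iK[of n], symmetric]
    by (simp only: real_norm_def abs_mult abs_of_nonneg[OF order_trans[OF zero_le_one N1]])
   ultimately show "norm (N n * JQ n - N n * JK n) \<le> L * (\<integral>x. indicator (sh n) x \<partial>leb B)" by (simp only:)
  qed
  have "(\<lambda>n. \<integral>x. indicator (sh n) x \<partial>leb B) \<longlonglongrightarrow> (\<integral>x. (0::real) \<partial>leb B)"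
  proof (rule integral_dominated_convergence[where w="\<lambda>_. 1"])
   show "AE x in leb B. (\<lambda>n. indicator (sh n) x :: real) \<longlonglongrightarrow> 0"
   proof (rule AE_I2)
    fix x assume "x \<in> space (leb B)"
    then have x: "norm x < 1" by (simp add: B_def)
    obtain n0 :: nat where n0: "1 / (1 - norm x) < real n0" using reals_Archimedean2 by blast
    have "indicator (sh n) x = (0::real)" if "n \<ge> n0" for n
    proof -
     have "1 / (1 - norm x) \<le> N n" using n0 that by (simp add: N_def)
     then have "1 \<le> N n * (1 - norm x)" using x by (simp add: field_simps)
     then have "1 / N n \<le> 1 - norm x" using N1[of n] by (simp add: field_simps)
     then show ?thesis by (simp add: sh_def)
    qed
    then show "(\<lambda>n. indicator (sh n) x :: real) \<longlonglongrightarrow> 0"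
     by (intro tendsto_eventually) (auto simp: eventually_sequentially)
   qed
   show "integrable (leb B) (\<lambda>_. 1::real)" by (rule integrable_bounded_on[OF Bm]) auto
  qed (auto simp: indicator_def intro!: borel_imp_lebesgue_on)
  then show "(\<lambda>n. L * (\<integral>x. indicator (sh n) x \<partial>leb B)) \<longlonglongrightarrow> 0"
   by (auto intro!: tendsto_eq_intros)
 qed
 have "(\<lambda>n. \<integral>x. cf n x * pd i H x \<partial>leb B) \<longlonglongrightarrow> real CARD('n) * IK"
  using tendsto_add[OF lim3 lim2] by (simp add: eq)
 from LIMSEQ_unique[OF lim1 this]
 have "(\<integral>x. pd i H x \<partial>leb B) = real CARD('n) * IK" .
 moreover have "(\<integral>x. pd i H x \<partial>leb B) = (\<integral>x. pd i F x \<partial>leb B)"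
 proof (intro bochner_cong refl pHF)
  fix x assume "x \<in> space (leb B)"
  then have "norm x < 1" by (simp add: B_def)
  then show "norm x < sqrt 2" using sq2 by (rule less_trans)
 qed
 ultimately show ?thesis by (simp add: IK_def KF B_def)
qed

section \<open>Integration over spheres\<close>

lemma sphere_measure_sets: "sets (sphere_measure a r) = sets (restrict_space borel (sphere a r))"
 by (simp add: sphere_measure_def)

lemma sphere_measure_space: "space (sphere_measure a r) = sphere a r"
 by (simp add: sphere_measure_def space_restrict_space)

lemma continuous_sphere_measurable:
 fixes g :: "real^'n \<Rightarrow> 'b::{second_countable_topology, real_normed_vector}"
 assumes "continuous_on (sphere a r) g"
 shows "g \<in> borel_measurable (sphere_measure a r)"
 using borel_measurable_continuous_on_restrict[OF assms]
 by (subst measurable_cong_sets[OF sphere_measure_sets refl])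

lemma radial_measurable:
 fixes a :: "real^'n"
 assumes "r \<ge> 0"
 shows "(\<lambda>x. a + (r / norm x) *\<^sub>R x) \<in> restrict_space lborel (ball 0 1 - {0}) \<rightarrow>\<^sub>M restrict_space borel (sphere a r)"
proof (rule measurable_restrict_space2)
 show "(\<lambda>x. a + (r / norm x) *\<^sub>R x) \<in> space (restrict_space lborel (ball 0 1 - {0})) \<rightarrow> sphere a r"
  using assms by (auto simp: space_restrict_space dist_norm norm_minus_commute)
 show "(\<lambda>x. a + (r / norm x) *\<^sub>R x) \<in> restrict_space lborel (ball 0 1 - {0}) \<rightarrow>\<^sub>M borel"
  by (intro measurable_restrict_space1) measurable
qed

text \<open>Up to the constant density the surface measure is a push-forward under radial
  projection, so integrating over the sphere means integrating the extension of degree 0 over the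
  punctured unit ball.\<close>

lemma sphere_measure_integrable_iff:
 fixes g :: "real^'n \<Rightarrow> 'b::{banach, second_countable_topology}"
 assumes r: "r > 0" and g: "g \<in> borel_measurable (sphere_measure a r)"
 shows "integrable (sphere_measure a r) g \<longleftrightarrow>
   integrable (restrict_space lborel (ball 0 1 - {0})) (\<lambda>x. g (a + (r / norm x) *\<^sub>R x))"
  "(\<integral>t. g t \<partial>sphere_measure a r) =
   (real CARD('n) * r ^ (CARD('n) - 1)) *\<^sub>R
   (\<integral>x. g (a + (r / norm x) *\<^sub>R x) \<partial>restrict_space lborel (ball 0 1 - {0}))"
proof -
 let ?D = "distr (restrict_space lborel (ball 0 1 - {0})) (restrict_space borel (sphere a r))
     (\<lambda>x. a + (r / norm x) *\<^sub>R x)"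
 have g': "g \<in> borel_measurable (restrict_space borel (sphere a r))"
  using g by (subst (asm) measurable_cong_sets[OF sphere_measure_sets refl])
 then have gD: "g \<in> borel_measurable ?D" by simp
 have rm: "(\<lambda>x. a + (r / norm x) *\<^sub>R x) \<in> restrict_space lborel (ball 0 1 - {0}) \<rightarrow>\<^sub>M restrict_space borel (sphere a r)"
  using r by (intro radial_measurable) auto
 have c: "real CARD('n) * r ^ (CARD('n) - 1) > 0" using r by simp
 have "integrable (sphere_measure a r) g \<longleftrightarrow> integrable ?D (\<lambda>x. (real CARD('n) * r ^ (CARD('n) - 1)) *\<^sub>R g x)"
  unfolding sphere_measure_def using c gD by (subst integrable_density) auto
 also have "\<dots> \<longleftrightarrow> integrable ?D g"
 proof
  define k where "k = real CARD('n) * r ^ (CARD('n) - 1)"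
  assume "integrable ?D (\<lambda>x. (real CARD('n) * r ^ (CARD('n) - 1)) *\<^sub>R g x)"
  then have "integrable ?D (\<lambda>x. (1 / k) *\<^sub>R (k *\<^sub>R g x))"
   unfolding k_def by (rule integrable_scaleR_right)
  moreover have "k > 0" using c by (simp add: k_def)
  ultimately show "integrable ?D g" by simp
 qed (rule integrable_scaleR_right)
 also have "\<dots> \<longleftrightarrow> integrable (restrict_space lborel (ball 0 1 - {0})) (\<lambda>x. g (a + (r / norm x) *\<^sub>R x))"
  by (rule integrable_distr_eq[OF rm g'])
 finally show "integrable (sphere_measure a r) g \<longleftrightarrow>
   integrable (restrict_space lborel (ball 0 1 - {0})) (\<lambda>x. g (a + (r / norm x) *\<^sub>R x))" .
 have "(\<integral>t. g t \<partial>sphere_measure a r) = (\<integral>t. (real CARD('n) * r ^ (CARD('n) - 1)) *\<^sub>R g t \<partial>?D)"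
  unfolding sphere_measure_def using c gD by (subst integral_density) auto
 also have "\<dots> = (real CARD('n) * r ^ (CARD('n) - 1)) *\<^sub>R (\<integral>t. g t \<partial>?D)" by simp
 also have "(\<integral>t. g t \<partial>?D) = (\<integral>x. g (a + (r / norm x) *\<^sub>R x) \<partial>restrict_space lborel (ball 0 1 - {0}))"
  by (rule integral_distr[OF rm g'])
 finally show "(\<integral>t. g t \<partial>sphere_measure a r) =
   (real CARD('n) * r ^ (CARD('n) - 1)) *\<^sub>R
   (\<integral>x. g (a + (r / norm x) *\<^sub>R x) \<partial>restrict_space lborel (ball 0 1 - {0}))" .
qed

lemma finite_sphere_measure:
 fixes a :: "real^'n"
 assumes "r > 0"
 shows "finite_measure (sphere_measure a r)"
proof -
 have "emeasure (restrict_space lborel (ball (0::real^'n) 1 - {0})) (space (restrict_space lborel (ball 0 1 - {0}))) < \<infinity>"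
 proof -
  have "emeasure lborel (ball (0::real^'n) 1 - {0}) \<le> emeasure lborel (ball (0::real^'n) 1)"
   by (intro emeasure_mono) auto
  also have "\<dots> < \<infinity>" using emeasure_lborel_ball_finite by (simp add: less_top)
  finally show ?thesis by (simp add: emeasure_restrict_space space_restrict_space)
 qed
 then interpret finite_measure "restrict_space lborel (ball (0::real^'n) 1 - {0})"
  by (intro finite_measureI) auto
 have "integrable (sphere_measure a r) (\<lambda>_. 1::real)"
  using assms by (subst sphere_measure_integrable_iff) auto
 then show ?thesis
  by (intro finite_measureI) (auto simp: integrable_iff_bounded)
qed

lemma sphere_integrable_bounded:
 fixes g :: "real^'n \<Rightarrow> 'b::{banach, second_countable_topology}"
 assumes "r > 0" "g \<in> borel_measurable (sphere_measure a r)" "\<And>x. x \<in> sphere a r \<Longrightarrow> norm (g x) \<le> B"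
 shows "integrable (sphere_measure a r) g"
 using assms
 by (intro finite_measure.integrable_const_bound[OF finite_sphere_measure, of _ _ B] AE_I2)
  (auto simp: sphere_measure_space)

lemma continuous_sphere_bounded:
 fixes g :: "real^'n \<Rightarrow> 'b::{banach, second_countable_topology}"
 assumes "continuous_on (sphere a r) g"
 obtains B where "\<And>x. x \<in> sphere a r \<Longrightarrow> norm (g x) \<le> B"
proof -
 have "bounded (g ` sphere a r)"
  by (intro compact_imp_bounded compact_continuous_image assms) auto
 then obtain B where "\<forall>x\<in>sphere a r. norm (g x) \<le> B" unfolding bounded_iff by blast
 with that[of B] show ?thesis by blast
qed

lemma sphere_integrable_continuous:
 fixes g :: "real^'n \<Rightarrow> 'b::{banach, second_countable_topology}"
 assumes "r > 0" "continuous_on (sphere a r) g"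
 shows "integrable (sphere_measure a r) g"
proof -
 obtain B where "\<And>x. x \<in> sphere a r \<Longrightarrow> norm (g x) \<le> B"
  using continuous_sphere_bounded[OF assms(2)] by blast
 then show ?thesis
  using assms by (intro sphere_integrable_bounded continuous_sphere_measurable)
qed

text \<open>The centre was removed in the definition of the measure because the projection is
  undefined there. As a null set it may be put back, which brings the integral into the form
  produced by the divergence theorem on the unit ball.\<close>

lemma sphere_integral_borel:
 fixes g :: "real^'n \<Rightarrow> 'b::{banach, second_countable_topology}"
 assumes r: "r > 0" and g: "g \<in> borel_measurable borel"
 shows "(\<integral>t. g t \<partial>sphere_measure a r) =
   (real CARD('n) * r ^ (CARD('n) - 1)) *\<^sub>R
   (\<integral>x. g (a + (r / norm x) *\<^sub>R x) \<partial>leb (ball 0 1))"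
proof -
 have gs: "g \<in> borel_measurable (sphere_measure a r)"
  using g by (subst measurable_cong_sets[OF sphere_measure_sets refl]) (rule measurable_restrict_space1)
 note g [measurable]
 have [measurable]: "ball (0::real^'n) 1 \<in> sets borel" by simp
 have m: "(\<lambda>x. indicator (ball 0 1 - {0}) x *\<^sub>R g (a + (r / norm x) *\<^sub>R x)) \<in> borel_measurable lborel"
  by measurable
 have "(\<integral>x. g (a + (r / norm x) *\<^sub>R x) \<partial>restrict_space lborel (ball 0 1 - {0})) =
   (\<integral>x. indicator (ball 0 1 - {0}) x *\<^sub>R g (a + (r / norm x) *\<^sub>R x) \<partial>lborel)"
  by (subst integral_restrict_space) auto
 also have "\<dots> = (\<integral>x. indicator (ball 0 1 - {0}) x *\<^sub>R g (a + (r / norm x) *\<^sub>R x) \<partial>lebesgue)"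
  using integral_completion[OF m] by simp
 also have "\<dots> = (\<integral>x. indicator (ball 0 1) x *\<^sub>R g (a + (r / norm x) *\<^sub>R x) \<partial>lebesgue)"
 proof (rule integral_cong_AE)
  have "negligible {0::real^'n}" by simp
  then have "AE x in lebesgue. x \<notin> {0::real^'n}" unfolding negligible_iff_null_sets by (rule AE_not_in)
  then show "AE x in lebesgue. indicator (ball 0 1 - {0}) x *\<^sub>R g (a + (r / norm x) *\<^sub>R x) = indicator (ball 0 1) x *\<^sub>R g (a + (r / norm x) *\<^sub>R x)"
   by eventually_elim (auto simp: indicator_def)
 qed (use m in \<open>(intro measurable_completion; measurable)+\<close>)
 also have "\<dots> = (\<integral>x. g (a + (r / norm x) *\<^sub>R x) \<partial>leb (ball 0 1))"
  by (simp add: lebesgue_on_indicator)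
 finally show ?thesis using sphere_measure_integrable_iff(2)[OF r gs] by simp
qed

text \<open>Scaling of the unit ball: volume contributes \<open>r ^ d\<close>, the chain rule takes
  away one factor \<open>r\<close>, and the exponent \<open>d - 1\<close> of the surface measure is
  what is left.\<close>

lemma divergence_ball:
 fixes F :: "real^'n \<Rightarrow> real"
 assumes r: "r > 0" and F: "elem F"
 shows "(\<integral>x. pd i F x \<partial>leb (ball a r)) =
  (\<integral>t. (t $ i - a $ i) / r * F t \<partial>sphere_measure a r)"
proof -
 define Fa where "Fa y = F (a + r *\<^sub>R y)" for y
 have Fa: "elem Fa" unfolding Fa_def[abs_def] by (rule elem_affine[OF F])
 have pFa: "pd i Fa y = r * pd i F (a + r *\<^sub>R y)" for y
  unfolding Fa_def[abs_def] by (rule part_deriv_affine[OF elem_UNIV_differentiable[OF F]])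
 have 1: "(\<integral>x. pd i F x \<partial>leb (ball a r)) = r ^ CARD('n) * (\<integral>x. pd i F (a + r *\<^sub>R x) \<partial>leb (ball 0 1))"
  using integral_ball_affine[OF elem_UNIV_borel[OF elem_UNIV_part_deriv[OF F]] r] by simp
 have 2: "r * (\<integral>x. pd i F (a + r *\<^sub>R x) \<partial>leb (ball 0 1)) =
   real CARD('n) * (\<integral>x. x $ i / norm x * F (a + (r / norm x) *\<^sub>R x) \<partial>leb (ball 0 1))"
  using divergence_unit_ball[OF Fa, of i] by (simp add: pFa) (simp add: Fa_def)
 have 3: "(\<integral>t. (t $ i - a $ i) / r * F t \<partial>sphere_measure a r) =
  (real CARD('n) * r ^ (CARD('n) - 1)) * (\<integral>x. x $ i / norm x * F (a + (r / norm x) *\<^sub>R x) \<partial>leb (ball 0 1))"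
 proof -
  have "(\<lambda>t. (t $ i - a $ i) / r * F t) \<in> borel_measurable borel"
   using elem_UNIV_borel[OF F] by measurable
  moreover have "((a + (r / norm x) *\<^sub>R x) $ i - a $ i) / r = x $ i / norm x" for x
   using r by (simp add: field_simps)
  ultimately show ?thesis using sphere_integral_borel[OF r, of "\<lambda>t. (t $ i - a $ i) / r * F t" a]
   by (simp only: real_scaleR_def)
 qed
 have "r ^ CARD('n) = r ^ (CARD('n) - 1) * r" by (simp flip: power_Suc2)
 with 1 2 3 show ?thesis by simp
qed

lemma sphere_total:
 fixes a :: "real^'n"
 assumes "r > 0"
 shows "(\<integral>t. 1 \<partial>sphere_measure a r) = real CARD('n) * r ^ (CARD('n) - 1) * measure lebesgue (ball (0::real^'n) 1)"
proof -
 have "(\<integral>x. (1::real) \<partial>leb (ball (0::real^'n) 1)) = measure lebesgue (ball (0::real^'n) 1)"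
  by (simp add: measure_restrict_space)
 then show ?thesis
  using sphere_integral_borel[OF assms, of "\<lambda>_. 1::real" a] by simp
qed

section \<open>Polynomials\<close>

abbreviation (input) rpoly :: "(real^'n \<Rightarrow> real) \<Rightarrow> bool" where
 "rpoly \<equiv> real_polynomial_function"

lemma poly_elem:
 fixes p :: "real^'n \<Rightarrow> real"
 assumes "rpoly p"
 shows "elementary U p"
 using assms
proof (induction rule: real_polynomial_function.induct)
 case (linear f)
 then have "linear f" by (rule bounded_linear.linear)
 then have "f x = (\<Sum>i\<in>UNIV. x $ i * f (axis i 1))" for x
  by (subst vec_sum_axis[of x]) (simp add: linear_sum linear_cmul)
 note eq = this
 have "elementary U (\<lambda>x. \<Sum>i\<in>UNIV. x $ i * f (axis i 1))"
  by (intro elem_sum elem_intros)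
 then show ?case by (rule elementary.cong) (rule eq[symmetric])
qed (auto intro: elem_intros)

lemma poly_part_deriv:
 fixes p :: "real^'n \<Rightarrow> real"
 assumes "rpoly p"
 shows "rpoly (pd i p)"
 using assms
proof (induction rule: real_polynomial_function.induct)
 case (linear f)
 then have "pd i f x = f (axis i 1)" for x
  by (intro part_deriv_eq bounded_linear_imp_has_derivative)
 then have "pd i f = (\<lambda>x. f (axis i 1))" by auto
 then show ?case by auto
next
 case (const c)
 have "pd i (\<lambda>x. c) = (\<lambda>x. 0)" by (auto simp: part_deriv_const)
 then show ?case by auto
next
 case (add f g)
 have "pd i (\<lambda>x. f x + g x) = (\<lambda>x. pd i f x + pd i g x)"
  using add.hyps by (auto intro!: part_deriv_add elem_UNIV_differentiable poly_elem)
 then show ?case using add by auto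
next
 case (mult f g)
 have "pd i (\<lambda>x. f x * g x) = (\<lambda>x. pd i f x * g x + f x * pd i g x)"
  using mult.hyps by (auto intro!: part_deriv_mult elem_UNIV_differentiable poly_elem)
 then show ?case using mult by auto
qed

lemma poly_coord [intro]: "rpoly (\<lambda>x::real^'n. x $ i)"
 by (rule real_polynomial_function.intros(1)) (rule bounded_linear_vec_nth)

text \<open>A measurable function is an almost everywhere limit of continuous ones; truncating these
  at the height \<open>M\<close> preserves the limit, and Stone-Weierstrass replaces them by
  polynomials. The extra 1 in the bound absorbs the uniform error.\<close>

lemma poly_approx_bounded:
 fixes f :: "real^'n \<Rightarrow> real"
 assumes f: "f \<in> borel_measurable (leb (ball a r))" and M: "\<And>x. x \<in> ball a r \<Longrightarrow> \<bar>f x\<bar> \<le> M"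
 obtains p where "\<And>n. rpoly (p n)" "\<And>n x. x \<in> ball a r \<Longrightarrow> \<bar>p n x\<bar> \<le> \<bar>M\<bar> + 1"
  "AE x in leb (ball a r). (\<lambda>n. p n x) \<longlonglongrightarrow> f x"
proof -
 have "f measurable_on (ball a r)"
  using f by (subst measurable_on_iff_borel_measurable) auto
 then obtain N g where N: "negligible N" and g: "\<And>n. continuous_on UNIV (g n)"
  and lim: "\<And>x. x \<notin> N \<Longrightarrow> (\<lambda>n. g n x) \<longlonglongrightarrow> (if x \<in> ball a r then f x else 0)"
  unfolding measurable_on_def by metis
 define h where "h n x = max (- \<bar>M\<bar>) (min \<bar>M\<bar> (g n x))" for n x
 have h: "continuous_on (cball a r) (h n)" for n
  unfolding h_def by (intro continuous_intros continuous_on_subset[OF g]) auto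
 have "\<exists>p. rpoly p \<and> (\<forall>x\<in>cball a r. \<bar>h n x - p x\<bar> < inverse (real (Suc n)))" for n
 proof -
  have "0 < inverse (real (Suc n))" by simp
  show ?thesis
   by (rule Stone_Weierstrass_real_polynomial_function[OF compact_cball h[of n] \<open>0 < inverse (real (Suc n))\<close>])
    (intro exI conjI ballI)
 qed
 then have "\<exists>p. \<forall>n. rpoly (p n) \<and> (\<forall>x\<in>cball a r. \<bar>h n x - p n x\<bar> < inverse (real (Suc n)))"
  by (intro choice allI)
 then obtain p where p: "\<And>n. rpoly (p n)"
  and hp: "\<And>n x. x \<in> cball a r \<Longrightarrow> \<bar>h n x - p n x\<bar> < inverse (real (Suc n))" by blast
 have hb: "\<bar>h n x\<bar> \<le> \<bar>M\<bar>" for n x by (auto simp: h_def)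
 show ?thesis
 proof (rule that[of p])
  fix n x assume "x \<in> ball a r"
  then have "\<bar>h n x - p n x\<bar> < inverse (real (Suc n))" by (intro hp) auto
  moreover have "inverse (real (Suc n)) \<le> 1" by (simp add: field_simps)
  ultimately show "\<bar>p n x\<bar> \<le> \<bar>M\<bar> + 1" using hb[of n x] by linarith
 next
  have "AE x in lebesgue. x \<notin> N" using N unfolding negligible_iff_null_sets by (rule AE_not_in)
  then have "AE x in leb (ball a r). x \<notin> N"
   by (subst AE_restrict_space_iff) auto
  then show "AE x in leb (ball a r). (\<lambda>n. p n x) \<longlonglongrightarrow> f x"
   using AE_space
  proof eventually_elim
   case (elim x)
   then have x: "x \<in> ball a r" by simp
   have "(\<lambda>n. g n x) \<longlonglongrightarrow> f x" using lim[of x] elim x by simp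
   then have "(\<lambda>n. h n x) \<longlonglongrightarrow> max (- \<bar>M\<bar>) (min \<bar>M\<bar> (f x))"
    unfolding h_def by (intro tendsto_intros)
   also have "max (- \<bar>M\<bar>) (min \<bar>M\<bar> (f x)) = f x" using M[OF x] by auto
   finally have 1: "(\<lambda>n. h n x) \<longlonglongrightarrow> f x" .
   have 2: "(\<lambda>n. p n x - h n x) \<longlonglongrightarrow> 0"
   proof (rule Lim_null_comparison[OF _ LIMSEQ_inverse_real_of_nat])
    have "norm (p n x - h n x) \<le> inverse (real (Suc n))" for n
     using hp[of x n] x by auto
    then show "\<forall>\<^sub>F n in sequentially. norm (p n x - h n x) \<le> inverse (real (Suc n))" by simp
   qed
   show ?case using tendsto_add[OF 1 2] by simp
  qed
 qed (rule p)
qed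

lemma poly_lebesgue_on: "rpoly (p::real^'n\<Rightarrow>real) \<Longrightarrow> p \<in> borel_measurable (leb S)"
 by (intro elem_UNIV_lebesgue_on poly_elem)

text \<open>Bounded polynomial approximation of the sign of \<open>h\<close> turns orthogonality
  into vanishing of the \<open>L1\<close> norm, so the argument works for integrable
  \<open>h\<close>.\<close>

lemma orth_poly_zero_real:
 fixes h :: "real^'n \<Rightarrow> real"
 assumes h: "integrable (leb (ball a r)) h"
  and orth: "\<And>p. rpoly p \<Longrightarrow> (\<integral>x. p x * h x \<partial>leb (ball a r)) = 0"
 shows "AE x in leb (ball a r). h x = 0"
proof -
 have hm: "h \<in> borel_measurable (leb (ball a r))" using h by auto
 have "(\<lambda>x. sgn (h x)) \<in> borel_measurable (leb (ball a r))" using hm by measurable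
 then obtain p where p: "\<And>n. rpoly (p n)" "\<And>n x. x \<in> ball a r \<Longrightarrow> \<bar>p n x\<bar> \<le> \<bar>1\<bar> + 1"
  "AE x in leb (ball a r). (\<lambda>n. p n x) \<longlonglongrightarrow> sgn (h x)"
  by (rule poly_approx_bounded[where M=1]) (auto simp: sgn_if)
 have "(\<lambda>n. \<integral>x. p n x * h x \<partial>leb (ball a r)) \<longlonglongrightarrow> (\<integral>x. sgn (h x) * h x \<partial>leb (ball a r))"
 proof (rule integral_dominated_convergence[where w="\<lambda>x. 2 * \<bar>h x\<bar>"])
  show "AE x in leb (ball a r). (\<lambda>n. p n x * h x) \<longlonglongrightarrow> sgn (h x) * h x"
   using p(3) by eventually_elim (intro tendsto_intros)
  show "AE x in leb (ball a r). norm (p n x * h x) \<le> 2 * \<bar>h x\<bar>" for n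
  proof (rule AE_I2)
   fix x assume "x \<in> space (leb (ball a r))"
   then have "\<bar>p n x\<bar> \<le> 2" using p(2)[of x n] by simp
   then show "norm (p n x * h x) \<le> 2 * \<bar>h x\<bar>" by (simp add: abs_mult mult_right_mono)
  qed
 qed (use h hm poly_lebesgue_on[OF p(1)] in auto)
 then have "(\<integral>x. sgn (h x) * h x \<partial>leb (ball a r)) = 0"
  by (simp add: orth[OF p(1)] LIMSEQ_const_iff)
 moreover have "sgn (h x) * h x = \<bar>h x\<bar>" for x by (simp add: sgn_if)
 ultimately have "(\<integral>x. \<bar>h x\<bar> \<partial>leb (ball a r)) = 0" by simp
 then have "AE x in leb (ball a r). \<bar>h x\<bar> = 0"
  using h by (subst (asm) integral_nonneg_eq_0_iff_AE) auto
 then show ?thesis by simp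
qed

lemma integral_Re_Im:
 assumes "integrable M (f :: _ \<Rightarrow> complex)"
 shows "integrable M (\<lambda>x. Re (f x))" "integrable M (\<lambda>x. Im (f x))"
  "Re (\<integral>x. f x \<partial>M) = (\<integral>x. Re (f x) \<partial>M)" "Im (\<integral>x. f x \<partial>M) = (\<integral>x. Im (f x) \<partial>M)"
 using integrable_bounded_linear[OF bounded_linear_Re assms] integrable_bounded_linear[OF bounded_linear_Im assms]
  integral_bounded_linear[OF bounded_linear_Re assms] integral_bounded_linear[OF bounded_linear_Im assms] by simp_all

lemma poly_bounded_ball:
 fixes p :: "real^'n \<Rightarrow> real"
 assumes "rpoly p"
 obtains B where "\<And>x. x \<in> ball a r \<Longrightarrow> \<bar>p x\<bar> \<le> B"
proof -
 have "bounded (p ` cball a r)"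
  by (intro compact_imp_bounded compact_continuous_image elem_UNIV_continuous poly_elem compact_cball assms)
 then obtain B where "\<forall>x\<in>cball a r. norm (p x) \<le> B" unfolding bounded_iff by blast
 then show ?thesis using that[of B] by auto
qed

lemma integrable_bounded_mult:
 fixes f :: "'a \<Rightarrow> real" and g :: "'a \<Rightarrow> 'b::{banach, second_countable_topology}"
 assumes "integrable M g" "f \<in> borel_measurable M" "AE x in M. \<bar>f x\<bar> \<le> B"
 shows "integrable M (\<lambda>x. f x *\<^sub>R g x)"
proof (rule bochner_bound[of _ "\<lambda>x. B * norm (g x)"])
 show "AE x in M. norm (f x *\<^sub>R g x) \<le> norm (B * norm (g x))"
  using assms(3) by eventually_elim (auto simp: abs_mult intro!: mult_right_mono)
qed (use assms in auto)

lemma orth_poly_zero: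
 fixes h :: "real^'n \<Rightarrow> complex"
 assumes h: "integrable (leb (ball a r)) h"
  and orth: "\<And>p. rpoly p \<Longrightarrow> (\<integral>x. p x *\<^sub>R h x \<partial>leb (ball a r)) = 0"
 shows "AE x in leb (ball a r). h x = 0"
proof -
 have i: "integrable (leb (ball a r)) (\<lambda>x. p x *\<^sub>R h x)" if p: "rpoly p" for p
 proof -
  obtain B where "\<And>x. x \<in> ball a r \<Longrightarrow> \<bar>p x\<bar> \<le> B" using poly_bounded_ball[OF p] by blast
  then show ?thesis using p by (intro integrable_bounded_mult[OF h, of _ B] poly_lebesgue_on AE_I2) auto
 qed
 have "AE x in leb (ball a r). Re (h x) = 0"
  using integral_Re_Im(3)[OF i] orth by (intro orth_poly_zero_real integral_Re_Im h) auto
 moreover have "AE x in leb (ball a r). Im (h x) = 0"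
  using integral_Re_Im(4)[OF i] orth by (intro orth_poly_zero_real integral_Re_Im h) auto
 ultimately show ?thesis by eventually_elim (simp add: complex_eq_iff)
qed

text \<open>Truncation reduces to a bounded function, where bounded polynomial approximations
  converge in mean square by dominated convergence. Each error is kept below \<open>e / 4\<close>
  because squaring a sum costs a factor 2.\<close>

lemma poly_dense_real:
 fixes f :: "real^'n \<Rightarrow> real"
 assumes f: "f \<in> borel_measurable (leb (ball a r))" "integrable (leb (ball a r)) (\<lambda>x. (f x)^2)"
  and e: "e > 0"
 obtains p where "rpoly p" "(\<integral>x. (f x - p x)^2 \<partial>leb (ball a r)) < e"
proof -
 let ?M = "leb (ball a r)"
 interpret finite_measure ?M by (rule finite_measure_lebesgue_on) simp
 define c where "c k x = max (- real k) (min (real k) (f x))" for k x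
 have cm: "c k \<in> borel_measurable ?M" for k unfolding c_def using f(1) by measurable
 have cb: "\<bar>c k x\<bar> \<le> real k" for k x by (auto simp: c_def)
 have d: "(f x - c k x)^2 \<le> (f x)^2" for k x
  by (subst abs_le_square_iff[symmetric]) (auto simp: c_def)
 have "(\<lambda>k. \<integral>x. (f x - c k x)^2 \<partial>?M) \<longlonglongrightarrow> (\<integral>x. 0 \<partial>?M)"
 proof (rule integral_dominated_convergence[where w="\<lambda>x. (f x)^2"])
  show "AE x in ?M. (\<lambda>k. (f x - c k x)^2) \<longlonglongrightarrow> 0"
  proof (rule AE_I2)
   fix x
   obtain n0 :: nat where n0: "\<bar>f x\<bar> < real n0" using reals_Archimedean2 by blast
   have "(f x - c n x)^2 = 0" if "n \<ge> n0" for n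
   proof -
    have "real n0 \<le> real n" using that by simp
    then show ?thesis using n0 by (auto simp: c_def)
   qed
   then show "(\<lambda>k. (f x - c k x)^2) \<longlonglongrightarrow> 0"
    by (intro tendsto_eventually) (auto simp: eventually_sequentially)
  qed
 qed (use f cm d in auto)
 then have "eventually (\<lambda>k. (\<integral>x. (f x - c k x)^2 \<partial>?M) < e / 4) sequentially"
  using e by (intro order_tendstoD(2)) auto
 then obtain k where k: "(\<integral>x. (f x - c k x)^2 \<partial>?M) < e / 4" by (auto simp: eventually_sequentially)
 obtain p where p: "\<And>n. rpoly (p n)" "\<And>n x. x \<in> ball a r \<Longrightarrow> \<bar>p n x\<bar> \<le> \<bar>real k\<bar> + 1"
  "AE x in ?M. (\<lambda>n. p n x) \<longlonglongrightarrow> c k x"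
  by (rule poly_approx_bounded[OF cm[of k] cb[of k]]) (rule that; assumption)
 have pb: "(c k x - p n x)^2 \<le> (2 * real k + 1)^2" if "x \<in> ball a r" for n x
  using p(2)[OF that, of n] cb[of k x] by (subst abs_le_square_iff[symmetric]) auto
 have ip: "integrable ?M (\<lambda>x. (c k x - p n x)^2)" for n
  using pb cm poly_lebesgue_on[OF p(1)] by (intro integrable_bounded_on[of _ _ "(2 * real k + 1)^2"]) auto
 have "(\<lambda>n. \<integral>x. (c k x - p n x)^2 \<partial>?M) \<longlonglongrightarrow> (\<integral>x. 0 \<partial>?M)"
 proof (rule integral_dominated_convergence[where w="\<lambda>x. (2 * real k + 1)^2"])
  show "AE x in ?M. (\<lambda>n. (c k x - p n x)^2) \<longlonglongrightarrow> 0"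
   using p(3)
  proof eventually_elim
   case (elim x)
   have "(\<lambda>n. (c k x - p n x)^2) \<longlonglongrightarrow> (c k x - c k x)^2" by (intro tendsto_intros elim)
   then show ?case by simp
  qed
 qed (use ip pb in auto)
 then have "eventually (\<lambda>n. (\<integral>x. (c k x - p n x)^2 \<partial>?M) < e / 4) sequentially"
  using e by (intro order_tendstoD(2)) auto
 then obtain n where n: "(\<integral>x. (c k x - p n x)^2 \<partial>?M) < e / 4" by (auto simp: eventually_sequentially)
 have i1: "integrable ?M (\<lambda>x. (f x - c k x)^2)"
  by (rule bochner_bound[OF f(2)]) (use f cm d in auto)
 have pt: "(f x - p n x)^2 \<le> 2 * (f x - c k x)^2 + 2 * (c k x - p n x)^2" for x
 proof -
  have "0 \<le> ((f x - c k x) - (c k x - p n x))^2" by simp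
  then show ?thesis by (simp add: power2_eq_square algebra_simps)
 qed
 have i2: "integrable ?M (\<lambda>x. 2 * (f x - c k x)^2 + 2 * (c k x - p n x)^2)" using i1 ip by auto
 have "(\<integral>x. (f x - p n x)^2 \<partial>?M) \<le> (\<integral>x. 2 * (f x - c k x)^2 + 2 * (c k x - p n x)^2 \<partial>?M)"
  using pt by (intro integral_mono_AE' i2 AE_I2) auto
 also have "\<dots> = 2 * (\<integral>x. (f x - c k x)^2 \<partial>?M) + 2 * (\<integral>x. (c k x - p n x)^2 \<partial>?M)"
  using i1 ip by simp
 also have "\<dots> < e" using k n by linarith
 finally show ?thesis using that[OF p(1)] by blast
qed

section \<open>The Laplacian on homogeneous polynomials\<close>

definition lap :: "(real^'n \<Rightarrow> real) \<Rightarrow> real^'n \<Rightarrow> real" where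
 "lap f x = (\<Sum>i\<in>UNIV. pd i (pd i f) x)"

lemma pd_add: "elem f \<Longrightarrow> elem g \<Longrightarrow>
  pd i (\<lambda>x. f x + g x) = (\<lambda>x. pd i f x + pd i g x)"
 by (rule ext) (intro part_deriv_add elem_UNIV_differentiable)

lemma pd_diff: "elem f \<Longrightarrow> elem g \<Longrightarrow>
  pd i (\<lambda>x. f x - g x) = (\<lambda>x. pd i f x - pd i g x)"
 by (rule ext) (intro part_deriv_diff elem_UNIV_differentiable)

lemma pd_mult: "elem f \<Longrightarrow> elem g \<Longrightarrow>
  pd i (\<lambda>x. f x * g x) = (\<lambda>x. pd i f x * g x + f x * pd i g x)"
 by (rule ext) (intro part_deriv_mult elem_UNIV_differentiable)

lemma pd_cmult: "elem f \<Longrightarrow> pd i (\<lambda>x. c * f x) = (\<lambda>x. c * pd i f x)"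
 by (rule ext) (intro part_deriv_cmult elem_UNIV_differentiable)

lemma pd_const: "pd i (\<lambda>x. c) = (\<lambda>x. 0)"
 by (rule ext) (rule part_deriv_const)

lemma pd_coord: "pd i (\<lambda>x. x $ j) = (\<lambda>x. if i = j then 1 else 0)"
 by (rule ext) (rule part_deriv_coord)

lemma pd_norm2: "pd i (\<lambda>x. (norm (x - a))^2) = (\<lambda>x. 2 * (x $ i - a $ i))"
 by (rule ext) (rule part_deriv_norm2)

lemmas pd_elem = elem_UNIV_part_deriv

lemma lap_elem: "elem f \<Longrightarrow> elem (lap f)"
 unfolding lap_def[abs_def] by (intro elem_sum pd_elem)

lemma lap_add: "elem f \<Longrightarrow> elem g \<Longrightarrow> lap (\<lambda>x. f x + g x) = (\<lambda>x. lap f x + lap g x)"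
 by (rule ext) (simp add: lap_def pd_add pd_elem sum.distrib)

lemma lap_diff: "elem f \<Longrightarrow> elem g \<Longrightarrow> lap (\<lambda>x. f x - g x) = (\<lambda>x. lap f x - lap g x)"
 by (rule ext) (simp add: lap_def pd_diff pd_elem sum_subtractf)

lemma lap_cmult: "elem f \<Longrightarrow> lap (\<lambda>x. c * f x) = (\<lambda>x. c * lap f x)"
 by (rule ext) (simp add: lap_def pd_cmult pd_elem sum_distrib_left)

lemma lap_mult:
 assumes f: "elem f" and g: "elem g"
 shows "lap (\<lambda>x. f x * g x) x = f x * lap g x + 2 * (\<Sum>i\<in>UNIV. pd i f x * pd i g x) + g x * lap f x"
proof -
 have "pd i (pd i (\<lambda>x. f x * g x)) x =
  f x * pd i (pd i g) x + 2 * (pd i f x * pd i g x) + g x * pd i (pd i f) x" for i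
  by (subst pd_mult[OF f g], subst pd_add) (auto intro!: elem_intros pd_elem f g simp: pd_mult pd_elem f g)
 then show ?thesis
  by (simp add: lap_def sum.distrib sum_distrib_left)
qed

lemma norm2_eq: "(\<lambda>x::real^'n. (norm x)^2) = (\<lambda>x. (norm (x - 0))^2)" by simp

lemma lap_norm2: "lap (\<lambda>x::real^'n. (norm x)^2) x = 2 * real CARD('n)"
 unfolding lap_def norm2_eq pd_norm2
 by (simp add: pd_cmult elem_intros pd_coord)

lemma lap_norm2_mult:
 fixes r :: "real^'n \<Rightarrow> real"
 assumes "elem r"
 shows "lap (\<lambda>x. (norm x)^2 * r x) x = (norm x)^2 * lap r x + 4 * (\<Sum>i\<in>UNIV. x $ i * pd i r x) + 2 * real CARD('n) * r x"
 unfolding lap_mult[OF elem_norm2_0 assms]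
 by (simp add: lap_norm2 part_deriv_norm2_0 sum_distrib_left mult_ac)

text \<open>The homogeneous polynomials of degree \<open>k\<close>, with 0 counted in every degree.
  Generating them by multiplication with coordinates makes Euler's identity and the drop of degree
  under differentiation plain inductions.\<close>

inductive hpoly :: "nat \<Rightarrow> (real^'n \<Rightarrow> real) \<Rightarrow> bool" where
 hp_const: "hpoly 0 (\<lambda>x. c)"
| hp_coord: "hpoly k p \<Longrightarrow> hpoly (Suc k) (\<lambda>x. x $ i * p x)"
| hp_add: "hpoly k p \<Longrightarrow> hpoly k q \<Longrightarrow> hpoly k (\<lambda>x. p x + q x)"

lemma hpoly_poly: "hpoly k p \<Longrightarrow> rpoly p"
 by (induction rule: hpoly.induct) (auto)

lemma hpoly_elem: "hpoly k p \<Longrightarrow> elementary U p"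
 by (rule poly_elem[OF hpoly_poly])

lemma hpoly_cmult: "hpoly k p \<Longrightarrow> hpoly k (\<lambda>x. c * p x)"
proof (induction rule: hpoly.induct)
 case (hp_const d)
 then show ?case by (rule hpoly.hp_const)
next
 case (hp_coord k p i)
 from hpoly.hp_coord[OF hp_coord.IH, of i] show ?case by (simp add: mult.left_commute)
next
 case (hp_add k p q)
 from hpoly.hp_add[OF hp_add.IH] show ?case by (simp add: distrib_left)
qed

lemma hpoly_zero: "hpoly k (\<lambda>x. 0)"
proof (induction k)
 case 0 show ?case by (rule hp_const)
next
 case (Suc k)
 from hp_coord[OF this] show ?case by simp
qed

lemma hpoly_sum: "(\<And>i. i \<in> I \<Longrightarrow> hpoly k (f i)) \<Longrightarrow> hpoly k (\<lambda>x. \<Sum>i\<in>I. f i x)"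
 by (induction I rule: infinite_finite_induct) (auto intro: hpoly_zero hp_add)

lemma hpoly_diff: "hpoly k p \<Longrightarrow> hpoly k q \<Longrightarrow> hpoly k (\<lambda>x. p x - q x)"
 using hp_add[of k p "\<lambda>x. - 1 * q x"] hpoly_cmult[of k q "-1"] by simp

lemma hpoly_norm2:
 fixes p :: "real^'n \<Rightarrow> real"
 assumes "hpoly k p" shows "hpoly (Suc (Suc k)) (\<lambda>x. (norm x)^2 * p x)"
proof -
 have "hpoly (Suc (Suc k)) (\<lambda>x. \<Sum>i\<in>UNIV. x $ i * (x $ i * p x))"
  by (intro hpoly_sum hp_coord assms)
 moreover have "(norm x)^2 * p x = (\<Sum>i\<in>UNIV. x $ i * (x $ i * p x))" for x :: "real^'n"
  unfolding norm_pow2_vec sum_distrib_right by (simp add: power2_eq_square mult.assoc)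
 ultimately show ?thesis by simp
qed

text \<open>Degree 0 has its own case, since a truncated \<open>k - 1\<close> would hide that the
  derivative of a constant vanishes, the fact behind \<open>hpoly_lap_low\<close>.\<close>

lemma hpoly_pd: "hpoly k p \<Longrightarrow> (case k of 0 \<Rightarrow> pd i p = (\<lambda>x. 0) | Suc k' \<Rightarrow> hpoly k' (pd i p))"
proof (induction rule: hpoly.induct)
 case (hp_const c)
 then show ?case by (simp add: pd_const)
next
 case (hp_coord k p j)
 have "pd i (\<lambda>x. x $ j * p x) = (\<lambda>x. (if i = j then 1 else 0) * p x + x $ j * pd i p x)"
  by (simp add: pd_mult elem_intros hpoly_elem[OF hp_coord.hyps] pd_coord)
 moreover have "hpoly k (\<lambda>x. (if i = j then 1 else 0) * p x + x $ j * pd i p x)"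
 proof (rule hp_add[OF hpoly_cmult[OF hp_coord.hyps]])
  show "hpoly k (\<lambda>x. x $ j * pd i p x)"
   using hp_coord.IH by (cases k) (auto intro: hpoly_zero hpoly.hp_coord)
 qed
 ultimately show ?case by simp
next
 case (hp_add k p q)
 have "pd i (\<lambda>x. p x + q x) = (\<lambda>x. pd i p x + pd i q x)"
  by (intro pd_add hpoly_elem[OF hp_add.hyps(1)] hpoly_elem[OF hp_add.hyps(2)])
 then show ?case using hp_add.IH by (cases k) (auto intro: hpoly.hp_add)
qed

text \<open>Euler's identity: on homogeneous polynomials the radial derivative acts as
  multiplication by the degree, which turns the first-order term of the Laplacian of a product with
  \<open>|x|^2\<close> into a number.\<close>

lemma hpoly_euler: "hpoly k p \<Longrightarrow> (\<Sum>i\<in>UNIV. x $ i * pd i p x) = real k * p x"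
proof (induction rule: hpoly.induct)
 case (hp_coord k p j)
 have "(\<Sum>i\<in>UNIV. x $ i * pd i (\<lambda>x. x $ j * p x) x) =
   (\<Sum>i\<in>UNIV. (if i = j then x $ i * p x else 0) + x $ j * (x $ i * pd i p x))"
  by (intro sum.cong) (auto simp: pd_mult elem_intros hpoly_elem[OF hp_coord.hyps] pd_coord algebra_simps)
 also have "\<dots> = x $ j * p x + x $ j * (real k * p x)"
  by (simp add: sum.distrib sum_distrib_left[symmetric] hp_coord.IH)
 finally show ?case by (simp add: algebra_simps)
next
 case (hp_add k p q)
 then show ?case by (simp add: pd_add hpoly_elem distrib_left sum.distrib)
qed (simp add: pd_const)

lemma hpoly_lap_low: "hpoly k p \<Longrightarrow> k < 2 \<Longrightarrow> lap p x = 0"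
proof -
 assume p: "hpoly k p" "k < 2"
 have "pd i (pd i p) = (\<lambda>x. 0)" for i
 proof (cases k)
  case 0 then show ?thesis using hpoly_pd[OF p(1), of i] by (simp add: pd_const)
 next
  case (Suc k')
  then have "hpoly 0 (pd i p)" using hpoly_pd[OF p(1), of i] p(2) by simp
  from hpoly_pd[OF this, of i] show ?thesis by simp
 qed
 then show ?thesis by (simp add: lap_def)
qed

lemma hpoly_lap: "hpoly (Suc (Suc k)) p \<Longrightarrow> hpoly k (lap p)"
 unfolding lap_def[abs_def]
proof (rule hpoly_sum)
 fix i assume "hpoly (Suc (Suc k)) p"
 from hpoly_pd[OF this, of i] have "hpoly (Suc k) (pd i p)" by simp
 from hpoly_pd[OF this, of i] show "hpoly k (pd i (pd i p))" by simp
qed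

text \<open>With \<open>q = (p - |x|^2 r) / a\<close> the equation reduces to an equation of the same kind for \<open>r\<close>,
 whose degree is smaller by 2; then \<open>\<Delta> q = r\<close>.\<close>

lemma hpoly_solve:
 fixes p :: "real^'n \<Rightarrow> real"
 shows "hpoly k p \<Longrightarrow> a > 0 \<Longrightarrow> \<exists>q. hpoly k q \<and> (\<forall>x. (norm x)^2 * lap q x + a * q x = p x)"
proof (induction k arbitrary: p a rule: less_induct)
 case (less k)
 show ?case
 proof (cases "k < 2")
  case True
  have "hpoly k (\<lambda>x. (1 / a) * p x)" by (rule hpoly_cmult[OF less.prems(1)])
  moreover from this True have "lap (\<lambda>x. (1 / a) * p x) x = 0" for x by (rule hpoly_lap_low)
  ultimately show ?thesis using less.prems(2) by (intro exI[of _ "\<lambda>x. (1 / a) * p x"]) auto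
 next
  case False
  then obtain k' where k: "k = Suc (Suc k')" by (metis Suc_diff_Suc Suc_1 less_Suc_eq_le not_less_eq numeral_2_eq_2 old.nat.exhaust zero_less_Suc)
  \<comment> \<open>\<open>b\<close> collects \<open>a\<close> and what the Laplacian of
    \<open>|x|^2 r\<close> adds to \<open>|x|^2\<close> times the Laplacian of \<open>r\<close>:
    \<open>2 d\<close> from the Laplacian of \<open>|x|^2\<close>, and \<open>4 k'\<close> from the
    mixed term by Euler's identity.\<close>
  define b where "b = 2 * real CARD('n) + 4 * real k' + a"
  have b: "b > 0" using less.prems(2) by (simp add: b_def add_nonneg_pos)
  have "hpoly k' (lap p)" using less.prems(1) k by (intro hpoly_lap) simp
  from less.IH[OF _ this b] obtain r where r: "hpoly k' r"
   and req: "\<And>x. (norm x)^2 * lap r x + b * r x = lap p x" using k by auto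
  note re = hpoly_elem[OF r] and pe = hpoly_elem[OF less.prems(1)]
  define q where "q x = (1 / a) * (p x - (norm x)^2 * r x)" for x
  have q: "hpoly k q" unfolding q_def[abs_def]
   using less.prems(1) hpoly_norm2[OF r] k by (intro hpoly_cmult hpoly_diff) auto
  have "lap q x = (1 / a) * (lap p x - lap (\<lambda>x. (norm x)^2 * r x) x)" for x
   unfolding q_def[abs_def] by (simp only: lap_cmult lap_diff elem_diff elem_intros elem_norm2_0 re pe)
  moreover have "lap p x - lap (\<lambda>x. (norm x)^2 * r x) x = a * r x" for x
   by (simp only: lap_norm2_mult[OF re] hpoly_euler[OF r] req[symmetric] b_def) (simp add: algebra_simps)
  ultimately have lq: "lap q x = r x" for x using less.prems(2) by simp
  have "(norm x)^2 * lap q x + a * q x = p x" for x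
   unfolding lq using less.prems(2) by (simp add: q_def)
  with q show ?thesis by blast
 qed
qed

lemma lap_rho_mult:
 fixes q :: "real^'n \<Rightarrow> real"
 assumes "elem q"
 shows "lap (\<lambda>x. (1 - (norm x)^2) * q x) x =
  lap q x - ((norm x)^2 * lap q x + 4 * (\<Sum>i\<in>UNIV. x $ i * pd i q x) + 2 * real CARD('n) * q x)"
proof -
 have "(\<lambda>x. (1 - (norm x)^2) * q x) = (\<lambda>x. q x - (norm x)^2 * q x)" by (simp add: algebra_simps)
 then show ?thesis
  using assms by (simp add: lap_diff elem_intros elem_norm2_0 lap_norm2_mult)
qed

lemma elem_rho: "elementary U (\<lambda>x. 1 - (norm x)^2)"
 by (intro elem_diff elementary.const elem_norm2_0)

text \<open>The part of the map that preserves the degree is inverted by \<open>hpoly_solve\<close>,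
  the constant \<open>4 k + 2 d\<close> coming from the product rule and Euler's identity. The error
  is the Laplacian of \<open>q\<close>, of degree lower by two, and the induction removes
  it.\<close>

lemma hpoly_dirichlet:
 fixes p :: "real^'n \<Rightarrow> real"
 shows "hpoly k p \<Longrightarrow> \<exists>q. rpoly q \<and> lap (\<lambda>x. (1 - (norm x)^2) * q x) = p"
proof (induction k arbitrary: p rule: less_induct)
 case (less k)
 have a: "4 * real k + 2 * real CARD('n) > 0" by (simp add: add_nonneg_pos)
 obtain q where q: "hpoly k q" and qeq: "\<And>x. (norm x)^2 * lap q x + (4 * real k + 2 * real CARD('n)) * q x = - 1 * p x"
  using hpoly_solve[OF hpoly_cmult[OF less.prems, of "-1"] a] by blast
 have lq: "lap (\<lambda>x. (1 - (norm x)^2) * q x) x = lap q x + p x" for x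
 proof -
  have "p x = - ((norm x)^2 * lap q x + (4 * real k + 2 * real CARD('n)) * q x)" using qeq[of x] by simp
  then show ?thesis
   by (simp only: lap_rho_mult[OF hpoly_elem[OF q]] hpoly_euler[OF q]) (simp add: algebra_simps)
 qed
 show ?case
 proof (cases "k < 2")
  case True
  then show ?thesis using lq hpoly_lap_low[OF q True] hpoly_poly[OF q] by (intro exI[of _ q]) auto
 next
  case False
  then have k: "k = Suc (Suc (k - 2))" by simp
  have "hpoly (k - 2) (lap q)" using q k by (intro hpoly_lap) simp
  from less.IH[OF _ this] obtain q' where q': "rpoly q'"
   "lap (\<lambda>x. (1 - (norm x)^2) * q' x) = lap q" using False by auto
  have "(\<lambda>x. (1 - (norm x)^2) * (q x - q' x)) = (\<lambda>x. (1 - (norm x)^2) * q x - (1 - (norm x)^2) * q' x)"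
   by (simp add: algebra_simps)
  then have "lap (\<lambda>x. (1 - (norm x)^2) * (q x - q' x)) = p"
   using q' lq by (simp add: lap_diff elem_intros elem_rho hpoly_elem[OF q] poly_elem[OF q'(1)])
  then show ?thesis using hpoly_poly[OF q] q'(1) by (intro exI[of _ "\<lambda>x. q x - q' x"]) auto
 qed
qed

text \<open>Sums of homogeneous polynomials of different degrees. Induction over this form transfers
  a linear statement from homogeneous to all polynomials.\<close>

inductive hpoly_span :: "(real^'n \<Rightarrow> real) \<Rightarrow> bool" where
 "hpoly k p \<Longrightarrow> hpoly_span p"
| "hpoly_span p \<Longrightarrow> hpoly_span q \<Longrightarrow> hpoly_span (\<lambda>x. p x + q x)"

lemma hpoly_mult: "hpoly j p \<Longrightarrow> hpoly k q \<Longrightarrow> hpoly (j + k) (\<lambda>x. p x * q x)"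
proof (induction rule: hpoly.induct)
 case (hp_const c)
 then show ?case by (simp add: hpoly_cmult)
next
 case (hp_coord j p i)
 from hpoly.hp_coord[OF hp_coord.IH[OF hp_coord.prems]] show ?case by (simp add: mult.assoc)
next
 case (hp_add j p p')
 from hpoly.hp_add[OF hp_add.IH(1)[OF hp_add.prems] hp_add.IH(2)[OF hp_add.prems]] show ?case
  by (simp add: distrib_right)
qed

lemma hpoly_span_mult: "hpoly_span p \<Longrightarrow> hpoly_span q \<Longrightarrow> hpoly_span (\<lambda>x. p x * q x)"
proof (induction rule: hpoly_span.induct)
 case (1 k p)
 from 1(2,1) show ?case
 proof (induction rule: hpoly_span.induct)
  case (1 j q)
  then show ?case by (intro hpoly_span.intros(1)) (rule hpoly_mult)
 next
  case (2 q q')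
  from hpoly_span.intros(2)[OF 2(3)[OF 2(5)] 2(4)[OF 2(5)]] show ?case by (simp add: distrib_left)
 qed
next
 case (2 p p')
 from hpoly_span.intros(2)[OF 2(3)[OF 2(5)] 2(4)[OF 2(5)]] show ?case by (simp add: distrib_right)
qed

lemma poly_hpoly_span: "rpoly p \<Longrightarrow> hpoly_span (p :: real^'n \<Rightarrow> real)"
proof (induction rule: real_polynomial_function.induct)
 case (linear f)
 then have "linear f" by (rule bounded_linear.linear)
 then have eq: "f x = (\<Sum>i\<in>UNIV. x $ i * f (axis i 1))" for x
  by (subst vec_sum_axis[of x]) (simp add: linear_sum linear_cmul)
 have "hpoly (Suc 0) (\<lambda>x. \<Sum>i\<in>UNIV. x $ i * f (axis i 1))"
  by (intro hpoly_sum hp_coord hp_const)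
 then have "hpoly_span (\<lambda>x. \<Sum>i\<in>UNIV. x $ i * f (axis i 1))" by (rule hpoly_span.intros)
 moreover have "(\<lambda>x. \<Sum>i\<in>UNIV. x $ i * f (axis i 1)) = f" by (rule ext) (rule eq[symmetric])
 ultimately show ?case by (simp only:)
next
 case (const c)
 show ?case by (rule hpoly_span.intros(1)[OF hp_const])
qed (auto intro: hpoly_span.intros hpoly_span_mult)

theorem poly_dirichlet:
 fixes p :: "real^'n \<Rightarrow> real"
 assumes "rpoly p"
 obtains q where "rpoly q" "lap (\<lambda>x. (1 - (norm x)^2) * q x) = p"
proof -
 have "\<exists>q. rpoly q \<and> lap (\<lambda>x. (1 - (norm x)^2) * q x) = p"
  using poly_hpoly_span[OF assms]
 proof (induction rule: hpoly_span.induct)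
  case (1 k p)
  then show ?case by (rule hpoly_dirichlet)
 next
  case (2 p p')
  then obtain q q' where q: "rpoly q" "lap (\<lambda>x. (1 - (norm x)^2) * q x) = p"
    and q': "rpoly q'" "lap (\<lambda>x. (1 - (norm x)^2) * q' x) = p'" by blast
  have "(\<lambda>x. (1 - (norm x)^2) * (q x + q' x)) = (\<lambda>x. (1 - (norm x)^2) * q x + (1 - (norm x)^2) * q' x)"
   by (simp add: algebra_simps)
  then have "lap (\<lambda>x. (1 - (norm x)^2) * (q x + q' x)) = (\<lambda>x. p x + p' x)"
   using q q' by (simp add: lap_add elem_intros elem_rho poly_elem)
  then show ?case using q q' by (intro exI[of _ "\<lambda>x. q x + q' x"]) auto
 qed
 then show ?thesis using that by blast
qed

section \<open>Square integrable functions and weak derivatives\<close>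

lemma norm_add_sq: "(norm (a + b))^2 \<le> 2 * (norm a)^2 + 2 * (norm (b::'a::real_normed_vector))^2"
proof -
 have "(norm (a + b))^2 \<le> (norm a + norm b)^2"
  by (intro power_mono norm_triangle_ineq) auto
 also have "\<dots> \<le> 2 * (norm a)^2 + 2 * (norm b)^2"
  using sum_squares_ge_zero[of "norm a - norm b" 0] by (simp add: power2_eq_square algebra_simps)
 finally show ?thesis .
qed

lemma L2D: "f \<in> L2 M \<Longrightarrow> f \<in> borel_measurable M" "f \<in> L2 M \<Longrightarrow> integrable M (\<lambda>x. (norm (f x))^2)"
 by (auto simp: L2_def)

lemma L2_add: assumes "f \<in> L2 M" "g \<in> L2 M" shows "(\<lambda>x. f x + g x) \<in> L2 M"
proof -
 note [measurable] = L2D(1)[OF assms(1)] L2D(1)[OF assms(2)]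
 have "integrable M (\<lambda>x. (norm (f x + g x))^2)"
  by (rule bochner_bound[of _ "\<lambda>x. 2 * (norm (f x))^2 + 2 * (norm (g x))^2"])
   (use L2D(2)[OF assms(1)] L2D(2)[OF assms(2)] norm_add_sq in auto)
 then show ?thesis by (simp add: L2_def)
qed

lemma L2_cmult: assumes "f \<in> L2 M" shows "(\<lambda>x. c * f x) \<in> L2 M"
 using assms by (auto simp: L2_def norm_mult power_mult_distrib)

lemma L2_diff: assumes "f \<in> L2 M" "g \<in> L2 M" shows "(\<lambda>x. f x - g x) \<in> L2 M"
 using L2_add[OF assms(1) L2_cmult[OF assms(2), of "-1"]] by simp

lemma L2_zero: "(\<lambda>x. 0) \<in> L2 M"
 by (simp add: L2_def)

lemma L2_sum: "(\<And>i. i \<in> I \<Longrightarrow> f i \<in> L2 M) \<Longrightarrow> (\<lambda>x. \<Sum>i\<in>I. f i x) \<in> L2 M"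
 by (induction I rule: infinite_finite_induct) (auto intro: L2_zero L2_add)

lemma L2_bounded:
 assumes "finite_measure M" "f \<in> borel_measurable M" "AE x in M. norm (f x) \<le> B"
 shows "f \<in> L2 M"
proof -
 have "integrable M (\<lambda>x. (norm (f x))^2)"
 proof (rule finite_measure.integrable_const_bound[OF assms(1), of _ "B^2"])
  show "AE x in M. norm ((norm (f x))^2) \<le> B^2"
   using assms(3) by eventually_elim (auto intro!: power_mono)
 qed (use assms in measurable)
 then show ?thesis using assms by (simp add: L2_def)
qed

lemma L2_integrable: "finite_measure M \<Longrightarrow> f \<in> L2 M \<Longrightarrow> integrable M f"
proof -
 assume f: "finite_measure M" "f \<in> L2 M"
 have "norm z \<le> 1 + (norm z)^2" for z :: complex
 proof -
  have "0 \<le> (norm z - 1)^2" by simp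
  then have "2 * norm z \<le> 1 + (norm z)^2" by (simp add: power2_eq_square algebra_simps)
  moreover have "norm z \<ge> 0" by simp
  ultimately show ?thesis by linarith
 qed
 moreover have "integrable M (\<lambda>x. 1 + (norm (f x))^2)"
  by (intro Bochner_Integration.integrable_add finite_measure.integrable_const f(1) L2D(2)[OF f(2)])
 ultimately show ?thesis using L2D(1)[OF f(2)]
  by - (rule bochner_bound[of _ "\<lambda>x. 1 + (norm (f x))^2"], auto)
qed

text \<open>The Cauchy-Schwarz inequality against the constant 1, obtained by expanding the
  nonnegative integral of \<open>(m * norm (f x) - I)^2\<close>; a space of measure 0 is treated
  apart because \<open>m\<close> is cancelled.\<close>

lemma L1_le_L2:
 assumes fin: "finite_measure M" and f: "f \<in> L2 M"
 shows "(\<integral>x. norm (f x) \<partial>M)^2 \<le> measure M (space M) * (\<integral>x. (norm (f x))^2 \<partial>M)"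
proof -
 interpret finite_measure M by (rule fin)
 define m where "m = measure M (space M)"
 define I where "I = (\<integral>x. norm (f x) \<partial>M)"
 define N where "N = (\<integral>x. (norm (f x))^2 \<partial>M)"
 have i: "integrable M (\<lambda>x. norm (f x))" using L2_integrable[OF fin f] by auto
 have m0: "m \<ge> 0" by (simp add: m_def)
 have e: "(m * norm (f x) - I)^2 = m^2 * (norm (f x))^2 - (2 * m * I) * norm (f x) + I^2" for x
  by (simp add: power2_eq_square algebra_simps)
 have "0 \<le> (\<integral>x. (m * norm (f x) - I)^2 \<partial>M)" by simp
 also have "\<dots> = m^2 * N - (2 * m * I) * I + m * I^2"
  unfolding e using i L2D(2)[OF f] by (simp add: I_def[symmetric] N_def m_def)
 also have "\<dots> = m * (m * N - I^2)" by (simp add: power2_eq_square algebra_simps)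
 finally have *: "0 \<le> m * (m * N - I^2)" .
 show ?thesis
 proof (cases "m = 0")
  case True
  then have "space M \<in> null_sets M" by (simp add: m_def measure_eq_0_null_sets[symmetric] emeasure_eq_measure null_setsI)
  then have "AE x in M. norm (f x) = 0" by (intro AE_I'[of "space M"]) auto
  then have "I = 0" unfolding I_def by (rule integral_eq_zero_AE)
  then show ?thesis using True by (simp add: I_def m_def)
 next
  case False
  with m0 have "m > 0" by simp
  with * have "0 \<le> m * N - I^2" by (simp add: zero_le_mult_iff)
  then show ?thesis by (simp add: I_def N_def m_def)
 qed
qed

lemma L2_lim_integral:
 assumes fin: "finite_measure M" and u: "\<And>n. u n \<in> L2 M" "v \<in> L2 M"
  and lim: "(\<lambda>n. \<integral>x. (norm (u n x - v x))^2 \<partial>M) \<longlonglongrightarrow> 0"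
  and g: "g \<in> borel_measurable M" "AE x in M. \<bar>g x\<bar> \<le> B"
 shows "(\<lambda>n. \<integral>x. g x *\<^sub>R u n x \<partial>M) \<longlonglongrightarrow> (\<integral>x. g x *\<^sub>R v x \<partial>M)"
proof -
 note d = L2_diff[OF u(1) u(2)]
 have L1: "(\<lambda>n. \<integral>x. norm (u n x - v x) \<partial>M) \<longlonglongrightarrow> 0"
 proof -
  have "(\<lambda>n. measure M (space M) * (\<integral>x. (norm (u n x - v x))^2 \<partial>M)) \<longlonglongrightarrow> measure M (space M) * 0"
   by (intro tendsto_intros lim)
  then have up: "(\<lambda>n. measure M (space M) * (\<integral>x. (norm (u n x - v x))^2 \<partial>M)) \<longlonglongrightarrow> 0" by simp
  have "(\<lambda>n. (\<integral>x. norm (u n x - v x) \<partial>M)^2) \<longlonglongrightarrow> 0"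
  proof (rule Lim_null_comparison[OF _ up])
   show "\<forall>\<^sub>F n in sequentially. norm ((\<integral>x. norm (u n x - v x) \<partial>M)^2) \<le> measure M (space M) * (\<integral>x. (norm (u n x - v x))^2 \<partial>M)"
    using L1_le_L2[OF fin d] by (intro always_eventually allI) simp
  qed
  from tendsto_real_sqrt[OF this] show ?thesis by simp
 qed
 have iu: "integrable M (\<lambda>x. g x *\<^sub>R u n x)" "integrable M (\<lambda>x. g x *\<^sub>R v x)" for n
  using integrable_bounded_mult[OF L2_integrable[OF fin u(1)] g] integrable_bounded_mult[OF L2_integrable[OF fin u(2)] g] by auto
 have "(\<lambda>n. (\<integral>x. g x *\<^sub>R u n x \<partial>M) - (\<integral>x. g x *\<^sub>R v x \<partial>M)) \<longlonglongrightarrow> 0"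
 proof (rule Lim_null_comparison)
  show "\<forall>\<^sub>F n in sequentially. norm ((\<integral>x. g x *\<^sub>R u n x \<partial>M) - (\<integral>x. g x *\<^sub>R v x \<partial>M)) \<le> B * (\<integral>x. norm (u n x - v x) \<partial>M)"
  proof (intro always_eventually allI)
   fix n
   have "(\<integral>x. g x *\<^sub>R u n x \<partial>M) - (\<integral>x. g x *\<^sub>R v x \<partial>M) = (\<integral>x. g x *\<^sub>R (u n x - v x) \<partial>M)"
    using iu by (simp add: scaleR_diff_right)
   also have "norm \<dots> \<le> (\<integral>x. norm (g x *\<^sub>R (u n x - v x)) \<partial>M)"
    by (rule integral_norm_bound)
   also have "\<dots> \<le> (\<integral>x. B * norm (u n x - v x) \<partial>M)"
   proof (rule integral_mono_AE)
    show "AE x in M. norm (g x *\<^sub>R (u n x - v x)) \<le> B * norm (u n x - v x)"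
     using g(2) by eventually_elim (simp add: mult_right_mono)
   qed (use L2_integrable[OF fin d] integrable_norm[OF integrable_bounded_mult[OF L2_integrable[OF fin d] g]] in auto)
   finally show "norm ((\<integral>x. g x *\<^sub>R u n x \<partial>M) - (\<integral>x. g x *\<^sub>R v x \<partial>M)) \<le> B * (\<integral>x. norm (u n x - v x) \<partial>M)"
    by simp
  qed
  show "(\<lambda>n. B * (\<integral>x. norm (u n x - v x) \<partial>M)) \<longlonglongrightarrow> 0"
   using tendsto_mult_left[OF L1, of B] by simp
 qed
 then show ?thesis by (simp add: LIM_zero_iff)
qed

text \<open>The Riesz-Fischer argument: on a finite measure space a Cauchy sequence in
  \<open>L2\<close> is Cauchy in \<open>L1\<close>, so a subsequence converges almost everywhere,
  and Fatou's lemma shows that its limit is also the limit in mean square.\<close>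

lemma L2_complete:
 fixes f :: "nat \<Rightarrow> 'a \<Rightarrow> complex"
 assumes fin: "finite_measure M" and f: "\<And>n. f n \<in> L2 M"
  and cauchy: "\<And>e. e > 0 \<Longrightarrow> \<exists>N. \<forall>m\<ge>N. \<forall>n\<ge>N. (\<integral>x. (norm (f m x - f n x))^2 \<partial>M) < e"
 obtains g where "g \<in> L2 M" "(\<lambda>n. \<integral>x. (norm (f n x - g x))^2 \<partial>M) \<longlonglongrightarrow> 0"
proof -
 \<comment> \<open>The summand 1 makes \<open>m\<close> positive, so that it may be divided
   by.\<close>
 define m where "m = measure M (space M) + 1"
 have m: "m > 0" "measure M (space M) \<le> m" by (auto simp: m_def add_nonneg_pos)
 note fm [measurable] = L2D(1)[OF f]
 have "\<exists>N. \<forall>i\<ge>N. \<forall>j\<ge>N. (\<integral>x. norm (f i x - f j x) \<partial>M) < e" if e: "e > 0" for e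
 proof -
  from e m have "e^2 / m > 0" by simp
  from cauchy[OF this] obtain N where N: "\<forall>i\<ge>N. \<forall>j\<ge>N. (\<integral>x. (norm (f i x - f j x))^2 \<partial>M) < e^2 / m" by blast
  have "(\<integral>x. norm (f i x - f j x) \<partial>M) < e" if "i \<ge> N" "j \<ge> N" for i j
  proof -
   have "(\<integral>x. norm (f i x - f j x) \<partial>M)^2 \<le> measure M (space M) * (\<integral>x. (norm (f i x - f j x))^2 \<partial>M)"
    by (rule L1_le_L2[OF fin L2_diff[OF f f]])
   also have "\<dots> \<le> m * (\<integral>x. (norm (f i x - f j x))^2 \<partial>M)"
    using m by (intro mult_right_mono) auto
   also have "\<dots> < m * (e^2 / m)" using N that m by (intro mult_strict_left_mono) auto
   also have "\<dots> = e^2" using m by simp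
   finally show ?thesis using e power2_less_imp_less by (simp add: power2_less_imp_less)
  qed
  then show ?thesis by blast
 qed
 then obtain r where r: "strict_mono r" and cs: "AE x in M. Cauchy (\<lambda>i. f (r i) x)"
  using cauchy_L1_AE_cauchy_subseq[of M f] L2_integrable[OF fin f] by blast
 define g where "g x = lim (\<lambda>i. f (r i) x)" for x
 have gm [measurable]: "g \<in> borel_measurable M" unfolding g_def by measurable
 have gl: "AE x in M. (\<lambda>i. f (r i) x) \<longlonglongrightarrow> g x"
  using cs by eventually_elim (auto simp: g_def Cauchy_convergent_iff convergent_LIMSEQ_iff)
 \<comment> \<open>Fatou's lemma along the subsequence passes the Cauchy bound to the limit
   \<open>g\<close>. It is stated with nonnegative integrals because square integrability of
   \<open>g\<close> is not yet known.\<close>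
 have bd: "(\<integral>\<^sup>+x. ennreal ((norm (f n x - g x))^2) \<partial>M) \<le> ennreal e"
  if N: "\<forall>i\<ge>N. \<forall>j\<ge>N. (\<integral>x. (norm (f i x - f j x))^2 \<partial>M) < e" and n: "n \<ge> N" and e: "e > 0" for n N e
 proof -
  have "(\<integral>\<^sup>+x. ennreal ((norm (f n x - g x))^2) \<partial>M) = (\<integral>\<^sup>+x. liminf (\<lambda>i. ennreal ((norm (f n x - f (r i) x))^2)) \<partial>M)"
  proof (rule nn_integral_cong_AE)
   show "AE x in M. ennreal ((norm (f n x - g x))^2) = liminf (\<lambda>i. ennreal ((norm (f n x - f (r i) x))^2))"
    using gl
   proof eventually_elim
    case (elim x)
    then have "(\<lambda>i. ennreal ((norm (f n x - f (r i) x))^2)) \<longlonglongrightarrow> ennreal ((norm (f n x - g x))^2)"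
     by (intro tendsto_ennrealI tendsto_intros)
    from lim_imp_Liminf[OF sequentially_bot this] show ?case by simp
   qed
  qed
  also have "\<dots> \<le> liminf (\<lambda>i. \<integral>\<^sup>+x. ennreal ((norm (f n x - f (r i) x))^2) \<partial>M)"
   by (rule nn_integral_liminf) measurable
  also have "\<dots> \<le> liminf (\<lambda>i. ennreal e)"
  proof (rule Liminf_mono)
   show "\<forall>\<^sub>F i in sequentially. (\<integral>\<^sup>+x. ennreal ((norm (f n x - f (r i) x))^2) \<partial>M) \<le> ennreal e"
    unfolding eventually_sequentially
   proof (intro exI[of _ N] allI impI)
    fix i assume "N \<le> i"
    then have "r i \<ge> N" using seq_suble[OF r, of i] by simp
    then have "(\<integral>x. (norm (f n x - f (r i) x))^2 \<partial>M) < e" using N n by blast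
    moreover have "(\<integral>\<^sup>+x. ennreal ((norm (f n x - f (r i) x))^2) \<partial>M) = ennreal (\<integral>x. (norm (f n x - f (r i) x))^2 \<partial>M)"
     using L2D(2)[OF L2_diff[OF f[of n] f[of "r i"]]] by (intro nn_integral_eq_integral) auto
    ultimately show "(\<integral>\<^sup>+x. ennreal ((norm (f n x - f (r i) x))^2) \<partial>M) \<le> ennreal e"
     by (simp add: ennreal_leI)
   qed
  qed
  also have "\<dots> = ennreal e" by (simp add: Liminf_const)
  finally show ?thesis .
 qed
 have dL2: "(\<lambda>x. f n x - g x) \<in> L2 M" if N: "\<forall>i\<ge>N. \<forall>j\<ge>N. (\<integral>x. (norm (f i x - f j x))^2 \<partial>M) < e"
   and n: "n \<ge> N" and e: "e > 0" for n N e
 proof -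
  have "integrable M (\<lambda>x. (norm (f n x - g x))^2)"
   using bd[OF N n e] by (intro integrableI_bounded) (auto simp: le_less_trans[OF _ ennreal_less_top])
  then show ?thesis by (simp add: L2_def)
 qed
 obtain N0 where N0: "\<forall>i\<ge>N0. \<forall>j\<ge>N0. (\<integral>x. (norm (f i x - f j x))^2 \<partial>M) < 1" using cauchy[of 1] by auto
 have gL2: "g \<in> L2 M"
  using L2_diff[OF f[of N0] dL2[OF N0, of N0]] by simp
 moreover have "(\<lambda>n. \<integral>x. (norm (f n x - g x))^2 \<partial>M) \<longlonglongrightarrow> 0"
 proof (rule LIMSEQ_I)
  fix e :: real assume "e > 0"
  then have e2: "e / 2 > 0" by simp
  from cauchy[OF this] obtain N where N: "\<forall>i\<ge>N. \<forall>j\<ge>N. (\<integral>x. (norm (f i x - f j x))^2 \<partial>M) < e / 2" by blast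
  have "(\<integral>x. (norm (f n x - g x))^2 \<partial>M) \<le> e / 2" if "n \<ge> N" for n
  proof -
   have "ennreal (\<integral>x. (norm (f n x - g x))^2 \<partial>M) = (\<integral>\<^sup>+x. ennreal ((norm (f n x - g x))^2) \<partial>M)"
    using L2D(2)[OF L2_diff[OF f[of n] gL2]] by (intro nn_integral_eq_integral[symmetric]) auto
   then have "ennreal (\<integral>x. (norm (f n x - g x))^2 \<partial>M) \<le> ennreal (e / 2)" using bd[OF N that e2] by simp
   then show ?thesis using e2 by (subst (asm) ennreal_le_iff) auto
  qed
  then show "\<exists>no. \<forall>n\<ge>no. norm ((\<integral>x. (norm (f n x - g x))^2 \<partial>M) - 0) < e"
   using \<open>e > 0\<close> by (intro exI[of _ N]) fastforce
 qed
 ultimately show ?thesis using that by blast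
qed

section \<open>Restriction to subsets and changes on null sets\<close>

lemma lebesgue_on_integrable_subset:
 fixes f :: "'a::euclidean_space \<Rightarrow> 'b::{banach, second_countable_topology}"
 assumes "S \<in> sets lebesgue" "T \<in> sets lebesgue" "T \<subseteq> S" "integrable (leb S) f"
 shows "integrable (leb T) f"
proof -
 have "integrable lebesgue (\<lambda>x. indicator T x *\<^sub>R (indicator S x *\<^sub>R f x))"
  by (rule integrable_mult_indicator[OF assms(2)])
   (use lebesgue_on_indicator(2)[OF assms(1), of f] assms(4) in simp)
 moreover have "(\<lambda>x. indicator T x *\<^sub>R (indicator S x *\<^sub>R f x)) = (\<lambda>x. indicator T x *\<^sub>R f x)"
  by (intro ext) (use assms(3) in \<open>auto simp: indicator_def\<close>)
 ultimately show ?thesis using assms(2) by (simp add: lebesgue_on_indicator)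
qed

lemma L2_subset:
 assumes "S \<in> sets lebesgue" "T \<in> sets lebesgue" "T \<subseteq> S" "f \<in> L2 (leb S)"
 shows "f \<in> L2 (leb T)"
proof -
 have "f \<in> borel_measurable (leb T)"
  using L2D(1)[OF assms(4)] assms(3) by (rule measurable_restrict_mono)
 moreover have "integrable (leb T) (\<lambda>x. (norm (f x))^2)"
  by (rule lebesgue_on_integrable_subset[OF assms(1-3) L2D(2)[OF assms(4)]])
 ultimately show ?thesis by (simp add: L2_def)
qed

text \<open>This is completeness of Lebesgue measure. Weak derivatives are determined only up to
  null sets, and this makes membership in the function spaces independent of the representative
  chosen.\<close>

lemma lebesgue_on_measurable_cong_AE:
 fixes f g :: "'a::euclidean_space \<Rightarrow> 'b::euclidean_space"
 assumes S: "S \<in> sets lebesgue" and f: "f \<in> borel_measurable (leb S)" and ae: "AE x in leb S. f x = g x"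
 shows "g \<in> borel_measurable (leb S)"
proof -
 have "(\<lambda>x. if x \<in> S then f x else 0) \<in> borel_measurable lebesgue"
  using f S by (simp add: borel_measurable_if)
 moreover have "AE x in lebesgue. (if x \<in> S then f x else 0) = (if x \<in> S then g x else 0)"
  using ae S by (subst (asm) AE_restrict_space_iff) (auto elim: eventually_mono)
 ultimately have "(\<lambda>x. if x \<in> S then g x else 0) \<in> borel_measurable lebesgue"
  by (rule borel_measurable_AE)
 then show ?thesis by (rule borel_measurable_if_D)
qed

lemma L2_cong_AE:
 fixes f g :: "'a::euclidean_space \<Rightarrow> complex"
 assumes S: "S \<in> sets lebesgue" and f: "f \<in> L2 (leb S)" and ae: "AE x in leb S. f x = g x"
 shows "g \<in> L2 (leb S)"
proof -
 have g: "g \<in> borel_measurable (leb S)"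
  using lebesgue_on_measurable_cong_AE[OF S L2D(1)[OF f] ae] .
 have "integrable (leb S) (\<lambda>x. (norm (f x))^2) \<longleftrightarrow> integrable (leb S) (\<lambda>x. (norm (g x))^2)"
  using L2D(1)[OF f] g ae by (intro integrable_cong_AE) auto
 then show ?thesis using g L2D(2)[OF f] by (simp add: L2_def)
qed

lemma abs_integrable_iff:
 fixes f :: "'a::euclidean_space \<Rightarrow> 'b::euclidean_space"
 assumes "C \<in> sets lebesgue"
 shows "f absolutely_integrable_on C \<longleftrightarrow> integrable (leb C) f"
 using assms by (simp add: set_integrable_def lebesgue_on_indicator)

lemma compact_lebesgue: "compact C \<Longrightarrow> C \<in> sets lebesgue"
 by (simp add: lmeasurable_compact fmeasurableD)

lemma open_lebesgue: "open C \<Longrightarrow> C \<in> sets (lebesgue :: 'a::euclidean_space measure)"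
 by (simp add: borel_open sets_completionI_sets)

section \<open>Local integrability and test functions\<close>

lemma locally_integrableD:
 "locally_integrable U u \<Longrightarrow> compact C \<Longrightarrow> C \<subseteq> U \<Longrightarrow> integrable (leb C) u"
 by (auto simp: locally_integrable_def abs_integrable_iff compact_lebesgue)

lemma locally_integrableI:
 "(\<And>C. compact C \<Longrightarrow> C \<subseteq> U \<Longrightarrow> integrable (leb C) u) \<Longrightarrow> locally_integrable U u"
 by (auto simp: locally_integrable_def abs_integrable_iff compact_lebesgue)

lemma locally_integrable_subset: "locally_integrable U u \<Longrightarrow> V \<subseteq> U \<Longrightarrow> locally_integrable V u"
 unfolding locally_integrable_def by blast

lemma L2_locally_integrable:
 assumes "U \<in> sets lebesgue" "u \<in> L2 (leb U)"
 shows "locally_integrable U u"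
proof (rule locally_integrableI)
 fix C assume C: "compact C" "C \<subseteq> U"
 show "integrable (leb C) u"
  using C assms
  by (intro L2_integrable[OF finite_measure_lebesgue_on L2_subset[OF assms(1) _ _ assms(2)]])
   (auto simp: compact_lebesgue lmeasurable_compact)
qed

lemma continuous_locally_integrable:
 fixes u :: "real^'n \<Rightarrow> complex"
 assumes "continuous_on U u" shows "locally_integrable U u"
proof (rule locally_integrableI)
 fix C assume C: "compact C" "C \<subseteq> U"
 have c: "continuous_on C u" using assms C(2) by (rule continuous_on_subset)
 have "bounded (u ` C)" by (intro compact_imp_bounded compact_continuous_image c C)
 then obtain B where "\<forall>x\<in>C. norm (u x) \<le> B" unfolding bounded_iff by blast
 then show "integrable (leb C) u"
  using C c by (intro integrable_bounded_on[of _ _ B] lmeasurable_compact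
    continuous_imp_measurable_on_sets_lebesgue compact_lebesgue) auto
qed

lemma supp_integral:
 fixes u :: "real^'n \<Rightarrow> complex" and g :: "real^'n \<Rightarrow> real"
 assumes K: "compact K" "K \<subseteq> S" "S \<in> sets lebesgue" and g: "\<And>x. x \<notin> K \<Longrightarrow> g x = 0"
 shows "(\<integral>x. g x *\<^sub>R u x \<partial>leb S) = (\<integral>x. g x *\<^sub>R u x \<partial>leb K)"
  "integrable (leb S) (\<lambda>x. g x *\<^sub>R u x) \<longleftrightarrow> integrable (leb K) (\<lambda>x. g x *\<^sub>R u x)"
proof -
 have e: "(\<lambda>x. indicator S x *\<^sub>R (g x *\<^sub>R u x)) = (\<lambda>x. indicator K x *\<^sub>R (g x *\<^sub>R u x))"
 proof
  fix x show "indicator S x *\<^sub>R (g x *\<^sub>R u x) = indicator K x *\<^sub>R (g x *\<^sub>R u x)"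
   using g[of x] K(2) by (cases "x \<in> K") (auto simp: indicator_def)
 qed
 show "(\<integral>x. g x *\<^sub>R u x \<partial>leb S) = (\<integral>x. g x *\<^sub>R u x \<partial>leb K)"
  "integrable (leb S) (\<lambda>x. g x *\<^sub>R u x) \<longleftrightarrow> integrable (leb K) (\<lambda>x. g x *\<^sub>R u x)"
  unfolding lebesgue_on_indicator[OF K(3)] lebesgue_on_indicator[OF compact_lebesgue[OF K(1)]] e by auto
qed

lemma supp_integrable:
 fixes u :: "real^'n \<Rightarrow> complex" and g :: "real^'n \<Rightarrow> real"
 assumes K: "compact K" "K \<subseteq> U" "U \<in> sets lebesgue" and g: "continuous_on K g" "\<And>x. x \<notin> K \<Longrightarrow> g x = 0"
  and u: "locally_integrable U u"
 shows "integrable (leb U) (\<lambda>x. g x *\<^sub>R u x)" "integrable (leb K) (\<lambda>x. g x *\<^sub>R u x)"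
proof -
 have "bounded (g ` K)" by (intro compact_imp_bounded compact_continuous_image g K)
 then obtain B where B: "\<forall>x\<in>K. norm (g x) \<le> B" unfolding bounded_iff by blast
 show "integrable (leb K) (\<lambda>x. g x *\<^sub>R u x)"
  using B g(1) K by (intro integrable_bounded_mult[OF locally_integrableD[OF u K(1,2)], of _ B]
    continuous_imp_measurable_on_sets_lebesgue AE_I2) (auto simp: compact_lebesgue)
 then show "integrable (leb U) (\<lambda>x. g x *\<^sub>R u x)"
  using supp_integral(2)[OF K, where g=g and u=u] g(2) by blast
qed

lemma test_functionD:
 assumes "\<phi> \<in> test_functions U"
 obtains K where "compact K" "K \<subseteq> U" "\<And>x. x \<notin> K \<Longrightarrow> \<phi> x = 0" "\<And>i x. x \<notin> K \<Longrightarrow> pd i \<phi> x = 0"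
  "\<And>x. \<phi> differentiable (at x)" "continuous_on UNIV \<phi>" "\<And>i. continuous_on UNIV (pd i \<phi>)"
proof -
 define K where "K = closure {x. \<phi> x \<noteq> 0}"
 have K: "compact K" "K \<subseteq> U" using assms by (auto simp: test_functions_def K_def)
 have z: "\<phi> x = 0" if "x \<notin> K" for x
  using that closure_subset[of "{x. \<phi> x \<noteq> 0}"] by (auto simp: K_def)
 have pz: "pd i \<phi> x = 0" if "x \<notin> K" for i x
 proof -
  have "open (- K)" using K(1) by (simp add: compact_imp_closed open_Compl)
  then show ?thesis
   using part_deriv_cong[of "- K" x \<phi> "\<lambda>x. 0" i] z that by (simp add: part_deriv_const)
 qed
 have "Ck 1 \<phi>" using assms by (simp add: test_functions_def)
 then have d: "\<And>x. \<phi> differentiable (at x)" and c: "\<And>i. continuous_on UNIV (pd i \<phi>)" by auto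
 have "continuous_on UNIV \<phi>"
  by (intro continuous_at_imp_continuous_on ballI differentiable_imp_continuous_within d)
 then show ?thesis using that[OF K z pz d _ c] by blast
qed

lemma compact_norm_bound:
 fixes K :: "'a::real_normed_vector set"
 assumes "compact K"
 obtains R where "\<And>x. norm x > R \<Longrightarrow> x \<notin> K"
proof -
 obtain R where "\<forall>x\<in>K. norm x \<le> R" using compact_imp_bounded[OF assms] unfolding bounded_iff by blast
 then show ?thesis using that[of R] by fastforce
qed

lemma test_functions_mono: "V \<subseteq> U \<Longrightarrow> test_functions V \<subseteq> test_functions U"
 unfolding test_functions_def by blast

lemma test_integrable:
 assumes "\<phi> \<in> test_functions U" "U \<in> sets lebesgue" "locally_integrable U u"
 shows "integrable (leb U) (\<lambda>x. \<phi> x *\<^sub>R u x)"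
  "integrable (leb U) (\<lambda>x. pd i \<phi> x *\<^sub>R u x)"
proof -
 obtain K where K: "compact K" "K \<subseteq> U" "\<And>x. x \<notin> K \<Longrightarrow> \<phi> x = 0" "\<And>i x. x \<notin> K \<Longrightarrow> pd i \<phi> x = 0"
  "\<And>x. \<phi> differentiable (at x)" "continuous_on UNIV \<phi>" "\<And>i. continuous_on UNIV (pd i \<phi>)"
  using test_functionD[OF assms(1)] by metis
 have c: "continuous_on K \<phi>" "continuous_on K (pd i \<phi>)"
  using K(6,7) continuous_on_subset by blast+
 show "integrable (leb U) (\<lambda>x. \<phi> x *\<^sub>R u x)"
  by (rule supp_integrable(1)[OF K(1,2) assms(2) c(1) K(3) assms(3)])
 show "integrable (leb U) (\<lambda>x. pd i \<phi> x *\<^sub>R u x)"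
  by (rule supp_integrable(1)[OF K(1,2) assms(2) c(2) K(4) assms(3)])
qed

lemma AE_lebesgue_on_iff: "S \<in> sets lebesgue \<Longrightarrow> (AE x in leb S. P x) \<longleftrightarrow> (AE x in lebesgue. x \<in> S \<longrightarrow> P x)"
 by (subst AE_restrict_space_iff) auto

lemma AE_lebesgue_on_subset:
 "S \<in> sets lebesgue \<Longrightarrow> T \<in> sets lebesgue \<Longrightarrow> T \<subseteq> S \<Longrightarrow> AE x in leb S. P x \<Longrightarrow> AE x in leb T. P x"
 unfolding AE_lebesgue_on_iff by (auto elim: eventually_mono)

text \<open>By the Lindelof property countably many of the balls whose closures lie in
  \<open>U\<close> already cover \<open>U\<close>, and countably many null sets form a null
  set.\<close>

lemma AE_open_local:
 fixes U :: "'a::euclidean_space set"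
 assumes "open U" "\<And>a r. r > 0 \<Longrightarrow> cball a r \<subseteq> U \<Longrightarrow> AE x in leb (ball a r). P x"
 shows "AE x in leb U. P x"
proof -
 define F where "F = {ball a r | a r. r > 0 \<and> cball a r \<subseteq> U}"
 have "\<And>S. S \<in> F \<Longrightarrow> openin (top_of_set UNIV) S" by (auto simp: F_def)
 then obtain F' where F': "F' \<subseteq> F" "countable F'" "\<Union>F' = \<Union>F" by (rule Lindelof_openin)
 have U: "U = \<Union>F"
 proof
  show "U \<subseteq> \<Union>F"
  proof
   fix x assume "x \<in> U"
   then obtain r where "r > 0" "cball x r \<subseteq> U" using assms(1) open_contains_cball by blast
   then show "x \<in> \<Union>F" unfolding F_def by (intro UnionI[of "ball x r"]) auto
  qed
  show "\<Union>F \<subseteq> U" by (fastforce simp: F_def)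
 qed
 have "AE x in lebesgue. \<forall>B\<in>F'. x \<in> B \<longrightarrow> P x"
 proof (subst AE_ball_countable[OF F'(2)], rule ballI)
  fix B assume "B \<in> F'"
  then obtain a r where B: "B = ball a r" "r > 0" "cball a r \<subseteq> U" using F'(1) by (auto simp: F_def)
  show "AE x in lebesgue. x \<in> B \<longrightarrow> P x"
   using assms(2)[OF B(2,3)] unfolding B(1) by (subst (asm) AE_lebesgue_on_iff) auto
 qed
 then show ?thesis
  using F'(3) U open_lebesgue[OF assms(1)] by (subst AE_lebesgue_on_iff) (auto elim!: eventually_mono)
qed

text \<open>Products of a bump function with polynomials are test functions, so the bump function times
 \<open>v\<close> is orthogonal to all polynomials.\<close>

lemma weak_zero:
 fixes v :: "real^'n \<Rightarrow> complex"
 assumes U: "open U" and v: "locally_integrable U v"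
  and z: "\<And>\<phi>. \<phi> \<in> test_functions U \<Longrightarrow> (\<integral>x. \<phi> x *\<^sub>R v x \<partial>leb U) = 0"
 shows "AE x in leb U. v x = 0"
proof (rule AE_open_local[OF U])
 fix a :: "real^'n" and r :: real
 assume r: "r > 0" "cball a r \<subseteq> U"
 define b where "b x = flat 0 (r^2 - (norm (x - a))^2)" for x
 have be: "elem b"
  unfolding b_def[abs_def] by (intro elementary.flat elem_diff elementary.const elem_norm2)
 have bpos: "b x > 0 \<longleftrightarrow> x \<in> ball a r" for x
 proof -
  have "(norm (x - a))^2 < r^2 \<longleftrightarrow> norm (x - a) < r"
   using r power2_less_imp_less[of "norm (x - a)" r] power_strict_mono[of "norm (x - a)" r 2] by auto
  then show ?thesis by (simp add: b_def flat_pos_iff dist_norm norm_minus_commute)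
 qed
 have bz: "b x = 0" if "x \<notin> ball a r" for x
  using bpos[of x] flat_nonneg[of 0 "r^2 - (norm (x - a))^2"] that by (simp add: b_def)
 have bm: "b \<in> borel_measurable (leb S)" for S by (rule elem_UNIV_lebesgue_on[OF be])
 have vi: "integrable (leb (ball a r)) v"
  by (rule lebesgue_on_integrable_subset[OF _ _ _ locally_integrableD[OF v compact_cball r(2)]]) auto
 have bb: "\<bar>b x\<bar> \<le> 1" for x by (auto simp: b_def flat_def)
 have bvi: "integrable (leb (ball a r)) (\<lambda>x. b x *\<^sub>R v x)"
  using bb by (intro integrable_bounded_mult[OF vi bm, of 1]) auto
 have "AE x in leb (ball a r). b x *\<^sub>R v x = 0"
 proof (rule orth_poly_zero[OF bvi])
  fix p :: "real^'n \<Rightarrow> real" assume p: "rpoly p"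
  have t: "(\<lambda>x. p x * b x) \<in> test_functions U"
  proof (rule test_functionI[of _ "cball a r"])
   show "elem (\<lambda>x. p x * b x)" by (intro elementary.mult be poly_elem p)
   show "x \<in> cball a r" if "p x * b x \<noteq> 0" for x
   proof -
    have "x \<in> ball a r" using that bz[of x] by (cases "x \<in> ball a r") auto
    then show ?thesis using ball_subset_cball by blast
   qed
  qed (use r in auto)
  have "(\<integral>x. p x *\<^sub>R b x *\<^sub>R v x \<partial>leb (ball a r)) = (\<integral>x. (p x * b x) *\<^sub>R v x \<partial>leb U)"
  proof -
   have e: "(\<lambda>x. indicator (ball a r) x *\<^sub>R (p x *\<^sub>R b x *\<^sub>R v x)) = (\<lambda>x. indicator U x *\<^sub>R ((p x * b x) *\<^sub>R v x))"
   proof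
    fix x show "indicator (ball a r) x *\<^sub>R (p x *\<^sub>R b x *\<^sub>R v x) = indicator U x *\<^sub>R ((p x * b x) *\<^sub>R v x)"
    proof (cases "x \<in> ball a r")
     case True
     then have "x \<in> U" using r(2) ball_subset_cball by blast
     with True show ?thesis by simp
    qed (simp add: bz)
   qed
   show ?thesis
    unfolding lebesgue_on_indicator(1)[OF open_lebesgue[OF U]]
     lebesgue_on_indicator(1)[OF open_lebesgue[OF open_ball]] e ..
  qed
  then show "(\<integral>x. p x *\<^sub>R b x *\<^sub>R v x \<partial>leb (ball a r)) = 0" using z[OF t] by simp
 qed
 then show "AE x in leb (ball a r). v x = 0"
  using AE_space
 proof eventually_elim
  case (elim x)
  then have "b x > 0" using bpos[of x] by simp
  with elim(1) show ?case by simp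
 qed
qed

section \<open>Calculus of weak derivatives\<close>

lemma has_weak_derivD:
 assumes "has_weak_deriv U i u v"
 shows "locally_integrable U u" "locally_integrable U v"
  "\<And>\<phi>. \<phi> \<in> test_functions U \<Longrightarrow>
    (\<integral>x. pd i \<phi> x *\<^sub>R u x \<partial>leb U) = - (\<integral>x. \<phi> x *\<^sub>R v x \<partial>leb U)"
 using assms by (auto simp: has_weak_deriv_def)

lemma locally_integrable_add: "locally_integrable U u \<Longrightarrow> locally_integrable U v \<Longrightarrow> locally_integrable U (\<lambda>x. u x + v x)"
 by (rule locally_integrableI) (intro Bochner_Integration.integrable_add locally_integrableD)

lemma locally_integrable_cmult: "locally_integrable U u \<Longrightarrow> locally_integrable U (\<lambda>x. c * u x)"
 by (rule locally_integrableI) (intro integrable_mult_right locally_integrableD)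

lemma has_weak_deriv_add:
 assumes U: "open U" and 1: "has_weak_deriv U i u v" and 2: "has_weak_deriv U i u' v'"
 shows "has_weak_deriv U i (\<lambda>x. u x + u' x) (\<lambda>x. v x + v' x)"
 unfolding has_weak_deriv_def
proof (intro conjI ballI)
 fix \<phi> assume \<phi>: "\<phi> \<in> test_functions U"
 note i = test_integrable[OF \<phi> open_lebesgue[OF U]]
 note d1 = has_weak_derivD[OF 1] and d2 = has_weak_derivD[OF 2]
 show "(\<integral>x. pd i \<phi> x *\<^sub>R (u x + u' x) \<partial>leb U) = - (\<integral>x. \<phi> x *\<^sub>R (v x + v' x) \<partial>leb U)"
  using d1(3)[OF \<phi>] d2(3)[OF \<phi>]
  by (simp add: scaleR_add_right i[OF d1(1)] i[OF d1(2)] i[OF d2(1)] i[OF d2(2)])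
qed (use has_weak_derivD[OF 1] has_weak_derivD[OF 2] in \<open>auto intro: locally_integrable_add\<close>)

lemma has_weak_deriv_cmult:
 assumes U: "open U" and 1: "has_weak_deriv U i u v"
 shows "has_weak_deriv U i (\<lambda>x. c * u x) (\<lambda>x. c * v x)"
 unfolding has_weak_deriv_def
proof (intro conjI ballI)
 fix \<phi> assume \<phi>: "\<phi> \<in> test_functions U"
 show "(\<integral>x. pd i \<phi> x *\<^sub>R (c * u x) \<partial>leb U) = - (\<integral>x. \<phi> x *\<^sub>R (c * v x) \<partial>leb U)"
  using has_weak_derivD(3)[OF 1 \<phi>] by (simp flip: mult_scaleR_right)
qed (use has_weak_derivD[OF 1] in \<open>auto intro: locally_integrable_cmult\<close>)

lemma has_weak_deriv_diff:
 assumes U: "open U" and 1: "has_weak_deriv U i u v" and 2: "has_weak_deriv U i u' v'"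
 shows "has_weak_deriv U i (\<lambda>x. u x - u' x) (\<lambda>x. v x - v' x)"
 using has_weak_deriv_add[OF U 1 has_weak_deriv_cmult[OF U 2, of "-1"]] by simp

lemma has_weak_deriv_zero: "has_weak_deriv U i (\<lambda>x. 0) (\<lambda>x. 0)"
 by (auto simp: has_weak_deriv_def intro: continuous_locally_integrable)

lemma has_weak_deriv_sum:
 "open U \<Longrightarrow> (\<And>j. j \<in> I \<Longrightarrow> has_weak_deriv U i (f j) (g j)) \<Longrightarrow>
  has_weak_deriv U i (\<lambda>x. \<Sum>j\<in>I. f j x) (\<lambda>x. \<Sum>j\<in>I. g j x)"
 by (induction I rule: infinite_finite_induct) (auto intro: has_weak_deriv_zero has_weak_deriv_add)

lemma has_weak_deriv_subset:
 assumes U: "open U" "open V" "V \<subseteq> U" and 1: "has_weak_deriv U i u v"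
 shows "has_weak_deriv V i u v"
 unfolding has_weak_deriv_def
proof (intro conjI ballI)
 show "locally_integrable V u" "locally_integrable V v"
  using has_weak_derivD[OF 1] U(3) locally_integrable_subset by blast+
 fix \<phi> assume \<phi>: "\<phi> \<in> test_functions V"
 obtain K where K: "compact K" "K \<subseteq> V" "\<And>x. x \<notin> K \<Longrightarrow> \<phi> x = 0" "\<And>i x. x \<notin> K \<Longrightarrow> pd i \<phi> x = 0"
  using test_functionD[OF \<phi>] by metis
 have KU: "K \<subseteq> U" using K U by auto
 show "(\<integral>x. pd i \<phi> x *\<^sub>R u x \<partial>leb V) = - (\<integral>x. \<phi> x *\<^sub>R v x \<partial>leb V)"
  using has_weak_derivD(3)[OF 1, of \<phi>] test_functions_mono[OF U(3)] \<phi>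
   supp_integral(1)[OF K(1,2) open_lebesgue[OF U(2)] K(3)] supp_integral(1)[OF K(1,2) open_lebesgue[OF U(2)] K(4)]
   supp_integral(1)[OF K(1) KU open_lebesgue[OF U(1)] K(3)] supp_integral(1)[OF K(1) KU open_lebesgue[OF U(1)] K(4)]
  by auto
qed

lemma locally_integrable_cong_AE:
 assumes U: "open U" and u: "locally_integrable U u" and ae: "AE x in leb U. u x = u' x"
 shows "locally_integrable U u'"
proof (rule locally_integrableI)
 fix C assume C: "compact C" "C \<subseteq> U"
 note l = compact_lebesgue[OF C(1)]
 have aeC: "AE x in leb C. u x = u' x"
  by (rule AE_lebesgue_on_subset[OF open_lebesgue[OF U] l C(2) ae])
 note i = locally_integrableD[OF u C]
 have "u' \<in> borel_measurable (leb C)"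
  using i aeC by (intro lebesgue_on_measurable_cong_AE[OF l _ aeC]) auto
 then show "integrable (leb C) u'"
  using i aeC integrable_cong_AE[of u "leb C" u'] by auto
qed

lemma AE_imp_integral_eq:
 fixes u :: "real^'n \<Rightarrow> complex" and g :: "real^'n \<Rightarrow> real"
 assumes "AE x in M. u x = u' x" "integrable M (\<lambda>x. g x *\<^sub>R u x)" "integrable M (\<lambda>x. g x *\<^sub>R u' x)"
 shows "(\<integral>x. g x *\<^sub>R u x \<partial>M) = (\<integral>x. g x *\<^sub>R u' x \<partial>M)"
 using assms by (intro integral_cong_AE) (auto elim: eventually_mono)

lemma has_weak_deriv_cong_AE:
 assumes U: "open U" and 1: "has_weak_deriv U i u v"
  and ae: "AE x in leb U. u x = u' x" "AE x in leb U. v x = v' x"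
 shows "has_weak_deriv U i u' v'"
 unfolding has_weak_deriv_def
proof (intro conjI ballI)
 show l: "locally_integrable U u'" "locally_integrable U v'"
  using has_weak_derivD[OF 1] locally_integrable_cong_AE[OF U] ae by blast+
 fix \<phi> assume \<phi>: "\<phi> \<in> test_functions U"
 note i = test_integrable[OF \<phi> open_lebesgue[OF U]]
 show "(\<integral>x. pd i \<phi> x *\<^sub>R u' x \<partial>leb U) = - (\<integral>x. \<phi> x *\<^sub>R v' x \<partial>leb U)"
  using has_weak_derivD(3)[OF 1 \<phi>]
   AE_imp_integral_eq[OF ae(1) i(2)[OF has_weak_derivD(1)[OF 1]] i(2)[OF l(1)]]
   AE_imp_integral_eq[OF ae(2) i(1)[OF has_weak_derivD(2)[OF 1]] i(1)[OF l(2)]] by simp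
qed

lemma has_weak_deriv_unique:
 assumes U: "open U" and 1: "has_weak_deriv U i u v" and 2: "has_weak_deriv U i u v'"
 shows "AE x in leb U. v x = v' x"
proof -
 have d: "has_weak_deriv U i (\<lambda>x. u x - u x) (\<lambda>x. v x - v' x)" by (rule has_weak_deriv_diff[OF U 1 2])
 have "AE x in leb U. v x - v' x = 0"
  using has_weak_derivD(3)[OF d] by (intro weak_zero[OF U has_weak_derivD(2)[OF d]]) auto
 then show ?thesis by simp
qed

lemma has_weak_deriv_weak_deriv: "has_weak_deriv U i u v \<Longrightarrow> has_weak_deriv U i u (weak_deriv U i u)"
 unfolding weak_deriv_def by (rule someI[of "has_weak_deriv U i u"])

lemma weak_deriv_AE:
 assumes "open U" "has_weak_deriv U i u v"
 shows "AE x in leb U. weak_deriv U i u x = v x"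
 by (rule has_weak_deriv_unique[OF assms(1) has_weak_deriv_weak_deriv[OF assms(2)] assms(2)])

text \<open>Equality as functions, not only almost everywhere: both sides are chosen from the same
  predicate, since changing \<open>u\<close> on a null set does not affect which functions are weak
  derivatives of it.\<close>

lemma weak_deriv_cong_AE:
 assumes U: "open U" and ae: "AE x in leb U. u x = u' x"
 shows "weak_deriv U i u = weak_deriv U i u'"
proof -
 have ae': "AE x in leb U. u' x = u x" using ae by (auto elim: eventually_mono)
 have "has_weak_deriv U i u = has_weak_deriv U i u'"
  using has_weak_deriv_cong_AE[OF U _ ae, of i] has_weak_deriv_cong_AE[OF U _ ae', of i] by fastforce
 then show ?thesis by (simp add: weak_deriv_def)
qed

text \<open>The product of \<open>f\<close> with a test function, continued by 0, is continuously
  differentiable with compact support, so its derivative has integral 0. Smoothness only relative to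
  \<open>U\<close> admits the Green function away from its pole.\<close>

lemma has_weak_deriv_elem:
 fixes f :: "real^'n \<Rightarrow> real"
 assumes U: "open U" and f: "elementary U f"
 shows "has_weak_deriv U i (\<lambda>x. of_real (f x)) (\<lambda>x. of_real (pd i f x))"
 unfolding has_weak_deriv_def
proof (intro conjI ballI)
 have cf: "continuous_on U f" "\<And>j. continuous_on U (pd j f)"
  using elem_continuous_on[OF f U] elem_continuous_on[OF elem_part_deriv[OF f U] U] by auto
 then show l: "locally_integrable U (\<lambda>x. of_real (f x))" "locally_integrable U (\<lambda>x. of_real (pd i f x))"
  by (intro continuous_locally_integrable continuous_intros; simp)+
 fix \<phi> assume \<phi>: "\<phi> \<in> test_functions U"
 obtain K where K: "compact K" "K \<subseteq> U" "\<And>x. x \<notin> K \<Longrightarrow> \<phi> x = 0" "\<And>i x. x \<notin> K \<Longrightarrow> pd i \<phi> x = 0"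
  "\<And>x. \<phi> differentiable (at x)" "continuous_on UNIV \<phi>" "\<And>i. continuous_on UNIV (pd i \<phi>)"
  using test_functionD[OF \<phi>] by metis
 have oK: "open (- K)" using K(1) by (simp add: compact_imp_closed open_Compl)
 have cover: "U \<union> - K = UNIV" using K(2) by auto
 define \<psi> where "\<psi> x = (if x \<in> K then \<phi> x * f x else 0)" for x
 have \<psi>U: "\<psi> x = \<phi> x * f x" for x using K(3)[of x] by (simp add: \<psi>_def)
 have fd: "f differentiable (at x)" if "x \<in> U" for x by (rule elem_differentiable[OF f U that])
 have d1: "\<psi> differentiable (at x)" "pd j \<psi> x = pd j \<phi> x * f x + \<phi> x * pd j f x" if "x \<in> U" for x j
 proof -
  have e: "\<psi> = (\<lambda>x. \<phi> x * f x)" using \<psi>U by auto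
  show "\<psi> differentiable (at x)" unfolding e by (intro differentiable_mult K(5) fd that)
  show "pd j \<psi> x = pd j \<phi> x * f x + \<phi> x * pd j f x"
   unfolding e by (rule part_deriv_mult[OF K(5) fd[OF that]])
 qed
 have d2: "\<psi> differentiable (at x)" "pd j \<psi> x = 0" if "x \<in> - K" for x j
 proof -
  have "((\<lambda>x. 0) has_derivative (\<lambda>x. 0)) (at x)" by simp
  then have "(\<psi> has_derivative (\<lambda>x. 0)) (at x)"
   by (rule has_derivative_transform_within_open[OF _ oK that]) (auto simp: \<psi>_def)
  then show "\<psi> differentiable (at x)" by (auto simp: differentiable_def)
  show "pd j \<psi> x = 0"
   using part_deriv_cong[OF oK that, of \<psi> "\<lambda>x. 0" j] by (simp add: \<psi>_def part_deriv_const)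
 qed
 have \<psi>d: "\<psi> differentiable (at x)" for x using d1(1)[of x] d2(1)[of x] K(2) by blast
 have \<psi>c: "continuous_on UNIV (pd j \<psi>)" for j
 proof -
  have "continuous_on U (pd j \<psi>)"
  proof (rule continuous_on_eq)
   show "continuous_on U (\<lambda>x. pd j \<phi> x * f x + \<phi> x * pd j f x)"
    using cf K(6,7) by (intro continuous_intros) (auto intro: continuous_on_subset)
  qed (simp add: d1(2))
  moreover have "continuous_on (- K) (pd j \<psi>)"
   by (rule continuous_on_eq[OF continuous_on_const[of _ 0]]) (use d2(2) in auto)
  ultimately show ?thesis using continuous_on_open_Un[OF U oK] cover by metis
 qed
 obtain R where R: "\<And>x. norm x > R \<Longrightarrow> x \<notin> K"
  using compact_norm_bound[OF K(1)] by blast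
 have z: "(\<integral>x. pd i \<psi> x \<partial>lebesgue) = 0"
  by (rule integral_part_deriv_zero(2)[OF \<psi>d \<psi>c, of R]) (use R in \<open>auto simp: \<psi>_def\<close>)
 note ii = test_integrable[OF \<phi> open_lebesgue[OF U]]
 have "(\<integral>x. pd i \<phi> x *\<^sub>R complex_of_real (f x) \<partial>leb U) + (\<integral>x. \<phi> x *\<^sub>R complex_of_real (pd i f x) \<partial>leb U)
  = (\<integral>x. pd i \<phi> x *\<^sub>R complex_of_real (f x) + \<phi> x *\<^sub>R complex_of_real (pd i f x) \<partial>leb U)"
  using ii(2)[OF l(1)] ii(1)[OF l(2)] by (rule Bochner_Integration.integral_add[symmetric])
 also have "\<dots> = (\<integral>x. complex_of_real (pd i \<psi> x) \<partial>leb U)"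
  by (intro bochner_cong) (auto simp: d1(2) scaleR_conv_of_real)
 also have "\<dots> = (\<integral>x. indicator U x *\<^sub>R complex_of_real (pd i \<psi> x) \<partial>lebesgue)"
  by (rule lebesgue_on_indicator(1)[OF open_lebesgue[OF U]])
 also have "\<dots> = (\<integral>x. complex_of_real (pd i \<psi> x) \<partial>lebesgue)"
 proof (rule bochner_cong[OF refl])
  fix x show "indicator U x *\<^sub>R complex_of_real (pd i \<psi> x) = complex_of_real (pd i \<psi> x)"
   using d2(2)[of x i] cover by (cases "x \<in> U") auto
 qed
 also have "\<dots> = 0" using z by simp
 finally show "(\<integral>x. pd i \<phi> x *\<^sub>R complex_of_real (f x) \<partial>leb U) =
  - (\<integral>x. \<phi> x *\<^sub>R complex_of_real (pd i f x) \<partial>leb U)"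
  by (simp add: eq_neg_iff_add_eq_0)
qed

lemma test_bounded:
 assumes "\<phi> \<in> test_functions U"
 obtains B where "\<And>x. \<bar>\<phi> x\<bar> \<le> B" "\<And>i x. \<bar>pd i \<phi> x\<bar> \<le> B" "\<phi> \<in> borel_measurable (leb S)"
  "\<And>i. pd i \<phi> \<in> borel_measurable (leb S)"
proof -
 obtain K where K: "compact K" "K \<subseteq> U" "\<And>x. x \<notin> K \<Longrightarrow> \<phi> x = 0" "\<And>i x. x \<notin> K \<Longrightarrow> pd i \<phi> x = 0"
  "\<And>x. \<phi> differentiable (at x)" "continuous_on UNIV \<phi>" "\<And>i. continuous_on UNIV (pd i \<phi>)"
  using test_functionD[OF assms] by metis
 obtain R where R: "\<And>x. norm x > R \<Longrightarrow> x \<notin> K"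
  using compact_norm_bound[OF K(1)] by blast
 then have s: "\<phi> x = 0" if "norm x > R" for x using that K(3) by blast
 obtain B1 where B1: "\<And>x. \<bar>\<phi> x\<bar> \<le> B1" using bounded_supp[OF K(6) s] by blast
 obtain B2 where B2: "\<And>x j. \<bar>pd j \<phi> x\<bar> \<le> B2" using part_derivs_bounded_supp[OF K(7) s] by blast
 have "\<bar>\<phi> x\<bar> \<le> max B1 B2" "\<bar>pd i \<phi> x\<bar> \<le> max B1 B2" for i x
  using B1[of x] B2[of i x] by auto
 moreover have "\<phi> \<in> borel_measurable (leb S)" "\<And>i. pd i \<phi> \<in> borel_measurable (leb S)"
  using K(6,7) by (auto intro!: borel_imp_lebesgue_on borel_measurable_continuous_onI)
 ultimately show ?thesis using that by blast
qed

text \<open>Weak differentiation is a closed operation: test functions and their derivatives are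
  bounded, so both sides of the defining identity are continuous under mean square
  convergence.\<close>

lemma has_weak_deriv_L2_limit:
 assumes U: "open U" "U \<in> lmeasurable"
  and uv: "\<And>n. has_weak_deriv U i (u n) (v n)"
  and L2: "\<And>n. u n \<in> L2 (leb U)" "\<And>n. v n \<in> L2 (leb U)" "w \<in> L2 (leb U)" "z \<in> L2 (leb U)"
  and lim: "(\<lambda>n. \<integral>x. (norm (u n x - w x))^2 \<partial>leb U) \<longlonglongrightarrow> 0"
   "(\<lambda>n. \<integral>x. (norm (v n x - z x))^2 \<partial>leb U) \<longlonglongrightarrow> 0"
 shows "has_weak_deriv U i w z"
 unfolding has_weak_deriv_def
proof (intro conjI ballI)
 show "locally_integrable U w" "locally_integrable U z"
  by (intro L2_locally_integrable open_lebesgue U L2)+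
 fix \<phi> assume \<phi>: "\<phi> \<in> test_functions U"
 obtain B where B: "\<And>x. \<bar>\<phi> x\<bar> \<le> B" "\<And>i x. \<bar>pd i \<phi> x\<bar> \<le> B" "\<phi> \<in> borel_measurable (leb U)"
  "\<And>i. pd i \<phi> \<in> borel_measurable (leb U)" using test_bounded[OF \<phi>] by blast
 note fin = finite_measure_lebesgue_on[OF U(2)]
 have 1: "(\<lambda>n. \<integral>x. pd i \<phi> x *\<^sub>R u n x \<partial>leb U) \<longlonglongrightarrow> (\<integral>x. pd i \<phi> x *\<^sub>R w x \<partial>leb U)"
  using B by (intro L2_lim_integral[OF fin L2(1,3) lim(1), of _ B]) auto
 have 2: "(\<lambda>n. - (\<integral>x. \<phi> x *\<^sub>R v n x \<partial>leb U)) \<longlonglongrightarrow> - (\<integral>x. \<phi> x *\<^sub>R z x \<partial>leb U)"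
  using B by (intro tendsto_minus L2_lim_integral[OF fin L2(2,4) lim(2), of _ B]) auto
 show "(\<integral>x. pd i \<phi> x *\<^sub>R w x \<partial>leb U) = - (\<integral>x. \<phi> x *\<^sub>R z x \<partial>leb U)"
  using 1 2 has_weak_derivD(3)[OF uv \<phi>] LIMSEQ_unique by auto
qed

section \<open>Sobolev spaces\<close>

lemma W2_add: "open U \<Longrightarrow> u \<in> W2 k U \<Longrightarrow> v \<in> W2 k U \<Longrightarrow> (\<lambda>x. u x + v x) \<in> W2 k U"
proof (induction k arbitrary: u v)
 case (Suc k)
 have "\<exists>z\<in>W2 k U. has_weak_deriv U i (\<lambda>x. u x + v x) z" for i
 proof -
  obtain u' v' where "u' \<in> W2 k U" "has_weak_deriv U i u u'" "v' \<in> W2 k U" "has_weak_deriv U i v v'"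
   using Suc.prems by auto blast
  then show ?thesis using Suc.IH[of u' v'] has_weak_deriv_add Suc.prems(1) by blast
 qed
 then show ?case using Suc.prems by (auto intro: L2_add)
qed (auto intro: L2_add)

lemma W2_cmult: "open U \<Longrightarrow> u \<in> W2 k U \<Longrightarrow> (\<lambda>x. c * u x) \<in> W2 k U"
proof (induction k arbitrary: u)
 case (Suc k)
 have "\<exists>z\<in>W2 k U. has_weak_deriv U i (\<lambda>x. c * u x) z" for i
 proof -
  obtain u' where "u' \<in> W2 k U" "has_weak_deriv U i u u'"
   using Suc.prems by auto
  then show ?thesis using Suc.IH[of u'] has_weak_deriv_cmult Suc.prems(1) by blast
 qed
 then show ?case using Suc.prems by (auto intro: L2_cmult)
qed (auto intro: L2_cmult)

lemma W2_diff: "open U \<Longrightarrow> u \<in> W2 k U \<Longrightarrow> v \<in> W2 k U \<Longrightarrow> (\<lambda>x. u x - v x) \<in> W2 k U"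
 using W2_add[of U u k "\<lambda>x. -1 * v x"] W2_cmult[of U v k "-1"] by simp

lemma W2_zero: "(\<lambda>x. 0) \<in> W2 k U"
 by (induction k) (auto intro: L2_zero has_weak_deriv_zero)

lemma W2_sum: "open U \<Longrightarrow> (\<And>j. j \<in> I \<Longrightarrow> f j \<in> W2 k U) \<Longrightarrow> (\<lambda>x. \<Sum>j\<in>I. f j x) \<in> W2 k U"
 by (induction I rule: infinite_finite_induct) (auto intro: W2_zero W2_add)

lemma W2_subset: "open U \<Longrightarrow> open V \<Longrightarrow> V \<subseteq> U \<Longrightarrow> u \<in> W2 k U \<Longrightarrow> u \<in> W2 k V"
proof (induction k arbitrary: u)
 case 0
 then show ?case using L2_subset[OF open_lebesgue open_lebesgue] by auto
next
 case (Suc k)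
 have "\<exists>z\<in>W2 k V. has_weak_deriv V i u z" for i
 proof -
  obtain u' where "u' \<in> W2 k U" "has_weak_deriv U i u u'"
   using Suc.prems by auto
  then show ?thesis using Suc.IH[of u'] has_weak_deriv_subset[OF Suc.prems(1-3)] Suc.prems(1-3) by blast
 qed
 then show ?case using Suc.prems L2_subset[OF open_lebesgue open_lebesgue] by auto
qed

lemma W2_cong_AE:
 assumes U: "open U" and ae: "AE x in leb U. u x = u' x" and u: "u \<in> W2 k U"
 shows "u' \<in> W2 k U"
proof (cases k)
 case 0
 then show ?thesis using u L2_cong_AE[OF open_lebesgue[OF U] _ ae] by auto
next
 case (Suc k')
 have "\<exists>z\<in>W2 k' U. has_weak_deriv U i u' z" for i
 proof -
  obtain z where z: "z \<in> W2 k' U" "has_weak_deriv U i u z" using u Suc by auto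
  have "has_weak_deriv U i u' z" by (rule has_weak_deriv_cong_AE[OF U z(2) ae]) simp
  with z(1) show ?thesis by blast
 qed
 then show ?thesis using u Suc L2_cong_AE[OF open_lebesgue[OF U] _ ae] by auto
qed

lemma L2_elem:
 fixes f :: "real^'n \<Rightarrow> real"
 assumes U: "open U" and f: "elementary U f" and V: "open V" "compact (closure V)" "closure V \<subseteq> U"
 shows "(\<lambda>x. c * of_real (f x)) \<in> L2 (leb V)"
proof (rule L2_cmult)
 have sub: "V \<subseteq> closure V" by (rule closure_subset)
 have c: "continuous_on (closure V) f" using elem_continuous_on[OF f U] V(3) by (rule continuous_on_subset)
 have "bounded (f ` closure V)" by (intro compact_imp_bounded compact_continuous_image c V)
 then obtain B where B: "\<forall>x\<in>closure V. norm (f x) \<le> B" unfolding bounded_iff by blast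
 have "V \<in> lmeasurable" using V compact_imp_bounded bounded_subset[OF _ sub] lmeasurable_open by blast
 moreover have "continuous_on V (\<lambda>x. complex_of_real (f x))"
  using c sub by (intro continuous_intros) (rule continuous_on_subset)
 ultimately show "(\<lambda>x. complex_of_real (f x)) \<in> L2 (leb V)"
  using B sub V by (intro L2_bounded[of _ _ B] finite_measure_lebesgue_on
    continuous_imp_measurable_on_sets_lebesgue open_lebesgue AE_I2) auto
qed

lemma has_weak_deriv_elem_cmult:
 assumes "open U" "elementary U f"
 shows "has_weak_deriv U i (\<lambda>x. c * of_real (f x)) (\<lambda>x. c * of_real (pd i f x))"
 by (intro has_weak_deriv_cmult has_weak_deriv_elem assms)

text \<open>The weak derivatives of an elementary function are elementary on the same
  \<open>U\<close>, so induction on the order closes. Compactness of the closure of \<open>V\<close>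
  inside \<open>U\<close> bounds each of them on \<open>V\<close>.\<close>

lemma W2_elem:
 fixes f :: "real^'n \<Rightarrow> real"
 assumes U: "open U" and V: "open V" "compact (closure V)" "closure V \<subseteq> U"
 shows "elementary U f \<Longrightarrow> (\<lambda>x. c * of_real (f x)) \<in> W2 k V"
proof (induction k arbitrary: f)
 case 0
 then show ?case using L2_elem[OF U _ V] by simp
next
 case (Suc k)
 have VU: "V \<subseteq> U" using V(3) closure_subset by blast
 have "has_weak_deriv V i (\<lambda>x. c * of_real (f x)) (\<lambda>x. c * of_real (pd i f x))" for i
  by (rule has_weak_deriv_subset[OF U V(1) VU has_weak_deriv_elem_cmult[OF U Suc.prems]])
 then have "\<exists>v\<in>W2 k V. has_weak_deriv V i (\<lambda>x. c * of_real (f x)) v" for i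
  using Suc.IH[OF elem_part_deriv[OF Suc.prems U]] by blast
 then show ?case using L2_elem[OF U Suc.prems V] by simp
qed

section \<open>The Dirichlet problem\<close>

lemma elem_integrable_ball: "elem F \<Longrightarrow> integrable (leb (ball a r)) F"
proof -
 assume F: "elem F"
 have "bounded (F ` cball a r)"
  by (intro compact_imp_bounded compact_continuous_image elem_UNIV_continuous F compact_cball)
 then obtain B where "\<forall>x\<in>cball a r. norm (F x) \<le> B" unfolding bounded_iff by blast
 then show ?thesis using F by (intro integrable_bounded_on[of _ _ B] elem_UNIV_lebesgue_on) auto
qed

lemma divergence_vanish:
 fixes F :: "real^'n \<Rightarrow> real"
 assumes F: "elem F" and z: "\<And>x. norm x = 1 \<Longrightarrow> F x = 0"
 shows "(\<integral>x. pd i F x \<partial>leb (ball 0 1)) = 0"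
proof -
 have "(\<integral>x. pd i F x \<partial>leb (ball 0 1)) = (\<integral>t. (t $ i - 0 $ i) / 1 * F t \<partial>sphere_measure 0 1)"
  by (rule divergence_ball[OF _ F]) simp
 also have "\<dots> = (\<integral>t. 0 \<partial>sphere_measure (0::real^'n) 1)"
  by (intro bochner_cong) (auto simp: sphere_measure_space z)
 finally show ?thesis by simp
qed

text \<open>Symmetry of second derivatives by induction on the structure of the polynomial; it is
  what makes the integrand of the Hessian estimate a divergence.\<close>

lemma poly_pd_commute:
 fixes p :: "real^'n \<Rightarrow> real"
 assumes "rpoly p"
 shows "pd i (pd j p) = pd j (pd i p)"
 using assms
proof (induction rule: real_polynomial_function.induct)
 case (linear f)
 then have "pd i f x = f (axis i 1)" for x i
  by (intro part_deriv_eq bounded_linear_imp_has_derivative)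
 then have "pd i f = (\<lambda>x. f (axis i 1))" for i by auto
 then show ?case by (simp add: pd_const)
next
 case (const c)
 show ?case by (simp add: pd_const)
next
 case (add f g)
 have fg: "elem f" "elem g" using add.hyps by (auto intro: poly_elem)
 show ?case using add.IH by (simp add: pd_add fg pd_elem)
next
 case (mult f g)
 have fg: "elem f" "elem g" using mult.hyps by (auto intro: poly_elem)
 show ?case using mult.IH
  by (simp add: pd_mult pd_add fg pd_elem elementary.mult) (simp add: algebra_simps)
qed

lemma pd_norm2_0: "pd i (\<lambda>x. (norm x)^2) = (\<lambda>x. 2 * x $ i)"
 by (rule ext) (rule part_deriv_norm2_0)

lemma pd_rho_mult:
 fixes q :: "real^'n \<Rightarrow> real"
 assumes q: "elem q"
 shows "pd i (\<lambda>x. (1 - (norm x)^2) * q x) = (\<lambda>x. (- 2 * x $ i) * q x + (1 - (norm x)^2) * pd i q x)"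
proof -
 have "pd i (\<lambda>x::real^'n. 1 - (norm x)^2) = (\<lambda>x. - 2 * x $ i)"
  by (simp add: pd_diff elem_intros elem_norm2_0 pd_const pd_norm2_0)
 then show ?thesis by (simp add: pd_mult elem_rho q)
qed

lemma pd2_rho_mult:
 fixes q :: "real^'n \<Rightarrow> real"
 assumes q: "elem q"
 shows "pd j (pd i (\<lambda>x. (1 - (norm x)^2) * q x)) x =
  - 2 * (if i = j then q x else 0) - 2 * x $ i * pd j q x - 2 * x $ j * pd i q x
   + (1 - (norm x)^2) * pd j (pd i q) x"
proof -
 have c: "pd j (\<lambda>x. - 2 * x $ i) = (\<lambda>x. if i = j then - 2 else 0)"
  by (subst pd_cmult) (auto simp: elem_intros pd_coord)
 have e: "elem (\<lambda>x. - 2 * x $ i)" by (intro elem_intros)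
 show ?thesis
  unfolding pd_rho_mult[OF q] pd_add[OF elementary.mult[OF e q] elementary.mult[OF elem_rho pd_elem[OF q]]]
   pd_mult[OF e q] pd_rho_mult[OF pd_elem[OF q]] c by simp
qed

text \<open>The two sides of the a priori estimate differ by the boundary term
 \<open>4 (d - 1) \<integral> q^2\<close> over the unit sphere, which is nonnegative.\<close>

lemma hessian_bound:
 fixes q :: "real^'n \<Rightarrow> real"
 assumes q: "rpoly q"
 defines "w \<equiv> \<lambda>x. (1 - (norm x)^2) * q x"
 shows "(\<Sum>i\<in>UNIV. \<Sum>j\<in>UNIV. \<integral>x. (pd j (pd i w) x)^2 \<partial>leb (ball 0 1))
  \<le> (\<integral>x. (lap w x)^2 \<partial>leb (ball 0 1))"
proof -
 let ?M = "leb (ball (0::real^'n) 1)"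
 have rho: "rpoly (\<lambda>x::real^'n. 1 - (norm x)^2)"
  unfolding norm_pow2_vec by (intro real_polynomial_function_diff real_polynomial_function_sum
    real_polynomial_function_power poly_coord real_polynomial_function.intros) auto
 have wp: "rpoly w" unfolding w_def using rho q by (rule real_polynomial_function.intros(4))
 have w: "elem w" by (rule poly_elem[OF wp])
 have qe: "elem q" by (rule poly_elem[OF q])
 note we [simp] = w pd_elem[OF w] pd_elem[OF pd_elem[OF w]] pd_elem[OF pd_elem[OF pd_elem[OF w]]]
 define D where "D i j = pd j (pd i w)" for i j
 have De [simp]: "elem (D i j)" for i j by (simp add: D_def)
 have Dc: "D i j = D j i" for i j unfolding D_def by (rule poly_pd_commute[OF wp])
 have D3: "pd i (D j j) = pd j (D i j)" for i j
 proof -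
  have "pd i (D j j) = pd i (pd j (pd j w))" by (simp add: D_def)
  also have "\<dots> = pd j (pd i (pd j w))" by (rule poly_pd_commute[OF poly_part_deriv[OF wp]])
  also have "pd i (pd j w) = D i j" unfolding D_def by (rule poly_pd_commute[OF wp])
  finally show ?thesis .
 qed
 \<comment> \<open>By symmetry of the third derivatives the two integrands differ by a divergence,
   so only an integral over the unit sphere survives.\<close>
 have pt: "D i i x * D j j x - (D i j x)^2 = pd i (\<lambda>x. pd i w x * D j j x) x - pd j (\<lambda>x. pd i w x * D i j x) x" for i j x
  by (simp only: pd_mult[OF pd_elem[OF w] De] D_def[symmetric]) (simp add: power2_eq_square D3[of i j])
 have F: "elem (\<lambda>x. pd i w x * D j k x)" for i j k by (intro elementary.mult) auto
 have int: "integrable ?M (\<lambda>x. D i i x * D j j x - (D i j x)^2)" "integrable ?M (\<lambda>x. (D i j x)^2)" "integrable ?M (\<lambda>x. D i i x * D j j x)" for i j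
  by (intro elem_integrable_ball elem_diff elementary.mult elem_power; simp)+
 have si: "integrable (sphere_measure (0::real^'n) 1) (\<lambda>t. t $ i * (pd k w t * D l m t))" for i k l m
  by (rule sphere_integrable_continuous) (auto intro!: elem_UNIV_continuous elementary.mult elementary.coord)
 have each: "(\<integral>x. D i i x * D j j x - (D i j x)^2 \<partial>?M) =
   (\<integral>t. t $ i * (pd i w t * D j j t) - t $ j * (pd i w t * D i j t) \<partial>sphere_measure 0 1)" for i j
 proof -
  have "(\<integral>x. D i i x * D j j x - (D i j x)^2 \<partial>?M) =
   (\<integral>x. pd i (\<lambda>x. pd i w x * D j j x) x \<partial>?M) - (\<integral>x. pd j (\<lambda>x. pd i w x * D i j x) x \<partial>?M)"
   unfolding pt by (intro bochner_diff elem_integrable_ball pd_elem F)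
  also have "\<dots> = (\<integral>t. t $ i * (pd i w t * D j j t) \<partial>sphere_measure 0 1) - (\<integral>t. t $ j * (pd i w t * D i j t) \<partial>sphere_measure 0 1)"
   using divergence_ball[where r=1 and a=0 and i=i, OF zero_less_one F[of i j j]]
    divergence_ball[where r=1 and a=0 and i=j, OF zero_less_one F[of i i j]] by simp
  also have "\<dots> = (\<integral>t. t $ i * (pd i w t * D j j t) - t $ j * (pd i w t * D i j t) \<partial>sphere_measure 0 1)"
   by (intro bochner_diff[symmetric] si)
  finally show ?thesis .
 qed
 \<comment> \<open>On the unit sphere the gradient of \<open>w\<close> is \<open>-2 q t\<close>.
   After inserting the second derivatives, the terms with the radial derivative \<open>E\<close> of
   \<open>q\<close> cancel and a nonnegative multiple of \<open>q^2\<close> is left.\<close>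
 have bd: "(\<Sum>i\<in>UNIV. \<Sum>j\<in>UNIV. t $ i * (pd i w t * D j j t) - t $ j * (pd i w t * D i j t)) =
   4 * (real CARD('n) - 1) * (q t)^2" if t: "norm t = 1" for t :: "real^'n"
 proof -
  have N: "(\<Sum>i\<in>UNIV. (t $ i)^2) = 1" using norm_pow2_vec[of t] t by simp
  have N': "(\<Sum>i\<in>UNIV. t $ i * t $ i) = 1" using N by (simp add: power2_eq_square)
  define E where "E = (\<Sum>i\<in>UNIV. t $ i * pd i q t)"
  have w1: "pd i w t = - 2 * q t * t $ i" for i
   unfolding w_def pd_rho_mult[OF qe] using t by simp
  have w2: "D i j t = - 2 * (if i = j then q t else 0) - 2 * t $ i * pd j q t - 2 * t $ j * pd i q t" for i j
   unfolding D_def w_def pd2_rho_mult[OF qe] using t by simp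
  have S1: "(\<Sum>j\<in>UNIV. D j j t) = - 2 * real CARD('n) * q t - 4 * E"
   unfolding w2 E_def by (simp add: sum_subtractf sum.distrib sum_distrib_left algebra_simps)
  have S2: "(\<Sum>j\<in>UNIV. t $ j * D i j t) = - 2 * t $ i * q t - 2 * t $ i * E - 2 * pd i q t" for i
  proof -
   have "t $ j * D i j t = (if i = j then - 2 * t $ i * q t else 0) - 2 * t $ i * (t $ j * pd j q t) - 2 * pd i q t * (t $ j * t $ j)" for j
    unfolding w2 by (simp add: algebra_simps)
   then show ?thesis by (simp add: sum_subtractf sum_distrib_left[symmetric] N' E_def)
  qed
  have S3: "(\<Sum>i\<in>UNIV. t $ i * (- 2 * t $ i * q t - 2 * t $ i * E - 2 * pd i q t)) = - 2 * q t - 4 * E"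
  proof -
   have "t $ i * (- 2 * t $ i * q t - 2 * t $ i * E - 2 * pd i q t) =
     (- 2 * q t - 2 * E) * (t $ i * t $ i) - 2 * (t $ i * pd i q t)" for i by (simp add: algebra_simps)
   then show ?thesis by (simp add: sum_subtractf sum_distrib_left[symmetric] N' E_def[symmetric])
  qed
  have "(\<Sum>i\<in>UNIV. \<Sum>j\<in>UNIV. t $ i * (pd i w t * D j j t) - t $ j * (pd i w t * D i j t)) =
    (\<Sum>i\<in>UNIV. t $ i * pd i w t * (\<Sum>j\<in>UNIV. D j j t) - pd i w t * (\<Sum>j\<in>UNIV. t $ j * D i j t))"
   by (simp add: sum_subtractf sum_distrib_left mult_ac)
  also have "\<dots> = (\<Sum>i\<in>UNIV. - 2 * q t * (\<Sum>j\<in>UNIV. D j j t) * (t $ i * t $ i) + 2 * q t * (t $ i * (\<Sum>j\<in>UNIV. t $ j * D i j t)))"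
   unfolding w1 by (simp add: algebra_simps)
  also have "\<dots> = - 2 * q t * (\<Sum>j\<in>UNIV. D j j t) + 2 * q t * (\<Sum>i\<in>UNIV. t $ i * (\<Sum>j\<in>UNIV. t $ j * D i j t))"
   by (simp only: sum.distrib sum_distrib_left[symmetric] N' mult_1_right)
  also have "\<dots> = 4 * (real CARD('n) - 1) * (q t)^2"
   unfolding S1 S2 S3 by (simp add: power2_eq_square algebra_simps)
  finally show ?thesis .
 qed
 have lw: "(lap w x)^2 = (\<Sum>i\<in>UNIV. \<Sum>j\<in>UNIV. D i i x * D j j x)" for x
  by (simp add: lap_def D_def power2_eq_square sum_product)
 have "(\<integral>x. (lap w x)^2 \<partial>?M) - (\<Sum>i\<in>UNIV. \<Sum>j\<in>UNIV. \<integral>x. (D i j x)^2 \<partial>?M) =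
   (\<Sum>i\<in>UNIV. \<Sum>j\<in>UNIV. \<integral>x. D i i x * D j j x - (D i j x)^2 \<partial>?M)"
  unfolding lw using int by (simp add: sum_subtractf)
 also have "\<dots> = (\<integral>t. (\<Sum>i\<in>UNIV. \<Sum>j\<in>UNIV. t $ i * (pd i w t * D j j t) - t $ j * (pd i w t * D i j t)) \<partial>sphere_measure 0 1)"
  unfolding each using si by (simp add: sum_subtractf)
 also have "\<dots> = (\<integral>t. 4 * (real CARD('n) - 1) * (q t)^2 \<partial>sphere_measure 0 1)"
  using bd by (intro bochner_cong) (auto simp: sphere_measure_space)
 also have "\<dots> \<ge> 0"
  by (intro Bochner_Integration.integral_nonneg) (auto simp: Suc_le_eq)
 finally show ?thesis by (simp add: D_def)
qed

lemma poly_rho: "rpoly (\<lambda>x::real^'n. 1 - (norm x)^2)"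
 unfolding norm_pow2_vec by (intro real_polynomial_function_diff real_polynomial_function_sum
   real_polynomial_function_power poly_coord real_polynomial_function.intros) auto

text \<open>A Poincare inequality \<open>W <= 4 * A\<close> and Green's identity with
  \<open>A <= W / 8 + 2 * L\<close> give \<open>A <= 4 * L\<close> and \<open>W <= 16 * L\<close>;
  the number 16 is the common constant that also covers the second derivatives.\<close>

lemma apriori:
 fixes q :: "real^'n \<Rightarrow> real"
 assumes q: "rpoly q"
 defines "w \<equiv> \<lambda>x. (1 - (norm x)^2) * q x"
 defines "L \<equiv> \<integral>x. (lap w x)^2 \<partial>leb (ball 0 1)"
 shows "(\<integral>x. (w x)^2 \<partial>leb (ball 0 1)) \<le> 16 * L"
  "(\<integral>x. (pd i w x)^2 \<partial>leb (ball 0 1)) \<le> 16 * L"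
  "(\<integral>x. (pd j (pd i w) x)^2 \<partial>leb (ball 0 1)) \<le> 16 * L"
proof -
 let ?M = "leb (ball (0::real^'n) 1)"
 have wp: "rpoly w" unfolding w_def using poly_rho q by (rule real_polynomial_function.intros(4))
 have w [simp]: "elem w" by (rule poly_elem[OF wp])
 note we [simp] = pd_elem[OF w] pd_elem[OF pd_elem[OF w]] lap_elem[OF w]
 note ei = elem_integrable_ball elem_power elementary.mult elementary.add elem_sum elem_cmult elementary.coord
 have w0: "w x = 0" if "norm x = 1" for x using that by (simp add: w_def)
 define A where "A = (\<integral>x. (\<Sum>i\<in>UNIV. (pd i w x)^2) \<partial>?M)"
 define W where "W = (\<integral>x. (w x)^2 \<partial>?M)"
 have L0: "L \<ge> 0" unfolding L_def by simp
 have iw: "integrable ?M (\<lambda>x. (w x)^2)" "integrable ?M (\<lambda>x. (lap w x)^2)" "integrable ?M (\<lambda>x. w x * lap w x)"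
   "integrable ?M (\<lambda>x. (pd i w x)^2)" "integrable ?M (\<lambda>x. \<Sum>i\<in>UNIV. (pd i w x)^2)"
   "integrable ?M (\<lambda>x. 2 * x $ i * (w x * pd i w x))" for i
  by (intro ei; simp)+
 have pA: "(\<integral>x. (pd i w x)^2 \<partial>?M) \<le> A" for i
  unfolding A_def by (intro integral_mono iw) (auto intro!: member_le_sum)
 have A1: "A = - (\<integral>x. w x * lap w x \<partial>?M)"
 proof -
  have "(\<Sum>i\<in>UNIV. (pd i w x)^2) + w x * lap w x = (\<Sum>i\<in>UNIV. pd i (\<lambda>x. w x * pd i w x) x)" for x
   by (simp add: pd_mult lap_def sum.distrib sum_distrib_left power2_eq_square)
  moreover have "A + (\<integral>x. w x * lap w x \<partial>?M) = (\<integral>x. (\<Sum>i\<in>UNIV. (pd i w x)^2) + w x * lap w x \<partial>?M)"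
   unfolding A_def by (rule Bochner_Integration.integral_add[symmetric]) (rule iw)+
  ultimately have "A + (\<integral>x. w x * lap w x \<partial>?M) = (\<integral>x. (\<Sum>i\<in>UNIV. pd i (\<lambda>x. w x * pd i w x) x) \<partial>?M)"
   by (simp only:)
  also have "\<dots> = (\<Sum>i\<in>UNIV. \<integral>x. pd i (\<lambda>x. w x * pd i w x) x \<partial>?M)"
   by (intro Bochner_Integration.integral_sum elem_integrable_ball pd_elem elementary.mult) auto
  also have "\<dots> = 0"
   by (intro sum.neutral ballI divergence_vanish elementary.mult) (auto simp: w0)
  finally show ?thesis by simp
 qed
 have W1: "W \<le> 4 * A"
 proof -
  \<comment> \<open>A single direction, whichever it is, suffices for the Poincare inequality:
    \<open>x $ i * w^2\<close> vanishes on the unit sphere, so the integral of its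
    \<open>i\<close>-th derivative \<open>w^2 + 2 * x $ i * w * pd i w\<close> is 0.\<close>
  obtain i :: 'n where True by auto
  have "(w x)^2 + 2 * x $ i * (w x * pd i w x) = pd i (\<lambda>x. x $ i * (w x * w x)) x" for x
   by (simp add: pd_mult pd_coord elementary.mult elementary.coord power2_eq_square algebra_simps)
  moreover have "W + (\<integral>x. 2 * x $ i * (w x * pd i w x) \<partial>?M) = (\<integral>x. (w x)^2 + 2 * x $ i * (w x * pd i w x) \<partial>?M)"
   unfolding W_def by (rule Bochner_Integration.integral_add[symmetric]) (rule iw)+
  ultimately have "W + (\<integral>x. 2 * x $ i * (w x * pd i w x) \<partial>?M) = (\<integral>x. pd i (\<lambda>x. x $ i * (w x * w x)) x \<partial>?M)"
   by (simp only:)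
  also have "\<dots> = 0"
   by (intro divergence_vanish elementary.mult elementary.coord) (auto simp: w0)
  finally have "W = (\<integral>x. - (2 * x $ i * (w x * pd i w x)) \<partial>?M)" by simp
  also have "\<dots> \<le> (\<integral>x. (1/2) * (w x)^2 + 2 * (pd i w x)^2 \<partial>?M)"
  proof (rule integral_mono)
   fix x assume "x \<in> space ?M"
   then have x: "norm x < 1" by simp
   have "\<bar>x $ i\<bar> \<le> 1" using component_le_norm_cart[of x i] x by linarith
   then have xi: "(x $ i)^2 \<le> 1" by (simp add: abs_square_le_1)
   have "0 \<le> (w x + 2 * (x $ i * pd i w x))^2" by simp
   then have "- (2 * x $ i * (w x * pd i w x)) \<le> (1/2) * (w x)^2 + 2 * ((x $ i)^2 * (pd i w x)^2)"
    by (simp add: power2_eq_square algebra_simps)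
   also have "(x $ i)^2 * (pd i w x)^2 \<le> 1 * (pd i w x)^2" using xi by (intro mult_right_mono) auto
   finally show "- (2 * x $ i * (w x * pd i w x)) \<le> (1/2) * (w x)^2 + 2 * (pd i w x)^2" by simp
  qed (intro integrable_minus Bochner_Integration.integrable_add integrable_mult_right iw)+
  also have "\<dots> = (1/2) * W + 2 * (\<integral>x. (pd i w x)^2 \<partial>?M)"
   unfolding W_def using iw by simp
  finally show ?thesis using pA[of i] by linarith
 qed
 \<comment> \<open>The weights in Young's inequality are chosen so that the term with
   \<open>W\<close>, being at most \<open>A / 2\<close> by the previous step, can be absorbed on the
   left.\<close>
 have A2: "A \<le> (1/8) * W + 2 * L"
 proof -
  have "A = (\<integral>x. - (w x * lap w x) \<partial>?M)" using A1 by simp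
  also have "\<dots> \<le> (\<integral>x. (1/8) * (w x)^2 + 2 * (lap w x)^2 \<partial>?M)"
  proof (rule integral_mono)
   fix x
   have "0 \<le> (w x + 4 * lap w x)^2" by simp
   then show "- (w x * lap w x) \<le> (1/8) * (w x)^2 + 2 * (lap w x)^2"
    by (simp add: power2_eq_square algebra_simps)
  qed (intro integrable_minus Bochner_Integration.integrable_add integrable_mult_right iw)+
  also have "\<dots> = (1/8) * W + 2 * L" unfolding W_def L_def using iw by simp
  finally show ?thesis .
 qed
 have "A \<le> 4 * L" using A2 W1 by linarith
 then show "(\<integral>x. (w x)^2 \<partial>?M) \<le> 16 * L" using W1 by (simp add: W_def)
 show "(\<integral>x. (pd i w x)^2 \<partial>?M) \<le> 16 * L" using pA[of i] \<open>A \<le> 4 * L\<close> L0 by linarith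
 have "(\<integral>x. (pd j (pd i w) x)^2 \<partial>?M) \<le> (\<Sum>j\<in>UNIV. \<integral>x. (pd j (pd i w) x)^2 \<partial>?M)"
  by (intro member_le_sum) auto
 also have "\<dots> \<le> (\<Sum>i\<in>UNIV. \<Sum>j\<in>UNIV. \<integral>x. (pd j (pd i w) x)^2 \<partial>?M)"
  by (rule member_le_sum[of i UNIV "\<lambda>i. \<Sum>j\<in>UNIV. \<integral>x. (pd j (pd i w) x)^2 \<partial>?M"]) (auto intro: sum_nonneg)
 also have "\<dots> \<le> L" using hessian_bound[OF q] by (simp add: w_def L_def)
 finally show "(\<integral>x. (pd j (pd i w) x)^2 \<partial>?M) \<le> 16 * L" using L0 by linarith
qed

section \<open>Mean square limits of polynomial approximations\<close>

definition L2_lim :: "'a measure \<Rightarrow> (nat \<Rightarrow> 'a \<Rightarrow> complex) \<Rightarrow> ('a \<Rightarrow> complex) \<Rightarrow> bool" where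
 "L2_lim M u w \<longleftrightarrow> (\<lambda>n. \<integral>x. (norm (u n x - w x))^2 \<partial>M) \<longlonglongrightarrow> 0"

lemma L2_lim_add:
 assumes "\<And>n. u n \<in> L2 M" "w \<in> L2 M" "\<And>n. u' n \<in> L2 M" "w' \<in> L2 M" "L2_lim M u w" "L2_lim M u' w'"
 shows "L2_lim M (\<lambda>n x. u n x + u' n x) (\<lambda>x. w x + w' x)"
 unfolding L2_lim_def
proof (rule Lim_null_comparison)
 note i = L2D(2)[OF L2_diff[OF assms(1,2)]] L2D(2)[OF L2_diff[OF assms(3,4)]]
 show "\<forall>\<^sub>F n in sequentially. norm (\<integral>x. (norm (u n x + u' n x - (w x + w' x)))^2 \<partial>M)
   \<le> 2 * (\<integral>x. (norm (u n x - w x))^2 \<partial>M) + 2 * (\<integral>x. (norm (u' n x - w' x))^2 \<partial>M)"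
 proof (intro always_eventually allI)
  fix n
  have e: "u n x + u' n x - (w x + w' x) = (u n x - w x) + (u' n x - w' x)" for x by simp
  have "(\<integral>x. (norm (u n x + u' n x - (w x + w' x)))^2 \<partial>M) \<le> (\<integral>x. 2 * (norm (u n x - w x))^2 + 2 * (norm (u' n x - w' x))^2 \<partial>M)"
   unfolding e
   by (rule integral_mono)
    (use i L2D(2)[OF L2_add[OF L2_diff[OF assms(1,2)] L2_diff[OF assms(3,4)]]] norm_add_sq in auto)
  also have "\<dots> = 2 * (\<integral>x. (norm (u n x - w x))^2 \<partial>M) + 2 * (\<integral>x. (norm (u' n x - w' x))^2 \<partial>M)"
   using i by simp
  finally show "norm (\<integral>x. (norm (u n x + u' n x - (w x + w' x)))^2 \<partial>M)
   \<le> 2 * (\<integral>x. (norm (u n x - w x))^2 \<partial>M) + 2 * (\<integral>x. (norm (u' n x - w' x))^2 \<partial>M)" by simp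
 qed
 show "(\<lambda>n. 2 * (\<integral>x. (norm (u n x - w x))^2 \<partial>M) + 2 * (\<integral>x. (norm (u' n x - w' x))^2 \<partial>M)) \<longlonglongrightarrow> 0"
 proof -
  have "(\<lambda>n. 2 * (\<integral>x. (norm (u n x - w x))^2 \<partial>M) + 2 * (\<integral>x. (norm (u' n x - w' x))^2 \<partial>M)) \<longlonglongrightarrow> 2 * 0 + 2 * 0"
   using assms(5,6) unfolding L2_lim_def by (intro tendsto_intros)
  then show ?thesis by simp
 qed
qed

lemma L2_lim_sum:
 "finite I \<Longrightarrow> (\<And>i n. i \<in> I \<Longrightarrow> u i n \<in> L2 M) \<Longrightarrow> (\<And>i. i \<in> I \<Longrightarrow> w i \<in> L2 M) \<Longrightarrow> (\<And>i. i \<in> I \<Longrightarrow> L2_lim M (u i) (w i))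
  \<Longrightarrow> L2_lim M (\<lambda>n x. \<Sum>i\<in>I. u i n x) (\<lambda>x. \<Sum>i\<in>I. w i x)"
proof (induction I rule: finite_induct)
 case empty
 show ?case by (simp add: L2_lim_def)
next
 case (insert i I)
 have "L2_lim M (\<lambda>n x. u i n x + (\<Sum>i\<in>I. u i n x)) (\<lambda>x. w i x + (\<Sum>i\<in>I. w i x))"
  using insert by (intro L2_lim_add L2_sum) auto
 then show ?case using insert by simp
qed

lemma L2_lim_unique:
 assumes "\<And>n. u n \<in> L2 M" "w \<in> L2 M" "w' \<in> L2 M" "L2_lim M u w" "L2_lim M u w'"
 shows "AE x in M. w x = w' x"
proof -
 note i = L2D(2)[OF L2_diff[OF assms(1,2)]] L2D(2)[OF L2_diff[OF assms(1,3)]]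
 note j = L2D(2)[OF L2_diff[OF assms(2,3)]]
 have le: "(\<integral>x. (norm (w x - w' x))^2 \<partial>M) \<le> 2 * (\<integral>x. (norm (u n x - w x))^2 \<partial>M) + 2 * (\<integral>x. (norm (u n x - w' x))^2 \<partial>M)" for n
 proof -
  have "(norm (w x - w' x))^2 \<le> 2 * (norm (u n x - w x))^2 + 2 * (norm (u n x - w' x))^2" for x
   using norm_add_sq[of "w x - u n x" "u n x - w' x"] by (simp add: norm_minus_commute)
  then have "(\<integral>x. (norm (w x - w' x))^2 \<partial>M) \<le> (\<integral>x. 2 * (norm (u n x - w x))^2 + 2 * (norm (u n x - w' x))^2 \<partial>M)"
   using i[of n] j by (intro integral_mono) auto
  then show ?thesis using i[of n] by simp
 qed
 have "(\<lambda>n. 2 * (\<integral>x. (norm (u n x - w x))^2 \<partial>M) + 2 * (\<integral>x. (norm (u n x - w' x))^2 \<partial>M)) \<longlonglongrightarrow> 2 * 0 + 2 * 0"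
  using assms(4,5) unfolding L2_lim_def by (intro tendsto_intros)
 then have "(\<integral>x. (norm (w x - w' x))^2 \<partial>M) \<le> 2 * 0 + 2 * 0"
  using le by (intro LIMSEQ_le_const) auto
 then have "(\<integral>x. (norm (w x - w' x))^2 \<partial>M) = 0" by (simp add: antisym)
 then have "AE x in M. (norm (w x - w' x))^2 = 0"
  using j by (subst (asm) integral_nonneg_eq_0_iff_AE) auto
 then show ?thesis by eventually_elim simp
qed

abbreviation cx :: "('a \<Rightarrow> real) \<Rightarrow> ('a \<Rightarrow> real) \<Rightarrow> 'a \<Rightarrow> complex" where
 "cx p q \<equiv> \<lambda>x. of_real (p x) + \<i> * of_real (q x)"

lemma norm_cx_diff: "(norm (complex_of_real a + \<i> * complex_of_real b - (complex_of_real a' + \<i> * complex_of_real b')))^2 = (a - a')^2 + (b - b')^2"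
 by (simp add: cmod_power2)

lemma L2_ball_cx:
 assumes "elem p" "elem q"
 shows "cx p q \<in> L2 (leb (ball a r))"
proof -
 have 1: "closure (ball a r) \<subseteq> UNIV" "compact (closure (ball a r))" by (auto simp: compact_closure)
 show ?thesis
  using L2_add[OF L2_elem[OF open_UNIV assms(1) open_ball 1(2,1), of 1] L2_elem[OF open_UNIV assms(2) open_ball 1(2,1), of \<i>]]
  by simp
qed

lemma has_weak_deriv_cx:
 assumes "open U" "elementary U p" "elementary U q"
 shows "has_weak_deriv U i (cx p q) (cx (pd i p) (pd i q))"
 using has_weak_deriv_add[OF assms(1) has_weak_deriv_elem_cmult[OF assms(1,2), of i 1] has_weak_deriv_elem_cmult[OF assms(1,3), of i \<i>]]
 by simp

lemma poly_cauchy_limit: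
 fixes A B :: "nat \<Rightarrow> real^'n \<Rightarrow> real"
 assumes e: "\<And>n. elem (A n)" "\<And>n. elem (B n)"
  and b: "\<And>m n. (\<integral>x. (A m x - A n x)^2 \<partial>leb (ball 0 1)) \<le> C * (inverse (real (Suc m)) + inverse (real (Suc n)))"
   "\<And>m n. (\<integral>x. (B m x - B n x)^2 \<partial>leb (ball 0 1)) \<le> C * (inverse (real (Suc m)) + inverse (real (Suc n)))"
  and C: "C > 0"
 shows "\<exists>w\<in>L2 (leb (ball 0 1)). L2_lim (leb (ball 0 1)) (\<lambda>n. cx (A n) (B n)) w"
proof -
 let ?M = "leb (ball (0::real^'n) 1)"
 have i: "integrable ?M (\<lambda>x. (A m x - A n x)^2)" "integrable ?M (\<lambda>x. (B m x - B n x)^2)" for m n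
  by (intro elem_integrable_ball elem_power elem_diff e)+
 have bd: "(\<integral>x. (norm (cx (A m) (B m) x - cx (A n) (B n) x))^2 \<partial>?M) \<le> 2 * C * (inverse (real (Suc m)) + inverse (real (Suc n)))" for m n
  unfolding norm_cx_diff using b[of m n] i[of m n] by simp
 have ca: "\<exists>N. \<forall>m\<ge>N. \<forall>n\<ge>N. (\<integral>x. (norm (cx (A m) (B m) x - cx (A n) (B n) x))^2 \<partial>?M) < \<epsilon>" if \<epsilon>: "\<epsilon> > 0" for \<epsilon>
 proof -
  have "\<epsilon> / (4 * C) > 0" using \<epsilon> C by simp
  then obtain N where N: "inverse (real (Suc N)) < \<epsilon> / (4 * C)" using reals_Archimedean by blast
  have "(\<integral>x. (norm (cx (A m) (B m) x - cx (A n) (B n) x))^2 \<partial>?M) < \<epsilon>" if "m \<ge> N" "n \<ge> N" for m n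
  proof -
   have "inverse (real (Suc m)) \<le> inverse (real (Suc N))" "inverse (real (Suc n)) \<le> inverse (real (Suc N))"
    using that by (auto intro!: le_imp_inverse_le)
   then have "inverse (real (Suc m)) + inverse (real (Suc n)) < \<epsilon> / (2 * C)"
   proof -
    have "\<epsilon> / (4 * C) + \<epsilon> / (4 * C) = \<epsilon> / (2 * C)" using C by (simp add: field_simps)
    with N \<open>inverse (real (Suc m)) \<le> inverse (real (Suc N))\<close> \<open>inverse (real (Suc n)) \<le> inverse (real (Suc N))\<close>
    show ?thesis by linarith
   qed
   then have "2 * C * (inverse (real (Suc m)) + inverse (real (Suc n))) < 2 * C * (\<epsilon> / (2 * C))"
    using C by (intro mult_strict_left_mono) auto
   also have "\<dots> = \<epsilon>" using C by simp
   finally show ?thesis using bd[of m n] by linarith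
  qed
  then show ?thesis by blast
 qed
 obtain g where "g \<in> L2 ?M" "(\<lambda>n. \<integral>x. (norm (cx (A n) (B n) x - g x))^2 \<partial>?M) \<longlonglongrightarrow> 0"
  by (rule L2_complete[OF finite_measure_lebesgue_on[OF lmeasurable_ball] L2_ball_cx[OF e] ca])
 then show ?thesis by (auto simp: L2_lim_def)
qed

lemma poly_dirichlet_seq:
 fixes f :: "real^'n \<Rightarrow> real"
 assumes "f \<in> borel_measurable (leb (ball 0 1))" "integrable (leb (ball 0 1)) (\<lambda>x. (f x)^2)"
 obtains \<alpha> where "\<And>n. rpoly (\<alpha> n)"
  "\<And>n. (\<integral>x. (f x - lap (\<lambda>x. (1 - (norm x)^2) * \<alpha> n x) x)^2 \<partial>leb (ball 0 1)) < inverse (real (Suc n))"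
proof -
 have "\<exists>q. rpoly q \<and> (\<integral>x. (f x - lap (\<lambda>x. (1 - (norm x)^2) * q x) x)^2 \<partial>leb (ball 0 1)) < inverse (real (Suc n))" for n
 proof -
  obtain p where p: "rpoly p" "(\<integral>x. (f x - p x)^2 \<partial>leb (ball 0 1)) < inverse (real (Suc n))"
   using poly_dense_real[OF assms, of "inverse (real (Suc n))"] by auto
  obtain q where "rpoly q" "lap (\<lambda>x. (1 - (norm x)^2) * q x) = p"
   using poly_dirichlet[OF p(1)] by blast
  then show ?thesis using p(2) by (intro exI[of _ q]) auto
 qed
 then have "\<forall>n. \<exists>q. rpoly q \<and> (\<integral>x. (f x - lap (\<lambda>x. (1 - (norm x)^2) * q x) x)^2 \<partial>leb (ball 0 1)) < inverse (real (Suc n))"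
  by (rule allI)
 from choice[OF this] obtain \<alpha> where A: "\<forall>n. rpoly (\<alpha> n) \<and> (\<integral>x. (f x - lap (\<lambda>x. (1 - (norm x)^2) * \<alpha> n x) x)^2 \<partial>leb (ball 0 1)) < inverse (real (Suc n))"
  by (elim exE)
 show ?thesis
  by (rule that[of \<alpha>]) (rule A[rule_format, THEN conjunct1] A[rule_format, THEN conjunct2])+
qed

lemma sq_dist_bound:
 fixes f p q :: "real^'n \<Rightarrow> real"
 assumes "f \<in> borel_measurable M" "integrable M (\<lambda>x. (f x)^2)" "p \<in> borel_measurable M" "q \<in> borel_measurable M"
  "integrable M (\<lambda>x. (p x)^2)" "integrable M (\<lambda>x. (q x)^2)"
  "(\<integral>x. (f x - p x)^2 \<partial>M) < a" "(\<integral>x. (f x - q x)^2 \<partial>M) < b"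
 shows "(\<integral>x. (p x - q x)^2 \<partial>M) \<le> 2 * (a + b)"
proof -
 have sq: "(x - y)^2 \<le> 2 * x^2 + 2 * y^2" for x y :: real
  using sum_squares_ge_zero[of "x + y" 0] by (simp add: power2_eq_square algebra_simps)
 have i: "integrable M (\<lambda>x. (f x - p x)^2)" "integrable M (\<lambda>x. (f x - q x)^2)" "integrable M (\<lambda>x. (p x - q x)^2)"
  by (rule bochner_bound[of _ "\<lambda>x. 2 * (f x)^2 + 2 * (p x)^2"], use assms sq in auto)
   (rule bochner_bound[of _ "\<lambda>x. 2 * (f x)^2 + 2 * (q x)^2"], use assms sq in auto,
    rule bochner_bound[of _ "\<lambda>x. 2 * (p x)^2 + 2 * (q x)^2"], use assms sq in auto)
 have "(\<integral>x. (p x - q x)^2 \<partial>M) \<le> (\<integral>x. 2 * (f x - p x)^2 + 2 * (f x - q x)^2 \<partial>M)"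
 proof (rule integral_mono)
  fix x show "(p x - q x)^2 \<le> 2 * (f x - p x)^2 + 2 * (f x - q x)^2"
   using sq[of "f x - q x" "f x - p x"] by simp
 qed (use i in auto)
 then show ?thesis using i assms(7,8) by simp
qed

text \<open>The approximating polynomials are handed out together with their limit: they vanish
  exactly on the unit sphere, which gives the boundary condition, and their restrictions to small
  spheres produce the traces needed for the functionals.\<close>

theorem dirichlet_exists:
 fixes f :: "real^'n \<Rightarrow> complex"
 assumes f: "f \<in> L2 (leb Om)"
 obtains a b :: "nat \<Rightarrow> real^'n \<Rightarrow> real" and w v v2 where
  "\<And>n. rpoly (a n)" "\<And>n. rpoly (b n)"
  "\<And>n x. norm x = 1 \<Longrightarrow> a n x = 0" "\<And>n x. norm x = 1 \<Longrightarrow> b n x = 0"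
  "w \<in> L2 (leb Om)" "\<And>i. v i \<in> L2 (leb Om)" "\<And>i j. v2 i j \<in> L2 (leb Om)"
  "L2_lim (leb Om) (\<lambda>n. cx (a n) (b n)) w"
  "\<And>i. L2_lim (leb Om) (\<lambda>n. cx (pd i (a n)) (pd i (b n))) (v i)"
  "\<And>i j. L2_lim (leb Om) (\<lambda>n. cx (pd j (pd i (a n))) (pd j (pd i (b n)))) (v2 i j)"
  "AE x in leb Om. (\<Sum>i\<in>UNIV. v2 i i x) = f x"
proof -
 let ?M = "leb (Om :: (real^'n) set)"
 note [measurable] = L2D(1)[OF f]
 have fi: "integrable ?M (\<lambda>x. (Re (f x))^2)" "integrable ?M (\<lambda>x. (Im (f x))^2)"
  by (rule bochner_bound[OF L2D(2)[OF f]]; simp add: cmod_power2)+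
 have fm: "(\<lambda>x. Re (f x)) \<in> borel_measurable ?M" "(\<lambda>x. Im (f x)) \<in> borel_measurable ?M" by measurable
 obtain \<alpha> where \<alpha>: "\<And>n. rpoly (\<alpha> n)"
  "\<And>n. (\<integral>x. (Re (f x) - lap (\<lambda>x. (1 - (norm x)^2) * \<alpha> n x) x)^2 \<partial>?M) < inverse (real (Suc n))"
  using poly_dirichlet_seq[OF fm(1) fi(1)] by blast
 obtain \<beta> where \<beta>: "\<And>n. rpoly (\<beta> n)"
  "\<And>n. (\<integral>x. (Im (f x) - lap (\<lambda>x. (1 - (norm x)^2) * \<beta> n x) x)^2 \<partial>?M) < inverse (real (Suc n))"
  using poly_dirichlet_seq[OF fm(2) fi(2)] by blast
 define a where "a n = (\<lambda>x. (1 - (norm x)^2) * \<alpha> n x)" for n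
 define b where "b n = (\<lambda>x. (1 - (norm x)^2) * \<beta> n x)" for n
 have ap: "rpoly (a n)" and bp: "rpoly (b n)" for n
  unfolding a_def b_def using poly_rho \<alpha>(1) \<beta>(1) by (auto intro: real_polynomial_function.intros(4))
 have ae [simp]: "elem (a n)" and be [simp]: "elem (b n)" for n
  using poly_elem ap bp by blast+
 have es: "elem (pd i (a n))" "elem (pd i (b n))"
  "elem (pd j (pd i (a n)))" "elem (pd j (pd i (b n)))"
  "elem (lap (a n))" "elem (lap (b n))" for n i j
  by (intro pd_elem lap_elem ae be)+
 \<comment> \<open>The constant 32 is 16 from the a priori estimate, applied to a difference of two
   approximations, times 2 from comparing both Laplacians with the same \<open>g\<close>.\<close>
 have main: "(\<integral>x. (a m x - a n x)^2 \<partial>?M) \<le> 32 * (inverse (real (Suc m)) + inverse (real (Suc n)))"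
   "(\<integral>x. (pd i (a m) x - pd i (a n) x)^2 \<partial>?M) \<le> 32 * (inverse (real (Suc m)) + inverse (real (Suc n)))"
   "(\<integral>x. (pd j (pd i (a m)) x - pd j (pd i (a n)) x)^2 \<partial>?M) \<le> 32 * (inverse (real (Suc m)) + inverse (real (Suc n)))"
  if p: "\<And>n. rpoly (\<alpha> n)" and a: "a = (\<lambda>n x. (1 - (norm x)^2) * \<alpha> n x)"
   and g: "g \<in> borel_measurable ?M" "integrable ?M (\<lambda>x. (g x)^2)"
   and l: "\<And>n. (\<integral>x. (g x - lap (a n) x)^2 \<partial>?M) < inverse (real (Suc n))"
  for \<alpha> a :: "nat \<Rightarrow> real^'n \<Rightarrow> real" and g m n i j
 proof -
  have dp: "rpoly (\<lambda>x. \<alpha> m x - \<alpha> n x)" using p by (intro real_polynomial_function_diff)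
  have ae: "elem (a n)" for n unfolding a by (intro elementary.mult elem_rho poly_elem p)
  have d: "(1 - (norm x)^2) * (\<alpha> m x - \<alpha> n x) = a m x - a n x" for x
   by (simp add: a algebra_simps)
  have "(\<integral>x. (lap (a m) x - lap (a n) x)^2 \<partial>?M) \<le> 2 * (inverse (real (Suc m)) + inverse (real (Suc n)))"
   by (rule sq_dist_bound[OF g _ _ _ _ l l])
    (intro elem_UNIV_lebesgue_on elem_integrable_ball elem_power lap_elem ae)+
  moreover have "lap (\<lambda>x. a m x - a n x) = (\<lambda>x. lap (a m) x - lap (a n) x)" by (rule lap_diff[OF ae ae])
  ultimately have L: "(\<integral>x. (lap (\<lambda>x. a m x - a n x) x)^2 \<partial>?M) \<le> 2 * (inverse (real (Suc m)) + inverse (real (Suc n)))" by simp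
  note ap = apriori[OF dp, unfolded d pd_diff[OF ae ae] pd_diff[OF pd_elem[OF ae] pd_elem[OF ae]]]
  show "(\<integral>x. (a m x - a n x)^2 \<partial>?M) \<le> 32 * (inverse (real (Suc m)) + inverse (real (Suc n)))"
   using ap(1) L by linarith
  show "(\<integral>x. (pd i (a m) x - pd i (a n) x)^2 \<partial>?M) \<le> 32 * (inverse (real (Suc m)) + inverse (real (Suc n)))"
   using ap(2)[of i] L by linarith
  show "(\<integral>x. (pd j (pd i (a m)) x - pd j (pd i (a n)) x)^2 \<partial>?M) \<le> 32 * (inverse (real (Suc m)) + inverse (real (Suc n)))"
   using ap(3)[of j i] L by linarith
 qed
 have aa: "a = (\<lambda>n x. (1 - (norm x)^2) * \<alpha> n x)" "b = (\<lambda>n x. (1 - (norm x)^2) * \<beta> n x)" by (auto simp: a_def b_def)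
 note ma = main[OF \<alpha>(1) aa(1) fm(1) fi(1) \<alpha>(2)[folded a_def]]
 note mb = main[OF \<beta>(1) aa(2) fm(2) fi(2) \<beta>(2)[folded b_def]]
 obtain w where w: "w \<in> L2 ?M" "L2_lim ?M (\<lambda>n. cx (a n) (b n)) w"
  using poly_cauchy_limit[OF ae be ma(1) mb(1) zero_less_numeral] by blast
 have "\<exists>v\<in>L2 ?M. L2_lim ?M (\<lambda>n. cx (pd i (a n)) (pd i (b n))) v" for i
  by (rule poly_cauchy_limit[OF es(1)[where i=i] es(2)[where i=i] ma(2)[where i=i] mb(2)[where i=i] zero_less_numeral])
 then have "\<forall>i. \<exists>v. v \<in> L2 ?M \<and> L2_lim ?M (\<lambda>n. cx (pd i (a n)) (pd i (b n))) v" by blast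
 from choice[OF this] obtain v where v: "\<And>i. v i \<in> L2 ?M" "\<And>i. L2_lim ?M (\<lambda>n. cx (pd i (a n)) (pd i (b n))) (v i)" by blast
 have "\<exists>v\<in>L2 ?M. L2_lim ?M (\<lambda>n. cx (pd j (pd i (a n))) (pd j (pd i (b n)))) v" for i j
  by (rule poly_cauchy_limit[OF es(3)[where i=i and j=j] es(4)[where i=i and j=j]
    ma(3)[where i=i and j=j] mb(3)[where i=i and j=j] zero_less_numeral])
 then have "\<forall>k. \<exists>v. v \<in> L2 ?M \<and> L2_lim ?M (\<lambda>n. cx (pd (snd k) (pd (fst k) (a n))) (pd (snd k) (pd (fst k) (b n)))) v" by blast
 from choice[OF this] obtain v2' where v2': "\<And>k. v2' k \<in> L2 ?M"
  "\<And>k. L2_lim ?M (\<lambda>n. cx (pd (snd k) (pd (fst k) (a n))) (pd (snd k) (pd (fst k) (b n)))) (v2' k)" by blast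
 define v2 where "v2 i j = v2' (i, j)" for i j
 have v2: "\<And>i j. v2 i j \<in> L2 ?M"
  "\<And>i j. L2_lim ?M (\<lambda>n. cx (pd j (pd i (a n))) (pd j (pd i (b n)))) (v2 i j)"
  using v2'(1) v2'(2)[of "(_, _)"] by (simp_all add: v2_def)
 have lc: "(\<Sum>i\<in>UNIV. cx (pd i (pd i (a n))) (pd i (pd i (b n))) x) = cx (lap (a n)) (lap (b n)) x" for n x
  by (simp add: lap_def sum.distrib sum_distrib_left)
 have "L2_lim ?M (\<lambda>n x. \<Sum>i\<in>UNIV. cx (pd i (pd i (a n))) (pd i (pd i (b n))) x) (\<lambda>x. \<Sum>i\<in>UNIV. v2 i i x)"
  by (intro L2_lim_sum v2 L2_ball_cx es) auto
 then have 1: "L2_lim ?M (\<lambda>n. cx (lap (a n)) (lap (b n))) (\<lambda>x. \<Sum>i\<in>UNIV. v2 i i x)" unfolding lc .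
 \<comment> \<open>The Laplacians approach \<open>f\<close> by construction and the trace of the
   limiting Hessian by convergence of the second derivatives; uniqueness of limits identifies the
   two.\<close>
 have 2: "L2_lim ?M (\<lambda>n. cx (lap (a n)) (lap (b n))) f"
  unfolding L2_lim_def
 proof (rule Lim_null_comparison)
  have e: "(norm (cx (lap (a n)) (lap (b n)) x - f x))^2 = (Re (f x) - lap (a n) x)^2 + (Im (f x) - lap (b n) x)^2" for n x
   by (simp add: cmod_power2 power2_commute)
  have bnd: "integrable ?M (\<lambda>x. (Re (f x) - lap (a n) x)^2 + (Im (f x) - lap (b n) x)^2)" for n
   using L2D(2)[OF L2_diff[OF L2_ball_cx[OF es(5)[where n=n] es(6)[where n=n]] f]] unfolding e .
  have mm: "(\<lambda>x. (Re (f x) - lap (a n) x)^2) \<in> borel_measurable ?M" "(\<lambda>x. (Im (f x) - lap (b n) x)^2) \<in> borel_measurable ?M" for n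
   by (intro borel_measurable_power borel_measurable_diff fm elem_UNIV_lebesgue_on es)+
  have i: "integrable ?M (\<lambda>x. (Re (f x) - lap (a n) x)^2)" "integrable ?M (\<lambda>x. (Im (f x) - lap (b n) x)^2)" for n
   by (rule bochner_bound[OF bnd[of n] mm(1)], rule AE_I2, simp)
    (rule bochner_bound[OF bnd[of n] mm(2)], rule AE_I2, simp)
  show "\<forall>\<^sub>F n in sequentially. norm (\<integral>x. (norm (cx (lap (a n)) (lap (b n)) x - f x))^2 \<partial>?M) \<le> 2 * inverse (real (Suc n))"
  proof (intro always_eventually allI)
   fix n
   show "norm (\<integral>x. (norm (cx (lap (a n)) (lap (b n)) x - f x))^2 \<partial>?M) \<le> 2 * inverse (real (Suc n))"
    unfolding e using \<alpha>(2)[of n, folded a_def] \<beta>(2)[of n, folded b_def] i[of n] by simp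
  qed
  show "(\<lambda>n. 2 * inverse (real (Suc n))) \<longlonglongrightarrow> 0"
   using tendsto_mult_left[OF LIMSEQ_inverse_real_of_nat, of 2] by simp
 qed
 have 3: "AE x in ?M. (\<Sum>i\<in>UNIV. v2 i i x) = f x"
  by (rule L2_lim_unique[OF _ _ f 1 2]) (intro L2_ball_cx es L2_sum v2)+
 show ?thesis
  by (rule that[OF ap bp _ _ w(1) v(1) v2(1) w(2) v(2) v2(2) 3]) (auto simp: a_def b_def)
qed

section \<open>Traces on spheres\<close>

lemma power_diff_le:
 fixes x y :: real
 assumes "0 \<le> y" "y \<le> x"
 shows "x ^ Suc k - y ^ Suc k \<le> real (Suc k) * x ^ k * (x - y)"
proof (induction k)
 case (Suc k)
 have "x ^ Suc (Suc k) - y ^ Suc (Suc k) = x * (x ^ Suc k - y ^ Suc k) + y ^ Suc k * (x - y)"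
  by (simp add: algebra_simps)
 also have "\<dots> \<le> x * (real (Suc k) * x ^ k * (x - y)) + x ^ Suc k * (x - y)"
  using assms by (intro add_mono mult_left_mono mult_right_mono Suc power_mono) auto
 also have "\<dots> = real (Suc (Suc k)) * x ^ Suc k * (x - y)" by (simp add: algebra_simps)
 finally show ?case .
qed simp

text \<open>The point is the linear dependence on the thickness \<open>h\<close>, which compensates
  the slope of order \<open>1 / h\<close> of a cutoff across the shell.\<close>

lemma annulus_measure:
 fixes a :: "real^'n"
 assumes "0 < h" "h \<le> r"
 shows "{x. \<bar>norm (x - a) - r\<bar> \<le> h} \<in> lmeasurable"
  "measure lebesgue {x. \<bar>norm (x - a) - r\<bar> \<le> h} \<le> (2 * unit_ball_vol (real CARD('n)) * real CARD('n) * (2 * r) ^ (CARD('n) - 1)) * h"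
proof -
 have e: "{x. \<bar>norm (x - a) - r\<bar> \<le> h} = cball a (r + h) - ball a (r - h)"
  by (auto simp: dist_norm norm_minus_commute)
 show "{x. \<bar>norm (x - a) - r\<bar> \<le> h} \<in> lmeasurable"
  unfolding e by (intro fmeasurable.Diff) auto
 obtain k where k: "CARD('n) = Suc k" by (metis gr0_implies_Suc zero_less_card_finite)
 have sub: "ball a (r - h) \<subseteq> cball a (r + h)" using assms by (auto simp: subset_eq)
 have "measure lebesgue {x. \<bar>norm (x - a) - r\<bar> \<le> h} = measure lebesgue (cball a (r + h)) - measure lebesgue (ball a (r - h))"
  unfolding e using sub by (intro measurable_measure_Diff) (auto simp: fmeasurableD)
 also have "\<dots> = unit_ball_vol (real CARD('n)) * ((r + h) ^ CARD('n) - (r - h) ^ CARD('n))"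
  using assms by (simp add: content_cball content_ball right_diff_distrib)
 also have "(r + h) ^ CARD('n) - (r - h) ^ CARD('n) \<le> real (Suc k) * (r + h) ^ k * (2 * h)"
  using power_diff_le[of "r - h" "r + h" k] assms by (simp add: k)
 also have "\<dots> \<le> real (Suc k) * (2 * r) ^ k * (2 * h)"
  using assms by (intro mult_right_mono mult_left_mono power_mono) auto
 finally show "measure lebesgue {x. \<bar>norm (x - a) - r\<bar> \<le> h} \<le> (2 * unit_ball_vol (real CARD('n)) * real CARD('n) * (2 * r) ^ (CARD('n) - 1)) * h"
  by (simp add: k mult_ac)
qed

text \<open>A one-sided cutoff: \<open>s = 1\<close> selects the exterior of the sphere and
  \<open>s = -1\<close> its interior. It vanishes near the sphere and on the other side, and becomes
  1 at every point of the selected side as \<epsilon> tends to 0.\<close>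

definition scut :: "real^'n \<Rightarrow> real \<Rightarrow> real \<Rightarrow> real \<Rightarrow> real^'n \<Rightarrow> real" where
 "scut a r s \<epsilon> x = step (s * ((norm (x - a))^2 - r^2) / \<epsilon>)"

lemma scut_elem: "elementary U (scut a r s \<epsilon>)"
 unfolding scut_def[abs_def] by (intro elem_step elem_divide elem_cmult elem_diff elementary.const elem_norm2)

lemma scut_bounds: "0 \<le> scut a r s \<epsilon> x" "scut a r s \<epsilon> x \<le> 1"
 unfolding scut_def by (rule step_range)+

lemma side_square:
 assumes "r > 0" "s = 1 \<or> s = (-1::real)"
 shows "s * ((norm (x - a))^2 - r^2) > 0 \<longleftrightarrow> s * (norm (x - a) - r) > 0"
proof -
 have eq: "s * ((norm (x - a))^2 - r^2) = (s * (norm (x - a) - r)) * (norm (x - a) + r)"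
  by (simp add: power2_eq_square algebra_simps)
 have pos: "norm (x - a) + r > 0" using assms(1) by (simp add: add_nonneg_pos)
 show ?thesis
  unfolding eq using mult_pos_pos[OF _ pos] zero_less_mult_pos2[OF _ pos] by blast
qed

lemma part_deriv_scut:
 assumes "\<And>t. (step has_real_derivative s' t) (at t)"
 shows "pd i (scut a r s \<epsilon>) x = s' (s * ((norm (x - a))^2 - r^2) / \<epsilon>) * ((s / \<epsilon>) * (2 * (x $ i - a $ i)))"
proof -
 have el: "elem (\<lambda>x. (norm (x - a))^2 - r^2)" by (intro elem_diff elem_norm2 elementary.const)
 have e: "elem (\<lambda>x. s * ((norm (x - a))^2 - r^2) / \<epsilon>)" by (intro elem_divide elem_cmult el)
 have "pd i (\<lambda>x. s * ((norm (x - a))^2 - r^2) / \<epsilon>) x = pd i (\<lambda>x. (s / \<epsilon>) * ((norm (x - a))^2 - r^2)) x"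
  by simp
 also have "\<dots> = (s / \<epsilon>) * (2 * (x $ i - a $ i))"
  unfolding pd_cmult[OF el] pd_diff[OF elem_norm2 elementary.const] pd_norm2 pd_const by simp
 finally show ?thesis
  unfolding scut_def[abs_def]
  by (subst part_deriv_chain[OF elem_UNIV_differentiable[OF e] assms]) simp
qed

text \<open>The gradient has size \<open>1/\<epsilon>\<close> on a shell of volume of order
  \<epsilon>, so its \<open>L1\<close> norm is bounded uniformly. Height \<open>D\<close> and shell
  \<open>Sh\<close> are kept separate so that the bound can be multiplied by a function bounded on
  the shell.\<close>

lemma scut_deriv_bound:
 fixes a :: "real^'n"
 assumes r: "r > 0" and s: "s = 1 \<or> s = (-1::real)"
 obtains C where "C \<ge> 0" "\<And>\<epsilon>. 0 < \<epsilon> \<Longrightarrow> \<epsilon> \<le> r^2 / 4 \<Longrightarrow>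
  \<exists>D Sh. D \<ge> 0 \<and> Sh \<in> lmeasurable \<and> (\<forall>x. \<bar>pd i (scut a r s \<epsilon>) x\<bar> \<le> D * indicator Sh x) \<and> D * measure lebesgue Sh \<le> C"
proof -
 obtain s' M where s': "\<And>t. (step has_real_derivative s' t) (at t)" "\<And>t. \<bar>s' t\<bar> \<le> M"
  "\<And>t. t < 1 \<or> t > 2 \<Longrightarrow> s' t = 0" "M > 0" using step_deriv_ex by metis
 define c where "c = 2 * unit_ball_vol (real CARD('n)) * real CARD('n) * (2 * r) ^ (CARD('n) - 1)"
 have c0: "c \<ge> 0" using r by (simp add: c_def)
 have abs_s: "\<bar>s\<bar> = 1" using s by auto
 show ?thesis
 proof (rule that[of "M * (4 * r) * c * (2 / r)"])
  show "M * (4 * r) * c * (2 / r) \<ge> 0" using r s'(4) c0 by simp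
  fix \<epsilon> :: real assume \<epsilon>: "0 < \<epsilon>" "\<epsilon> \<le> r^2 / 4"
  \<comment> \<open>Where the derivative is nonzero the squared distance differs from
    \<open>r^2\<close> by at most \<open>2 * \<epsilon>\<close>, hence the distance differs from
    \<open>r\<close> by at most \<open>h\<close>. The upper bound on \<epsilon> keeps
    \<open>h\<close> below \<open>r\<close>.\<close>
  define h where "h = 2 * \<epsilon> / r"
  have h: "0 < h" "h \<le> r" using \<epsilon> r by (auto simp: h_def field_simps power2_eq_square)
  define Sh where "Sh = {x. \<bar>norm (x - a) - r\<bar> \<le> h}"
  define D where "D = M * (4 * r) / \<epsilon>"
  have bd: "\<bar>pd i (scut a r s \<epsilon>) x\<bar> \<le> D * indicator Sh x" for x
  proof -
   define t where "t = s * ((norm (x - a))^2 - r^2) / \<epsilon>"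
   have pd: "pd i (scut a r s \<epsilon>) x = s' t * ((s / \<epsilon>) * (2 * (x $ i - a $ i)))"
    unfolding t_def by (rule part_deriv_scut[OF s'(1)])
   show ?thesis
   proof (cases "t < 1 \<or> t > 2")
    case True
    have "0 \<le> D * indicator Sh x" using s'(4) r \<epsilon> by (simp add: D_def indicator_def)
    then show ?thesis using s'(3)[OF True] by (simp add: pd)
   next
    case False
    then have t: "1 \<le> t" "t \<le> 2" by auto
    have st: "s * ((norm (x - a))^2 - r^2) = t * \<epsilon>" using \<epsilon> by (simp add: t_def)
    have te: "0 \<le> t * \<epsilon>" "t * \<epsilon> \<le> 2 * \<epsilon>" using t \<epsilon> by auto
    have up: "(norm (x - a))^2 \<le> r^2 + 2 * \<epsilon>" and lo: "(norm (x - a))^2 \<ge> r^2 - 2 * \<epsilon>"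
     using s st te by (auto simp: algebra_simps)
    have hr: "h * r = 2 * \<epsilon>" using r by (simp add: h_def)
    have "(norm (x - a))^2 \<le> (r + h)^2"
    proof -
     have "(r + h)^2 = r^2 + 2 * (h * r) + h^2" by (simp add: power2_eq_square algebra_simps)
     moreover have "h^2 \<ge> 0" by simp
     ultimately show ?thesis using up hr \<epsilon> by linarith
    qed
    then have 1: "norm (x - a) \<le> r + h" by (rule power2_le_imp_le) (use h r in auto)
    have "h * h \<le> h * r" using h by (intro mult_left_mono) auto
    then have "(r - h)^2 \<le> (norm (x - a))^2"
     using lo hr by (simp add: power2_eq_square algebra_simps)
    then have 2: "r - h \<le> norm (x - a)" by (rule power2_le_imp_le) auto
    have inSh: "x \<in> Sh" using 1 2 by (auto simp: Sh_def)
    have "\<bar>x $ i - a $ i\<bar> \<le> norm (x - a)" using component_le_norm_cart[of "x - a" i] by simp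
    also have "\<dots> \<le> 2 * r" using 1 h by simp
    finally have xa: "\<bar>x $ i - a $ i\<bar> \<le> 2 * r" .
    have "\<bar>pd i (scut a r s \<epsilon>) x\<bar> = \<bar>s' t\<bar> * ((1 / \<epsilon>) * (2 * \<bar>x $ i - a $ i\<bar>))"
     unfolding pd abs_mult using abs_s \<epsilon> by simp
    also have "\<dots> \<le> M * ((1 / \<epsilon>) * (2 * (2 * r)))"
     using s'(2)[of t] xa \<epsilon> s'(4) by (intro mult_mono mult_left_mono) auto
    finally show ?thesis using inSh by (simp add: D_def)
   qed
  qed
  have "D * measure lebesgue Sh \<le> D * (c * h)"
   using annulus_measure(2)[OF h] s'(4) r \<epsilon> by (intro mult_left_mono) (auto simp: Sh_def c_def D_def)
  also have "\<dots> = M * (4 * r) * c * (2 / r)" using \<epsilon> by (simp add: D_def h_def)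
  finally have "D * measure lebesgue Sh \<le> M * (4 * r) * c * (2 / r)" .
  moreover have "D \<ge> 0" using s'(4) r \<epsilon> by (simp add: D_def)
  moreover have "Sh \<in> lmeasurable" unfolding Sh_def by (rule annulus_measure(1)[OF h])
  ultimately show "\<exists>D Sh. D \<ge> 0 \<and> Sh \<in> lmeasurable \<and> (\<forall>x. \<bar>pd i (scut a r s \<epsilon>) x\<bar> \<le> D * indicator Sh x) \<and> D * measure lebesgue Sh \<le> M * (4 * r) * c * (2 / r)"
   using bd by blast
 qed
qed

text \<open>\<eta> may be nonzero on the sphere, so it is no test function on one side of it. The
  cutoff removes a neighbourhood of the sphere, and the product gets compact support in the open set
  \<open>W\<close>.\<close>

lemma scut_test:
 fixes a :: "real^'n"
 assumes r: "r > 0" and s: "s = 1 \<or> s = (-1::real)" and \<epsilon>: "\<epsilon> > 0"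
  and \<eta>: "elem \<eta>" "compact K" "\<And>x. \<eta> x \<noteq> 0 \<Longrightarrow> x \<in> K"
  and KW: "\<And>x. x \<in> K \<Longrightarrow> s * (norm (x - a) - r) > 0 \<Longrightarrow> x \<in> W"
 shows "(\<lambda>x. scut a r s \<epsilon> x * \<eta> x) \<in> test_functions W"
proof (rule test_functionI[of _ "K \<inter> {x. s * ((norm (x - a))^2 - r^2) \<ge> \<epsilon>}"])
 show "elem (\<lambda>x. scut a r s \<epsilon> x * \<eta> x)" by (intro elementary.mult scut_elem \<eta>)
 have "closed {x. s * ((norm (x - a))^2 - r^2) \<ge> \<epsilon>}"
  by (intro closed_Collect_le continuous_intros)
 then show "compact (K \<inter> {x. s * ((norm (x - a))^2 - r^2) \<ge> \<epsilon>})" using \<eta>(2) by (rule compact_Int_closed[rotated])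
 show "K \<inter> {x. s * ((norm (x - a))^2 - r^2) \<ge> \<epsilon>} \<subseteq> W"
  using KW \<epsilon> side_square[OF r s] by force
 fix x assume "scut a r s \<epsilon> x * \<eta> x \<noteq> 0"
 then have "scut a r s \<epsilon> x \<noteq> 0" "\<eta> x \<noteq> 0" by auto
 then have "\<not> s * ((norm (x - a))^2 - r^2) / \<epsilon> \<le> 1" "x \<in> K" using step_0 \<eta>(3) by (auto simp: scut_def)
 then show "x \<in> K \<inter> {x. s * ((norm (x - a))^2 - r^2) \<ge> \<epsilon>}" using \<epsilon> by (simp add: field_simps)
qed

lemma supp_part_deriv:
 assumes "closed K" "\<And>x. \<eta> x \<noteq> 0 \<Longrightarrow> x \<in> K" "pd i \<eta> x \<noteq> 0"
 shows "x \<in> K"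
proof (rule ccontr)
 assume "x \<notin> K"
 then have "x \<in> - K" "open (- K)" using assms(1) by (auto simp: open_Compl)
 from part_deriv_cong[OF this(2,1), of \<eta> "\<lambda>_. 0" i] assms show False by (auto simp: part_deriv_const)
qed

lemma elem_compact_bounded:
 assumes "elem \<eta>" "compact K" "\<And>x. \<eta> x \<noteq> 0 \<Longrightarrow> x \<in> K"
 obtains B where "B \<ge> 0" "\<And>x. \<bar>\<eta> x\<bar> \<le> B"
proof -
 obtain R where "\<And>x. norm x > R \<Longrightarrow> x \<notin> K" using compact_norm_bound[OF assms(2)] by blast
 then have "\<eta> x = 0" if "norm x > R" for x using assms(3) that by blast
 from bounded_supp[OF elem_UNIV_continuous[OF assms(1)] this] show ?thesis using that by blast
qed

lemma supp_mult_integrable: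
 fixes u :: "real^'n \<Rightarrow> complex"
 assumes \<eta>: "elem \<eta>" "compact K" "\<And>x. \<eta> x \<noteq> 0 \<Longrightarrow> x \<in> K"
  and W: "W \<in> sets lebesgue" and u: "u \<in> L2 (leb W)"
 shows "integrable (leb W) (\<lambda>x. \<eta> x *\<^sub>R u x)"
proof -
 have WK: "W \<inter> K \<in> lmeasurable"
  using fmeasurable_Int_fmeasurable[OF lmeasurable_compact[OF \<eta>(2)] W] by (simp add: Int_commute)
 obtain B where B: "\<And>x. \<bar>\<eta> x\<bar> \<le> B" using elem_compact_bounded[OF \<eta>] by blast
 have "u \<in> L2 (leb (W \<inter> K))" using WK by (intro L2_subset[OF W _ _ u]) (auto simp: fmeasurableD)
 then have "integrable (leb (W \<inter> K)) u" by (rule L2_integrable[OF finite_measure_lebesgue_on[OF WK]])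
 then have "integrable (leb (W \<inter> K)) (\<lambda>x. \<eta> x *\<^sub>R u x)"
  by (rule integrable_bounded_mult[OF _ elem_UNIV_lebesgue_on[OF \<eta>(1)], of _ _ B]) (simp add: B)
 moreover have "(\<lambda>x. indicator (W \<inter> K) x *\<^sub>R (\<eta> x *\<^sub>R u x)) = (\<lambda>x. indicator W x *\<^sub>R (\<eta> x *\<^sub>R u x))"
 proof
  fix x show "indicator (W \<inter> K) x *\<^sub>R (\<eta> x *\<^sub>R u x) = indicator W x *\<^sub>R (\<eta> x *\<^sub>R u x)"
   using \<eta>(3)[of x] by (cases "x \<in> K") (auto simp: indicator_def)
 qed
 ultimately show ?thesis
  using lebesgue_on_indicator(2)[OF W, of "\<lambda>x. \<eta> x *\<^sub>R u x"] lebesgue_on_indicator(2)[OF fmeasurableD[OF WK], of "\<lambda>x. \<eta> x *\<^sub>R u x"]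
  by simp
qed

text \<open>Although \<psi>' occurs in the integral, only the supremum of \<psi> controls it: with a
  one-sided cutoff the integral equals, up to sign, that of \<psi> against the gradient of the
  cutoff, whose \<open>L1\<close> norm is bounded. \<open>C\<close> does not depend on \<psi>, which
  permits approximation.\<close>

lemma trace_ibp_bound:
 fixes a :: "real^'n"
 assumes r: "r > 0" and s: "s = 1 \<or> s = (-1::real)"
  and W: "open W" "\<And>x. x \<in> W \<Longrightarrow> s * (norm (x - a) - r) > 0"
  and \<eta>: "elem \<eta>" "compact K" "\<And>x. \<eta> x \<noteq> 0 \<Longrightarrow> x \<in> K"
  and KW: "\<And>x. x \<in> K \<Longrightarrow> s * (norm (x - a) - r) > 0 \<Longrightarrow> x \<in> W"
 obtains C where "C \<ge> 0" "\<And>(\<psi>::real^'n \<Rightarrow> complex) \<psi>' \<kappa>. \<psi> \<in> L2 (leb W) \<Longrightarrow> \<psi>' \<in> L2 (leb W) \<Longrightarrow> has_weak_deriv W i \<psi> \<psi>' \<Longrightarrow>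
  \<kappa> \<ge> 0 \<Longrightarrow> (\<And>x. x \<in> W \<Longrightarrow> x \<in> K \<Longrightarrow> norm (\<psi> x) \<le> \<kappa>) \<Longrightarrow>
  norm (\<integral>x. pd i \<eta> x *\<^sub>R \<psi> x + \<eta> x *\<^sub>R \<psi>' x \<partial>leb W) \<le> C * \<kappa>"
proof -
 obtain C where C: "C \<ge> 0" "\<And>\<epsilon>. 0 < \<epsilon> \<Longrightarrow> \<epsilon> \<le> r^2 / 4 \<Longrightarrow>
  \<exists>D Sh. D \<ge> 0 \<and> Sh \<in> lmeasurable \<and> (\<forall>x. \<bar>pd i (scut a r s \<epsilon>) x\<bar> \<le> D * indicator Sh x) \<and> D * measure lebesgue Sh \<le> C"
  using scut_deriv_bound[OF r s, of i a] by metis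
 obtain B where B: "B \<ge> 0" "\<And>x. \<bar>\<eta> x\<bar> \<le> B" using elem_compact_bounded[OF \<eta>] by blast
 have pK: "x \<in> K" if "pd i \<eta> x \<noteq> 0" for x
  using supp_part_deriv[OF compact_imp_closed[OF \<eta>(2)] \<eta>(3)] that by blast
 note Wl = open_lebesgue[OF W(1)]
 show ?thesis
 proof (rule that[of "C * B"])
  show "C * B \<ge> 0" using C B by simp
  fix \<psi> \<psi>' :: "real^'n \<Rightarrow> complex" and \<kappa> :: real
  assume L2: "\<psi> \<in> L2 (leb W)" "\<psi>' \<in> L2 (leb W)" and wd: "has_weak_deriv W i \<psi> \<psi>'"
   and \<kappa>: "\<kappa> \<ge> 0" "\<And>x. x \<in> W \<Longrightarrow> x \<in> K \<Longrightarrow> norm (\<psi> x) \<le> \<kappa>"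
  define h where "h x = pd i \<eta> x *\<^sub>R \<psi> x + \<eta> x *\<^sub>R \<psi>' x" for x
  have hi: "integrable (leb W) h"
   unfolding h_def by (rule Bochner_Integration.integrable_add[OF supp_mult_integrable[OF pd_elem[OF \<eta>(1)] \<eta>(2) pK Wl L2(1)]
      supp_mult_integrable[OF \<eta> Wl L2(2)]])
  define \<epsilon> where "\<epsilon> n = r^2 / 4 * inverse (real (Suc n))" for n
  have \<epsilon>: "0 < \<epsilon> n" "\<epsilon> n \<le> r^2 / 4" for n
  proof -
   show "0 < \<epsilon> n" using r by (simp add: \<epsilon>_def)
   have "inverse (real (Suc n)) \<le> 1" by (simp add: field_simps)
   then show "\<epsilon> n \<le> r^2 / 4" using r unfolding \<epsilon>_def by (intro mult_left_le) auto
  qed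
  have \<epsilon>0: "\<epsilon> \<longlonglongrightarrow> 0"
   unfolding \<epsilon>_def using tendsto_mult_left[OF LIMSEQ_inverse_real_of_nat, of "r^2 / 4"] by simp
  have bd: "norm (\<integral>x. scut a r s (\<epsilon> n) x *\<^sub>R h x \<partial>leb W) \<le> C * B * \<kappa>" for n
  proof -
   let ?c = "scut a r s (\<epsilon> n)"
   obtain D Sh where D: "D \<ge> 0" "Sh \<in> lmeasurable" "\<And>x. \<bar>pd i ?c x\<bar> \<le> D * indicator Sh x" "D * measure lebesgue Sh \<le> C"
    using C(2)[OF \<epsilon>] by blast
   have t: "(\<lambda>x. ?c x * \<eta> x) \<in> test_functions W"
    by (rule scut_test[OF r s \<epsilon>(1) \<eta> KW])
   have pm: "pd i (\<lambda>x. ?c x * \<eta> x) x = pd i ?c x * \<eta> x + ?c x * pd i \<eta> x" for x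
    by (rule part_deriv_mult) (intro elem_UNIV_differentiable scut_elem \<eta>)+
   have i1: "integrable (leb W) (\<lambda>x. (pd i ?c x * \<eta> x) *\<^sub>R \<psi> x)"
    by (rule supp_mult_integrable[OF _ \<eta>(2) _ Wl L2(1)]) (auto intro!: elementary.mult pd_elem scut_elem \<eta>)
   have i2: "integrable (leb W) (\<lambda>x. (?c x * pd i \<eta> x) *\<^sub>R \<psi> x)"
    by (rule supp_mult_integrable[OF _ \<eta>(2) _ Wl L2(1)]) (use pK in \<open>auto intro!: elementary.mult pd_elem scut_elem \<eta>\<close>)
   have i3: "integrable (leb W) (\<lambda>x. (?c x * \<eta> x) *\<^sub>R \<psi>' x)"
    by (rule supp_mult_integrable[OF _ \<eta>(2) _ Wl L2(2)]) (auto intro!: elementary.mult pd_elem scut_elem \<eta>)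
   have "(\<integral>x. (pd i ?c x * \<eta> x) *\<^sub>R \<psi> x \<partial>leb W) + (\<integral>x. (?c x * pd i \<eta> x) *\<^sub>R \<psi> x \<partial>leb W)
     = - (\<integral>x. (?c x * \<eta> x) *\<^sub>R \<psi>' x \<partial>leb W)"
    using has_weak_derivD(3)[OF wd t] unfolding pm scaleR_add_left using i1 i2 by simp
   moreover have "(\<integral>x. ?c x *\<^sub>R h x \<partial>leb W) = (\<integral>x. (?c x * pd i \<eta> x) *\<^sub>R \<psi> x \<partial>leb W) + (\<integral>x. (?c x * \<eta> x) *\<^sub>R \<psi>' x \<partial>leb W)"
    unfolding h_def scaleR_add_right scaleR_scaleR using i2 i3 by simp
   ultimately have e: "(\<integral>x. ?c x *\<^sub>R h x \<partial>leb W) = - (\<integral>x. (pd i ?c x * \<eta> x) *\<^sub>R \<psi> x \<partial>leb W)"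
    by (simp add: algebra_simps eq_neg_iff_add_eq_0)
   have "norm (\<integral>x. (pd i ?c x * \<eta> x) *\<^sub>R \<psi> x \<partial>leb W) \<le> (\<integral>x. norm ((pd i ?c x * \<eta> x) *\<^sub>R \<psi> x) \<partial>leb W)"
    by (rule integral_norm_bound)
   also have "\<dots> \<le> (\<integral>x. D * B * \<kappa> * indicator Sh x \<partial>leb W)"
   proof (rule integral_mono)
    have "integrable lebesgue (indicator Sh :: _ \<Rightarrow> real)" using D(2) by (intro integrable_real_indicator) (auto simp: fmeasurable_def)
    then have "integrable (leb W) (indicator Sh :: _ \<Rightarrow> real)"
     unfolding lebesgue_on_indicator(2)[OF Wl] by (rule integrable_mult_indicator[OF Wl])
    then show "integrable (leb W) (\<lambda>x. D * B * \<kappa> * indicator Sh x)" by simp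
    show "integrable (leb W) (\<lambda>x. norm ((pd i ?c x * \<eta> x) *\<^sub>R \<psi> x))" using i1 by (rule integrable_norm)
    fix x assume "x \<in> space (leb W)"
    then have xW: "x \<in> W" by simp
    have "\<bar>\<eta> x\<bar> * norm (\<psi> x) \<le> B * \<kappa>"
    proof (cases "x \<in> K")
     case True then show ?thesis using B \<kappa> xW by (intro mult_mono) auto
    next
     case False then have "\<eta> x = 0" using \<eta>(3) by blast
     then show ?thesis using B \<kappa> by simp
    qed
    then have "\<bar>pd i ?c x\<bar> * (\<bar>\<eta> x\<bar> * norm (\<psi> x)) \<le> (D * indicator Sh x) * (B * \<kappa>)"
     using D(3)[of x] D(1) by - (rule mult_mono, auto)
    then show "norm ((pd i ?c x * \<eta> x) *\<^sub>R \<psi> x) \<le> D * B * \<kappa> * indicator Sh x"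
     by (simp add: abs_mult mult_ac)
   qed
   also have "\<dots> = D * B * \<kappa> * (\<integral>x. indicator W x * indicator Sh x \<partial>lebesgue)"
    using lebesgue_on_indicator(1)[OF Wl, of "\<lambda>x. indicator Sh x :: real"] by simp
   also have "(\<integral>x. indicator W x * indicator Sh x \<partial>lebesgue) = measure lebesgue (W \<inter> Sh)"
    by (simp flip: indicator_inter_arith)
   also have "D * B * \<kappa> * measure lebesgue (W \<inter> Sh) \<le> D * B * \<kappa> * measure lebesgue Sh"
    using D B \<kappa> Wl by (intro mult_left_mono measure_mono_fmeasurable) (auto simp: fmeasurableD)
   also have "\<dots> = (D * measure lebesgue Sh) * (B * \<kappa>)" by simp
   also have "\<dots> \<le> C * (B * \<kappa>)" using D(4) B \<kappa> by (intro mult_right_mono) auto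
   finally show ?thesis unfolding e by simp
  qed
  have lim: "(\<lambda>n. \<integral>x. scut a r s (\<epsilon> n) x *\<^sub>R h x \<partial>leb W) \<longlonglongrightarrow> (\<integral>x. h x \<partial>leb W)"
  proof (rule integral_dominated_convergence[where w="\<lambda>x. norm (h x)"])
   show "integrable (leb W) (\<lambda>x. norm (h x))" using hi by (rule integrable_norm)
   show "h \<in> borel_measurable (leb W)" using hi by auto
   show "(\<lambda>x. scut a r s (\<epsilon> n) x *\<^sub>R h x) \<in> borel_measurable (leb W)" for n
    using hi elem_UNIV_lebesgue_on[OF scut_elem] by (intro borel_measurable_scaleR) auto
   show "AE x in leb W. norm (scut a r s (\<epsilon> n) x *\<^sub>R h x) \<le> norm (h x)" for n
    using scut_bounds[of a r s "\<epsilon> n"] by (intro AE_I2) (auto intro!: mult_left_le_one_le)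
   show "AE x in leb W. (\<lambda>n. scut a r s (\<epsilon> n) x *\<^sub>R h x) \<longlonglongrightarrow> h x"
   proof (rule AE_I2)
    fix x assume "x \<in> space (leb W)"
    then have "x \<in> W" by simp
    then have "s * ((norm (x - a))^2 - r^2) > 0" using W(2)[of x] side_square[OF r s, of x a] by blast
    then have "\<forall>\<^sub>F n in sequentially. \<epsilon> n < s * ((norm (x - a))^2 - r^2) / 2"
     using \<epsilon>0 by (intro order_tendstoD(2)) auto
    then have "\<forall>\<^sub>F n in sequentially. scut a r s (\<epsilon> n) x *\<^sub>R h x = h x"
    proof eventually_elim
     case (elim n)
     then have "s * ((norm (x - a))^2 - r^2) / \<epsilon> n \<ge> 2" using \<epsilon>(1)[of n] by (simp add: field_simps)
     then show ?case by (simp add: scut_def step_1)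
    qed
    then show "(\<lambda>n. scut a r s (\<epsilon> n) x *\<^sub>R h x) \<longlonglongrightarrow> h x" by (rule tendsto_eventually)
   qed
  qed
  have "norm (\<integral>x. h x \<partial>leb W) \<le> C * B * \<kappa>"
   by (rule LIMSEQ_le_const2[OF tendsto_norm[OF lim]]) (use bd in auto)
  then show "norm (\<integral>x. pd i \<eta> x *\<^sub>R \<psi> x + \<eta> x *\<^sub>R \<psi>' x \<partial>leb W) \<le> C * B * \<kappa>"
   by (simp add: h_def)
 qed
qed

text \<open>For smooth functions the interior side is the divergence theorem on the ball; the
  exterior side is its negative, since the derivative of a compactly supported function has total
  integral 0.\<close>

lemma side_ibp_elem:
 fixes a :: "real^'n"
 assumes r: "r > 0" and s: "s = 1 \<or> s = (-1::real)"
  and W: "open W" "\<And>x. x \<in> W \<Longrightarrow> s * (norm (x - a) - r) > 0"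
  and \<eta>: "elem \<eta>" "compact K" "\<And>x. \<eta> x \<noteq> 0 \<Longrightarrow> x \<in> K"
  and KW: "\<And>x. x \<in> K \<Longrightarrow> s * (norm (x - a) - r) > 0 \<Longrightarrow> x \<in> W"
  and P: "elem P"
 shows "(\<integral>x. pd i \<eta> x * P x + \<eta> x * pd i P x \<partial>leb W) =
   - s * (\<integral>t. ((t $ i - a $ i) / r * \<eta> t) * P t \<partial>sphere_measure a r)"
proof -
 define F where "F = (\<lambda>x. \<eta> x * P x)"
 have F: "elem F" unfolding F_def by (intro elementary.mult \<eta> P)
 have FK: "x \<in> K" if "F x \<noteq> 0" for x using that \<eta>(3) by (auto simp: F_def)
 have pF: "pd i F x = pd i \<eta> x * P x + \<eta> x * pd i P x" for x
  unfolding F_def by (rule part_deriv_mult) (intro elem_UNIV_differentiable \<eta> P)+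
 have pK: "x \<in> K" if "pd i F x \<noteq> 0" for x
  using supp_part_deriv[OF compact_imp_closed[OF \<eta>(2)] FK] that by blast
 obtain R where R: "\<And>x. norm x > R \<Longrightarrow> x \<notin> K" using compact_norm_bound[OF \<eta>(2)] by blast
 have FR: "F x = 0" if "norm x > R" for x using R[OF that] FK by blast
 note tot = integral_part_deriv_zero[OF elem_UNIV_differentiable[OF F] elem_UNIV_continuous[OF pd_elem[OF F]] FR, where i=i]
 have ball: "(\<integral>x. indicator (ball a r) x *\<^sub>R pd i F x \<partial>lebesgue) = (\<integral>t. (t $ i - a $ i) / r * F t \<partial>sphere_measure a r)"
  using divergence_ball[OF r F, where i=i and a=a] by (subst lebesgue_on_indicator(1)[symmetric]) auto
 have ibi: "integrable lebesgue (\<lambda>x. indicator (ball a r) x *\<^sub>R pd i F x)"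
  by (rule integrable_mult_indicator[OF _ tot(1)]) auto
 have "(\<integral>x. pd i F x \<partial>leb W) = (\<integral>x. indicator W x *\<^sub>R pd i F x \<partial>lebesgue)"
  by (rule lebesgue_on_indicator(1)[OF open_lebesgue[OF W(1)]])
 also have "\<dots> = - s * (\<integral>x. indicator (ball a r) x *\<^sub>R pd i F x \<partial>lebesgue)"
 proof (cases "s = 1")
  case True
  have "AE x in lebesgue. x \<notin> sphere a r" using negligible_sphere unfolding negligible_iff_null_sets by (rule AE_not_in)
  then have "AE x in lebesgue. indicator W x *\<^sub>R pd i F x = pd i F x - indicator (ball a r) x *\<^sub>R pd i F x"
  proof eventually_elim
   case (elim x)
   show ?case
   proof (cases "pd i F x = 0")
    case False
    then have "x \<in> K" by (rule pK)
    then show ?thesis using KW[of x] W(2)[of x] elim True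
     by (cases "x \<in> W") (auto simp: indicator_def dist_norm norm_minus_commute)
   qed simp
  qed
  then have "(\<integral>x. indicator W x *\<^sub>R pd i F x \<partial>lebesgue) = (\<integral>x. pd i F x - indicator (ball a r) x *\<^sub>R pd i F x \<partial>lebesgue)"
   using integrable_mult_indicator[OF open_lebesgue[OF W(1)] tot(1)] tot(1) ibi
   by (intro integral_cong_AE) auto
  also have "\<dots> = - (\<integral>x. indicator (ball a r) x *\<^sub>R pd i F x \<partial>lebesgue)"
   using tot ibi by (subst bochner_diff) auto
  finally show ?thesis using True by simp
 next
  case False
  with s have s1: "s = -1" by simp
  have "indicator W x *\<^sub>R pd i F x = indicator (ball a r) x *\<^sub>R pd i F x" for x
  proof (cases "pd i F x = 0")
   case False
   then have "x \<in> K" by (rule pK)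
   then show ?thesis using KW[of x] W(2)[of x] s1
    by (cases "x \<in> W") (auto simp: indicator_def dist_norm norm_minus_commute)
  qed simp
  from ext[OF this] have e: "(\<lambda>x. indicator W x *\<^sub>R pd i F x) = (\<lambda>x. indicator (ball a r) x *\<^sub>R pd i F x)" .
  show ?thesis unfolding e using s1 by simp
 qed
 finally have "(\<integral>x. pd i F x \<partial>leb W) = - s * (\<integral>t. (t $ i - a $ i) / r * F t \<partial>sphere_measure a r)"
  unfolding ball .
 then show ?thesis unfolding pF by (simp add: F_def mult.assoc)
qed

lemma L2_bounded_cx:
 fixes W :: "(real^'n) set"
 assumes "bounded W" "open W" "elem p" "elem q"
 shows "cx p q \<in> L2 (leb W)"
proof -
 obtain r where "W \<subseteq> ball 0 r" using bounded_subset_ballD[OF assms(1)] by blast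
 then show ?thesis by (intro L2_subset[OF _ _ _ L2_ball_cx[OF assms(3,4)]] open_lebesgue assms) auto
qed

lemma integral_cx:
 assumes "integrable M f" "integrable M g"
 shows "(\<integral>x. complex_of_real (f x) + \<i> * complex_of_real (g x) \<partial>M) = complex_of_real (\<integral>x. f x \<partial>M) + \<i> * complex_of_real (\<integral>x. g x \<partial>M)"
 using assms by simp

lemma bounded_open_lmeasurable: "bounded W \<Longrightarrow> open W \<Longrightarrow> W \<in> lmeasurable"
 by (rule lmeasurable_open)

text \<open>Both sides are controlled by the supremum of \<open>|\<phi>|\<close> on the support of \<open>\<eta>\<close>, so \<open>\<phi>\<close> may be
 replaced by a polynomial.\<close>

lemma trace_ibp:
 fixes \<phi> \<phi>' :: "real^'n \<Rightarrow> complex"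
 assumes r: "r > 0" and s: "s = 1 \<or> s = (-1::real)"
  and W: "open W" "\<And>x. x \<in> W \<Longrightarrow> s * (norm (x - a) - r) > 0" and bW: "bounded W"
  and \<eta>: "elem \<eta>" "compact K" "\<And>x. \<eta> x \<noteq> 0 \<Longrightarrow> x \<in> K"
  and KW: "\<And>x. x \<in> K \<Longrightarrow> s * (norm (x - a) - r) > 0 \<Longrightarrow> x \<in> W"
  and S: "sphere a r \<subseteq> closure W"
  and \<phi>: "\<phi> \<in> L2 (leb W)" "\<phi>' \<in> L2 (leb W)" "has_weak_deriv W i \<phi> \<phi>'" "continuous_on (closure W) \<phi>"
 shows "(\<integral>x. pd i \<eta> x *\<^sub>R \<phi> x + \<eta> x *\<^sub>R \<phi>' x \<partial>leb W) =
   - (s *\<^sub>R (\<integral>t. ((t $ i - a $ i) / r * \<eta> t) *\<^sub>R \<phi> t \<partial>sphere_measure a r))"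
proof -
 let ?M = "leb W" and ?S = "sphere_measure a r"
 obtain C where C: "C \<ge> 0" "\<And>(\<psi>::real^'n \<Rightarrow> complex) \<psi>' \<kappa>. \<psi> \<in> L2 ?M \<Longrightarrow> \<psi>' \<in> L2 ?M \<Longrightarrow> has_weak_deriv W i \<psi> \<psi>' \<Longrightarrow>
  \<kappa> \<ge> 0 \<Longrightarrow> (\<And>x. x \<in> W \<Longrightarrow> x \<in> K \<Longrightarrow> norm (\<psi> x) \<le> \<kappa>) \<Longrightarrow>
  norm (\<integral>x. pd i \<eta> x *\<^sub>R \<psi> x + \<eta> x *\<^sub>R \<psi>' x \<partial>?M) \<le> C * \<kappa>"
  using trace_ibp_bound[OF r s W \<eta> KW, of i] by blast
 obtain B where B: "B \<ge> 0" "\<And>x. \<bar>\<eta> x\<bar> \<le> B" using elem_compact_bounded[OF \<eta>] by blast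
 define \<sigma> where "\<sigma> = measure ?S (space ?S)"
 define \<nu> where "\<nu> t = (t $ i - a $ i) / r * \<eta> t" for t
 have \<nu>e: "elem \<nu>" unfolding \<nu>_def[abs_def]
  by (intro elementary.mult \<eta> elem_divide elem_diff elementary.coord elementary.const)
 have \<nu>b: "\<bar>\<nu> t\<bar> \<le> B" if "t \<in> sphere a r" for t
 proof -
  have "norm (t - a) = r" using that by (simp add: dist_norm norm_minus_commute)
  then have "\<bar>(t $ i - a $ i) / r\<bar> \<le> 1" using component_le_norm_cart[of "t - a" i] r by simp
  then have "\<bar>(t $ i - a $ i) / r\<bar> * \<bar>\<eta> t\<bar> \<le> 1 * B" using B by (intro mult_mono) auto
  then show ?thesis by (simp add: \<nu>_def abs_mult)
 qed
 have pK: "x \<in> K" if "pd i \<eta> x \<noteq> 0" for x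
  using supp_part_deriv[OF compact_imp_closed[OF \<eta>(2)] \<eta>(3)] that by blast
 note Wl = open_lebesgue[OF W(1)]
 have int: "integrable ?M (\<lambda>x. pd i \<eta> x *\<^sub>R \<psi> x + \<eta> x *\<^sub>R \<psi>' x)" if "\<psi> \<in> L2 ?M" "\<psi>' \<in> L2 ?M" for \<psi> \<psi>' :: "real^'n \<Rightarrow> complex"
  by (rule Bochner_Integration.integrable_add[OF supp_mult_integrable[OF pd_elem[OF \<eta>(1)] \<eta>(2) pK Wl that(1)]
      supp_mult_integrable[OF \<eta> Wl that(2)]])
 have \<phi>S: "continuous_on (sphere a r) \<phi>" using \<phi>(4) S by (rule continuous_on_subset)
 have iS: "integrable ?S (\<lambda>t. \<nu> t *\<^sub>R \<psi> t)" if "continuous_on (sphere a r) \<psi>" for \<psi> :: "real^'n \<Rightarrow> complex"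
  using that by (intro sphere_integrable_continuous[OF r] continuous_intros elem_UNIV_continuous[OF \<nu>e])
 define I where "I = (\<integral>x. pd i \<eta> x *\<^sub>R \<phi> x + \<eta> x *\<^sub>R \<phi>' x \<partial>?M)"
 define J where "J = (\<integral>t. \<nu> t *\<^sub>R \<phi> t \<partial>?S)"
 have est: "norm (I + s *\<^sub>R J) \<le> 2 * (C + B * \<sigma>) * \<kappa>" if \<kappa>: "\<kappa> > 0" for \<kappa>
 proof -
  \<comment> \<open>Only the part of \<open>K\<close> on the selected side and the sphere itself
    matter. This compact set lies in the closure of \<open>W\<close>, where \<phi> is continuous, so
    Stone-Weierstrass applies to its real and imaginary parts.\<close>
  define K' where "K' = (K \<inter> {x. s * (norm (x - a) - r) \<ge> 0}) \<union> sphere a r"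
  have "closed {x. s * (norm (x - a) - r) \<ge> 0}" by (intro closed_Collect_le continuous_intros)
  then have K'c: "compact K'" unfolding K'_def using \<eta>(2) by (intro compact_Un compact_Int_closed) auto
  have "K' \<subseteq> closure W"
  proof
   fix x assume x: "x \<in> K'"
   show "x \<in> closure W"
   proof (cases "x \<in> sphere a r")
    case True then show ?thesis using S by blast
   next
    case False
    then have "x \<in> K" "s * (norm (x - a) - r) \<ge> 0" "norm (x - a) \<noteq> r"
     using x by (auto simp: K'_def dist_norm norm_minus_commute)
    then have "s * (norm (x - a) - r) > 0" using s by auto
    then show ?thesis using KW[OF \<open>x \<in> K\<close>] closure_subset by blast
   qed
  qed
  then have cK: "continuous_on K' \<phi>" using \<phi>(4) continuous_on_subset by blast
  obtain p where p: "rpoly p" "\<And>x. x \<in> K' \<Longrightarrow> \<bar>Re (\<phi> x) - p x\<bar> < \<kappa>"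
   by (rule Stone_Weierstrass_real_polynomial_function[OF K'c continuous_on_Re[OF cK] \<kappa>]) blast
  obtain q where q: "rpoly q" "\<And>x. x \<in> K' \<Longrightarrow> \<bar>Im (\<phi> x) - q x\<bar> < \<kappa>"
   by (rule Stone_Weierstrass_real_polynomial_function[OF K'c continuous_on_Im[OF cK] \<kappa>]) blast
  note pe = poly_elem[OF p(1), of UNIV] and qe = poly_elem[OF q(1), of UNIV]
  have close: "norm (\<phi> x - cx p q x) \<le> 2 * \<kappa>" if "x \<in> K'" for x
  proof -
   have "norm (\<phi> x - cx p q x) \<le> \<bar>Re (\<phi> x - cx p q x)\<bar> + \<bar>Im (\<phi> x - cx p q x)\<bar>" by (rule cmod_le)
   then show ?thesis using p(2)[OF that] q(2)[OF that] by simp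
  qed
  define c' where "c' = cx (pd i p) (pd i q)"
  have cL: "cx p q \<in> L2 ?M" "c' \<in> L2 ?M"
   unfolding c'_def by (intro L2_bounded_cx[OF bW W(1)] pe qe pd_elem)+
  have wd: "has_weak_deriv W i (cx p q) c'"
   unfolding c'_def by (rule has_weak_deriv_cx[OF W(1) poly_elem[OF p(1)] poly_elem[OF q(1)]])
  have 1: "norm (\<integral>x. pd i \<eta> x *\<^sub>R (\<phi> x - cx p q x) + \<eta> x *\<^sub>R (\<phi>' x - c' x) \<partial>?M) \<le> C * (2 * \<kappa>)"
  proof (rule C(2)[OF L2_diff[OF \<phi>(1) cL(1)] L2_diff[OF \<phi>(2) cL(2)] has_weak_deriv_diff[OF W(1) \<phi>(3) wd]])
   fix x assume "x \<in> W" "x \<in> K"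
   then have "x \<in> K'" using W(2)[of x] by (auto simp: K'_def)
   then show "norm (\<phi> x - cx p q x) \<le> 2 * \<kappa>" by (rule close)
  qed (use \<kappa> in auto)
  have 2: "(\<integral>x. pd i \<eta> x *\<^sub>R (\<phi> x - cx p q x) + \<eta> x *\<^sub>R (\<phi>' x - c' x) \<partial>?M) =
    I - (\<integral>x. pd i \<eta> x *\<^sub>R cx p q x + \<eta> x *\<^sub>R c' x \<partial>?M)"
   unfolding I_def by (subst bochner_diff[symmetric, OF int[OF \<phi>(1,2)] int[OF cL]])
    (simp add: algebra_simps)
  have ir: "integrable ?M (\<lambda>x. pd i \<eta> x * P x + \<eta> x * pd i P x)" if "elem P" for P
  proof -
   obtain \<rho> where "W \<subseteq> ball 0 \<rho>" using bounded_subset_ballD[OF bW] by blast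
   moreover have "integrable (leb (ball 0 \<rho>)) (\<lambda>x. pd i \<eta> x * P x + \<eta> x * pd i P x)"
    by (intro elem_integrable_ball elementary.add elementary.mult pd_elem \<eta> that)
   ultimately show ?thesis by (intro lebesgue_on_integrable_subset[OF _ Wl]) auto
  qed
  have 3: "(\<integral>x. pd i \<eta> x *\<^sub>R cx p q x + \<eta> x *\<^sub>R c' x \<partial>?M) = - (s *\<^sub>R (\<integral>t. \<nu> t *\<^sub>R cx p q t \<partial>?S))"
  proof -
   have "(\<integral>x. pd i \<eta> x *\<^sub>R cx p q x + \<eta> x *\<^sub>R c' x \<partial>?M) =
    (\<integral>x. complex_of_real (pd i \<eta> x * p x + \<eta> x * pd i p x) + \<i> * complex_of_real (pd i \<eta> x * q x + \<eta> x * pd i q x) \<partial>?M)"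
    by (intro bochner_cong refl) (simp add: c'_def scaleR_conv_of_real algebra_simps)
   also have "\<dots> = complex_of_real (- s * (\<integral>t. \<nu> t * p t \<partial>?S)) + \<i> * complex_of_real (- s * (\<integral>t. \<nu> t * q t \<partial>?S))"
   proof -
    have "(\<integral>x. pd i \<eta> x * P x + \<eta> x * pd i P x \<partial>?M) = - s * (\<integral>t. \<nu> t * P t \<partial>?S)"
     if "elem P" for P
     unfolding \<nu>_def by (rule side_ibp_elem[OF r s W \<eta> KW that])
    from this[OF pe] this[OF qe] show ?thesis unfolding integral_cx[OF ir[OF pe] ir[OF qe]] by simp
   qed
   also have "\<dots> = - (s *\<^sub>R (complex_of_real (\<integral>t. \<nu> t * p t \<partial>?S) + \<i> * complex_of_real (\<integral>t. \<nu> t * q t \<partial>?S)))"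
    by (simp add: scaleR_conv_of_real algebra_simps)
   also have "complex_of_real (\<integral>t. \<nu> t * p t \<partial>?S) + \<i> * complex_of_real (\<integral>t. \<nu> t * q t \<partial>?S) =
    (\<integral>t. complex_of_real (\<nu> t * p t) + \<i> * complex_of_real (\<nu> t * q t) \<partial>?S)"
    by (intro integral_cx[symmetric] sphere_integrable_continuous[OF r] elem_UNIV_continuous elementary.mult \<nu>e pe qe)
   also have "\<dots> = (\<integral>t. \<nu> t *\<^sub>R cx p q t \<partial>?S)"
    by (intro bochner_cong refl) (simp add: scaleR_conv_of_real algebra_simps)
   finally show ?thesis .
  qed
  have cS: "continuous_on (sphere a r) (cx p q)"
   by (intro continuous_intros elem_UNIV_continuous pe qe)
  have 4: "norm (J - (\<integral>t. \<nu> t *\<^sub>R cx p q t \<partial>?S)) \<le> B * (2 * \<kappa>) * \<sigma>"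
  proof -
   interpret finite_measure ?S by (rule finite_sphere_measure[OF r])
   have "J - (\<integral>t. \<nu> t *\<^sub>R cx p q t \<partial>?S) = (\<integral>t. \<nu> t *\<^sub>R (\<phi> t - cx p q t) \<partial>?S)"
    unfolding J_def by (subst bochner_diff[symmetric, OF iS[OF \<phi>S] iS[OF cS]])
     (simp add: scaleR_diff_right)
   also have "norm \<dots> \<le> (\<integral>t. norm (\<nu> t *\<^sub>R (\<phi> t - cx p q t)) \<partial>?S)" by (rule integral_norm_bound)
   also have "\<dots> \<le> (\<integral>t. B * (2 * \<kappa>) \<partial>?S)"
   proof (rule integral_mono)
    show "integrable ?S (\<lambda>t. norm (\<nu> t *\<^sub>R (\<phi> t - cx p q t)))"
     by (intro integrable_norm iS continuous_on_diff \<phi>S cS)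
    fix t assume "t \<in> space ?S"
    then have t: "t \<in> sphere a r" by (simp add: sphere_measure_space)
    then have "t \<in> K'" by (simp add: K'_def)
    then have "\<bar>\<nu> t\<bar> * norm (\<phi> t - cx p q t) \<le> B * (2 * \<kappa>)"
     using \<nu>b[OF t] close[of t] B by (intro mult_mono) auto
    then show "norm (\<nu> t *\<^sub>R (\<phi> t - cx p q t)) \<le> B * (2 * \<kappa>)" by simp
   qed simp
   also have "\<dots> = B * (2 * \<kappa>) * \<sigma>" by (simp add: \<sigma>_def)
   finally show ?thesis .
  qed
  have "I + s *\<^sub>R J = (I - (\<integral>x. pd i \<eta> x *\<^sub>R cx p q x + \<eta> x *\<^sub>R c' x \<partial>?M)) + s *\<^sub>R (J - (\<integral>t. \<nu> t *\<^sub>R cx p q t \<partial>?S))"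
   unfolding 3 by (simp add: algebra_simps)
  also have "norm \<dots> \<le> norm (I - (\<integral>x. pd i \<eta> x *\<^sub>R cx p q x + \<eta> x *\<^sub>R c' x \<partial>?M)) + norm (s *\<^sub>R (J - (\<integral>t. \<nu> t *\<^sub>R cx p q t \<partial>?S)))"
   by (rule norm_triangle_ineq)
  also have "norm (s *\<^sub>R (J - (\<integral>t. \<nu> t *\<^sub>R cx p q t \<partial>?S))) = norm (J - (\<integral>t. \<nu> t *\<^sub>R cx p q t \<partial>?S))"
   using s by auto
  also have "norm (I - (\<integral>x. pd i \<eta> x *\<^sub>R cx p q x + \<eta> x *\<^sub>R c' x \<partial>?M)) + norm (J - (\<integral>t. \<nu> t *\<^sub>R cx p q t \<partial>?S)) \<le> C * (2 * \<kappa>) + B * (2 * \<kappa>) * \<sigma>"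
   using 1 2 4 by (intro add_mono) auto
  also have "\<dots> = 2 * (C + B * \<sigma>) * \<kappa>" by (simp add: algebra_simps)
  finally show ?thesis .
 qed
 have "norm (I + s *\<^sub>R J) = 0"
 proof (rule ccontr)
  assume n: "norm (I + s *\<^sub>R J) \<noteq> 0"
  define A where "A = 2 * (C + B * \<sigma>)"
  have A: "A \<ge> 0" using C(1) B(1) by (simp add: A_def \<sigma>_def)
  have np: "norm (I + s *\<^sub>R J) > 0" using n by auto
  define \<kappa> where "\<kappa> = norm (I + s *\<^sub>R J) / (2 * (A + 1))"
  have "\<kappa> > 0" using np A by (simp add: \<kappa>_def)
  from est[OF this] have "norm (I + s *\<^sub>R J) \<le> A * \<kappa>" by (simp add: A_def)
  also have "\<dots> \<le> (A + 1) * \<kappa>" using \<open>\<kappa> > 0\<close> by (simp add: algebra_simps)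
  also have "\<dots> = norm (I + s *\<^sub>R J) / 2" using A by (simp add: \<kappa>_def field_simps)
  finally show False using np by simp
 qed
 then show ?thesis by (simp add: I_def J_def \<nu>_def eq_neg_iff_add_eq_0)
qed

section \<open>Limits in the first-order Sobolev norm and properties of traces\<close>

lemma W21_norm_sq:
 "(W21_norm U h)^2 = (\<integral>x. (norm (h x))^2 \<partial>leb U) + (\<Sum>i\<in>UNIV. \<integral>x. (norm (weak_deriv U i h x))^2 \<partial>leb U)"
 unfolding W21_norm_def L2_norm_def by (simp add: sum_nonneg)

lemma W21_norm_tendsto_iff:
 "(\<lambda>n. W21_norm U (h n)) \<longlonglongrightarrow> 0 \<longleftrightarrow>
  (\<lambda>n. \<integral>x. (norm (h n x))^2 \<partial>leb U) \<longlonglongrightarrow> 0 \<and>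
  (\<forall>i. (\<lambda>n. \<integral>x. (norm (weak_deriv U i (h n) x))^2 \<partial>leb U) \<longlonglongrightarrow> 0)" (is "?l \<longleftrightarrow> ?a \<and> (\<forall>i. ?b i)")
proof
 assume l: ?l
 have sq: "(\<lambda>n. (W21_norm U (h n))^2) \<longlonglongrightarrow> 0" using tendsto_power[OF l, of 2] by simp
 have ?a
  by (rule Lim_null_comparison[OF _ sq]) (auto simp: W21_norm_sq sum_nonneg)
 moreover have "?b i" for i
 proof (rule Lim_null_comparison[OF _ sq], intro always_eventually allI)
  fix n
  have "(\<integral>x. (norm (weak_deriv U i (h n) x))^2 \<partial>leb U) \<le> (\<Sum>i\<in>UNIV. \<integral>x. (norm (weak_deriv U i (h n) x))^2 \<partial>leb U)"
   by (rule member_le_sum) auto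
  moreover have "(\<integral>x. (norm (h n x))^2 \<partial>leb U) \<ge> 0" by simp
  ultimately show "norm (\<integral>x. (norm (weak_deriv U i (h n) x))^2 \<partial>leb U) \<le> (W21_norm U (h n))^2"
   unfolding W21_norm_sq by (simp add: add_increasing)
 qed
 ultimately show "?a \<and> (\<forall>i. ?b i)" by blast
next
 assume r: "?a \<and> (\<forall>i. ?b i)"
 then have "(\<lambda>n. (W21_norm U (h n))^2) \<longlonglongrightarrow> 0 + (\<Sum>i\<in>(UNIV::'a set). 0)"
  unfolding W21_norm_sq by (intro tendsto_add tendsto_sum) auto
 then have "(\<lambda>n. sqrt ((W21_norm U (h n))^2)) \<longlonglongrightarrow> sqrt 0" by (intro tendsto_real_sqrt) simp
 moreover have "W21_norm U (h n) \<ge> 0" for n unfolding W21_norm_def L2_norm_def by (simp add: sum_nonneg)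
 ultimately show ?l by simp
qed

lemma L2_norm_tendsto_iff: "(\<lambda>n. L2_norm M (h n)) \<longlonglongrightarrow> 0 \<longleftrightarrow> (\<lambda>n. \<integral>x. (norm (h n x))^2 \<partial>M) \<longlonglongrightarrow> 0"
proof
 assume "(\<lambda>n. L2_norm M (h n)) \<longlonglongrightarrow> 0"
 from tendsto_power[OF this, of 2] show "(\<lambda>n. \<integral>x. (norm (h n x))^2 \<partial>M) \<longlonglongrightarrow> 0"
  by (simp add: L2_norm_def)
next
 assume "(\<lambda>n. \<integral>x. (norm (h n x))^2 \<partial>M) \<longlonglongrightarrow> 0"
 from tendsto_real_sqrt[OF this] show "(\<lambda>n. L2_norm M (h n)) \<longlonglongrightarrow> 0"
  by (simp add: L2_norm_def)
qed

lemma W21D: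
 assumes "u \<in> W2 1 U" "open U"
 shows "u \<in> L2 (leb U)" "has_weak_deriv U i u (weak_deriv U i u)" "weak_deriv U i u \<in> L2 (leb U)"
proof -
 have u: "u \<in> L2 (leb U)" "\<exists>v\<in>L2 (leb U). has_weak_deriv U i u v"
  using assms(1) by (simp_all add: eval_nat_numeral)
 then obtain v where v: "v \<in> L2 (leb U)" "has_weak_deriv U i u v" by blast
 show "u \<in> L2 (leb U)" by (rule u)
 show "has_weak_deriv U i u (weak_deriv U i u)" by (rule has_weak_deriv_weak_deriv[OF v(2)])
 have "AE x in leb U. v x = weak_deriv U i u x"
  using weak_deriv_AE[OF assms(2) v(2)] by (auto elim: eventually_mono)
 then show "weak_deriv U i u \<in> L2 (leb U)"
  by (rule L2_cong_AE[OF open_lebesgue[OF assms(2)] v(1)])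
qed

lemma W21I:
 assumes "u \<in> L2 (leb U)" "\<And>i. has_weak_deriv U i u (v i)" "\<And>i. v i \<in> L2 (leb U)"
 shows "u \<in> W2 1 U"
 using assms by (auto simp: eval_nat_numeral)

lemma L2_integral_mono_set:
 assumes "S \<in> sets lebesgue" "T \<in> sets lebesgue" "T \<subseteq> S" "f \<in> L2 (leb S)"
 shows "(\<integral>x. (norm (f x))^2 \<partial>leb T) \<le> (\<integral>x. (norm (f x))^2 \<partial>leb S)"
 unfolding lebesgue_on_indicator(1)[OF assms(1)] lebesgue_on_indicator(1)[OF assms(2)]
proof (rule integral_mono)
 show "integrable lebesgue (\<lambda>x. indicator T x *\<^sub>R (norm (f x))^2)" "integrable lebesgue (\<lambda>x. indicator S x *\<^sub>R (norm (f x))^2)"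
  using L2D(2)[OF assms(4)] L2D(2)[OF L2_subset[OF assms]] assms(1,2) by (simp_all add: lebesgue_on_indicator)
 show "indicator T x *\<^sub>R (norm (f x))^2 \<le> indicator S x *\<^sub>R (norm (f x))^2" for x
  using assms(3) by (auto simp: indicator_def)
qed

lemma integral_norm_cong_AE:
 assumes U: "open U" and f: "f \<in> L2 (leb U)" and ae: "AE x in leb U. f x = g x"
 shows "(\<integral>x. (norm (f x))^2 \<partial>leb U) = (\<integral>x. (norm (g x :: complex))^2 \<partial>leb U)"
proof (rule integral_cong_AE)
 have g: "g \<in> L2 (leb U)" by (rule L2_cong_AE[OF open_lebesgue[OF U] f ae])
 show "(\<lambda>x. (norm (f x))^2) \<in> borel_measurable (leb U)" "(\<lambda>x. (norm (g x))^2) \<in> borel_measurable (leb U)"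
  using L2D(2)[OF f] L2D(2)[OF g] by auto
 show "AE x in leb U. (norm (f x))^2 = (norm (g x))^2" using ae by eventually_elim simp
qed

lemma W21_norm_tendsto_subset:
 assumes U: "open U" "open V" "V \<subseteq> U" and h: "\<And>n. h n \<in> W2 1 U" and l: "(\<lambda>n. W21_norm U (h n)) \<longlonglongrightarrow> 0"
 shows "(\<lambda>n. W21_norm V (h n)) \<longlonglongrightarrow> 0"
 unfolding W21_norm_tendsto_iff
proof (intro conjI allI)
 note l' = l[unfolded W21_norm_tendsto_iff]
 note hD = W21D[OF h U(1)]
 note m = L2_integral_mono_set[OF open_lebesgue[OF U(1)] open_lebesgue[OF U(2)] U(3)]
 show "(\<lambda>n. \<integral>x. (norm (h n x))^2 \<partial>leb V) \<longlonglongrightarrow> 0"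
  by (rule Lim_null_comparison[OF _ l'[THEN conjunct1]]) (use m[OF hD(1)] in auto)
 fix i
 have "(\<integral>x. (norm (weak_deriv V i (h n) x))^2 \<partial>leb V) = (\<integral>x. (norm (weak_deriv U i (h n) x))^2 \<partial>leb V)" for n
 proof (rule integral_norm_cong_AE[OF U(2), symmetric])
  show "weak_deriv U i (h n) \<in> L2 (leb V)"
   by (rule L2_subset[OF open_lebesgue[OF U(1)] open_lebesgue[OF U(2)] U(3) hD(3)])
  show "AE x in leb V. weak_deriv U i (h n) x = weak_deriv V i (h n) x"
  proof -
   have "AE x in leb V. weak_deriv V i (h n) x = weak_deriv U i (h n) x"
    by (rule weak_deriv_AE[OF U(2) has_weak_deriv_subset[OF U hD(2)]])
   then show ?thesis by eventually_elim simp
  qed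
 qed
 then show "(\<lambda>n. \<integral>x. (norm (weak_deriv V i (h n) x))^2 \<partial>leb V) \<longlonglongrightarrow> 0"
  using m[OF hD(3)] by (intro Lim_null_comparison[OF _ l'[THEN conjunct2, rule_format, of i]]) auto
qed

lemma has_trace_cong_AE:
 assumes U: "open U" and ae: "AE x in leb U. g x = g' x" and t: "has_trace U a r g T"
 shows "has_trace U a r g' T"
proof -
 obtain V \<phi> where V: "open V" "sphere a r \<subseteq> V" "g \<in> W2 1 (U \<inter> V)"
  and \<phi>: "\<And>n. \<phi> n \<in> W2 1 (U \<inter> V)" "\<And>n. continuous_on (closure (U \<inter> V)) (\<phi> n)"
  "(\<lambda>n. W21_norm (U \<inter> V) (\<lambda>x. \<phi> n x - g x)) \<longlonglongrightarrow> 0"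
  "(\<lambda>n. L2_norm (sphere_measure a r) (\<lambda>t. \<phi> n t - T t)) \<longlonglongrightarrow> 0"
  using t unfolding has_trace_def by blast
 have W: "open (U \<inter> V)" using U V by auto
 have aeW: "AE x in leb (U \<inter> V). g x = g' x"
  by (rule AE_lebesgue_on_subset[OF open_lebesgue[OF U] open_lebesgue[OF W] _ ae]) auto
 have "W21_norm (U \<inter> V) (\<lambda>x. \<phi> n x - g' x) = W21_norm (U \<inter> V) (\<lambda>x. \<phi> n x - g x)" for n
 proof -
  have d: "AE x in leb (U \<inter> V). \<phi> n x - g x = \<phi> n x - g' x" using aeW by eventually_elim simp
  have dL: "(\<lambda>x. \<phi> n x - g x) \<in> L2 (leb (U \<inter> V))"
   by (rule L2_diff[OF W21D(1)[OF \<phi>(1) W] W21D(1)[OF V(3) W]])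
  have "(W21_norm (U \<inter> V) (\<lambda>x. \<phi> n x - g' x))^2 = (W21_norm (U \<inter> V) (\<lambda>x. \<phi> n x - g x))^2"
   unfolding W21_norm_sq weak_deriv_cong_AE[OF W d] integral_norm_cong_AE[OF W dL d] ..
  then show ?thesis unfolding W21_norm_def by (simp add: sum_nonneg)
 qed
 then have "(\<lambda>n. W21_norm (U \<inter> V) (\<lambda>x. \<phi> n x - g' x)) \<longlonglongrightarrow> 0" using \<phi>(3) by simp
 moreover have "g' \<in> W2 1 (U \<inter> V)" by (rule W2_cong_AE[OF W aeW V(3)])
 ultimately show ?thesis using t V \<phi> unfolding has_trace_def by blast
qed

text \<open>The approximating sequence of \<open>g\<close> is shifted by the fixed function
  \<open>z\<close>. Only the neighbourhood \<open>V0\<close> of the sphere matters, so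
  \<open>z\<close> may be singular elsewhere, as the Green function is at its pole.\<close>

lemma has_trace_add_smooth:
 assumes U: "open U" and t: "has_trace U a r g T" and r: "r > 0"
  and V0: "open V0" "sphere a r \<subseteq> V0" and z: "z \<in> W2 1 (U \<inter> V0)" "continuous_on (closure (U \<inter> V0)) z"
 shows "has_trace U a r (\<lambda>x. g x + z x) (\<lambda>t. T t + z t)"
proof -
 obtain V \<phi> where V: "open V" "sphere a r \<subseteq> V" "g \<in> W2 1 (U \<inter> V)"
  and \<phi>: "\<And>n. \<phi> n \<in> W2 1 (U \<inter> V)" "\<And>n. continuous_on (closure (U \<inter> V)) (\<phi> n)"
  "(\<lambda>n. W21_norm (U \<inter> V) (\<lambda>x. \<phi> n x - g x)) \<longlonglongrightarrow> 0"
  "(\<lambda>n. L2_norm (sphere_measure a r) (\<lambda>t. \<phi> n t - T t)) \<longlonglongrightarrow> 0"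
  and fr: "sphere a r \<subseteq> frontier U" and T: "T \<in> L2 (sphere_measure a r)"
  using t unfolding has_trace_def by blast
 let ?V = "V \<inter> V0"
 have op: "open (U \<inter> V)" "open (U \<inter> V0)" "open (U \<inter> ?V)" using U V V0 by auto
 have sub: "U \<inter> ?V \<subseteq> U \<inter> V" "U \<inter> ?V \<subseteq> U \<inter> V0" by auto
 have cl: "closure (U \<inter> ?V) \<subseteq> closure (U \<inter> V)" "closure (U \<inter> ?V) \<subseteq> closure (U \<inter> V0)"
  using sub by (auto intro!: closure_mono)
 have S: "sphere a r \<subseteq> closure (U \<inter> V0)"
  using fr V0 open_Int_closure_subset[OF V0(1), of U] by (auto simp: frontier_def Int_commute)
 have zS: "continuous_on (sphere a r) z" using z(2) S by (rule continuous_on_subset)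
 have zL: "z \<in> L2 (sphere_measure a r)"
 proof -
  obtain B where "\<And>x. x \<in> sphere a r \<Longrightarrow> norm (z x) \<le> B" using continuous_sphere_bounded[OF zS] by blast
  then show ?thesis
   by (intro L2_bounded[OF finite_sphere_measure[OF r] continuous_sphere_measurable[OF zS], of B] AE_I2)
    (simp add: sphere_measure_space)
 qed
 note w2 = W2_subset[OF op(1,3) sub(1)]
 have zz: "z \<in> W2 1 (U \<inter> ?V)" by (rule W2_subset[OF op(2,3) sub(2) z(1)])
 have "(\<lambda>n. W21_norm (U \<inter> ?V) (\<lambda>x. \<phi> n x - g x)) \<longlonglongrightarrow> 0"
  by (rule W21_norm_tendsto_subset[OF op(1,3) sub(1) _ \<phi>(3)]) (intro W2_diff op \<phi> V)
 then have 1: "(\<lambda>n. W21_norm (U \<inter> ?V) (\<lambda>x. (\<phi> n x + z x) - (g x + z x))) \<longlonglongrightarrow> 0" by simp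
 have 2: "(\<lambda>n. L2_norm (sphere_measure a r) (\<lambda>t. (\<phi> n t + z t) - (T t + z t))) \<longlonglongrightarrow> 0" using \<phi>(4) by simp
 have 3: "(\<lambda>x. \<phi> n x + z x) \<in> W2 1 (U \<inter> ?V)" for n by (intro W2_add op w2 \<phi> zz)
 have 4: "continuous_on (closure (U \<inter> ?V)) (\<lambda>x. \<phi> n x + z x)" for n
  by (intro continuous_on_add continuous_on_subset[OF \<phi>(2) cl(1)] continuous_on_subset[OF z(2) cl(2)])
 have 5: "(\<lambda>x. g x + z x) \<in> W2 1 (U \<inter> ?V)" by (intro W2_add op w2 V zz)
 have 6: "(\<lambda>t. T t + z t) \<in> L2 (sphere_measure a r)" by (rule L2_add[OF T zL])
 have 7: "open ?V" "sphere a r \<subseteq> ?V" using V V0 by auto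
 show ?thesis
  unfolding has_trace_def
  by (intro conjI exI[of _ ?V] exI[of _ "\<lambda>n x. \<phi> n x + z x"] allI) (rule fr 1 2 3 4 5 6 7)+
qed

text \<open>The integrated form of the trace, obtained from \<open>trace_ibp\<close> by passing to
  the limit along the approximating continuous functions. It holds for every trace \<open>T\<close>,
  hence for whichever one \<open>sphere_trace\<close> selects. \<open>N'\<close> is where the
  approximation takes place, so the part of the support of \<eta> on the side of \<open>U\<close>
  has to lie there.\<close>

lemma has_trace_ibp:
 fixes g T :: "real^'n \<Rightarrow> complex"
 assumes U: "open U" "bounded U" "\<And>x. x \<in> U \<Longrightarrow> s * (norm (x - a) - r) > 0"
  and r: "r > 0" and s: "s = 1 \<or> s = (-1::real)" and t: "has_trace U a r g T"
  and N: "open N" "sphere a r \<subseteq> N" "\<And>x. x \<in> N \<Longrightarrow> s * (norm (x - a) - r) > 0 \<Longrightarrow> x \<in> U"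
 obtains N' where "open N'" "sphere a r \<subseteq> N'" "N' \<subseteq> N"
  "\<And>\<eta> K v i. elem \<eta> \<Longrightarrow> compact K \<Longrightarrow> (\<And>x. \<eta> x \<noteq> 0 \<Longrightarrow> x \<in> K) \<Longrightarrow>
   (\<And>x. x \<in> K \<Longrightarrow> s * (norm (x - a) - r) > 0 \<Longrightarrow> x \<in> N') \<Longrightarrow>
   has_weak_deriv (U \<inter> N') i g v \<Longrightarrow> v \<in> L2 (leb (U \<inter> N')) \<Longrightarrow>
   (\<integral>x. pd i \<eta> x *\<^sub>R g x + \<eta> x *\<^sub>R v x \<partial>leb (U \<inter> N')) =
   - (s *\<^sub>R (\<integral>t. ((t $ i - a $ i) / r * \<eta> t) *\<^sub>R T t \<partial>sphere_measure a r))"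
proof -
 obtain V \<phi> where V: "open V" "sphere a r \<subseteq> V" "g \<in> W2 1 (U \<inter> V)"
  and \<phi>: "\<And>n. \<phi> n \<in> W2 1 (U \<inter> V)" "\<And>n. continuous_on (closure (U \<inter> V)) (\<phi> n)"
  "(\<lambda>n. W21_norm (U \<inter> V) (\<lambda>x. \<phi> n x - g x)) \<longlonglongrightarrow> 0"
  "(\<lambda>n. L2_norm (sphere_measure a r) (\<lambda>t. \<phi> n t - T t)) \<longlonglongrightarrow> 0"
  and fr: "sphere a r \<subseteq> frontier U" and T: "T \<in> L2 (sphere_measure a r)"
  using t unfolding has_trace_def by blast
 let ?S = "sphere_measure a r"
 show ?thesis
 proof (rule that[of "N \<inter> V"])
  show "open (N \<inter> V)" "sphere a r \<subseteq> N \<inter> V" "N \<inter> V \<subseteq> N" using N V by auto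
  fix \<eta> K v i
  assume \<eta>: "elem \<eta>" "compact K" "\<And>x. \<eta> x \<noteq> 0 \<Longrightarrow> x \<in> K"
   and K: "\<And>x. x \<in> K \<Longrightarrow> s * (norm (x - a) - r) > 0 \<Longrightarrow> x \<in> N \<inter> V"
   and v: "has_weak_deriv (U \<inter> (N \<inter> V)) i g v" "v \<in> L2 (leb (U \<inter> (N \<inter> V)))"
  define W where "W = U \<inter> (N \<inter> V)"
  note v = v[folded W_def]
  have W: "open W" "bounded W" "W \<subseteq> U \<inter> V" "open (U \<inter> V)"
   using U V N by (auto simp: W_def intro: bounded_subset)
  have WU: "x \<in> U" if "x \<in> W" for x using that by (simp add: W_def)
  have Wm: "W \<in> lmeasurable" by (rule bounded_open_lmeasurable[OF W(2,1)])
  have KW: "x \<in> W" if "x \<in> K" "s * (norm (x - a) - r) > 0" for x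
   using K[OF that] N(3)[of x] that(2) by (auto simp: W_def)
  have S: "sphere a r \<subseteq> closure W"
  proof -
   have "sphere a r \<subseteq> (N \<inter> V) \<inter> closure U" using N V fr by (auto simp: frontier_def)
   also have "\<dots> \<subseteq> closure ((N \<inter> V) \<inter> U)" using N V by (intro open_Int_closure_subset) auto
   finally show ?thesis by (simp add: W_def Int_commute)
  qed
  \<comment> \<open>Splitting off the derivative of \<open>\<phi> n - g\<close> writes the
    derivative of \<open>\<phi> n\<close> as \<open>v + d n\<close>, where \<open>d n\<close> tends
    to 0 in mean square.\<close>
  define d where "d n = weak_deriv (U \<inter> V) i (\<lambda>x. \<phi> n x - g x)" for n
  have dW2: "(\<lambda>x. \<phi> n x - g x) \<in> W2 1 (U \<inter> V)" for n by (rule W2_diff[OF W(4) \<phi>(1) V(3)])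
  note dD = W21D[OF dW2 W(4)]
  have dL: "d n \<in> L2 (leb W)" for n
   unfolding d_def by (rule L2_subset[OF open_lebesgue[OF W(4)] open_lebesgue[OF W(1)] W(3) dD(3)])
  have \<phi>L: "\<phi> n \<in> L2 (leb W)" for n
   by (rule L2_subset[OF open_lebesgue[OF W(4)] open_lebesgue[OF W(1)] W(3) W21D(1)[OF \<phi>(1) W(4)]])
  have gL: "g \<in> L2 (leb W)"
   by (rule L2_subset[OF open_lebesgue[OF W(4)] open_lebesgue[OF W(1)] W(3) W21D(1)[OF V(3) W(4)]])
  have wd: "has_weak_deriv W i (\<phi> n) (\<lambda>x. v x + d n x)" for n
  proof -
   have "has_weak_deriv W i (\<lambda>x. \<phi> n x - g x) (d n)"
    unfolding d_def by (rule has_weak_deriv_subset[OF W(4,1,3) dD(2)])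
   from has_weak_deriv_add[OF W(1) v(1) this] show ?thesis by simp
  qed
  have vd: "(\<lambda>x. v x + d n x) \<in> L2 (leb W)" for n by (rule L2_add[OF v(2) dL])
  have cW: "continuous_on (closure W) (\<phi> n)" for n
   by (rule continuous_on_subset[OF \<phi>(2) closure_mono[OF W(3)]])
  have each: "(\<integral>x. pd i \<eta> x *\<^sub>R \<phi> n x + \<eta> x *\<^sub>R (v x + d n x) \<partial>leb W) =
    - (s *\<^sub>R (\<integral>t. ((t $ i - a $ i) / r * \<eta> t) *\<^sub>R \<phi> n t \<partial>?S))" for n
   by (rule trace_ibp[OF r s W(1) U(3)[OF WU] W(2) \<eta> KW S \<phi>L vd wd cW])
  obtain B where B: "\<And>x. \<bar>\<eta> x\<bar> \<le> B" "B \<ge> 0" using elem_compact_bounded[OF \<eta>] by blast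
  obtain B' where B': "\<And>x. \<bar>pd i \<eta> x\<bar> \<le> B'"
  proof -
   have "x \<in> K" if "pd i \<eta> x \<noteq> 0" for x
    using supp_part_deriv[OF compact_imp_closed[OF \<eta>(2)] \<eta>(3)] that by blast
   from elem_compact_bounded[OF pd_elem[OF \<eta>(1)] \<eta>(2) this] show ?thesis using that by blast
  qed
  have n1: "(\<lambda>n. \<integral>x. (norm (\<phi> n x - g x))^2 \<partial>leb (U \<inter> V)) \<longlonglongrightarrow> 0"
   and n2: "(\<lambda>n. \<integral>x. (norm (d n x))^2 \<partial>leb (U \<inter> V)) \<longlonglongrightarrow> 0"
   using \<phi>(3)[unfolded W21_norm_tendsto_iff] by (auto simp: d_def)
  note fin = finite_measure_lebesgue_on[OF Wm]
  note mono = L2_integral_mono_set[OF open_lebesgue[OF W(4)] open_lebesgue[OF W(1)] W(3)]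
  have m1: "(\<lambda>n. \<integral>x. (norm (\<phi> n x - g x))^2 \<partial>leb W) \<longlonglongrightarrow> 0"
   by (rule Lim_null_comparison[OF _ n1]) (use mono[OF dD(1)] in auto)
  have m2: "(\<lambda>n. \<integral>x. (norm ((v x + d n x) - v x))^2 \<partial>leb W) \<longlonglongrightarrow> 0"
   by (rule Lim_null_comparison[OF _ n2]) (use mono[OF dD(3)] in \<open>auto simp: d_def\<close>)
  have L1: "(\<lambda>n. \<integral>x. pd i \<eta> x *\<^sub>R \<phi> n x \<partial>leb W) \<longlonglongrightarrow> (\<integral>x. pd i \<eta> x *\<^sub>R g x \<partial>leb W)"
   by (rule L2_lim_integral[OF fin \<phi>L gL m1 elem_UNIV_lebesgue_on[OF pd_elem[OF \<eta>(1)]], where B=B']) (simp add: B')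
  have L2': "(\<lambda>n. \<integral>x. \<eta> x *\<^sub>R (v x + d n x) \<partial>leb W) \<longlonglongrightarrow> (\<integral>x. \<eta> x *\<^sub>R v x \<partial>leb W)"
   by (rule L2_lim_integral[OF fin vd v(2) m2 elem_UNIV_lebesgue_on[OF \<eta>(1)], where B=B]) (simp add: B)
  have ii: "integrable (leb W) (\<lambda>x. pd i \<eta> x *\<^sub>R u x)" "integrable (leb W) (\<lambda>x. \<eta> x *\<^sub>R u x)"
   if "u \<in> L2 (leb W)" for u :: "real^'n \<Rightarrow> complex"
   by (rule integrable_bounded_mult[OF L2_integrable[OF fin that] elem_UNIV_lebesgue_on[OF pd_elem[OF \<eta>(1)]], where B=B'], simp add: B')
    (rule integrable_bounded_mult[OF L2_integrable[OF fin that] elem_UNIV_lebesgue_on[OF \<eta>(1)], where B=B], simp add: B)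
  have lhs: "(\<lambda>n. \<integral>x. pd i \<eta> x *\<^sub>R \<phi> n x + \<eta> x *\<^sub>R (v x + d n x) \<partial>leb W) \<longlonglongrightarrow>
    (\<integral>x. pd i \<eta> x *\<^sub>R g x + \<eta> x *\<^sub>R v x \<partial>leb W)"
   unfolding Bochner_Integration.integral_add[OF ii(1)[OF \<phi>L] ii(2)[OF vd]] Bochner_Integration.integral_add[OF ii(1)[OF gL] ii(2)[OF v(2)]]
   by (rule tendsto_add[OF L1 L2'])
  define \<nu> where "\<nu> t = (t $ i - a $ i) / r * \<eta> t" for t
  have \<nu>e: "elem \<nu>" unfolding \<nu>_def[abs_def]
   by (intro elementary.mult \<eta> elem_divide elem_diff elementary.coord elementary.const)
  have \<nu>c: "continuous_on (sphere a r) \<nu>" by (rule elem_UNIV_continuous[OF \<nu>e])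
  obtain B'' where B'': "\<And>x. x \<in> sphere a r \<Longrightarrow> norm (\<nu> x) \<le> B''" using continuous_sphere_bounded[OF \<nu>c] by blast
  have \<phi>S: "\<phi> n \<in> L2 ?S" for n
  proof -
   have c: "continuous_on (sphere a r) (\<phi> n)" by (rule continuous_on_subset[OF cW S])
   obtain b where "\<And>x. x \<in> sphere a r \<Longrightarrow> norm (\<phi> n x) \<le> b" using continuous_sphere_bounded[OF c] by blast
   then show ?thesis
    by (intro L2_bounded[OF finite_sphere_measure[OF r] continuous_sphere_measurable[OF c], of b] AE_I2)
     (simp add: sphere_measure_space)
  qed
  have rhs: "(\<lambda>n. \<integral>t. \<nu> t *\<^sub>R \<phi> n t \<partial>?S) \<longlonglongrightarrow> (\<integral>t. \<nu> t *\<^sub>R T t \<partial>?S)"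
   by (rule L2_lim_integral[OF finite_sphere_measure[OF r] \<phi>S T \<phi>(4)[unfolded L2_norm_tendsto_iff] continuous_sphere_measurable[OF \<nu>c], where B=B''])
    (use B'' in \<open>auto simp: sphere_measure_space\<close>)
  have "(\<lambda>n. - (s *\<^sub>R (\<integral>t. \<nu> t *\<^sub>R \<phi> n t \<partial>?S))) \<longlonglongrightarrow> - (s *\<^sub>R (\<integral>t. \<nu> t *\<^sub>R T t \<partial>?S))"
   by (intro tendsto_intros rhs)
  moreover have "(\<lambda>n. - (s *\<^sub>R (\<integral>t. \<nu> t *\<^sub>R \<phi> n t \<partial>?S))) \<longlonglongrightarrow> (\<integral>x. pd i \<eta> x *\<^sub>R g x + \<eta> x *\<^sub>R v x \<partial>leb W)"
   using lhs unfolding each \<nu>_def .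
  ultimately show "(\<integral>x. pd i \<eta> x *\<^sub>R g x + \<eta> x *\<^sub>R v x \<partial>leb (U \<inter> (N \<inter> V))) =
   - (s *\<^sub>R (\<integral>t. ((t $ i - a $ i) / r * \<eta> t) *\<^sub>R T t \<partial>sphere_measure a r))"
   unfolding W_def[symmetric] \<nu>_def using LIMSEQ_unique by blast
 qed
qed

text \<open>The divergence theorem for the field \<open>(x - a) * F^2\<close>, whose normal
  component on the sphere is \<open>r * F^2\<close>; the mixed term of its divergence is split by
  Young's inequality.\<close>

lemma trace_inequality:
 fixes F :: "real^'n \<Rightarrow> real"
 assumes r: "r > 0" and F: "elem F"
 shows "r * (\<integral>t. (F t)^2 \<partial>sphere_measure a r) \<le>
  real CARD('n) * (1 + r) * (\<integral>x. (F x)^2 \<partial>leb (ball a r)) + r * (\<Sum>i\<in>UNIV. \<integral>x. (pd i F x)^2 \<partial>leb (ball a r))"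
proof -
 let ?M = "leb (ball a r)"
 define X where "X i x = (x $ i - a $ i) * (F x * F x)" for i x
 have ce: "elem (\<lambda>x. x $ i - a $ i)" for i by (intro elem_diff elementary.coord elementary.const)
 have Xe: "elem (X i)" for i unfolding X_def[abs_def] by (intro elementary.mult ce F)
 have pX: "pd i (X i) x = (F x)^2 + 2 * ((x $ i - a $ i) * (F x * pd i F x))" for i x
 proof -
  have "pd i (\<lambda>x. x $ i - a $ i) = (\<lambda>x. 1)"
   unfolding pd_diff[OF elementary.coord elementary.const] pd_coord pd_const by simp
  then show ?thesis
   unfolding X_def[abs_def] pd_mult[OF ce elementary.mult[OF F F]] pd_mult[OF F F]
   by (simp add: power2_eq_square algebra_simps)
 qed
 have "r * (\<integral>t. (F t)^2 \<partial>sphere_measure a r) = (\<integral>t. (\<Sum>i\<in>UNIV. (t $ i - a $ i) / r * X i t) \<partial>sphere_measure a r)"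
 proof (subst integral_mult_right_zero[symmetric], rule bochner_cong[OF refl])
  fix t assume "t \<in> space (sphere_measure a r)"
  then have "norm (t - a) = r" by (simp add: sphere_measure_space dist_norm norm_minus_commute)
  then have n: "(\<Sum>i\<in>UNIV. (t $ i - a $ i)^2) = r^2" using norm_pow2_vec[of "t - a"] by simp
  have "(\<Sum>i\<in>UNIV. (t $ i - a $ i) / r * X i t) = (\<Sum>i\<in>UNIV. (t $ i - a $ i)^2 * ((F t)^2 / r))"
   by (intro sum.cong refl) (simp add: X_def power2_eq_square)
  also have "\<dots> = r^2 * ((F t)^2 / r)" unfolding sum_distrib_right[symmetric] n ..
  also have "\<dots> = r * (F t)^2" using r by (simp add: power2_eq_square)
  finally show "r * (F t)^2 = (\<Sum>i\<in>UNIV. (t $ i - a $ i) / r * X i t)" by simp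
 qed
 also have "\<dots> = (\<Sum>i\<in>UNIV. \<integral>t. (t $ i - a $ i) / r * X i t \<partial>sphere_measure a r)"
  by (intro Bochner_Integration.integral_sum sphere_integrable_continuous[OF r] elem_UNIV_continuous elementary.mult elem_divide ce Xe)
 also have "\<dots> = (\<Sum>i\<in>UNIV. \<integral>x. pd i (X i) x \<partial>?M)"
  unfolding divergence_ball[OF r Xe] ..
 also have "\<dots> \<le> (\<Sum>i\<in>UNIV. \<integral>x. (1 + r) * (F x)^2 + r * (pd i F x)^2 \<partial>?M)"
 proof (intro sum_mono integral_mono)
  fix i x
  show "integrable ?M (pd i (X i))" by (intro elem_integrable_ball pd_elem Xe)
  show "integrable ?M (\<lambda>x. (1 + r) * (F x)^2 + r * (pd i F x)^2)"
   by (intro elem_integrable_ball elementary.add elem_cmult elem_power pd_elem F)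
  assume "x \<in> space ?M"
  then have "norm (x - a) < r" by (simp add: dist_norm norm_minus_commute)
  then have c: "\<bar>x $ i - a $ i\<bar> \<le> r" using component_le_norm_cart[of "x - a" i] by simp
  have "2 * \<bar>F x * pd i F x\<bar> \<le> (F x)^2 + (pd i F x)^2"
   using sum_squares_ge_zero[of "\<bar>F x\<bar> - \<bar>pd i F x\<bar>" 0]
   by (simp add: power2_eq_square algebra_simps abs_mult)
  then have "\<bar>x $ i - a $ i\<bar> * (2 * \<bar>F x * pd i F x\<bar>) \<le> r * ((F x)^2 + (pd i F x)^2)"
   using c r by (intro mult_mono) auto
  moreover have "2 * ((x $ i - a $ i) * (F x * pd i F x)) \<le> \<bar>x $ i - a $ i\<bar> * (2 * \<bar>F x * pd i F x\<bar>)"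
   using abs_ge_self[of "(x $ i - a $ i) * (F x * pd i F x)"] unfolding abs_mult by simp
  ultimately show "pd i (X i) x \<le> (1 + r) * (F x)^2 + r * (pd i F x)^2"
   unfolding pX by (simp add: algebra_simps)
 qed
 also have "\<dots> = (\<Sum>i\<in>(UNIV::'n set). (1 + r) * (\<integral>x. (F x)^2 \<partial>?M) + r * (\<integral>x. (pd i F x)^2 \<partial>?M))"
  by (intro sum.cong refl, subst Bochner_Integration.integral_add)
   (auto intro!: elem_integrable_ball elem_cmult elem_power pd_elem F)
 also have "\<dots> = real CARD('n) * (1 + r) * (\<integral>x. (F x)^2 \<partial>?M) + r * (\<Sum>i\<in>UNIV. \<integral>x. (pd i F x)^2 \<partial>?M)"
  by (simp add: sum.distrib sum_distrib_left)
 finally show ?thesis .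
qed

lemma L2_triangle:
 assumes "f \<in> L2 M" "g \<in> L2 M" "w \<in> L2 M"
 shows "(\<integral>x. (norm (f x - g x))^2 \<partial>M) \<le> 2 * (\<integral>x. (norm (f x - w x))^2 \<partial>M) + 2 * (\<integral>x. (norm (g x - w x))^2 \<partial>M)"
proof -
 note i = L2D(2)[OF L2_diff[OF assms(1,3)]] L2D(2)[OF L2_diff[OF assms(2,3)]] L2D(2)[OF L2_diff[OF assms(1,2)]]
 have "(norm (f x - g x))^2 \<le> 2 * (norm (f x - w x))^2 + 2 * (norm (g x - w x))^2" for x
  using norm_add_sq[of "f x - w x" "w x - g x"] by (simp add: norm_minus_commute)
 then have "(\<integral>x. (norm (f x - g x))^2 \<partial>M) \<le> (\<integral>x. 2 * (norm (f x - w x))^2 + 2 * (norm (g x - w x))^2 \<partial>M)"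
  using i by (intro integral_mono) auto
 then show ?thesis using i by simp
qed

lemma frontier_ball_diff:
 fixes x0 :: "real^'n"
 assumes "r > 0" "cball x0 r \<subseteq> Om"
 shows "sphere x0 r \<subseteq> frontier (Om - cball x0 r)"
proof
 fix x assume x: "x \<in> sphere x0 r"
 have "closure (- cball x0 r) = - ball x0 r" by (simp add: closure_complement)
 then have "x \<in> Om \<inter> closure (- cball x0 r)" using x assms(2) by (auto simp: subset_eq)
 then have "x \<in> closure (Om \<inter> (- cball x0 r))" using open_Int_closure_subset[of Om "- cball x0 r"] by auto
 moreover have "Om - cball x0 r = Om \<inter> (- cball x0 r)" by auto
 moreover have "open (Om - cball x0 r)" by (intro open_Diff) auto
 moreover have "x \<notin> Om - cball x0 r" using x by auto
 ultimately show "x \<in> frontier (Om - cball x0 r)"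
  by (simp only: frontier_def interior_open Diff_iff simp_thms)
qed

lemma lmeas_Om [simp]: "(Om :: (real^'n) set) \<in> lmeasurable" by simp

text \<open>Used for \<open>w\<close> with its gradient and again for each first derivative with the
  second ones: mean square convergence of smooth functions and of their gradients on the ball gives
  Sobolev convergence on every open subset.\<close>

lemma W21_approx:
 fixes U :: "(real^'n) set"
 assumes U: "open U" "U \<subseteq> Om"
  and w: "w \<in> L2 (leb Om)" "\<And>i. v i \<in> L2 (leb Om)"
  and AB: "\<And>n. elem (A n)" "\<And>n. elem (B n)"
  and lim: "L2_lim (leb Om) (\<lambda>n. cx (A n) (B n)) w"
   "\<And>i. L2_lim (leb Om) (\<lambda>n. cx (pd i (A n)) (pd i (B n))) (v i)"
 shows "has_weak_deriv Om i w (v i)" "w \<in> W2 1 U" "cx (A n) (B n) \<in> W2 1 U"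
  "(\<lambda>n. W21_norm U (\<lambda>x. cx (A n) (B n) x - w x)) \<longlonglongrightarrow> 0"
proof -
 let ?M = "leb (Om :: (real^'n) set)"
 have Oml: "Om \<in> sets (lebesgue :: (real^'n) measure)" by simp
 define \<phi> where "\<phi> n = cx (A n) (B n)" for n
 define d where "d i n = cx (pd i (A n)) (pd i (B n))" for i n
 have \<phi>L: "\<phi> n \<in> L2 ?M" and dL: "d i n \<in> L2 ?M" for n i
  unfolding \<phi>_def d_def by (intro L2_ball_cx AB pd_elem)+
 have wd\<phi>: "has_weak_deriv Om i (\<phi> n) (d i n)" for i n
  unfolding \<phi>_def d_def by (rule has_weak_deriv_cx) (auto intro: elem_subset[OF AB(1)] elem_subset[OF AB(2)])
 note lim' = lim(1)[folded \<phi>_def, unfolded L2_lim_def] lim(2)[folded d_def, unfolded L2_lim_def]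
 have wdw: "has_weak_deriv Om i w (v i)" for i
  by (rule has_weak_deriv_L2_limit[OF open_ball lmeas_Om wd\<phi> \<phi>L dL w lim'])
 note sub = L2_subset[OF Oml open_lebesgue[OF U(1)] U(2)]
 note wsub = has_weak_deriv_subset[OF open_ball U]
 have "\<phi> n \<in> W2 1 U" for n
  by (rule W21I[OF sub[OF \<phi>L] wsub[OF wd\<phi>] sub[OF dL]])
 then show "cx (A n) (B n) \<in> W2 1 U" by (simp add: \<phi>_def)
 show "has_weak_deriv Om i w (v i)" by (rule wdw)
 show "w \<in> W2 1 U" by (rule W21I[OF sub[OF w(1)] wsub[OF wdw] sub[OF w(2)]])
 note mono = L2_integral_mono_set[OF Oml open_lebesgue[OF U(1)] U(2)]
 have "(\<lambda>n. W21_norm U (\<lambda>x. \<phi> n x - w x)) \<longlonglongrightarrow> 0"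
  unfolding W21_norm_tendsto_iff
 proof (intro conjI allI)
  show "(\<lambda>n. \<integral>x. (norm (\<phi> n x - w x))^2 \<partial>leb U) \<longlonglongrightarrow> 0"
   by (rule Lim_null_comparison[OF _ lim'(1)]) (use mono[OF L2_diff[OF \<phi>L w(1)]] in auto)
  fix i
  have "(\<integral>x. (norm (weak_deriv U i (\<lambda>x. \<phi> n x - w x) x))^2 \<partial>leb U) = (\<integral>x. (norm (d i n x - v i x))^2 \<partial>leb U)" for n
  proof (rule integral_norm_cong_AE[OF U(1), symmetric])
   show "(\<lambda>x. d i n x - v i x) \<in> L2 (leb U)" by (rule sub[OF L2_diff[OF dL w(2)]])
   have "AE x in leb U. weak_deriv U i (\<lambda>x. \<phi> n x - w x) x = d i n x - v i x"
    by (rule weak_deriv_AE[OF U(1) wsub[OF has_weak_deriv_diff[OF open_ball wd\<phi> wdw]]])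
   then show "AE x in leb U. d i n x - v i x = weak_deriv U i (\<lambda>x. \<phi> n x - w x) x"
    by eventually_elim simp
  qed
  then show "(\<lambda>n. \<integral>x. (norm (weak_deriv U i (\<lambda>x. \<phi> n x - w x) x))^2 \<partial>leb U) \<longlonglongrightarrow> 0"
   by (intro Lim_null_comparison[OF _ lim'(2)[of i]]) (use mono[OF L2_diff[OF dL w(2)]] in auto)
 qed
 then show "(\<lambda>n. W21_norm U (\<lambda>x. cx (A n) (B n) x - w x)) \<longlonglongrightarrow> 0" by (simp add: \<phi>_def)
qed

text \<open>The trace inequality applied to differences of the approximations makes their
  restrictions to the sphere a Cauchy sequence in \<open>L2\<close> of the surface measure;
  completeness provides the trace.\<close>

lemma trace_exists:
 fixes x0 :: "real^'n"
 assumes r: "r > 0" "cball x0 r \<subseteq> Om"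
  and w: "w \<in> L2 (leb Om)" "\<And>i. v i \<in> L2 (leb Om)"
  and AB: "\<And>n. elem (A n)" "\<And>n. elem (B n)"
  and lim: "L2_lim (leb Om) (\<lambda>n. cx (A n) (B n)) w"
   "\<And>i. L2_lim (leb Om) (\<lambda>n. cx (pd i (A n)) (pd i (B n))) (v i)"
 shows "\<exists>T. has_trace (Om - cball x0 r) x0 r w T"
proof -
 let ?U = "Om - cball x0 r" and ?S = "sphere_measure x0 r" and ?M = "leb (Om :: (real^'n) set)"
 have U: "open ?U" "?U \<subseteq> Om" by auto
 define \<phi> where "\<phi> n = cx (A n) (B n)" for n
 define d where "d i n = cx (pd i (A n)) (pd i (B n))" for i n
 have \<phi>L: "\<phi> n \<in> L2 ?M" and dL: "d i n \<in> L2 ?M" for n i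
  unfolding \<phi>_def d_def by (intro L2_ball_cx AB pd_elem)+
 have Oml: "Om \<in> sets (lebesgue :: (real^'n) measure)" by simp
 note lim' = lim(1)[folded \<phi>_def, unfolded L2_lim_def] lim(2)[folded d_def, unfolded L2_lim_def]
 note approx = W21_approx[OF U w AB lim, folded \<phi>_def]
 have Ww: "w \<in> W2 1 ?U" and W\<phi>: "\<phi> n \<in> W2 1 ?U" for n by (fact approx)+
 have n: "(\<lambda>n. W21_norm ?U (\<lambda>x. \<phi> n x - w x)) \<longlonglongrightarrow> 0"
  unfolding \<phi>_def by (rule W21_approx(4)[OF U w AB lim])
 have c\<phi>: "continuous_on S (\<phi> n)" for n S
  unfolding \<phi>_def by (intro continuous_intros elem_UNIV_continuous AB)
 define C where "C = max (real CARD('n) * (1 + r)) r / r"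
 have C: "C \<ge> 0" using r by (simp add: C_def)
 define D where "D n = C * (2 * (\<integral>x. (norm (\<phi> n x - w x))^2 \<partial>?M) + (\<Sum>i\<in>UNIV. 2 * (\<integral>x. (norm (d i n x - v i x))^2 \<partial>?M)))" for n
 have D0: "D \<longlonglongrightarrow> 0"
 proof -
  have "D \<longlonglongrightarrow> C * (2 * 0 + (\<Sum>i\<in>(UNIV::'n set). 2 * 0))"
   unfolding D_def by (intro tendsto_intros lim')
  then show ?thesis by simp
 qed
 have ti: "(\<integral>t. (F t)^2 \<partial>?S) \<le> C * ((\<integral>x. (F x)^2 \<partial>?M) + (\<Sum>i\<in>UNIV. \<integral>x. (pd i F x)^2 \<partial>?M))" if F: "elem F" for F
 proof -
  let ?B = "leb (ball x0 r)"
  have m: "(\<integral>x. (P x)^2 \<partial>?B) \<le> (\<integral>x. (P x)^2 \<partial>?M)" if P: "elem P" for P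
  proof -
   have s: "ball x0 r \<subseteq> Om" using r(2) ball_subset_cball by blast
   have L: "(\<lambda>x. complex_of_real (P x)) \<in> L2 ?M" using L2_ball_cx[OF P elementary.const[of _ 0], of 0 1] by simp
   show ?thesis using L2_integral_mono_set[OF Oml _ s L] by simp
  qed
  define m where "m = max (real CARD('n) * (1 + r)) r"
  have mm: "real CARD('n) * (1 + r) \<le> m" "r \<le> m" "0 \<le> m" using r by (auto simp: m_def)
  have "r * (\<integral>t. (F t)^2 \<partial>?S) \<le> real CARD('n) * (1 + r) * (\<integral>x. (F x)^2 \<partial>?B) + r * (\<Sum>i\<in>UNIV. \<integral>x. (pd i F x)^2 \<partial>?B)"
   by (rule trace_inequality[OF r(1) F])
  also have "\<dots> \<le> m * (\<integral>x. (F x)^2 \<partial>?M) + m * (\<Sum>i\<in>UNIV. \<integral>x. (pd i F x)^2 \<partial>?M)"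
   using mm m[OF F] m[OF pd_elem[OF F]] by (intro add_mono mult_mono sum_mono) (auto intro: sum_nonneg)
  finally have "r * (\<integral>t. (F t)^2 \<partial>?S) \<le> m * ((\<integral>x. (F x)^2 \<partial>?M) + (\<Sum>i\<in>UNIV. \<integral>x. (pd i F x)^2 \<partial>?M))"
   by (simp add: distrib_left)
  then show ?thesis using r(1) unfolding C_def m_def[symmetric] by (simp add: field_simps)
 qed
 have bd: "(\<integral>t. (norm (\<phi> m t - \<phi> n t))^2 \<partial>?S) \<le> D m + D n" for m n
 proof -
  define F where "F = (\<lambda>x. A m x - A n x)"
  define G where "G = (\<lambda>x. B m x - B n x)"
  have F: "elem F" and G: "elem G" unfolding F_def G_def by (intro elem_diff AB)+
  have pF: "pd i F = (\<lambda>x. pd i (A m) x - pd i (A n) x)"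
   and pG: "pd i G = (\<lambda>x. pd i (B m) x - pd i (B n) x)" for i
   unfolding F_def G_def by (intro pd_diff AB)+
  have iss: "integrable ?S (\<lambda>t. (F t)^2)" "integrable ?S (\<lambda>t. (G t)^2)"
   by (intro sphere_integrable_continuous[OF r(1)] elem_UNIV_continuous elem_power F G)+
  have io: "integrable ?M (\<lambda>t. (P t)^2)" if "elem P" for P
   by (intro elem_integrable_ball elem_power that)
  have "(\<integral>t. (norm (\<phi> m t - \<phi> n t))^2 \<partial>?S) = (\<integral>t. (F t)^2 \<partial>?S) + (\<integral>t. (G t)^2 \<partial>?S)"
   unfolding \<phi>_def norm_cx_diff using iss by (simp add: F_def G_def)
  also have "\<dots> \<le> C * ((\<integral>x. (F x)^2 \<partial>?M) + (\<Sum>i\<in>UNIV. \<integral>x. (pd i F x)^2 \<partial>?M)) + C * ((\<integral>x. (G x)^2 \<partial>?M) + (\<Sum>i\<in>UNIV. \<integral>x. (pd i G x)^2 \<partial>?M))"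
   by (intro add_mono ti F G)
  also have "\<dots> = C * ((\<integral>x. (norm (\<phi> m x - \<phi> n x))^2 \<partial>?M) + (\<Sum>i\<in>UNIV. \<integral>x. (norm (d i m x - d i n x))^2 \<partial>?M))"
  proof -
   have 1: "(\<integral>x. (norm (\<phi> m x - \<phi> n x))^2 \<partial>?M) = (\<integral>x. (F x)^2 \<partial>?M) + (\<integral>x. (G x)^2 \<partial>?M)"
    unfolding \<phi>_def norm_cx_diff using io[OF F] io[OF G] by (simp add: F_def G_def)
   have 2: "(\<integral>x. (norm (d i m x - d i n x))^2 \<partial>?M) = (\<integral>x. (pd i F x)^2 \<partial>?M) + (\<integral>x. (pd i G x)^2 \<partial>?M)" for i
    unfolding d_def norm_cx_diff using io[OF pd_elem[OF F, of i]] io[OF pd_elem[OF G, of i]] by (simp add: pF pG)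
   show ?thesis unfolding 1 2 by (simp add: sum.distrib algebra_simps)
  qed
  also have "\<dots> \<le> C * ((2 * (\<integral>x. (norm (\<phi> m x - w x))^2 \<partial>?M) + 2 * (\<integral>x. (norm (\<phi> n x - w x))^2 \<partial>?M)) +
    (\<Sum>i\<in>UNIV. 2 * (\<integral>x. (norm (d i m x - v i x))^2 \<partial>?M) + 2 * (\<integral>x. (norm (d i n x - v i x))^2 \<partial>?M)))"
   using C by (intro mult_left_mono add_mono sum_mono L2_triangle \<phi>L dL w) auto
  also have "\<dots> = D m + D n" unfolding D_def by (simp add: sum.distrib algebra_simps)
  finally show ?thesis .
 qed
 have \<phi>S: "\<phi> n \<in> L2 ?S" for n
 proof -
  obtain b where "\<And>x. x \<in> sphere x0 r \<Longrightarrow> norm (\<phi> n x) \<le> b" using continuous_sphere_bounded[OF c\<phi>] by blast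
  then show ?thesis
   by (intro L2_bounded[OF finite_sphere_measure[OF r(1)] continuous_sphere_measurable[OF c\<phi>], where B=b] AE_I2)
    (simp add: sphere_measure_space)
 qed
 have ca: "\<exists>N. \<forall>m\<ge>N. \<forall>n\<ge>N. (\<integral>x. (norm (\<phi> m x - \<phi> n x))^2 \<partial>?S) < e" if "e > 0" for e
 proof -
  have "\<forall>\<^sub>F n in sequentially. D n < e / 2" using D0 that by (intro order_tendstoD(2)) auto
  then obtain N where N: "\<And>n. n \<ge> N \<Longrightarrow> D n < e / 2" by (auto simp: eventually_sequentially)
  have "(\<integral>x. (norm (\<phi> m x - \<phi> n x))^2 \<partial>?S) < e" if "m \<ge> N" "n \<ge> N" for m n
   using bd[of m n] N[OF that(1)] N[OF that(2)] by linarith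
  then show ?thesis by blast
 qed
 obtain T where T: "T \<in> L2 ?S" "(\<lambda>n. \<integral>x. (norm (\<phi> n x - T x))^2 \<partial>?S) \<longlonglongrightarrow> 0"
  by (rule L2_complete[OF finite_sphere_measure[OF r(1)] \<phi>S ca])
 have "has_trace ?U x0 r w T"
  unfolding has_trace_def
 proof (intro conjI exI[of _ UNIV] exI[of _ \<phi>] allI)
  show "sphere x0 r \<subseteq> frontier ?U" by (rule frontier_ball_diff[OF r])
  show "(\<lambda>n. L2_norm ?S (\<lambda>t. \<phi> n t - T t)) \<longlonglongrightarrow> 0" unfolding L2_norm_tendsto_iff by (rule T(2))
 qed (use T W\<phi> Ww c\<phi> n in \<open>auto simp del: W2.simps\<close>)
 then show ?thesis by blast
qed

text \<open>The compact ball has a neighbourhood of some width \<open>e\<close> inside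
  \<open>N\<close>. In terms of squared radii the enlargement \<open>r * e\<close> is admissible
  because \<open>r^2 + r * e < (r + e)^2\<close>.\<close>

lemma cball_enlarge:
 fixes a :: "real^'n"
 assumes "r > 0" "cball a r \<subseteq> N" "open N"
 obtains c where "c > 0" "\<And>x. (norm (x - a))^2 \<le> r^2 + c \<Longrightarrow> x \<in> N"
proof -
 obtain e where e: "e > 0" "(\<Union>x\<in>cball a r. ball x e) \<subseteq> N"
  using compact_subset_open_imp_ball_epsilon_subset[OF compact_cball assms(3,2)] by blast
 show ?thesis
 proof (rule that[of "r * e"])
  show "r * e > 0" using assms e by simp
  fix x assume x: "(norm (x - a))^2 \<le> r^2 + r * e"
  show "x \<in> N"
  proof (cases "norm (x - a) \<le> r")
   case True
   then show ?thesis using assms(2) by (auto simp: dist_norm norm_minus_commute subset_eq)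
  next
   case False
   define y where "y = a + (r / norm (x - a)) *\<^sub>R (x - a)"
   have "(norm (x - a))^2 < (r + e)^2"
   proof -
    have "(r + e)^2 = r^2 + 2 * (r * e) + e * e" by (simp add: power2_eq_square algebra_simps)
    moreover have "e * e > 0" "r * e > 0" using assms(1) e(1) by auto
    ultimately show ?thesis using x by linarith
   qed
   then have lt: "norm (x - a) < r + e" by (rule power2_less_imp_less) (use assms e in auto)
   have "norm (x - a) > 0" using False assms(1) by linarith
   then have ya: "norm (y - a) = r" using assms(1) by (simp add: y_def)
   have "x - y = (1 - r / norm (x - a)) *\<^sub>R (x - a)" by (simp add: y_def algebra_simps)
   then have "norm (x - y) = \<bar>1 - r / norm (x - a)\<bar> * norm (x - a)" by simp
   also have "\<dots> = norm (x - a) - r" using False assms(1) \<open>norm (x - a) > 0\<close> by (simp add: abs_if field_simps)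
   finally have "norm (x - y) < e" using lt by simp
   then have "x \<in> ball y e" by (simp add: dist_norm norm_minus_commute)
   moreover have "y \<in> cball a r" using ya by (simp add: dist_norm norm_minus_commute)
   ultimately show ?thesis using e(2) by blast
  qed
 qed
qed

text \<open>Since \<open>\<eta>\<close> equals 1 on the ball and \<open>\<integral> \<partial>\<^sub>i (\<eta> g) = 0\<close>, the exterior integral that determines the
 trace turns into the integral of \<open>\<partial>\<^sub>i g\<close> over the ball.\<close>

lemma interior_trace_integral:
 fixes x0 :: "real^'n"
 assumes r: "r > 0" "cball x0 r \<subseteq> Om"
  and g: "has_weak_deriv Om i g v" "v \<in> L2 (leb Om)" "g \<in> L2 (leb Om)"
  and t: "has_trace (Om - cball x0 r) x0 r g T"
 shows "(\<integral>t. ((t $ i - x0 $ i) / r) *\<^sub>R T t \<partial>sphere_measure x0 r) = (\<integral>x. v x \<partial>leb (ball x0 r))"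
proof -
 let ?U = "Om - cball x0 r" and ?S = "sphere_measure x0 r" and ?M = "leb (Om :: (real^'n) set)"
 have U: "open ?U" "bounded ?U" "?U \<subseteq> Om" by (auto intro: bounded_subset[of "ball 0 1"])
 have U1: "1 * (norm (x - x0) - r) > 0" if "x \<in> ?U" for x using that by (auto simp: dist_norm norm_minus_commute)
 have Oml: "Om \<in> sets (lebesgue :: (real^'n) measure)" by simp
 have sO: "sphere x0 r \<subseteq> Om" using r(2) by auto
 have N1: "x \<in> ?U" if "x \<in> Om" "1 * (norm (x - x0) - r) > 0" for x using that by (auto simp: dist_norm norm_minus_commute)
 obtain N' where N': "open N'" "sphere x0 r \<subseteq> N'" "N' \<subseteq> Om"
  and ibp: "\<And>\<eta> K v i. elem \<eta> \<Longrightarrow> compact K \<Longrightarrow> (\<And>x. \<eta> x \<noteq> 0 \<Longrightarrow> x \<in> K) \<Longrightarrow>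
   (\<And>x. x \<in> K \<Longrightarrow> 1 * (norm (x - x0) - r) > 0 \<Longrightarrow> x \<in> N') \<Longrightarrow>
   has_weak_deriv (?U \<inter> N') i g v \<Longrightarrow> v \<in> L2 (leb (?U \<inter> N')) \<Longrightarrow>
   (\<integral>x. pd i \<eta> x *\<^sub>R g x + \<eta> x *\<^sub>R v x \<partial>leb (?U \<inter> N')) =
   - (1 *\<^sub>R (\<integral>t. ((t $ i - x0 $ i) / r * \<eta> t) *\<^sub>R T t \<partial>sphere_measure x0 r))"
  using has_trace_ibp[OF U(1,2) U1 r(1) _ t open_ball sO N1] by blast
 \<comment> \<open>The set \<open>N'\<close> is only known to surround the sphere. Together with the
   open ball it covers a slightly larger closed ball, and this one carries the cutoff.\<close>
 have "cball x0 r \<subseteq> N' \<union> ball x0 r" using N'(2) by (auto simp: subset_eq)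
 then obtain c where c: "c > 0" "\<And>x. (norm (x - x0))^2 \<le> r^2 + c \<Longrightarrow> x \<in> N' \<union> ball x0 r"
  using cball_enlarge[OF r(1), of x0 "N' \<union> ball x0 r"] N'(1) by blast
 define \<eta> where "\<eta> = rcut x0 (r^2 + c) (c / 2)"
 define K where "K = cball x0 (sqrt (r^2 + c))"
 have Kiff: "x \<in> K \<longleftrightarrow> (norm (x - x0))^2 \<le> r^2 + c" for x
 proof -
  have "x \<in> K \<longleftrightarrow> sqrt ((norm (x - x0))^2) \<le> sqrt (r^2 + c)"
   by (simp add: K_def dist_norm norm_minus_commute)
  also have "\<dots> \<longleftrightarrow> (norm (x - x0))^2 \<le> r^2 + c" by (rule real_sqrt_le_iff)
  finally show ?thesis .
 qed
 have \<eta>e: "elem \<eta>" unfolding \<eta>_def by (rule rcut_elem)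
 have \<eta>0: "\<eta> x = 0" if "x \<notin> K" for x unfolding \<eta>_def using that c(1) by (intro rcut_0) (auto simp: Kiff)
 have \<eta>1: "\<eta> x = 1" if "norm (x - x0) \<le> r" for x
  unfolding \<eta>_def using power_mono[OF that, of 2] c(1) by (intro rcut_1) auto
 have KO: "K \<subseteq> Om"
 proof
  fix x assume "x \<in> K"
  then have "x \<in> N' \<union> ball x0 r" using c(2) Kiff by blast
  then show "x \<in> Om" using N'(3) r(2) ball_subset_cball[of x0 r] by blast
 qed
 have Kc: "compact K" by (simp add: K_def)
 have \<eta>K: "x \<in> K" if "\<eta> x \<noteq> 0" for x using \<eta>0 that by blast
 have KN: "x \<in> N'" if "x \<in> K" "1 * (norm (x - x0) - r) > 0" for x
  using c(2)[of x] that by (auto simp: Kiff dist_norm norm_minus_commute)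
 have W: "open (?U \<inter> N')" "?U \<inter> N' \<subseteq> Om" using U N' by auto
 have test: "\<eta> \<in> test_functions Om" by (rule test_functionI[OF \<eta>e Kc KO \<eta>K])
 define h where "h x = pd i \<eta> x *\<^sub>R g x + \<eta> x *\<^sub>R v x" for x
 have e1: "(\<integral>x. h x \<partial>leb (?U \<inter> N')) = - (\<integral>t. ((t $ i - x0 $ i) / r * \<eta> t) *\<^sub>R T t \<partial>?S)"
  using ibp[OF \<eta>e Kc \<eta>K KN has_weak_deriv_subset[OF open_ball W g(1)] L2_subset[OF Oml open_lebesgue[OF W(1)] W(2) g(2)]]
  by (simp add: h_def)
 have e2: "(\<integral>t. ((t $ i - x0 $ i) / r * \<eta> t) *\<^sub>R T t \<partial>?S) = (\<integral>t. ((t $ i - x0 $ i) / r) *\<^sub>R T t \<partial>?S)"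
  by (intro bochner_cong refl) (simp add: sphere_measure_space \<eta>1 dist_norm norm_minus_commute)
 note ii = test_integrable[OF test Oml]
 have hi: "integrable ?M h" unfolding h_def
  by (intro Bochner_Integration.integrable_add ii has_weak_derivD[OF g(1)])
 have e3: "(\<integral>x. h x \<partial>?M) = 0"
  unfolding h_def using has_weak_derivD(3)[OF g(1) test] ii(2)[OF has_weak_derivD(1)[OF g(1)], of i] ii(1)[OF has_weak_derivD(2)[OF g(1)]]
  by (simp add: )
 have vb: "integrable (leb (ball x0 r)) v"
  using r(2) ball_subset_cball[of x0 r]
  by (intro lebesgue_on_integrable_subset[OF Oml _ _ L2_integrable[OF finite_measure_lebesgue_on g(2)]]) auto
 have hW: "integrable (leb (?U \<inter> N')) h"
  by (rule lebesgue_on_integrable_subset[OF Oml open_lebesgue[OF W(1)] W(2) hi])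
 have "AE x in lebesgue. x \<notin> sphere x0 r" using negligible_sphere unfolding negligible_iff_null_sets by (rule AE_not_in)
 \<comment> \<open>Inside the ball \<eta> is 1 and \<open>h\<close> reduces to \<open>v\<close>;
   outside it the support of \<open>h\<close> lies in the set where the trace identity holds; the
   sphere itself is a null set.\<close>
 then have ae: "AE x in lebesgue. indicator Om x *\<^sub>R h x = indicator (?U \<inter> N') x *\<^sub>R h x + indicator (ball x0 r) x *\<^sub>R v x"
 proof eventually_elim
  case (elim x)
  consider "x \<in> ball x0 r" | "norm (x - x0) > r" using elim by (force simp: dist_norm norm_minus_commute)
  then show ?case
  proof cases
   case 1
   have "pd i \<eta> x = pd i (\<lambda>x. 1) x"
    by (rule part_deriv_cong[of "ball x0 r"]) (use 1 \<eta>1 in \<open>auto simp: dist_norm norm_minus_commute\<close>)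
   then have "h x = v x" using 1 \<eta>1[of x] by (simp add: h_def part_deriv_const dist_norm norm_minus_commute)
   moreover have "x \<in> Om" using 1 r(2) ball_subset_cball[of x0 r] by blast
   ultimately show ?thesis using 1 by (simp add: indicator_def)
  next
   case 2
   then have nb: "x \<notin> ball x0 r" "x \<notin> cball x0 r" by (auto simp: dist_norm norm_minus_commute)
   show ?thesis
   proof (cases "x \<in> K")
    case True
    then have "x \<in> N'" "x \<in> Om" using KN 2 KO by auto
    then show ?thesis using nb by (simp add: indicator_def)
   next
    case False
    then have "h x = 0" using \<eta>0 supp_part_deriv[OF compact_imp_closed[OF Kc] \<eta>K, where i=i and x=x and \<eta>=\<eta>] by (auto simp: h_def)
    then show ?thesis using nb by (simp add: indicator_def)
   qed
  qed
 qed
 have "(\<integral>x. h x \<partial>?M) = (\<integral>x. indicator (?U \<inter> N') x *\<^sub>R h x + indicator (ball x0 r) x *\<^sub>R v x \<partial>lebesgue)"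
  unfolding lebesgue_on_indicator(1)[OF Oml]
  using hi hW vb open_lebesgue[OF W(1)] by (intro integral_cong_AE ae) (auto simp: lebesgue_on_indicator)
 also have "\<dots> = (\<integral>x. h x \<partial>leb (?U \<inter> N')) + (\<integral>x. v x \<partial>leb (ball x0 r))"
  using hW vb open_lebesgue[OF W(1)] by (simp add: lebesgue_on_indicator)
 finally show ?thesis using e1 e2 e3 by (simp add: eq_neg_iff_add_eq_0 algebra_simps)
qed

section \<open>Green's formula for functions of zero trace\<close>

lemma elem_Om_bounded:
 fixes F :: "real^'n \<Rightarrow> real"
 assumes "elem F"
 obtains B where "B \<ge> 0" "\<And>x. norm x \<le> 1 \<Longrightarrow> \<bar>F x\<bar> \<le> B"
proof -
 have "bounded (F ` cball 0 1)"
  by (intro compact_imp_bounded compact_continuous_image elem_UNIV_continuous assms compact_cball)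
 then obtain B where B: "\<forall>x\<in>cball 0 1. norm (F x) \<le> B" unfolding bounded_iff by blast
 then have "norm (F 0) \<le> B" by simp
 then have "B \<ge> 0" using norm_ge_zero order_trans by blast
 with B that show ?thesis by simp
qed

lemma Om_poly_integrable:
 assumes "elem F" "z \<in> L2 (leb Om)"
 shows "integrable (leb Om) (\<lambda>x::real^'n. F x *\<^sub>R z x)"
proof -
 obtain B where "\<And>x. norm x \<le> 1 \<Longrightarrow> \<bar>F x\<bar> \<le> B" using elem_Om_bounded[OF assms(1)] by blast
 then show ?thesis
  by (intro integrable_bounded_mult[OF L2_integrable[OF finite_measure_lebesgue_on[OF lmeas_Om] assms(2)]
    elem_UNIV_lebesgue_on[OF assms(1)], where B=B] AE_I2) auto
qed

lemma inner_test_function: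
 fixes F :: "real^'n \<Rightarrow> real"
 assumes "elem F" "c > 0" "\<And>x. F x \<noteq> 0 \<Longrightarrow> (norm x)^2 \<le> 1 - c"
 shows "F \<in> test_functions Om"
proof (rule test_functionI[of _ "{x. (norm x)^2 \<le> 1 - c}", OF assms(1)])
 show K: "{x::real^'n. (norm x)^2 \<le> 1 - c} \<subseteq> Om"
 proof
  fix x :: "real^'n" assume "x \<in> {x. (norm x)^2 \<le> 1 - c}"
  then have "(norm x)^2 < 1^2" using assms(2) by simp
  then have "norm x < 1" by (rule power2_less_imp_less) simp
  then show "x \<in> Om" by simp
 qed
 have "closed {x::real^'n. (norm x)^2 \<le> 1 - c}" by (intro closed_Collect_le continuous_intros)
 moreover have "bounded {x::real^'n. (norm x)^2 \<le> 1 - c}" using K by (rule bounded_subset[OF bounded_ball])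
 ultimately show "compact {x::real^'n. (norm x)^2 \<le> 1 - c}" by (simp add: compact_eq_bounded_closed)
qed (use assms(3) in simp)

text \<open>The factor \<open>1 - |x|^2\<close> compensates the growing gradients of the cutoffs
  near the unit sphere. The boundary condition sits in \<open>p\<close> alone, so the identity
  applies to the first derivatives of \<open>w\<close>, whose boundary values are unknown.\<close>

lemma rho_vanish_green:
 fixes u u' :: "real^'n \<Rightarrow> complex"
 assumes u: "has_weak_deriv Om i u u'" "u \<in> L2 (leb Om)" "u' \<in> L2 (leb Om)"
  and q: "elem q"
 defines "p \<equiv> \<lambda>x. (1 - (norm x)^2) * q x"
 shows "(\<integral>x. pd i p x *\<^sub>R u x + p x *\<^sub>R u' x \<partial>leb Om) = 0"
proof -
 let ?M = "leb (Om :: (real^'n) set)"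
 have Oml: "Om \<in> sets (lebesgue :: (real^'n) measure)" by simp
 note fin = finite_measure_lebesgue_on[OF lmeas_Om]
 note ui = L2_integrable[OF fin u(2)] L2_integrable[OF fin u(3)]
 obtain s' M where s': "\<And>t. (step has_real_derivative s' t) (at t)" "\<And>t. \<bar>s' t\<bar> \<le> M"
  "\<And>t. t < 1 \<or> t > 2 \<Longrightarrow> s' t = 0" "M > 0" using step_deriv_ex by metis
 have pe: "elem p" unfolding p_def by (intro elementary.mult elem_rho q)
 obtain Bq where Bq: "\<And>x. norm x \<le> 1 \<Longrightarrow> \<bar>q x\<bar> \<le> Bq" using elem_Om_bounded[OF q] by blast
 obtain Bp where Bp: "\<And>x. norm x \<le> 1 \<Longrightarrow> \<bar>p x\<bar> \<le> Bp" using elem_Om_bounded[OF pe] by blast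
 obtain Bd where Bd: "\<And>x. norm x \<le> 1 \<Longrightarrow> \<bar>pd i p x\<bar> \<le> Bd" using elem_Om_bounded[OF pd_elem[OF pe]] by blast
 define c where "c n = scut (0::real^'n) 1 (-1) (inverse (real (Suc n)))" for n
 have ce: "elem (c n)" for n unfolding c_def by (rule scut_elem)
 have c01: "0 \<le> c n x" "c n x \<le> 1" for n x unfolding c_def by (rule scut_bounds)+
 have pdc: "pd i (c n) x = s' ((1 - (norm x)^2) * real (Suc n)) * (- real (Suc n) * (2 * x $ i))" for n x
  unfolding c_def part_deriv_scut[OF s'(1)] by (simp add: divide_inverse del: of_nat_Suc)
 have pc: "\<bar>p x * pd i (c n) x\<bar> \<le> 4 * M * Bq" if x: "x \<in> Om" for n x
 proof -
  define t where "t = (1 - (norm x)^2) * real (Suc n)"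
  have nx: "norm x < 1" using x by simp
  then have rp: "0 \<le> 1 - (norm x)^2" by (simp add: abs_square_le_1)
  have xi: "\<bar>x $ i\<bar> \<le> 1" using component_le_norm_cart[of x i] nx by linarith
  have Bq0: "0 \<le> Bq" using Bq[of x] nx by (auto intro: order_trans[OF abs_ge_zero])
  \<comment> \<open>In the variable \<open>t\<close> the factor \<open>Suc n\<close> is absorbed,
    and \<open>t * s' t\<close> is bounded by \<open>2 * M\<close> because \<open>s'\<close>
    vanishes beyond 2.\<close>
  have "p x * pd i (c n) x = - 2 * ((t * s' t) * (q x * x $ i))"
   unfolding pdc p_def t_def by (simp add: algebra_simps)
  then have "\<bar>p x * pd i (c n) x\<bar> = 2 * (\<bar>t * s' t\<bar> * (\<bar>q x\<bar> * \<bar>x $ i\<bar>))" by (simp add: abs_mult)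
  also have "\<dots> \<le> 2 * ((2 * M) * (Bq * 1))"
  proof (intro mult_left_mono mult_mono)
   show "\<bar>t * s' t\<bar> \<le> 2 * M"
   proof (cases "t > 2")
    case True then show ?thesis using s'(3,4) by simp
   next
    case False
    have "0 \<le> t" unfolding t_def using rp by (intro mult_nonneg_nonneg) auto
    then show ?thesis unfolding abs_mult using False s'(2)[of t] by (intro mult_mono) auto
   qed
   show "\<bar>q x\<bar> \<le> Bq" using Bq[of x] nx by simp
  qed (use xi s'(4) Bq0 in auto)
  finally show ?thesis by simp
 qed
 have test: "(\<lambda>x. c n x * p x) \<in> test_functions Om" for n
 proof (rule inner_test_function[where c="inverse (real (Suc n))"])
  show "elem (\<lambda>x. c n x * p x)" by (intro elementary.mult ce pe)
  fix x assume "c n x * p x \<noteq> 0"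
  then have "c n x \<noteq> 0" by auto
  then have "\<not> (1 - (norm x)^2) * real (Suc n) \<le> 1" using step_0 by (auto simp: c_def scut_def divide_inverse simp del: of_nat_Suc)
  then have "1 / real (Suc n) < 1 - (norm x)^2" by (simp add: field_simps del: of_nat_Suc)
  then show "(norm x)^2 \<le> 1 - inverse (real (Suc n))" by (simp add: inverse_eq_divide del: of_nat_Suc)
 qed simp
 have pcp: "pd i (\<lambda>x. c n x * p x) x = pd i (c n) x * p x + c n x * pd i p x" for n x
  by (rule part_deriv_mult) (intro elem_UNIV_differentiable ce pe)+
 define h where "h n x = (pd i (c n) x * p x + c n x * pd i p x) *\<^sub>R u x + (c n x * p x) *\<^sub>R u' x" for n x
 have ii: "integrable ?M (\<lambda>x. pd i (\<lambda>x. c n x * p x) x *\<^sub>R u x)" "integrable ?M (\<lambda>x. (c n x * p x) *\<^sub>R u' x)" for n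
  using test_integrable[OF test Oml] has_weak_derivD[OF u(1)] by auto
 have h0: "(\<integral>x. h n x \<partial>?M) = 0" for n
  using has_weak_derivD(3)[OF u(1) test, of n] ii[of n] unfolding h_def pcp by simp
 have "(\<lambda>n. \<integral>x. h n x \<partial>?M) \<longlonglongrightarrow> (\<integral>x. pd i p x *\<^sub>R u x + p x *\<^sub>R u' x \<partial>?M)"
 proof (rule integral_dominated_convergence[where w="\<lambda>x. (4 * M * Bq + Bd) * norm (u x) + Bp * norm (u' x)"])
  show "integrable ?M (\<lambda>x. (4 * M * Bq + Bd) * norm (u x) + Bp * norm (u' x))" using ui by auto
  show "h n \<in> borel_measurable ?M" for n
   using ii[of n] unfolding h_def pcp by (intro borel_measurable_add) auto
  show "(\<lambda>x. pd i p x *\<^sub>R u x + p x *\<^sub>R u' x) \<in> borel_measurable ?M"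
   using ui elem_UNIV_lebesgue_on[OF pe] elem_UNIV_lebesgue_on[OF pd_elem[OF pe]] by auto
  show "AE x in ?M. norm (h n x) \<le> (4 * M * Bq + Bd) * norm (u x) + Bp * norm (u' x)" for n
  proof (rule AE_I2)
   fix x assume "x \<in> space ?M"
   then have x: "x \<in> Om" "norm x \<le> 1" by auto
   have 1: "\<bar>pd i (c n) x * p x + c n x * pd i p x\<bar> \<le> 4 * M * Bq + 1 * Bd"
   proof (rule order_trans[OF abs_triangle_ineq add_mono])
    show "\<bar>pd i (c n) x * p x\<bar> \<le> 4 * M * Bq" using pc[OF x(1), of n] by (simp add: mult.commute)
    show "\<bar>c n x * pd i p x\<bar> \<le> 1 * Bd" unfolding abs_mult
     using c01[of n x] Bd[OF x(2)] by (intro mult_mono) auto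
   qed
   have 2: "\<bar>c n x * p x\<bar> \<le> 1 * Bp" unfolding abs_mult
    using c01[of n x] Bp[OF x(2)] by (intro mult_mono) auto
   have "norm (h n x) \<le> \<bar>pd i (c n) x * p x + c n x * pd i p x\<bar> * norm (u x) + \<bar>c n x * p x\<bar> * norm (u' x)"
    unfolding h_def by (rule order_trans[OF norm_triangle_ineq]) simp
   also have "\<dots> \<le> (4 * M * Bq + 1 * Bd) * norm (u x) + (1 * Bp) * norm (u' x)"
    by (intro add_mono mult_right_mono 1 2) auto
   finally show "norm (h n x) \<le> (4 * M * Bq + Bd) * norm (u x) + Bp * norm (u' x)" by simp
  qed
  show "AE x in ?M. (\<lambda>n. h n x) \<longlonglongrightarrow> pd i p x *\<^sub>R u x + p x *\<^sub>R u' x"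
  proof (rule AE_I2)
   fix x assume "x \<in> space ?M"
   then have "norm x < 1" by simp
   then have rp: "0 < 1 - (norm x)^2" by (simp add: abs_square_less_1)
   obtain n0 :: nat where n0: "2 / (1 - (norm x)^2) < real n0" using reals_Archimedean2 by blast
   have "h n x = pd i p x *\<^sub>R u x + p x *\<^sub>R u' x" if "n \<ge> n0" for n
   proof -
    have "2 / (1 - (norm x)^2) < real (Suc n)" using n0 that by simp
    then have t: "(1 - (norm x)^2) * real (Suc n) > 2" using rp by (simp add: field_simps del: of_nat_Suc)
    then have "pd i (c n) x = 0" unfolding pdc using s'(3) by simp
    moreover have "c n x = 1" using t step_1 by (simp add: c_def scut_def divide_inverse del: of_nat_Suc)
    ultimately show ?thesis by (simp add: h_def)
   qed
   then show "(\<lambda>n. h n x) \<longlonglongrightarrow> pd i p x *\<^sub>R u x + p x *\<^sub>R u' x"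
    by (intro tendsto_eventually) (auto simp: eventually_sequentially)
  qed
 qed
 then show ?thesis by (simp add: h0 LIMSEQ_const_iff)
qed

text \<open>\<open>P\<close> is arbitrary on the unit sphere, so the zero trace of \<open>w\<close>
  has to remove the boundary term. A cutoff \<zeta> splits \<open>P\<close> into an inner test
  function, handled by the weak derivative, and a part near the sphere, handled by
  \<open>has_trace_ibp\<close>.\<close>

lemma zero_trace_green:
 fixes w w' :: "real^'n \<Rightarrow> complex"
 assumes x0: "x0 \<in> Om" and w: "has_weak_deriv Om i w w'" "w \<in> L2 (leb Om)" "w' \<in> L2 (leb Om)"
  and t: "has_trace (Om0 x0) 0 1 w T" "\<And>x. norm x = 1 \<Longrightarrow> T x = 0"
  and P: "elem P"
 shows "(\<integral>x. pd i P x *\<^sub>R w x + P x *\<^sub>R w' x \<partial>leb Om) = 0"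
proof -
 let ?M = "leb (Om :: (real^'n) set)"
 have Oml: "Om \<in> sets (lebesgue :: (real^'n) measure)" by simp
 have U: "open (Om0 x0)" "bounded (Om0 x0)" by (auto intro: bounded_subset[of "ball 0 1"] open_delete)
 have U1: "(-1) * (norm (x - 0) - 1) > 0" if "x \<in> Om0 x0" for x using that by auto
 have N: "open (- {x0})" "sphere 0 1 \<subseteq> - {x0}" using x0 by auto
 have N1: "x \<in> Om0 x0" if "x \<in> - {x0}" "(-1) * (norm (x - 0) - 1) > 0" for x using that by auto
 obtain N' where N': "open N'" "sphere 0 1 \<subseteq> N'" "N' \<subseteq> - {x0}"
  and ibp: "\<And>\<eta> K v i. elem \<eta> \<Longrightarrow> compact K \<Longrightarrow> (\<And>x. \<eta> x \<noteq> 0 \<Longrightarrow> x \<in> K) \<Longrightarrow>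
   (\<And>x. x \<in> K \<Longrightarrow> (-1) * (norm (x - 0) - 1) > 0 \<Longrightarrow> x \<in> N') \<Longrightarrow>
   has_weak_deriv (Om0 x0 \<inter> N') i w v \<Longrightarrow> v \<in> L2 (leb (Om0 x0 \<inter> N')) \<Longrightarrow>
   (\<integral>x. pd i \<eta> x *\<^sub>R w x + \<eta> x *\<^sub>R v x \<partial>leb (Om0 x0 \<inter> N')) =
   - ((-1) *\<^sub>R (\<integral>t. ((t $ i - 0 $ i) / 1 * \<eta> t) *\<^sub>R T t \<partial>sphere_measure 0 1))"
  using has_trace_ibp[OF U(1,2) U1 zero_less_one _ t(1) N N1] by blast
 obtain e where e: "e > 0" "(\<Union>x\<in>sphere 0 1. ball x e) \<subseteq> N'"
  using compact_subset_open_imp_ball_epsilon_subset[OF compact_sphere N'(1,2)] by blast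
 \<comment> \<open>The shell between \<rho> and 1 lies within distance \<open>e\<close> of the unit
   sphere, hence in \<open>N'\<close>; the bound \<open>1/2\<close> keeps the radial projection
   defined.\<close>
 define \<rho> where "\<rho> = max (1/2) (1 - e / 2)"
 have \<rho>: "1/2 \<le> \<rho>" "\<rho> < 1" "1 - e < \<rho>" using e by (auto simp: \<rho>_def)
 have shell: "x \<in> N'" if "\<rho> \<le> norm x" "norm x < 1" for x
 proof -
  have x0: "norm x > 0" using that \<rho> by linarith
  define y where "y = (1 / norm x) *\<^sub>R x"
  have "x - y = (1 - 1 / norm x) *\<^sub>R x" by (simp add: y_def algebra_simps)
  then have "norm (x - y) = \<bar>1 - 1 / norm x\<bar> * norm x" by simp
  also have "\<dots> = 1 - norm x" using x0 that by (simp add: abs_if field_simps)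
  also have "\<dots> < e" using that \<rho> by linarith
  finally have "x \<in> ball y e" by (simp add: dist_norm norm_minus_commute)
  moreover have "norm y = 1" using x0 by (simp add: y_def)
  ultimately show ?thesis using e(2) by (auto simp: subset_eq)
 qed
 \<comment> \<open>With this \<open>c\<close> the cutoff \<open>rcut 0 1 c\<close> equals 1 up to
   radius \<rho> and vanishes in a neighbourhood of the unit sphere.\<close>
 define c where "c = (1 - \<rho>^2) / 2"
 have c: "c > 0" "1 - 2 * c = \<rho>^2" using \<rho> by (auto simp: c_def power2_eq_square field_simps mult_less_cancel_left1 intro: less_trans[OF mult_strict_left_mono])
 define \<zeta> where "\<zeta> = rcut (0::real^'n) 1 c"
 have \<zeta>e: "elem \<zeta>" unfolding \<zeta>_def by (rule rcut_elem)
 have \<zeta>1: "\<zeta> x = 1" if "norm x \<le> \<rho>" for x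
  unfolding \<zeta>_def using power_mono[OF that, of 2] c by (intro rcut_1) auto
 have \<zeta>0: "\<zeta> x = 0" if "(norm x)^2 \<ge> 1 - c" for x
  unfolding \<zeta>_def using that c by (intro rcut_0) auto
 \<comment> \<open>The factor \<open>rcut 0 4 1\<close> is 1 on the unit ball and only serves to
   give compact support beyond it.\<close>
 define \<eta> where "\<eta> = (\<lambda>x. rcut 0 4 1 x * ((1 - \<zeta> x) * P x))"
 have \<eta>e: "elem \<eta>" unfolding \<eta>_def by (intro elementary.mult rcut_elem elem_diff elementary.const \<zeta>e P)
 define K where "K = cball 0 2 - ball (0::real^'n) \<rho>"
 have Kc: "compact K" unfolding K_def by (intro compact_diff) auto
 have \<eta>K: "x \<in> K" if "\<eta> x \<noteq> 0" for x
 proof -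
  have "rcut 0 4 1 x \<noteq> 0" "\<zeta> x \<noteq> 1" using that by (auto simp: \<eta>_def)
  then have 1: "\<not> (norm (x - 0))^2 \<ge> 4 - 1" "\<not> norm x \<le> \<rho>" using rcut_0[of 1 4 x 0] \<zeta>1[of x] by auto
  then have "(norm x)^2 \<le> 2^2" by simp
  then have "norm x \<le> 2" by (rule power2_le_imp_le) simp
  with 1 show ?thesis by (simp add: K_def)
 qed
 have KN: "x \<in> N'" if "x \<in> K" "(-1) * (norm (x - 0) - 1) > 0" for x
  using that by (intro shell) (auto simp: K_def)
 have W: "open (Om0 x0 \<inter> N')" "Om0 x0 \<inter> N' \<subseteq> Om" using U N' by auto
 define h where "h x = pd i \<eta> x *\<^sub>R w x + \<eta> x *\<^sub>R w' x" for x
 have T0: "(\<integral>t. ((t $ i - 0 $ i) / 1 * \<eta> t) *\<^sub>R T t \<partial>sphere_measure 0 1) = (\<integral>t. 0 \<partial>sphere_measure (0::real^'n) 1)"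
  by (intro bochner_cong refl) (simp add: sphere_measure_space t(2))
 have e1: "(\<integral>x. h x \<partial>leb (Om0 x0 \<inter> N')) = 0"
  using ibp[OF \<eta>e Kc \<eta>K KN has_weak_deriv_subset[OF open_ball W w(1)] L2_subset[OF Oml open_lebesgue[OF W(1)] W(2) w(3)]]
  unfolding T0 h_def by simp
 have "(\<lambda>x. indicator Om x *\<^sub>R h x) = (\<lambda>x. indicator (Om0 x0 \<inter> N') x *\<^sub>R h x)"
 proof
  fix x
  show "indicator Om x *\<^sub>R h x = indicator (Om0 x0 \<inter> N') x *\<^sub>R h x"
  proof (cases "x \<in> K")
   case True
   then show ?thesis using KN[of x] N'(3) by (auto simp: indicator_def)
  next
   case False
   then have "\<eta> x = 0" "pd i \<eta> x = 0"
    using \<eta>K[of x] supp_part_deriv[OF compact_imp_closed[OF Kc] \<eta>K, where i=i and x=x and \<eta>=\<eta>] by blast+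
   then have "h x = 0" by (simp add: h_def)
   then show ?thesis by simp
  qed
 qed
 then have e2: "(\<integral>x. h x \<partial>?M) = 0"
  using e1 unfolding lebesgue_on_indicator(1)[OF Oml] lebesgue_on_indicator(1)[OF open_lebesgue[OF W(1)]] by simp
 define \<zeta>P where "\<zeta>P = (\<lambda>x. \<zeta> x * P x)"
 have \<zeta>Pe: "elem \<zeta>P" unfolding \<zeta>P_def by (intro elementary.mult \<zeta>e P)
 have test: "\<zeta>P \<in> test_functions Om"
 proof (rule inner_test_function[OF \<zeta>Pe c(1)])
  fix x assume "\<zeta>P x \<noteq> 0"
  then show "(norm x)^2 \<le> 1 - c" using \<zeta>0[of x] by (cases "(norm x)^2 \<ge> 1 - c") (auto simp: \<zeta>P_def)
 qed
 note ii = test_integrable(2)[OF test Oml has_weak_derivD(1)[OF w(1)], of i] test_integrable(1)[OF test Oml has_weak_derivD(2)[OF w(1)]]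
 have \<eta>Om: "\<eta> x = P x - \<zeta>P x" if "x \<in> Om" for x
 proof -
  have "norm x \<le> 1" using that by simp
  from power_mono[OF this, of 2] have "rcut 0 4 1 x = 1" by (intro rcut_1) auto
  then show ?thesis by (simp add: \<eta>_def \<zeta>P_def algebra_simps)
 qed
 have pOm: "pd i \<eta> x = pd i P x - pd i \<zeta>P x" if "x \<in> Om" for x
  using part_deriv_cong[OF open_ball that \<eta>Om, where i=i] pd_diff[OF P \<zeta>Pe, where i=i] by simp
 have "(\<integral>x. h x \<partial>?M) = (\<integral>x. (pd i P x *\<^sub>R w x + P x *\<^sub>R w' x) - (pd i \<zeta>P x *\<^sub>R w x + \<zeta>P x *\<^sub>R w' x) \<partial>?M)"
  by (intro bochner_cong refl) (simp add: h_def \<eta>Om pOm algebra_simps)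
 also have "\<dots> = (\<integral>x. pd i P x *\<^sub>R w x + P x *\<^sub>R w' x \<partial>?M) - (\<integral>x. pd i \<zeta>P x *\<^sub>R w x + \<zeta>P x *\<^sub>R w' x \<partial>?M)"
  by (intro bochner_diff Bochner_Integration.integrable_add ii Om_poly_integrable P pd_elem w)
 also have "(\<integral>x. pd i \<zeta>P x *\<^sub>R w x + \<zeta>P x *\<^sub>R w' x \<partial>?M) = 0"
  using has_weak_derivD(3)[OF w(1) test] ii by simp
 finally show ?thesis using e2 by simp
qed

text \<open>Two integrations by parts, with the two boundary conditions used once each: the first
  relies on the zero trace of \<open>w\<close>, as the derivatives of \<open>p\<close> need not
  vanish on the sphere, and the second on the vanishing of \<open>p\<close>.\<close>

lemma green_weak:
 fixes w :: "real^'n \<Rightarrow> complex"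
 assumes x0: "x0 \<in> Om"
  and w: "\<And>i. has_weak_deriv Om i w (v i)" "w \<in> L2 (leb Om)" "\<And>i. v i \<in> L2 (leb Om)"
   "\<And>i. has_weak_deriv Om i (v i) (v2 i)" "\<And>i. v2 i \<in> L2 (leb Om)"
  and t: "has_trace (Om0 x0) 0 1 w T" "\<And>x. norm x = 1 \<Longrightarrow> T x = 0"
  and q: "elem q"
 defines "p \<equiv> \<lambda>x. (1 - (norm x)^2) * q x"
 shows "(\<integral>x. lap p x *\<^sub>R w x \<partial>leb Om) = (\<integral>x. p x *\<^sub>R (\<Sum>i\<in>UNIV. v2 i x) \<partial>leb Om)"
proof -
 let ?M = "leb (Om :: (real^'n) set)"
 have pe: "elem p" unfolding p_def by (intro elementary.mult elem_rho q)
 note ii = Om_poly_integrable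
 have p_app: "p x = (1 - (norm x)^2) * q x" for x by (simp add: p_def)
 have 1: "(\<integral>x. pd i (pd i p) x *\<^sub>R w x \<partial>?M) = (\<integral>x. p x *\<^sub>R v2 i x \<partial>?M)" for i
 proof -
  have a: "(\<integral>x. pd i (pd i p) x *\<^sub>R w x \<partial>?M) + (\<integral>x. pd i p x *\<^sub>R v i x \<partial>?M) = 0"
   using zero_trace_green[OF x0 w(1,2,3) t pd_elem[OF pe], of i i] ii[OF pd_elem[OF pd_elem[OF pe]] w(2), of i i] ii[OF pd_elem[OF pe] w(3), of i i]
   by simp
  have b: "(\<integral>x. pd i p x *\<^sub>R v i x \<partial>?M) + (\<integral>x. p x *\<^sub>R v2 i x \<partial>?M) = 0"
   using rho_vanish_green[OF w(4,3,5) q, of i] ii[OF pd_elem[OF pe] w(3), of i i] ii[OF pe w(5), of i]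
   unfolding p_def[symmetric] p_app[symmetric] by simp
  from a b show ?thesis by (simp add: eq_neg_iff_add_eq_0[symmetric])
 qed
 have "(\<integral>x. lap p x *\<^sub>R w x \<partial>?M) = (\<Sum>i\<in>UNIV. \<integral>x. pd i (pd i p) x *\<^sub>R w x \<partial>?M)"
  unfolding lap_def scaleR_sum_left by (intro Bochner_Integration.integral_sum ii pd_elem pe w)
 also have "\<dots> = (\<Sum>i\<in>UNIV. \<integral>x. p x *\<^sub>R v2 i x \<partial>?M)" unfolding 1 ..
 also have "\<dots> = (\<integral>x. p x *\<^sub>R (\<Sum>i\<in>UNIV. v2 i x) \<partial>?M)"
  unfolding scaleR_sum_right by (intro Bochner_Integration.integral_sum[symmetric] ii pe w)
 finally show ?thesis .
qed

section \<open>The Green function\<close>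

lemma norm_powr_square: "norm (x::'a::real_normed_vector) powr (2 * b) = ((norm x)^2) powr b"
proof (cases "x = 0")
 case False
 then show ?thesis using powr_powr[of "norm x" 2 b] by (simp add: powr_numeral)
qed simp

text \<open>\<open>|y|^2\<close> times the squared distance from \<open>x\<close> to the image point
  \<open>y / |y|^2\<close>, written in a form that is polynomial also at
  \<open>y = 0\<close>.\<close>

definition hs :: "real^'n \<Rightarrow> real^'n \<Rightarrow> real" where
 "hs x y = 1 - 2 * (x \<bullet> y) + (norm x)^2 * (norm y)^2"

text \<open>The form that explains the boundary values of the Green function: if one of the points
  is on the unit sphere this is the squared distance, and for points inside it is larger.\<close>

lemma hs_eq: "hs x y = (norm (x - y))^2 + (1 - (norm x)^2) * (1 - (norm y)^2)"
 by (simp add: hs_def power2_norm_eq_inner inner_diff_left inner_diff_right inner_commute algebra_simps)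

text \<open>The Cauchy-Schwarz inequality; it keeps the image term away from its singularity as long
  as \<open>norm x * norm y < 1\<close>.\<close>

lemma hs_lower: "(1 - norm x * norm y)^2 \<le> hs x y"
 using norm_cauchy_schwarz[of x y] by (simp add: hs_def power2_eq_square algebra_simps)

lemma hs_nonneg: "0 \<le> hs x y"
 using hs_lower[of x y] by (meson order_trans zero_le_power2)

lemma hs_commute: "hs x y = hs y x"
 by (simp add: hs_def inner_commute mult.commute)

lemma hs_pos: "norm x < 1 \<Longrightarrow> norm y \<le> 1 \<Longrightarrow> (1 - norm x)^2 \<le> hs x y \<and> 0 < hs x y"
proof -
 assume a: "norm x < 1" "norm y \<le> 1"
 then have "norm x * norm y \<le> norm x * 1" by (intro mult_left_mono) auto
 then have "(1 - norm x)^2 \<le> (1 - norm x * norm y)^2" using a by (intro power_mono) auto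
 also have "\<dots> \<le> hs x y" by (rule hs_lower)
 finally have "(1 - norm x)^2 \<le> hs x y" .
 moreover have "0 < (1 - norm x)^2" using a by simp
 ultimately show ?thesis by linarith
qed

lemma elem_hs: "elementary U (hs x)"
 unfolding hs_def by (intro elem_simps)

text \<open>The exponents are halved so that the powers act on squared distances, which are smooth.
  The limit value 1 prescribed at \<open>y = 0\<close> is the value of the image term there, since
  \<open>hs x 0 = 1\<close>.\<close>

lemma G_eq:
 "G x (y::real^'n) = C_dim TYPE('n) * (((norm (x - y))^2) powr ((2 - real CARD('n)) / 2) - hs x y powr ((2 - real CARD('n)) / 2))"
proof -
 define a where "a = (2 - real CARD('n)) / 2"
 have a2: "2 - real CARD('n) = 2 * a" by (simp add: a_def)
 have "(if y = 0 then 1 else norm y powr (2 * a) * norm (x - (1 / (norm y)^2) *\<^sub>R y) powr (2 * a)) = hs x y powr a"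
 proof (cases "y = 0")
  case True then show ?thesis by (simp add: hs_def)
 next
  case False
  let ?y = "x - (1 / (norm y)^2) *\<^sub>R y"
  have "(norm ?y)^2 = x \<bullet> x - 2 * ((1 / (norm y)^2) * (x \<bullet> y)) + (1 / (norm y)^2) * ((1 / (norm y)^2) * (y \<bullet> y))"
   by (simp add: power2_norm_eq_inner inner_diff_left inner_diff_right inner_commute)
  then have "(norm y)^2 * (norm ?y)^2 = hs x y"
   using False by (simp add: hs_def power2_norm_eq_inner[symmetric] field_simps power2_eq_square)
  then show ?thesis
   using False by (simp only: norm_powr_square if_False powr_mult[symmetric] zero_le_power2)
 qed
 then show ?thesis unfolding G_def a2 norm_powr_square[of "x - y"] by (simp add: a_def[symmetric])
qed

lemma G_commute: "G x y = G y x"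
 by (simp add: G_eq hs_commute norm_minus_commute)

section \<open>Laplacians of the regularized kernels\<close>

lemma pd_powr:
 assumes "elem s" "\<And>x. s x > 0"
 shows "pd i (\<lambda>x. s x powr b) = (\<lambda>x. b * s x powr (b - 1) * pd i s x)"
 by (rule ext) (intro part_deriv_powr elem_UNIV_differentiable assms)

text \<open>For such a quadratic \<open>s\<close> the exponent \<open>(2 - d) / 2\<close> makes the
  terms of order \<open>s powr (a - 1)\<close> cancel, as \<open>4 * (a - 1) + 2 * d = 0\<close>;
  only the contribution of the shift \<open>e\<close> is left. Pole and image are the cases
  \<open>k = 1\<close> and \<open>k = |x|^2\<close>.\<close>

lemma lap_powr:
 fixes s :: "real^'n \<Rightarrow> real"
 assumes s: "elem s" "\<And>x. s x > 0"
  and g: "\<And>x. (\<Sum>i\<in>UNIV. (pd i s x)^2) = 4 * k * (s x - e)"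
  and l: "\<And>x. lap s x = 2 * k * real CARD('n)"
 defines "a \<equiv> (2 - real CARD('n)) / 2"
 shows "lap (\<lambda>x. s x powr a) x = - 4 * a * (a - 1) * k * e * s x powr (a - 2)"
proof -
 have pe: "elem (\<lambda>x. b * s x powr c)" for b c by (intro elem_cmult elementary.pow s)
 have "pd i (pd i (\<lambda>x. s x powr a)) x =
   (a * (a - 1) * s x powr (a - 2)) * (pd i s x)^2 + (a * s x powr (a - 1)) * pd i (pd i s) x" for i
  unfolding pd_powr[OF s] pd_mult[OF pe pd_elem[OF s(1)]] pd_cmult[OF elementary.pow[OF s]]
  by (simp add: power2_eq_square algebra_simps)
 then have "lap (\<lambda>x. s x powr a) x = (a * (a - 1) * s x powr (a - 2)) * (4 * k * (s x - e)) + (a * s x powr (a - 1)) * lap s x"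
  unfolding lap_def by (simp add: sum.distrib sum_distrib_left[symmetric] g)
 moreover have "s x powr (a - 1) = s x * s x powr (a - 2)"
  using powr_mult_base[of "s x" "a - 2"] s(2)[of x] by simp
 moreover have "real CARD('n) = 2 - 2 * a" unfolding a_def by (simp add: field_simps)
 ultimately show ?thesis unfolding l by (simp add: algebra_simps)
qed

lemma pd_hs: "pd i (hs x) = (\<lambda>y. 2 * (norm x)^2 * y $ i - 2 * x $ i)"
proof -
 have "pd i (\<lambda>y. (1 - 2 * (x \<bullet> y)) + (norm x)^2 * (norm y)^2) = (\<lambda>y. (0 - 2 * x $ i) + (norm x)^2 * (2 * y $ i))"
  by (subst pd_add, intro elem_simps, intro elem_simps, subst pd_diff, intro elem_simps, intro elem_simps,
    subst pd_cmult, intro elem_simps, subst pd_cmult, intro elem_simps)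
   (simp add: pd_const pd_norm2_0 part_deriv_inner)
 then show ?thesis by (simp add: hs_def[abs_def] algebra_simps)
qed

lemma hs_grad: "(\<Sum>i\<in>UNIV. (pd i (hs x) y)^2) = 4 * (norm x)^2 * hs x y"
 and hs_lap: "lap (hs x) y = 2 * (norm x)^2 * real CARD('n)" for x y :: "real^'n"
proof -
 have "pd i (pd i (hs x)) y = 2 * (norm x)^2" for i
  unfolding pd_hs by (subst pd_diff, intro elem_simps, intro elem_simps, subst pd_cmult, intro elem_simps)
   (simp add: pd_const pd_coord)
 then show "lap (hs x) y = 2 * (norm x)^2 * real CARD('n)" by (simp add: lap_def)
 have "(pd i (hs x) y)^2 = 4 * (norm x)^2 * ((norm x)^2 * (y $ i)^2) - 8 * (norm x)^2 * (x $ i * y $ i) + 4 * (x $ i)^2" for i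
  unfolding pd_hs by (simp add: power2_eq_square algebra_simps)
 then have "(\<Sum>i\<in>UNIV. (pd i (hs x) y)^2) = 4 * (norm x)^2 * ((norm x)^2 * (norm y)^2) - 8 * (norm x)^2 * (x \<bullet> y) + 4 * (norm x)^2"
  by (simp add: sum.distrib sum_subtractf sum_distrib_left[symmetric] norm_pow2_vec inner_vec_def)
 then show "(\<Sum>i\<in>UNIV. (pd i (hs x) y)^2) = 4 * (norm x)^2 * hs x y" by (simp add: hs_def algebra_simps)
qed

lemma lap_add_const: "elem s \<Longrightarrow> lap (\<lambda>x. s x + e) = lap s"
 by (subst lap_add) (auto simp: lap_def pd_const intro: elem_simps)

lemma pd_add_const: "elem s \<Longrightarrow> pd i (\<lambda>x. s x + e) = pd i s"
 by (subst pd_add) (auto simp: pd_const intro: elem_simps)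

lemma lap_reg_image:
 fixes x :: "real^'n"
 assumes "e > 0"
 defines "a \<equiv> (2 - real CARD('n)) / 2"
 shows "lap (\<lambda>y. (hs x y + e) powr a) y = - 4 * a * (a - 1) * (norm x)^2 * e * (hs x y + e) powr (a - 2)"
 unfolding a_def using assms(1) hs_nonneg[of x]
 by (intro lap_powr elem_simps elem_hs) (auto simp: pd_add_const lap_add_const elem_hs hs_grad hs_lap intro: add_nonneg_pos)

lemma lap_reg_pole:
 fixes x :: "real^'n"
 assumes "e > 0"
 defines "a \<equiv> (2 - real CARD('n)) / 2"
 shows "lap (\<lambda>y. ((norm (y - x))^2 + e) powr a) y = - 4 * a * (a - 1) * e * ((norm (y - x))^2 + e) powr (a - 2)"
proof -
 have g: "(\<Sum>i\<in>UNIV. (pd i (\<lambda>y. (norm (y - x))^2) y)^2) = 4 * (norm (y - x))^2" for y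
  unfolding pd_norm2 norm_pow2_vec[of "y - x"] by (simp add: sum_distrib_left power2_eq_square algebra_simps)
 have l: "lap (\<lambda>y. (norm (y - x))^2) y = 2 * real CARD('n)" for y
  unfolding lap_def pd_norm2 by (subst pd_cmult, intro elem_simps, subst pd_diff, intro elem_simps, intro elem_simps)
   (simp add: pd_const pd_coord)
 have "lap (\<lambda>y. ((norm (y - x))^2 + e) powr a) y = - 4 * a * (a - 1) * 1 * e * ((norm (y - x))^2 + e) powr (a - 2)"
  unfolding a_def using assms(1)
  by (intro lap_powr elem_simps) (auto simp: pd_add_const lap_add_const elem_norm2 g l intro: add_nonneg_pos)
 then show ?thesis by simp
qed

lemma sphere_space_norm: "t \<in> space (sphere_measure a r) \<Longrightarrow> norm (t - a) = r"
 by (simp add: sphere_measure_space dist_norm norm_minus_commute)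

lemma normal_integrable:
 fixes T :: "real^'n \<Rightarrow> complex"
 assumes r: "r > 0" and T: "integrable (sphere_measure a r) T"
 shows "integrable (sphere_measure a r) (\<lambda>t. ((t $ i - a $ i) / r) *\<^sub>R T t)"
proof (rule integrable_bounded_mult[OF T, where B=1])
 show "(\<lambda>t. (t $ i - a $ i) / r) \<in> borel_measurable (sphere_measure a r)"
  by (intro continuous_sphere_measurable continuous_intros) (use r in auto)
 show "AE t in sphere_measure a r. \<bar>(t $ i - a $ i) / r\<bar> \<le> 1"
 proof (rule AE_I2)
  fix t assume "t \<in> space (sphere_measure a r)"
  then show "\<bar>(t $ i - a $ i) / r\<bar> \<le> 1" using component_le_norm_cart[of "t - a" i] r by (simp add: sphere_space_norm)
 qed
qed

lemma cball_subset_Om: "r < 1 - norm x0 \<Longrightarrow> cball x0 r \<subseteq> (Om :: (real^'n) set)"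
proof
 fix y :: "real^'n" assume "r < 1 - norm x0" "y \<in> cball x0 r"
 then show "y \<in> Om" using norm_triangle_sub[of y x0] by (simp add: dist_norm norm_minus_commute)
qed

text \<open>On the sphere the field \<open>(y - x) * \<phi>\<close> has the constant normal
  component \<open>r * c\<close>, so its flux is this constant times the surface area.\<close>

lemma divergence_radial:
 fixes x :: "real^'n"
 assumes r: "r > 0" and \<phi>: "elem \<phi>" and c: "\<And>t. norm (t - x) = r \<Longrightarrow> \<phi> t = c"
 shows "(\<integral>y. (\<Sum>i\<in>UNIV. pd i (\<lambda>y. (y $ i - x $ i) * \<phi> y) y) \<partial>leb (ball x r)) =
  c * (real CARD('n) * r ^ CARD('n) * measure lebesgue (ball (0::real^'n) 1))"
proof -
 have e: "elem (\<lambda>y. (y $ i - x $ i) * \<phi> y)" for i by (intro elem_simps \<phi>)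
 have i: "integrable (sphere_measure x r) (\<lambda>t. (t $ i - x $ i) / r * ((t $ i - x $ i) * \<phi> t))" for i
  by (intro sphere_integrable_continuous r elem_UNIV_continuous elem_simps \<phi>)
 have "(\<integral>y. (\<Sum>i\<in>UNIV. pd i (\<lambda>y. (y $ i - x $ i) * \<phi> y) y) \<partial>leb (ball x r)) =
   (\<Sum>i\<in>UNIV. \<integral>t. (t $ i - x $ i) / r * ((t $ i - x $ i) * \<phi> t) \<partial>sphere_measure x r)"
  by (simp add: Bochner_Integration.integral_sum elem_integrable_ball pd_elem[OF e] divergence_ball[OF r e])
 also have "\<dots> = (\<integral>t. (\<Sum>i\<in>UNIV. (t $ i - x $ i) / r * ((t $ i - x $ i) * \<phi> t)) \<partial>sphere_measure x r)"
  by (rule Bochner_Integration.integral_sum[symmetric]) (rule i)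
 also have "\<dots> = (\<integral>t. r * c * 1 \<partial>sphere_measure x r)"
 proof (rule bochner_cong[OF refl])
  fix t assume "t \<in> space (sphere_measure x r)"
  then have t: "norm (t - x) = r" by (rule sphere_space_norm)
  have "(t $ i - x $ i) / r * ((t $ i - x $ i) * \<phi> t) = (t $ i - x $ i)^2 * (\<phi> t / r)" for i
   by (simp add: power2_eq_square)
  then have "(\<Sum>i\<in>UNIV. (t $ i - x $ i) / r * ((t $ i - x $ i) * \<phi> t)) = (norm (t - x))^2 * (\<phi> t / r)"
   by (simp only: norm_pow2_vec[of "t - x"] sum_distrib_right vector_minus_component)
  then show "(\<Sum>i\<in>UNIV. (t $ i - x $ i) / r * ((t $ i - x $ i) * \<phi> t)) = r * c * 1"
   using t c r by (simp add: power2_eq_square)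
 qed
 also have "\<dots> = r * c * (\<integral>t. 1 \<partial>sphere_measure x r)" by (rule Bochner_Integration.integral_mult_right_zero)
 also have "\<dots> = c * (real CARD('n) * (r * r ^ (CARD('n) - 1)) * measure lebesgue (ball (0::real^'n) 1))"
  unfolding sphere_total[OF r] by simp
 also have "r * r ^ (CARD('n) - 1) = r ^ CARD('n)" by (simp add: power_eq_if)
 finally show ?thesis .
qed

lemma AE_neq: "AE y in leb S. y \<noteq> (x::real^'n)" if "S \<in> sets lebesgue"
proof -
 have "{x} \<in> null_sets lebesgue" using negligible_sing negligible_iff_null_sets by blast
 then have "AE y in lebesgue. y \<noteq> x" using AE_not_in by fastforce
 then show ?thesis unfolding AE_lebesgue_on_iff[OF that] by (auto elim: AE_mp)
qed

text \<open>For the regularized power \<open>s powr b\<close> the divergence of the field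
  \<open>(y - x) * s powr b\<close> dominates \<open>(d + 2 * b)\<close> times the power, since
  \<open>b <= 0\<close>. The divergence theorem then bounds the integrals independently of the
  regularization, which monotone convergence removes.\<close>

lemma singular_integrable:
 fixes x :: "real^'n"
 assumes r: "r > 0" and b: "- real CARD('n) < 2 * b" "b \<le> 0"
 defines "B \<equiv> ((r^2) powr b) * (real CARD('n) * r ^ CARD('n) * measure lebesgue (ball (0::real^'n) 1)) / (real CARD('n) + 2 * b)"
 shows "integrable (leb (ball x r)) (\<lambda>y. ((norm (y - x))^2) powr b)"
  "(\<integral>y. ((norm (y - x))^2) powr b \<partial>leb (ball x r)) \<le> B"
proof -
 let ?M = "leb (ball x r)"
 define s where "s e y = (norm (y - x))^2 + e" for e y
 have se: "elem (s e)" for e unfolding s_def by (intro elem_simps)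
 have sp: "s e y > 0" if "e > 0" for e y using that by (auto simp: s_def intro: add_nonneg_pos)
 have d0: "real CARD('n) + 2 * b > 0" using b by simp
 have pe: "elem (\<lambda>y. s e y powr b)" if "e > 0" for e by (intro elementary.pow se sp that)
 have bound: "(\<integral>y. s e y powr b \<partial>?M) \<le> B" if e: "e > 0" for e
 proof -
  have pd: "(\<Sum>i\<in>UNIV. pd i (\<lambda>y. (y $ i - x $ i) * s e y powr b) y) =
   real CARD('n) * s e y powr b + 2 * b * (norm (y - x))^2 * s e y powr (b - 1)" for y
  proof -
   have "pd i (\<lambda>y. (y $ i - x $ i) * s e y powr b) y =
     s e y powr b + 2 * b * s e y powr (b - 1) * (y $ i - x $ i)^2" for i
   proof -
    have "pd i (\<lambda>y. y $ i - x $ i) = (\<lambda>y. 1)"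
     by (subst pd_diff, intro elem_simps, intro elem_simps) (simp add: pd_coord pd_const)
    moreover have "pd i (\<lambda>y. (y $ i - x $ i) * s e y powr b) = (\<lambda>y. pd i (\<lambda>y. y $ i - x $ i) y * s e y powr b + (y $ i - x $ i) * pd i (\<lambda>y. s e y powr b) y)"
     by (intro pd_mult elem_simps pe e)
    moreover have "pd i (s e) = (\<lambda>y. 2 * (y $ i - x $ i))"
     unfolding s_def[abs_def] by (simp add: pd_add_const elem_norm2 pd_norm2)
    ultimately show ?thesis
     by (simp add: pd_powr[OF se sp[OF e]] power2_eq_square algebra_simps)
   qed
   then show ?thesis by (simp add: sum.distrib norm_pow2_vec sum_distrib_left algebra_simps)
  qed
  have ge: "(real CARD('n) + 2 * b) * s e y powr b \<le> (\<Sum>i\<in>UNIV. pd i (\<lambda>y. (y $ i - x $ i) * s e y powr b) y)" for y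
  proof -
   have "(norm (y - x))^2 * s e y powr (b - 1) \<le> s e y * s e y powr (b - 1)"
    using e by (intro mult_right_mono) (auto simp: s_def)
   also have "\<dots> = s e y powr b" using powr_mult_base[of "s e y" "b - 1"] sp[OF e, of y] by simp
   finally have "2 * b * s e y powr b \<le> 2 * b * ((norm (y - x))^2 * s e y powr (b - 1))"
    using b by (intro mult_left_mono_neg) auto
   then show ?thesis unfolding pd by (simp add: algebra_simps)
  qed
  have "(real CARD('n) + 2 * b) * (\<integral>y. s e y powr b \<partial>?M) = (\<integral>y. (real CARD('n) + 2 * b) * s e y powr b \<partial>?M)" by simp
  also have "\<dots> \<le> (\<integral>y. (\<Sum>i\<in>UNIV. pd i (\<lambda>y. (y $ i - x $ i) * s e y powr b) y) \<partial>?M)"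
   by (intro integral_mono ge elem_integrable_ball elem_simps pd_elem pe e)
  also have "\<dots> = ((r^2 + e) powr b) * (real CARD('n) * r ^ CARD('n) * measure lebesgue (ball (0::real^'n) 1))"
   by (intro divergence_radial r pe e) (simp add: s_def)
  also have "\<dots> \<le> ((r^2) powr b) * (real CARD('n) * r ^ CARD('n) * measure lebesgue (ball (0::real^'n) 1))"
   using r e b by (intro mult_right_mono powr_mono2') auto
  finally show ?thesis unfolding B_def using d0 by (simp add: pos_le_divide_eq mult.commute)
 qed
 define e where "e n = inverse (real (Suc n))" for n
 have ep: "e n > 0" for n by (simp add: e_def)
 have el: "e \<longlonglongrightarrow> 0" unfolding e_def by (rule LIMSEQ_inverse_real_of_nat)
 have edec: "e n \<le> e m" if "m \<le> n" for m n using that by (auto simp: e_def field_simps)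
 have mono: "s (e m) y powr b \<le> s (e n) y powr b" if "m \<le> n" for m n y
  using sp[OF ep, of n y] edec[OF that] b by (intro powr_mono2') (auto simp: s_def)
 have ii: "integrable ?M (\<lambda>y. s (e n) y powr b)" for n by (intro elem_integrable_ball pe ep)
 have inc: "incseq (\<lambda>n. \<integral>y. s (e n) y powr b \<partial>?M)"
  by (intro monoI integral_mono ii mono)
 then obtain L where L: "(\<lambda>n. \<integral>y. s (e n) y powr b \<partial>?M) \<longlonglongrightarrow> L" "\<forall>i. (\<integral>y. s (e i) y powr b \<partial>?M) \<le> L"
  using bound[OF ep] by (elim incseq_convergent) auto
 have LB: "L \<le> B" by (rule LIMSEQ_le_const2[OF L(1)]) (use bound[OF ep] in auto)
 have lim: "AE y in ?M. (\<lambda>n. s (e n) y powr b) \<longlonglongrightarrow> ((norm (y - x))^2) powr b"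
 proof (rule AE_mp[OF AE_neq[of "ball x r" x]])
  show "AE y in ?M. y \<noteq> x \<longrightarrow> (\<lambda>n. s (e n) y powr b) \<longlonglongrightarrow> ((norm (y - x))^2) powr b"
  proof (intro AE_I2 impI)
   fix y assume "y \<noteq> x"
   moreover have "(\<lambda>n. s (e n) y) \<longlonglongrightarrow> (norm (y - x))^2 + 0" unfolding s_def by (intro tendsto_intros el)
   ultimately show "(\<lambda>n. s (e n) y powr b) \<longlonglongrightarrow> ((norm (y - x))^2) powr b"
    by (intro tendsto_powr) auto
  qed
 qed simp
 have m: "(\<lambda>y. ((norm (y - x))^2) powr b) \<in> borel_measurable ?M"
  by (intro borel_imp_lebesgue_on) measurable
 have mo: "AE y in ?M. mono (\<lambda>n. s (e n) y powr b)" by (intro AE_I2 monoI mono)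
 show "integrable ?M (\<lambda>y. ((norm (y - x))^2) powr b)"
  by (rule integrable_monotone_convergence[OF ii mo lim L(1) m])
 show "(\<integral>y. ((norm (y - x))^2) powr b \<partial>?M) \<le> B"
  using integral_monotone_convergence[OF ii mo lim L(1) m] LB by simp
qed

lemma Om_subset_ball: "(x::real^'n) \<in> Om \<Longrightarrow> Om \<subseteq> ball x 2"
proof
 fix y :: "real^'n" assume "x \<in> Om" "y \<in> Om"
 then show "y \<in> ball x 2" using norm_triangle_ineq4[of x y] by (simp add: dist_norm)
qed

lemma sphere_area:
 "measure (sphere_measure (0::real^'n) 1) (sphere 0 1) = real CARD('n) * measure lebesgue (ball (0::real^'n) 1)"
 "0 < measure lebesgue (ball (0::real^'n) 1)"
proof -
 have "(\<integral>t. 1 \<partial>sphere_measure (0::real^'n) 1) = measure (sphere_measure (0::real^'n) 1) (sphere 0 1)"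
  by (simp add: sphere_measure_space)
 then show "measure (sphere_measure (0::real^'n) 1) (sphere 0 1) = real CARD('n) * measure lebesgue (ball (0::real^'n) 1)"
  using sphere_total[of 1 "0::real^'n"] by simp
 show "0 < measure lebesgue (ball (0::real^'n) 1)" using content_ball_pos[of 1 "0::real^'n"] by simp
qed

text \<open>Inside the ball \<open>hs x y\<close> is at least the squared distance, so with a
  nonpositive exponent both powers lie between 0 and the singular kernel, and so does their
  difference. The bound is independent of \<open>e\<close> and serves as majorant.\<close>

lemma Green_kernel_bound:
 fixes x :: "real^'n"
 assumes "x \<in> Om" "y \<in> Om" "y \<noteq> x" "a \<le> 0" "e \<ge> 0"
 shows "\<bar>((norm (y - x))^2 + e) powr a - (hs x y + e) powr a\<bar> \<le> ((norm (y - x))^2) powr a"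
proof -
 have "(norm x)^2 \<le> 1" "(norm y)^2 \<le> 1" using assms by (simp_all add: abs_square_le_1)
 then have "(norm (y - x))^2 \<le> hs x y" unfolding hs_eq by (simp add: norm_minus_commute)
 moreover have "0 < (norm (y - x))^2" using assms by simp
 ultimately have "(hs x y + e) powr a \<le> ((norm (y - x))^2 + e) powr a"
  "((norm (y - x))^2 + e) powr a \<le> ((norm (y - x))^2) powr a"
  using assms by (intro powr_mono2'; linarith)+
 then show ?thesis using powr_ge_zero[of "hs x y + e" a] by linarith
qed

text \<open>The field \<open>g * grad p - p * grad g\<close> vanishes on the unit sphere along with
  both functions, so its divergence has integral 0.\<close>

lemma vanishing_green_identity:
 fixes g p :: "real^'n \<Rightarrow> real"
 assumes g: "elem g" "\<And>x. norm x = 1 \<Longrightarrow> g x = 0"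
  and p: "elem p" "\<And>x. norm x = 1 \<Longrightarrow> p x = 0"
 shows "(\<integral>x. g x * lap p x \<partial>leb Om) = (\<integral>x. p x * lap g x \<partial>leb Om)"
proof -
 let ?M = "leb (Om :: (real^'n) set)"
 define F where "F i x = g x * pd i p x - p x * pd i g x" for i x
 have Fe: "elem (F i)" for i unfolding F_def by (intro elem_simps g p pd_elem)
 have "pd i (F i) x = g x * pd i (pd i p) x - p x * pd i (pd i g) x" for i x
  unfolding F_def by (simp add: pd_diff pd_mult elem_simps g p pd_elem algebra_simps)
 then have "(\<Sum>i\<in>UNIV. pd i (F i) x) = g x * lap p x - p x * lap g x" for x
  by (simp add: lap_def sum_subtractf sum_distrib_left)
 then have "(\<integral>x. g x * lap p x - p x * lap g x \<partial>?M) = (\<Sum>i\<in>UNIV. \<integral>x. pd i (F i) x \<partial>?M)"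
  by (simp add: Bochner_Integration.integral_sum[symmetric] elem_integrable_ball pd_elem[OF Fe])
 also have "\<dots> = 0"
  by (intro sum.neutral ballI divergence_vanish Fe) (simp add: F_def g p)
 finally show ?thesis
  by (simp add: elem_integrable_ball elem_simps g p lap_elem)
qed

text \<open>\<open>\<Delta>\<close> of the regularized fundamental solution is an approximate identity up to the factor
 \<open>(2 - d)\<sigma>\<^sub>d\<close>. Its mass is computed on the ball of radius 2 around \<open>x\<close>, which contains \<open>\<Omega>\<close>.\<close>

lemma pole_mass_limit:
 fixes x :: "real^'n" and p :: "real^'n \<Rightarrow> real"
 assumes dim: "CARD('n) \<ge> 3" and x: "x \<in> Om" and p: "elem p"
  and e: "\<And>n. e n > 0" "e \<longlonglongrightarrow> 0"
 defines "a \<equiv> (2 - real CARD('n)) / 2"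
 shows "(\<lambda>n. \<integral>y. p y * lap (\<lambda>y. ((norm (y - x))^2 + e n) powr a) y \<partial>leb Om)
  \<longlonglongrightarrow> (2 - real CARD('n)) * (real CARD('n) * measure lebesgue (ball (0::real^'n) 1)) * p x"
proof -
 let ?B = "leb (ball x 2)"
 define V where "V = measure lebesgue (ball (0::real^'n) 1)"
 have Oml: "Om \<in> sets (lebesgue :: (real^'n) measure)" "ball x 2 \<in> sets (lebesgue :: (real^'n) measure)" by simp_all
 have a: "a < 0" "2 * a = 2 - real CARD('n)" using dim by (simp_all add: a_def)
 define s where "s n y = (norm (y - x))^2 + e n" for n y
 have se: "elem (s n)" for n unfolding s_def by (intro elem_simps)
 have sp: "s n y > 0" for n y using e by (auto simp: s_def intro: add_nonneg_pos)
 define k where "k n = lap (\<lambda>y. s n y powr a)" for n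
 have ke: "elem (k n)" for n unfolding k_def by (intro lap_elem elementary.pow se sp)
 have k: "k n y = - (4 * a * (a - 1)) * e n * s n y powr (a - 2)" for n y
  unfolding k_def s_def using lap_reg_pole[OF e(1), of x n y, folded a_def] by simp
 have c0: "4 * a * (a - 1) \<ge> 0" using a by (intro mult_nonpos_nonpos) auto
 \<comment> \<open>\<open>p\<close>, continued by 0 outside the unit ball, minus its value at
   \<open>x\<close>. Its growth is linear in the distance from \<open>x\<close>; outside the unit
   ball this holds because that distance is at least \<open>1 - norm x\<close>.\<close>
 define f where "f y = indicator Om y * p y - p x" for y
 have "elem (\<lambda>y. rcut 0 4 1 y * p y)" by (intro elementary.mult rcut_elem p)
 moreover have "rcut 0 4 1 y * p y = 0" if "norm y > 2" for y :: "real^'n"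
  using power_strict_mono[OF that, of 2] rcut_0[of 1 4 y 0] by simp
 ultimately obtain L where L: "\<And>y z. \<bar>rcut 0 4 1 y * p y - rcut 0 4 1 z * p z\<bar> \<le> L * norm (y - z)" "L \<ge> 0"
  using elem_supp_bounds[of "\<lambda>y. rcut 0 4 1 y * p y" 2] by blast
 have r1: "rcut 0 4 1 y = 1" if "y \<in> Om" for y :: "real^'n"
 proof (rule rcut_1)
  have "norm y \<le> 1" using that by simp
  from power_mono[OF this, of 2] show "(norm (y - 0))^2 \<le> 4 - 2 * 1" by simp
 qed simp
 define L' where "L' = L + \<bar>p x\<bar> / (1 - norm x)"
 have x1: "1 - norm x > 0" using x by simp
 have L'0: "L' \<ge> 0" using L x1 by (simp add: L'_def)
 have fL: "\<bar>f y\<bar> \<le> L' * norm (y - x)" for y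
 proof (cases "y \<in> Om")
  case True
  then have "\<bar>f y\<bar> \<le> L * norm (y - x)" using L(1)[of y x] r1[OF True] r1[OF x] by (simp add: f_def)
  also have "\<dots> \<le> L' * norm (y - x)" unfolding L'_def using x1 by (intro mult_right_mono) auto
  finally show ?thesis .
 next
  case False
  then have "1 - norm x \<le> norm (y - x)" using norm_triangle_ineq2[of y x] by simp
  then have "\<bar>p x\<bar> * 1 \<le> \<bar>p x\<bar> * (norm (y - x) / (1 - norm x))" using x1 by (intro mult_left_mono) auto
  also have "\<dots> \<le> L' * norm (y - x)" using L unfolding L'_def by (simp add: algebra_simps)
  finally show ?thesis using False by (simp add: f_def)
 qed
 have fm: "f \<in> borel_measurable ?B"
  unfolding f_def by (intro borel_imp_lebesgue_on borel_measurable_diff borel_measurable_times borel_measurable_indicator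
    elem_UNIV_borel[OF p] borel_measurable_const) simp
 have iB: "integrable ?B (\<lambda>y. ((norm (y - x))^2) powr (a - 1/2))"
  using a by (intro singular_integrable) auto
 \<comment> \<open>The linear bound on \<open>f\<close> gains half a power of the squared distance:
   the majorant behaves like the distance to the power \<open>1 - d\<close>, which is integrable,
   whereas the kernel alone has no integrable majorant of this kind.\<close>
 have bnd: "\<bar>f y * k n y\<bar> \<le> L' * (4 * a * (a - 1)) * ((norm (y - x))^2) powr (a - 1/2)" if "y \<noteq> x" for n y
 proof -
  define S where "S = s n y"
  have S: "S > 0" "0 < (norm (y - x))^2" "(norm (y - x))^2 \<le> S" "e n \<le> S"
   using sp[of n y] that e(1)[of n] by (auto simp: S_def s_def)
  have "norm (y - x) \<le> S powr (1/2)"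
   using real_le_rsqrt[OF S(3)] S(1) by (simp add: powr_half_sqrt)
  then have "norm (y - x) * (e n * S powr (a - 2)) \<le> S powr (1/2) * (S * S powr (a - 2))"
   using S e(1)[of n] by (intro mult_mono) auto
  also have "\<dots> = S powr (a - 1/2)"
   using S(1) powr_mult_base[of S "a - 2"] by (simp add: powr_add[symmetric])
  also have "\<dots> \<le> ((norm (y - x))^2) powr (a - 1/2)"
   using S a by (intro powr_mono2') auto
  finally have 1: "norm (y - x) * (e n * S powr (a - 2)) \<le> ((norm (y - x))^2) powr (a - 1/2)" .
  have "\<bar>k n y\<bar> = (4 * a * (a - 1)) * (e n * S powr (a - 2))"
   unfolding k mult_minus_left abs_minus_cancel S_def[symmetric] mult.assoc[of "4 * a * (a - 1)"]
   using e(1)[of n] by (intro abs_of_nonneg mult_nonneg_nonneg[OF c0]) simp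
  then have "\<bar>f y * k n y\<bar> = \<bar>f y\<bar> * ((4 * a * (a - 1)) * (e n * S powr (a - 2)))"
   by (simp only: abs_mult)
  also have "\<dots> \<le> (L' * norm (y - x)) * ((4 * a * (a - 1)) * (e n * S powr (a - 2)))"
   using e(1)[of n] by (intro mult_right_mono[OF fL] mult_nonneg_nonneg[OF c0]) simp
  also have "\<dots> = L' * (4 * a * (a - 1)) * (norm (y - x) * (e n * S powr (a - 2)))" by simp
  also have "\<dots> \<le> L' * (4 * a * (a - 1)) * ((norm (y - x))^2) powr (a - 1/2)"
   using L'0 c0 1 by (intro mult_left_mono) auto
  finally show ?thesis .
 qed
 have lim1: "(\<lambda>n. \<integral>y. f y * k n y \<partial>?B) \<longlonglongrightarrow> (\<integral>y. 0 \<partial>?B)"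
 proof (rule integral_dominated_convergence[where w="\<lambda>y. L' * (4 * a * (a - 1)) * ((norm (y - x))^2) powr (a - 1/2)"])
  show "(\<lambda>y. f y * k n y) \<in> borel_measurable ?B" for n
   using fm elem_UNIV_lebesgue_on[OF ke] by (intro borel_measurable_times)
  show "AE y in ?B. norm (f y * k n y) \<le> L' * (4 * a * (a - 1)) * ((norm (y - x))^2) powr (a - 1/2)" for n
   using AE_neq[OF Oml(2), of x] by eventually_elim (unfold real_norm_def, rule bnd)
  show "AE y in ?B. (\<lambda>n. f y * k n y) \<longlonglongrightarrow> 0"
   using AE_neq[OF Oml(2), of x]
  proof eventually_elim
   case (elim y)
   then have 0: "(norm (y - x))^2 + 0 \<noteq> 0" by simp
   have "(\<lambda>n. f y * (- (4 * a * (a - 1)) * e n * s n y powr (a - 2))) \<longlonglongrightarrow>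
    f y * (- (4 * a * (a - 1)) * 0 * ((norm (y - x))^2 + 0) powr (a - 2))"
    unfolding s_def by (intro tendsto_intros tendsto_powr e(2) 0)
   then show ?case by (simp add: k)
  qed
 qed (use iB in auto)
 \<comment> \<open>The gradient of a radial function is a radial field, so the mass over the ball of
   radius 2 is a flux through its boundary, where the squared distance is 4.\<close>
 have mass: "(\<integral>y. k n y \<partial>?B) = 2 * a * (4 + e n) powr (a - 1) * (real CARD('n) * 2 ^ CARD('n) * V)" for n
 proof -
  have "pd i (\<lambda>y. s n y powr a) = (\<lambda>y. (y $ i - x $ i) * (2 * a * s n y powr (a - 1)))" for i
   unfolding pd_powr[OF se sp] unfolding s_def pd_add_const[OF elem_norm2] pd_norm2 by (simp add: algebra_simps)
  then have "k n y = (\<Sum>i\<in>UNIV. pd i (\<lambda>y. (y $ i - x $ i) * (2 * a * s n y powr (a - 1))) y)" for y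
   by (simp add: k_def lap_def)
  then show ?thesis unfolding V_def
   by (simp only:) (intro divergence_radial elem_cmult elementary.pow se sp; simp add: s_def)
 qed
 have "(\<lambda>n. \<integral>y. k n y \<partial>?B) \<longlonglongrightarrow> 2 * a * (4 + 0) powr (a - 1) * (real CARD('n) * 2 ^ CARD('n) * V)"
  unfolding mass by (intro tendsto_intros tendsto_powr e(2)) simp
 also have "2 * a * (4 + 0) powr (a - 1) * (real CARD('n) * 2 ^ CARD('n) * V) = (2 - real CARD('n)) * (real CARD('n) * V)"
 proof -
  have "(4::real) powr (a - 1) = (2 powr 2) powr (a - 1)" by (simp add: powr_numeral)
  also have "\<dots> = 2 powr (2 * (a - 1))" by (rule powr_powr)
  also have "2 * (a - 1) = - real CARD('n)" using a(2) by (simp add: algebra_simps)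
  also have "2 powr (- real CARD('n)) = 1 / 2 ^ CARD('n)" by (simp add: powr_minus powr_realpow divide_inverse)
  finally show ?thesis using a(2) by simp
 qed
 finally have lim2: "(\<lambda>n. \<integral>y. k n y \<partial>?B) \<longlonglongrightarrow> (2 - real CARD('n)) * (real CARD('n) * V)" .
 have split: "(\<integral>y. p y * k n y \<partial>leb Om) = (\<integral>y. f y * k n y \<partial>?B) + p x * (\<integral>y. k n y \<partial>?B)" for n
 proof -
  have i1: "integrable ?B (\<lambda>y. f y * k n y)"
  proof (rule bochner_bound[OF integrable_mult_right[OF iB, of "L' * (4 * a * (a - 1))"]])
   show "(\<lambda>y. f y * k n y) \<in> borel_measurable ?B"
    using fm elem_UNIV_lebesgue_on[OF ke] by (intro borel_measurable_times)
   show "AE y in ?B. norm (f y * k n y) \<le> norm (L' * (4 * a * (a - 1)) * ((norm (y - x))^2) powr (a - 1/2))"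
    using AE_neq[OF Oml(2), of x] by eventually_elim (unfold real_norm_def, rule order_trans[OF bnd abs_ge_self])
  qed
  have "(\<integral>y. f y * k n y \<partial>?B) + p x * (\<integral>y. k n y \<partial>?B) = (\<integral>y. f y * k n y + p x * k n y \<partial>?B)"
   using i1 elem_integrable_ball[OF ke] by simp
  also have "\<dots> = (\<integral>y. indicator (ball x 2) y *\<^sub>R (f y * k n y + p x * k n y) \<partial>lebesgue)"
   by (rule lebesgue_on_indicator[OF Oml(2)])
  also have "\<dots> = (\<integral>y. indicator Om y *\<^sub>R (p y * k n y) \<partial>lebesgue)"
   using Om_subset_ball[OF x] by (intro bochner_cong refl) (auto simp: f_def indicator_def algebra_simps)
  also have "\<dots> = (\<integral>y. p y * k n y \<partial>leb Om)" by (rule lebesgue_on_indicator[OF Oml(1), symmetric])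
  finally show ?thesis ..
 qed
 have "(\<lambda>n. \<integral>y. p y * k n y \<partial>leb Om) \<longlonglongrightarrow> (\<integral>y. 0 \<partial>?B) + p x * ((2 - real CARD('n)) * (real CARD('n) * V))"
  unfolding split by (intro tendsto_intros lim1 lim2)
 then show ?thesis by (simp add: k_def s_def V_def mult_ac)
qed

text \<open>Inside the ball \<open>hs x y\<close> stays above \<open>(1 - norm x)^2\<close>, so
  there is no singularity and the factor \<open>e n\<close> of the Laplacian sends the integral to
  0.\<close>

lemma image_mass_limit:
 fixes x :: "real^'n" and p :: "real^'n \<Rightarrow> real"
 assumes dim: "CARD('n) \<ge> 3" and x: "x \<in> Om" and p: "elem p"
  and e: "\<And>n. e n > 0" "\<And>n. e n \<le> 1" "e \<longlonglongrightarrow> 0"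
 defines "a \<equiv> (2 - real CARD('n)) / 2"
 shows "(\<lambda>n. \<integral>y. p y * lap (\<lambda>y. (hs x y + e n) powr a) y \<partial>leb Om) \<longlonglongrightarrow> 0"
proof -
 let ?M = "leb (Om :: (real^'n) set)"
 have a: "a < 0" using dim by (simp add: a_def)
 obtain B where B: "B \<ge> 0" "\<And>x. norm x \<le> 1 \<Longrightarrow> \<bar>p x\<bar> \<le> B" using elem_Om_bounded[OF p] by blast
 define c where "c = - 4 * a * (a - 1) * (norm x)^2"
 have k: "lap (\<lambda>y. (hs x y + e n) powr a) y = c * e n * (hs x y + e n) powr (a - 2)" for n y
  unfolding c_def using lap_reg_image[OF e(1), of x n y, folded a_def] by simp
 have pos: "(1 - norm x)^2 \<le> hs x y" "0 < hs x y" "0 < (1 - norm x)^2" if "y \<in> Om" for y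
  using hs_pos[of x y] that x by auto
 have m: "(\<lambda>y. p y * lap (\<lambda>y. (hs x y + e n) powr a) y) \<in> borel_measurable ?M" for n
  by (intro elem_UNIV_lebesgue_on elem_simps p lap_elem elementary.pow elem_hs add_nonneg_pos hs_nonneg e)
 have "(\<lambda>n. \<integral>y. p y * lap (\<lambda>y. (hs x y + e n) powr a) y \<partial>?M) \<longlonglongrightarrow> (\<integral>y. 0 \<partial>?M)"
 proof (rule integral_dominated_convergence[where w="\<lambda>_. B * (\<bar>c\<bar> * 1 * ((1 - norm x)^2) powr (a - 2))", OF _ m])
  show "integrable ?M (\<lambda>_. B * (\<bar>c\<bar> * 1 * ((1 - norm x)^2) powr (a - 2)))"
   by (intro finite_measure.integrable_const finite_measure_lebesgue_on lmeas_Om)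
  show "AE y in ?M. norm (p y * lap (\<lambda>y. (hs x y + e n) powr a) y) \<le> B * (\<bar>c\<bar> * 1 * ((1 - norm x)^2) powr (a - 2))" for n
  proof (rule AE_I2)
   fix y assume "y \<in> space ?M"
   then have y: "y \<in> Om" by simp
   have "(hs x y + e n) powr (a - 2) \<le> ((1 - norm x)^2) powr (a - 2)"
    using pos[OF y] e(1)[of n] a by (intro powr_mono2') auto
   then show "norm (p y * lap (\<lambda>y. (hs x y + e n) powr a) y) \<le> B * (\<bar>c\<bar> * 1 * ((1 - norm x)^2) powr (a - 2))"
    unfolding k real_norm_def abs_mult using B y e(1,2)[of n] by (intro mult_mono mult_nonneg_nonneg) auto
  qed
  show "AE y in ?M. (\<lambda>n. p y * lap (\<lambda>y. (hs x y + e n) powr a) y) \<longlonglongrightarrow> 0"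
  proof (rule AE_I2)
   fix y assume "y \<in> space ?M"
   then have y: "y \<in> Om" by simp
   have "(\<lambda>n. p y * (c * e n * (hs x y + e n) powr (a - 2))) \<longlonglongrightarrow> p y * (c * 0 * (hs x y + 0) powr (a - 2))"
    using pos[OF y] by (intro tendsto_intros tendsto_powr e(3)) auto
   then show "(\<lambda>n. p y * lap (\<lambda>y. (hs x y + e n) powr a) y) \<longlonglongrightarrow> 0" by (simp add: k)
  qed
 qed simp
 then show ?thesis by simp
qed

text \<open>Pole and image receive the same shift \<open>e n\<close>, so the regularized kernel
  vanishes exactly on the unit sphere and Green's identity has no boundary term. The pole
  contributes \<open>(2 - d)\<close> times the sphere area times \<open>p x\<close>, the image
  nothing, and \<open>C_dim\<close> normalizes the factor.\<close>

lemma Green_representation: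
 fixes x :: "real^'n"
 assumes dim: "CARD('n) \<ge> 3" and x: "x \<in> Om" and q: "elem q"
 defines "p \<equiv> \<lambda>x. (1 - (norm x)^2) * q x"
 shows "(\<integral>y. G x y * lap p y \<partial>leb Om) = p x"
proof -
 let ?M = "leb (Om :: (real^'n) set)"
 have Oml: "Om \<in> sets (lebesgue :: (real^'n) measure)" by simp
 define a where "a = (2 - real CARD('n)) / 2"
 have a: "a < 0" "2 * a = 2 - real CARD('n)" using dim by (simp_all add: a_def)
 define e where "e n = inverse (real (Suc n))" for n
 have e: "e n > 0" "e n \<le> 1" "e \<longlonglongrightarrow> 0" for n
  using LIMSEQ_inverse_real_of_nat by (auto simp: e_def[abs_def] inverse_eq_divide)
 have pe: "elem p" unfolding p_def by (intro elem_simps elem_rho q)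
 define u where "u n y = ((norm (y - x))^2 + e n) powr a" for n y
 define h where "h n y = (hs x y + e n) powr a" for n y
 have ue: "elem (u n)" for n unfolding u_def by (intro elementary.pow elem_simps add_nonneg_pos e) simp
 have he: "elem (h n)" for n unfolding h_def by (intro elementary.pow elem_simps elem_hs add_nonneg_pos e hs_nonneg)
 define g where "g n y = u n y - h n y" for n y
 have ge: "elem (g n)" for n unfolding g_def by (intro elem_simps ue he)
 define \<Gamma> where "\<Gamma> y = ((norm (y - x))^2) powr a - hs x y powr a" for y
 have "(\<integral>y. g n y * lap p y \<partial>?M) = (\<integral>y. p y * lap (g n) y \<partial>?M)" for n
  by (intro vanishing_green_identity ge pe) (simp_all add: p_def g_def u_def h_def hs_eq norm_minus_commute)
 also have "(\<integral>y. p y * lap (g n) y \<partial>?M) = (\<integral>y. p y * lap (u n) y \<partial>?M) - (\<integral>y. p y * lap (h n) y \<partial>?M)" for n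
  unfolding g_def lap_diff[OF ue he] right_diff_distrib
  by (intro bochner_diff elem_integrable_ball elem_simps pe lap_elem ue he)
 finally have eq: "(\<integral>y. g n y * lap p y \<partial>?M) = (\<integral>y. p y * lap (u n) y \<partial>?M) - (\<integral>y. p y * lap (h n) y \<partial>?M)" for n .
 define \<sigma> where "\<sigma> = real CARD('n) * measure lebesgue (ball (0::real^'n) 1)"
 have "(\<lambda>n. \<integral>y. g n y * lap p y \<partial>?M) \<longlonglongrightarrow> (2 - real CARD('n)) * \<sigma> * p x - 0"
  unfolding eq u_def h_def a_def \<sigma>_def
  by (intro tendsto_diff pole_mass_limit[OF dim x pe e(1,3)] image_mass_limit[OF dim x pe e])
 moreover have "(\<lambda>n. \<integral>y. g n y * lap p y \<partial>?M) \<longlonglongrightarrow> (\<integral>y. \<Gamma> y * lap p y \<partial>?M)"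
 proof -
  obtain B where B: "B \<ge> 0" "\<And>x. norm x \<le> 1 \<Longrightarrow> \<bar>lap p x\<bar> \<le> B" using elem_Om_bounded[OF lap_elem[OF pe]] by blast
  show ?thesis
  proof (rule integral_dominated_convergence[where w="\<lambda>y. ((norm (y - x))^2) powr a * B"])
   show "(\<lambda>y. \<Gamma> y * lap p y) \<in> borel_measurable ?M"
    unfolding \<Gamma>_def using elem_UNIV_borel[OF lap_elem[OF pe]] elem_UNIV_borel[OF elem_hs]
    by (intro borel_imp_lebesgue_on) measurable
   show "(\<lambda>y. g n y * lap p y) \<in> borel_measurable ?M" for n
    by (intro elem_UNIV_lebesgue_on elem_simps ge lap_elem pe)
   have "integrable (leb (ball x 2)) (\<lambda>y. ((norm (y - x))^2) powr a)"
    using a by (intro singular_integrable) auto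
   from lebesgue_on_integrable_subset[OF _ Oml Om_subset_ball[OF x] this]
   show "integrable ?M (\<lambda>y. ((norm (y - x))^2) powr a * B)" by simp
   show "AE y in ?M. norm (g n y * lap p y) \<le> ((norm (y - x))^2) powr a * B" for n
    using AE_neq[OF Oml, of x] AE_space
   proof eventually_elim
    case (elim y)
    then have y: "y \<in> Om" by simp
    have "\<bar>g n y\<bar> \<le> ((norm (y - x))^2) powr a"
     unfolding g_def u_def h_def using e(1)[of n] a by (intro Green_kernel_bound x y elim) auto
    then show ?case unfolding real_norm_def abs_mult using B y by (intro mult_mono) auto
   qed
   show "AE y in ?M. (\<lambda>n. g n y * lap p y) \<longlonglongrightarrow> \<Gamma> y * lap p y"
    using AE_neq[OF Oml, of x] AE_space
   proof eventually_elim
    case (elim y)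
    then have 0: "(norm (y - x))^2 + 0 \<noteq> 0" "hs x y + 0 \<noteq> 0" using hs_pos[of x y] x by auto
    have "(\<lambda>n. g n y * lap p y) \<longlonglongrightarrow> (((norm (y - x))^2 + 0) powr a - (hs x y + 0) powr a) * lap p y"
     unfolding g_def u_def h_def by (intro tendsto_intros tendsto_powr e(3) 0)
    then show ?case by (simp add: \<Gamma>_def)
   qed
  qed
 qed
 ultimately have "(\<integral>y. \<Gamma> y * lap p y \<partial>?M) = (2 - real CARD('n)) * \<sigma> * p x"
  using LIMSEQ_unique by fastforce
 moreover have "(\<integral>y. G x y * lap p y \<partial>?M) = C_dim TYPE('n) * (\<integral>y. \<Gamma> y * lap p y \<partial>?M)"
  unfolding G_eq \<Gamma>_def a_def by (simp add: norm_minus_commute mult.assoc)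
 moreover have "C_dim TYPE('n) * ((2 - real CARD('n)) * \<sigma>) = 1"
  using dim sphere_area(2)[where 'n='n] by (simp add: C_dim_def sphere_area \<sigma>_def field_simps)
 ultimately show ?thesis by (simp add: mult.assoc[symmetric])
qed

text \<open>The bound is uniform in the point, which is what Fubini's theorem needs for the product
  of the kernel with an integrable function.\<close>

lemma G_section:
 fixes x :: "real^'n"
 assumes dim: "CARD('n) \<ge> 3"
 obtains B where "\<And>x::real^'n. x \<in> Om \<Longrightarrow> integrable (leb Om) (G x)"
  "\<And>x::real^'n. x \<in> Om \<Longrightarrow> (\<integral>y. \<bar>G x y\<bar> \<partial>leb Om) \<le> B"
proof -
 let ?M = "leb (Om :: (real^'n) set)"
 have Oml: "Om \<in> sets (lebesgue :: (real^'n) measure)" by simp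
 define a where "a = (2 - real CARD('n)) / 2"
 have a: "a < 0" "2 * a = 2 - real CARD('n)" using dim by (simp_all add: a_def)
 define c where "c = \<bar>C_dim TYPE('n)\<bar>"
 define B where "B = c * (((2^2) powr a) * (real CARD('n) * 2 ^ CARD('n) * measure lebesgue (ball (0::real^'n) 1)) / (real CARD('n) + 2 * a))"
 have *: "integrable ?M (G x)" "(\<integral>y. \<bar>G x y\<bar> \<partial>?M) \<le> B" if x: "x \<in> Om" for x :: "real^'n"
 proof -
  let ?k = "\<lambda>y. ((norm (y - x))^2) powr a"
  have s: "integrable (leb (ball x 2)) ?k"
   "(\<integral>y. ?k y \<partial>leb (ball x 2)) \<le> (((2^2) powr a) * (real CARD('n) * 2 ^ CARD('n) * measure lebesgue (ball (0::real^'n) 1)) / (real CARD('n) + 2 * a))"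
   using a by (intro singular_integrable; simp)+
  have k: "integrable ?M ?k" by (rule lebesgue_on_integrable_subset[OF _ Oml Om_subset_ball[OF x] s(1)]) simp
  have m: "G x \<in> borel_measurable ?M"
   unfolding G_eq using elem_UNIV_borel[OF elem_hs] by (intro borel_imp_lebesgue_on) measurable
  have b: "AE y in ?M. \<bar>G x y\<bar> \<le> c * ?k y"
   using AE_neq[OF Oml, of x] AE_space
  proof eventually_elim
   case (elim y)
   then have "\<bar>((norm (y - x))^2 + 0) powr a - (hs x y + 0) powr a\<bar> \<le> ((norm (y - x))^2) powr a"
    using x a by (intro Green_kernel_bound) auto
   then show ?case unfolding G_eq c_def abs_mult a_def[symmetric] by (intro mult_left_mono) (auto simp: norm_minus_commute)
  qed
  show i: "integrable ?M (G x)"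
   by (rule bochner_bound[OF integrable_mult_right[OF k, of c] m])
    (use b in \<open>auto elim!: eventually_mono intro: order_trans[OF _ abs_ge_self]\<close>)
  have "(\<integral>y. \<bar>G x y\<bar> \<partial>?M) \<le> (\<integral>y. c * ?k y \<partial>?M)"
   using i k b by (intro integral_mono_AE) auto
  also have "\<dots> = c * (\<integral>y. ?k y \<partial>?M)" by simp
  also have "(\<integral>y. ?k y \<partial>?M) \<le> (\<integral>y. ?k y \<partial>leb (ball x 2))"
  proof -
   have "(\<integral>y. indicator Om y *\<^sub>R ?k y \<partial>lebesgue) \<le> (\<integral>y. indicator (ball x 2) y *\<^sub>R ?k y \<partial>lebesgue)"
    using s(1) k lebesgue_on_indicator(2)[OF Oml, of ?k] lebesgue_on_indicator(2)[of "ball x 2" ?k] Om_subset_ball[OF x]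
    by (intro integral_mono) (auto simp: indicator_def)
   then show ?thesis using lebesgue_on_indicator(1)[OF Oml, of ?k] lebesgue_on_indicator(1)[of "ball x 2" ?k] by simp
  qed
  also note s(2)
  finally show "(\<integral>y. \<bar>G x y\<bar> \<partial>?M) \<le> B" unfolding B_def by (auto simp: c_def mult_left_mono)
 qed
 show ?thesis by (rule that; rule *)
qed

lemma G_product_measurable:
 "(\<lambda>z. G (snd z) (fst z)) \<in> borel_measurable (leb (S :: (real^'n) set) \<Otimes>\<^sub>M leb T)"
proof -
 have i: "id \<in> leb U \<rightarrow>\<^sub>M (borel :: (real^'n) measure)" for U
  by (rule borel_imp_lebesgue_on) simp
 have f: "fst \<in> leb S \<Otimes>\<^sub>M leb T \<rightarrow>\<^sub>M (borel :: (real^'n) measure)"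
  "snd \<in> leb S \<Otimes>\<^sub>M leb T \<rightarrow>\<^sub>M (borel :: (real^'n) measure)"
  using measurable_comp[OF measurable_fst i] measurable_comp[OF measurable_snd i] by (simp_all add: comp_def)
 show ?thesis unfolding G_eq hs_def using f by measurable
qed

text \<open>Fubini's theorem and the symmetry of the kernel move the Laplacian of a test polynomial
  onto the kernel, where the representation formula returns the polynomial itself. Integrability of
  the sections is obtained from the same theorem, hence for almost every \<open>x\<close>.\<close>

lemma Green_potential:
 fixes f :: "real^'n \<Rightarrow> complex"
 assumes dim: "CARD('n) \<ge> 3" and f: "f \<in> L2 (leb Om)"
 shows "AE x in leb Om. integrable (leb Om) (\<lambda>y. G x y *\<^sub>R f y)"
  "integrable (leb Om) (\<lambda>x. \<integral>y. G x y *\<^sub>R f y \<partial>leb Om)"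
  "elem q \<Longrightarrow>
   (\<integral>x. lap (\<lambda>x. (1 - (norm x)^2) * q x) x *\<^sub>R (\<integral>y. G x y *\<^sub>R f y \<partial>leb Om) \<partial>leb Om) =
   (\<integral>y. ((1 - (norm y)^2) * q y) *\<^sub>R f y \<partial>leb Om)"
proof -
 let ?M = "leb (Om :: (real^'n) set)"
 have fin: "finite_measure ?M" by (intro finite_measure_lebesgue_on lmeas_Om)
 interpret finite_measure ?M by (rule fin)
 interpret pair_sigma_finite ?M ?M ..
 note fi = L2_integrable[OF fin f]
 obtain B where B: "\<And>x::real^'n. x \<in> Om \<Longrightarrow> integrable ?M (G x)"
  "\<And>x::real^'n. x \<in> Om \<Longrightarrow> (\<integral>y. \<bar>G x y\<bar> \<partial>?M) \<le> B" using G_section[OF dim] by blast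
 define F where "F = (\<lambda>y x. G x y *\<^sub>R f y)"
 have Fm: "case_prod F \<in> borel_measurable (?M \<Otimes>\<^sub>M ?M)"
 proof -
  have "(\<lambda>z. f (fst z)) \<in> borel_measurable (?M \<Otimes>\<^sub>M ?M)"
   using measurable_comp[OF measurable_fst L2D(1)[OF f]] by (simp add: comp_def)
  with G_product_measurable[of Om Om] show ?thesis
   unfolding F_def case_prod_unfold by (intro borel_measurable_scaleR)
 qed
 have sec: "integrable ?M (F y)" if "y \<in> Om" for y
  unfolding F_def G_commute[of _ y] using B(1)[OF that] by (intro integrable_scaleR_left) auto
 have Fi: "integrable (?M \<Otimes>\<^sub>M ?M) (case_prod F)"
 proof (rule Fubini_integrable[OF Fm])
  show "integrable ?M (\<lambda>y. \<integral>x. norm (case_prod F (y, x)) \<partial>?M)"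
  proof (rule bochner_bound[OF integrable_mult_right[OF integrable_norm[OF fi], of B]])
   show "(\<lambda>y. \<integral>x. norm (case_prod F (y, x)) \<partial>?M) \<in> borel_measurable ?M"
    using Fm by measurable
   show "AE y in ?M. norm (\<integral>x. norm (case_prod F (y, x)) \<partial>?M) \<le> norm (B * norm (f y))"
   proof (rule AE_I2)
    fix y assume "y \<in> space ?M"
    then have y: "y \<in> Om" by simp
    have "(\<integral>x. norm (case_prod F (y, x)) \<partial>?M) = (\<integral>x. \<bar>G y x\<bar> \<partial>?M) * norm (f y)"
     by (simp add: F_def G_commute[of _ y])
    moreover have "(\<integral>x. \<bar>G y x\<bar> \<partial>?M) * norm (f y) \<le> B * norm (f y)"
     by (intro mult_right_mono B(2) y) simp
    moreover have "0 \<le> (\<integral>x. \<bar>G y x\<bar> \<partial>?M) * norm (f y)"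
     by (intro mult_nonneg_nonneg Bochner_Integration.integral_nonneg) auto
    ultimately show "norm (\<integral>x. norm (case_prod F (y, x)) \<partial>?M) \<le> norm (B * norm (f y))" by simp
   qed
  qed
  show "AE y in ?M. integrable ?M (\<lambda>x. case_prod F (y, x))"
   using sec by (intro AE_I2) simp
 qed
 show "AE x in ?M. integrable ?M (\<lambda>y. G x y *\<^sub>R f y)"
  using AE_integrable_snd[OF Fi] by (simp add: F_def)
 show "integrable ?M (\<lambda>x. \<integral>y. G x y *\<^sub>R f y \<partial>?M)"
  using integrable_snd[OF Fi] by (simp add: F_def)
 assume q: "elem q"
 define p where "p = (\<lambda>x. (1 - (norm x)^2) * q x)"
 have pe: "elem p" unfolding p_def by (intro elem_simps elem_rho q)
 obtain C where C: "\<And>x. norm x \<le> 1 \<Longrightarrow> \<bar>lap p x\<bar> \<le> C" using elem_Om_bounded[OF lap_elem[OF pe]] by blast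
 have lm: "lap p \<in> borel_measurable ?M" by (rule elem_UNIV_lebesgue_on[OF lap_elem[OF pe]])
 have "integrable (?M \<Otimes>\<^sub>M ?M) (\<lambda>z. lap p (snd z) *\<^sub>R case_prod F z)"
 proof (rule integrable_bounded_mult[OF Fi, where B=C])
  show "(\<lambda>z. lap p (snd z)) \<in> borel_measurable (?M \<Otimes>\<^sub>M ?M)"
   using measurable_comp[OF measurable_snd lm] by (simp add: comp_def)
  show "AE z in ?M \<Otimes>\<^sub>M ?M. \<bar>lap p (snd z)\<bar> \<le> C"
   using C by (intro AE_I2) (auto simp: space_pair_measure)
 qed
 then have "integrable (?M \<Otimes>\<^sub>M ?M) (case_prod (\<lambda>y x. lap p x *\<^sub>R F y x))" by (simp add: case_prod_unfold)
 from Fubini_integral[OF this]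
 have "(\<integral>x. (\<integral>y. lap p x *\<^sub>R F y x \<partial>?M) \<partial>?M) = (\<integral>y. (\<integral>x. lap p x *\<^sub>R F y x \<partial>?M) \<partial>?M)" .
 \<comment> \<open>Valid for every \<open>x\<close>, also where the inner integrand is not
   integrable, since both sides are then 0 by convention.\<close>
 moreover have "(\<integral>y. lap p x *\<^sub>R F y x \<partial>?M) = lap p x *\<^sub>R (\<integral>y. F y x \<partial>?M)" for x
  by (cases "lap p x = 0") simp_all
 moreover have "(\<integral>y. (\<integral>x. lap p x *\<^sub>R F y x \<partial>?M) \<partial>?M) = (\<integral>y. p y *\<^sub>R f y \<partial>?M)"
 proof (rule bochner_cong[OF refl])
  fix y assume "y \<in> space ?M"
  then have y: "y \<in> Om" by simp
  have "integrable ?M (\<lambda>x. lap p x *\<^sub>R G y x)"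
   by (rule integrable_bounded_mult[OF B(1)[OF y] lm, where B=C]) (use C in \<open>auto intro!: AE_I2\<close>)
  then have i: "integrable ?M (\<lambda>x. G y x * lap p x)" by (simp add: mult.commute)
  have "(\<integral>x. lap p x *\<^sub>R F y x \<partial>?M) = (\<integral>x. (G y x * lap p x) *\<^sub>R f y \<partial>?M)"
   by (simp add: F_def G_commute[of _ y] mult.commute)
  also have "\<dots> = (\<integral>x. G y x * lap p x \<partial>?M) *\<^sub>R f y" using i by simp
  also have "\<dots> = p y *\<^sub>R f y" unfolding p_def by (subst Green_representation[OF dim y q]) simp
  finally show "(\<integral>x. lap p x *\<^sub>R F y x \<partial>?M) = p y *\<^sub>R f y" .
 qed
 ultimately show "(\<integral>x. lap (\<lambda>x. (1 - (norm x)^2) * q x) x *\<^sub>R (\<integral>y. G x y *\<^sub>R f y \<partial>?M) \<partial>?M) =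
   (\<integral>y. ((1 - (norm y)^2) * q y) *\<^sub>R f y \<partial>?M)"
  unfolding p_def[symmetric] by (simp add: F_def p_def)
qed

text \<open>The images \<open>\<Delta>((1 - |x|^2)q)\<close> of polynomials \<open>q\<close> exhaust the polynomials, so testing against
 them determines \<open>w\<close>.\<close>

lemma zero_trace_representation:
 fixes w :: "real^'n \<Rightarrow> complex"
 assumes dim: "CARD('n) \<ge> 3" and x0: "x0 \<in> Om"
  and w: "\<And>i. has_weak_deriv Om i w (v i)" "w \<in> L2 (leb Om)" "\<And>i. v i \<in> L2 (leb Om)"
   "\<And>i. has_weak_deriv Om i (v i) (v2 i)" "\<And>i. v2 i \<in> L2 (leb Om)"
  and t: "has_trace (Om0 x0) 0 1 w T" "\<And>x. norm x = 1 \<Longrightarrow> T x = 0"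
  and f: "f \<in> L2 (leb Om)" "AE x in leb Om. (\<Sum>i\<in>UNIV. v2 i x) = f x"
 shows "AE x in leb Om. w x = (\<integral>y. G x y *\<^sub>R f y \<partial>leb Om)"
proof -
 let ?M = "leb (Om :: (real^'n) set)"
 define P where "P x = (\<integral>y. G x y *\<^sub>R f y \<partial>?M)" for x
 have Pi: "integrable ?M P" unfolding P_def by (rule Green_potential(2)[OF dim f(1)])
 have wi: "integrable ?M w" by (rule L2_integrable[OF finite_measure_lebesgue_on[OF lmeas_Om] w(2)])
 have "AE x in ?M. w x - P x = 0"
 proof (rule orth_poly_zero)
  show "integrable ?M (\<lambda>x. w x - P x)" using wi Pi by simp
  fix r :: "real^'n \<Rightarrow> real" assume r: "rpoly r"
  obtain q where q: "rpoly q" "lap (\<lambda>x. (1 - (norm x)^2) * q x) = r"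
   using poly_dirichlet[OF r] by blast
  have qe: "elem q" by (rule poly_elem[OF q(1)])
  obtain C where C: "\<And>x. x \<in> Om \<Longrightarrow> \<bar>r x\<bar> \<le> C" using poly_bounded_ball[OF r, of 0 1] by blast
  have ri: "integrable ?M (\<lambda>x. r x *\<^sub>R g x)" if "integrable ?M g" for g :: "real^'n \<Rightarrow> complex"
   by (rule integrable_bounded_mult[OF that poly_lebesgue_on[OF r], where B=C]) (use C in \<open>auto intro!: AE_I2\<close>)
  have "(\<integral>x. r x *\<^sub>R w x \<partial>?M) = (\<integral>x. ((1 - (norm x)^2) * q x) *\<^sub>R (\<Sum>i\<in>UNIV. v2 i x) \<partial>?M)"
   using green_weak[OF x0 w t qe] unfolding q(2) .
  also have "\<dots> = (\<integral>x. ((1 - (norm x)^2) * q x) *\<^sub>R f x \<partial>?M)"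
  proof (rule AE_imp_integral_eq[OF f(2)])
   have e: "elem (\<lambda>x. (1 - (norm x)^2) * q x)" by (intro elem_simps elem_rho qe)
   show "integrable ?M (\<lambda>x. ((1 - (norm x)^2) * q x) *\<^sub>R (\<Sum>i\<in>UNIV. v2 i x))"
    "integrable ?M (\<lambda>x. ((1 - (norm x)^2) * q x) *\<^sub>R f x)"
    by (intro Om_poly_integrable[OF e] L2_sum w f)+
  qed
  also have "\<dots> = (\<integral>x. r x *\<^sub>R P x \<partial>?M)" using Green_potential(3)[OF dim f(1) qe] unfolding q(2) P_def ..
  finally show "(\<integral>x. r x *\<^sub>R (w x - P x) \<partial>?M) = 0"
   using ri[OF wi] ri[OF Pi] by (simp add: scaleR_diff_right)
 qed
 then show ?thesis by (simp add: P_def)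
qed

section \<open>Singular solutions and the functionals\<close>

text \<open>The Green function with pole \<open>x0\<close> (index \<open>None\<close>) and its derivatives (index \<open>Some s\<close>), each
 split into an explicit singular part and a part that is smooth near the closed unit ball.\<close>

definition Gx :: "real^'n \<Rightarrow> 'n option \<Rightarrow> real^'n \<Rightarrow> real" where
 "Gx x0 k x = (case k of None \<Rightarrow> G x x0 | Some s \<Rightarrow> dG s x x0)"

definition Gs :: "real^'n \<Rightarrow> 'n option \<Rightarrow> real^'n \<Rightarrow> real" where
 "Gs x0 k x = (let a = (2 - real CARD('n)) / 2 in
   case k of None \<Rightarrow> C_dim TYPE('n) * ((norm (x - x0))^2) powr a
   | Some s \<Rightarrow> - (2 * a * C_dim TYPE('n)) * ((x $ s - x0 $ s) * ((norm (x - x0))^2) powr (a - 1)))"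

definition Gh :: "real^'n \<Rightarrow> 'n option \<Rightarrow> real^'n \<Rightarrow> real" where
 "Gh x0 k x = (let a = (2 - real CARD('n)) / 2 in
   case k of None \<Rightarrow> - (C_dim TYPE('n)) * hs x0 x powr a
   | Some s \<Rightarrow> - (C_dim TYPE('n) * a) * (hs x0 x powr (a - 1) * (2 * (norm x)^2 * x0 $ s - 2 * x $ s)))"

text \<open>An open set containing the closed unit ball on which the image part is smooth, because
  \<open>hs x0\<close> is positive there. Reaching beyond the ball makes that part bounded, with all
  derivatives, up to the boundary.\<close>

definition Dx :: "real^'n \<Rightarrow> (real^'n) set" where
 "Dx x0 = {x. norm x0 * norm x < 1}"

lemma Dx_open: "open (Dx x0)"
 unfolding Dx_def by (intro open_Collect_less continuous_intros)

lemma Dx_ball: "x0 \<in> Om \<Longrightarrow> norm x \<le> 1 \<Longrightarrow> x \<in> Dx x0"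
proof -
 assume a: "x0 \<in> Om" "norm x \<le> 1"
 then have "norm x0 * norm x \<le> norm x0 * 1" by (intro mult_left_mono) auto
 then show ?thesis using a by (simp add: Dx_def)
qed

lemma hs_pos_Dx: "x \<in> Dx x0 \<Longrightarrow> 0 < hs x0 x"
proof -
 assume "x \<in> Dx x0"
 then have "0 < (1 - norm x0 * norm x)^2" by (simp add: Dx_def)
 also have "\<dots> \<le> hs x0 x" by (rule hs_lower)
 finally show ?thesis .
qed

lemma Gx_split:
 fixes x0 :: "real^'n"
 assumes "x \<in> Dx x0" "x \<noteq> x0"
 shows "Gx x0 k x = Gs x0 k x + Gh x0 k x"
proof (cases k)
 case None
 then show ?thesis by (simp add: Gx_def Gs_def Gh_def G_eq hs_commute[of x] Let_def algebra_simps)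
next
 case (Some s)
 define a where "a = (2 - real CARD('n)) / 2"
 have p: "0 < (norm (x0 - x))^2" "0 < hs x x0" using assms hs_pos_Dx[of x x0] by (simp_all add: hs_commute)
 have d: "(\<lambda>\<eta>. (norm (\<eta> - x))^2) differentiable (at x0)" "hs x differentiable (at x0)"
  by (intro elem_UNIV_differentiable elem_norm2 elem_hs)+
 have e: "(\<lambda>\<eta>. ((norm (\<eta> - x))^2) powr a) differentiable (at x0)" "(\<lambda>\<eta>. hs x \<eta> powr a) differentiable (at x0)"
 proof -
  have "elementary {\<eta>. 0 < f \<eta>} (\<lambda>\<eta>. f \<eta> powr a)" "open {\<eta>. 0 < f \<eta>}" if "elem f" for f :: "real^'n \<Rightarrow> real"
   using elem_UNIV_continuous[OF that] by (auto intro!: elementary.pow elem_subset[OF that] open_Collect_less continuous_intros)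
  from elem_differentiable[OF this, of "\<lambda>\<eta>. (norm (\<eta> - x))^2"] elem_differentiable[OF this, of "hs x"]
  show "(\<lambda>\<eta>. ((norm (\<eta> - x))^2) powr a) differentiable (at x0)" "(\<lambda>\<eta>. hs x \<eta> powr a) differentiable (at x0)"
   using p elem_norm2 elem_hs by blast+
 qed
 have "dG s x x0 = pd s (\<lambda>\<eta>. C_dim TYPE('n) * (((norm (\<eta> - x))^2) powr a - hs x \<eta> powr a)) x0"
  unfolding dG_def G_eq a_def by (simp add: norm_minus_commute)
 also have "\<dots> = C_dim TYPE('n) * (a * ((norm (x0 - x))^2) powr (a - 1) * (2 * (x0 $ s - x $ s))
   - a * hs x x0 powr (a - 1) * (2 * (norm x)^2 * x0 $ s - 2 * x $ s))"
  using part_deriv_cmult[OF differentiable_diff[OF e], of s "C_dim TYPE('n)"] part_deriv_diff[OF e, of s]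
   part_deriv_powr[OF d(1) p(1), of s a] part_deriv_powr[OF d(2) p(2), of s a]
  by (simp add: part_deriv_norm2 pd_hs)
 finally show ?thesis using Some
  by (simp add: Gx_def Gs_def Gh_def a_def[symmetric] Let_def hs_commute[of x] norm_minus_commute[of x0 x] algebra_simps)
qed

lemma Gh_elem: "elementary (Dx x0) (Gh x0 k)"
proof -
 have p: "elementary (Dx x0) (\<lambda>x. hs x0 x powr b)" for b
  by (intro elementary.pow elem_hs hs_pos_Dx)
 show ?thesis unfolding Gh_def[abs_def] Let_def
  by (cases k) (simp only: option.case, intro p elem_cmult elementary.mult elem_diff elem_norm2_0 elementary.coord elementary.const)+
qed

lemma Gs_elem: "elementary (- {x0}) (Gs x0 k)"
proof -
 have p: "elementary (- {x0}) (\<lambda>x. ((norm (x - x0))^2) powr b)" for b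
  by (intro elementary.pow elem_norm2) simp
 show ?thesis unfolding Gs_def[abs_def] Let_def
  by (cases k) (simp only: option.case, intro p elem_cmult elementary.mult elem_diff elementary.coord elementary.const)+
qed

lemma Gx_elem: "elementary (Dx x0 - {x0}) (Gx x0 k)"
 by (rule elementary.cong[of _ "\<lambda>x. Gs x0 k x + Gh x0 k x"])
  (auto simp: Gx_split intro!: elementary.add elem_subset[OF Gs_elem] elem_subset[OF Gh_elem])

text \<open>On the unit sphere \<open>hs x0 x\<close> is the squared distance to \<open>x0\<close>,
  so the singular and the smooth part cancel; for the derivatives \<open>|x|^2 = 1\<close> also
  matches the linear factors.\<close>

lemma Gx_boundary:
 fixes x0 :: "real^'n"
 assumes "x0 \<in> Om" "norm x = 1"
 shows "Gx x0 k x = 0"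
proof -
 have "x \<in> Dx x0" "x \<noteq> x0" using assms Dx_ball[of x0 x] by auto
 moreover have "hs x0 x = (norm (x - x0))^2" using assms by (simp add: hs_eq norm_minus_commute)
 ultimately show ?thesis unfolding Gx_split[OF \<open>x \<in> Dx x0\<close> \<open>x \<noteq> x0\<close>]
  using assms by (cases k) (simp_all add: Gs_def Gh_def Let_def algebra_simps)
qed

text \<open>The divergence theorem for the constant 1 and for the coordinate functions centred at
  \<open>x0\<close>.\<close>

lemma sphere_moments:
 fixes x0 :: "real^'n"
 assumes r: "r > 0"
 shows "(\<integral>t. (t $ i - x0 $ i) / r \<partial>sphere_measure x0 r) = 0"
  "(\<integral>t. (t $ i - x0 $ i) / r * (t $ j - x0 $ j) \<partial>sphere_measure x0 r) =
   (if i = j then r ^ CARD('n) * measure lebesgue (ball (0::real^'n) 1) else 0)"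
proof -
 show "(\<integral>t. (t $ i - x0 $ i) / r \<partial>sphere_measure x0 r) = 0"
  using divergence_ball[OF r elementary.const[of _ 1], where i=i and a=x0] by (simp add: pd_const)
 have 1: "pd i (\<lambda>x. x $ j - x0 $ j) = (\<lambda>x. if i = j then 1 else 0)"
  by (subst pd_diff, intro elem_simps, intro elem_simps) (simp add: pd_coord pd_const)
 have "(\<integral>t. (t $ i - x0 $ i) / r * (t $ j - x0 $ j) \<partial>sphere_measure x0 r) = (\<integral>x. (if i = j then 1 else 0) \<partial>leb (ball x0 r))"
  using divergence_ball[OF r, where F="\<lambda>x. x $ j - x0 $ j" and i=i and a=x0] by (simp add: 1 elem_simps)
 also have "\<dots> = r ^ CARD('n) * (\<integral>x. (if i = j then 1 else 0) \<partial>leb (ball (0::real^'n) 1))"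
  using integral_ball_affine[OF _ r, of "\<lambda>_. if i = j then 1 else (0::real)" x0] by simp
 finally show "(\<integral>t. (t $ i - x0 $ i) / r * (t $ j - x0 $ j) \<partial>sphere_measure x0 r) =
   (if i = j then r ^ CARD('n) * measure lebesgue (ball (0::real^'n) 1) else 0)" by (simp add: measure_restrict_space)
qed

lemma C_dim_vol:
 assumes "CARD('n) \<ge> 3"
 shows "C_dim TYPE('n) * ((2 - real CARD('n)) * (real CARD('n) * measure lebesgue (ball (0::real^'n) 1))) = 1"
 using assms sphere_area(2)[where 'n='n] by (simp add: C_dim_def sphere_area field_simps)

text \<open>The exponent amounts to \<open>r\<close> to the power \<open>-d\<close>. This
  cancellation is why moments and fluxes of the singular parts are independent of the
  radius.\<close>

lemma radial_powr:
 assumes "r > 0"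
 shows "(r^2) powr ((2 - real d) / 2 - 1) * r ^ d = 1"
proof -
 have "(r^2) powr ((2 - real d) / 2 - 1) = r powr (2 * ((2 - real d) / 2 - 1))"
  using assms norm_powr_square[of r "(2 - real d) / 2 - 1"] by simp
 also have "2 * ((2 - real d) / 2 - 1) = - real d" by (simp add: field_simps)
 finally show ?thesis using assms by (simp add: powr_minus powr_realpow)
qed

text \<open>On the sphere the singular part is a constant for \<open>None\<close> and a multiple of
  a centred coordinate for \<open>Some s\<close>, so the moments of the sphere apply. The value
  \<open>-1/d\<close> is inverted by the factor \<open>-d\<close> in \<open>gamma\<close>.\<close>

lemma Gs_moment:
 fixes x0 :: "real^'n"
 assumes dim: "CARD('n) \<ge> 3" and r: "r > 0"
 shows "(\<integral>t. (t $ i - x0 $ i) / r * Gs x0 k t \<partial>sphere_measure x0 r) = (if k = Some i then - 1 / real CARD('n) else 0)"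
proof -
 let ?S = "sphere_measure x0 r"
 define a where "a = (2 - real CARD('n)) / 2"
 have n: "(norm (t - x0))^2 = r^2" if "t \<in> space ?S" for t
  using sphere_space_norm[OF that] by simp
 show ?thesis
 proof (cases k)
  case None
  have "(\<integral>t. (t $ i - x0 $ i) / r * Gs x0 k t \<partial>?S) = (\<integral>t. (C_dim TYPE('n) * (r^2) powr a) * ((t $ i - x0 $ i) / r) \<partial>?S)"
   by (intro bochner_cong refl) (simp add: None Gs_def a_def n)
  then show ?thesis using sphere_moments(1)[OF r, where i=i and ?x0.0=x0] None by (simp del: times_divide_eq_right times_divide_eq_left)
 next
  case (Some s)
  have "(\<integral>t. (t $ i - x0 $ i) / r * Gs x0 k t \<partial>?S) =
    (\<integral>t. (- (2 * a * C_dim TYPE('n)) * (r^2) powr (a - 1)) * ((t $ i - x0 $ i) / r * (t $ s - x0 $ s)) \<partial>?S)"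
   by (intro bochner_cong refl) (simp add: Some Gs_def Let_def a_def[symmetric] n)
  also have "\<dots> = - (2 * a * C_dim TYPE('n)) * (r^2) powr (a - 1) *
    (if i = s then r ^ CARD('n) * measure lebesgue (ball (0::real^'n) 1) else 0)"
   by (subst integral_mult_right_zero, subst sphere_moments(2)[OF r]) simp
  also have "\<dots> = (if i = s then - ((r^2) powr (a - 1) * r ^ CARD('n)) * (C_dim TYPE('n) * ((2 * a) * measure lebesgue (ball (0::real^'n) 1))) else 0)"
   by simp
  also have "\<dots> = (if i = s then - 1 / real CARD('n) else 0)"
  proof -
   have "real CARD('n) * (C_dim TYPE('n) * ((2 - real CARD('n)) * measure lebesgue (ball (0::real^'n) 1))) = 1"
    by (subst C_dim_vol[OF dim, symmetric]) (simp only: mult_ac)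
   then have "C_dim TYPE('n) * ((2 - real CARD('n)) * measure lebesgue (ball (0::real^'n) 1)) = 1 / real CARD('n)"
    by (simp only: eq_divide_eq) (simp add: mult.commute)
   moreover have "2 * a = 2 - real CARD('n)" by (simp add: a_def)
   ultimately show ?thesis by (simp only: radial_powr[OF r, of "CARD('n)", folded a_def]) simp
  qed
  finally show ?thesis using Some by simp
 qed
qed

text \<open>The normalization \<open>C_dim\<close> gives the fundamental solution flux 1. The
  derivatives carry no flux: their normal derivative is a multiple of a centred coordinate, whose
  mean over the sphere is 0.\<close>

lemma Gs_flux:
 fixes x0 :: "real^'n"
 assumes dim: "CARD('n) \<ge> 3" and r: "r > 0"
 shows "(\<Sum>i\<in>UNIV. \<integral>t. (t $ i - x0 $ i) / r * pd i (Gs x0 k) t \<partial>sphere_measure x0 r) = (if k = None then 1 else 0)"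
proof -
 let ?S = "sphere_measure x0 r"
 define a where "a = (2 - real CARD('n)) / 2"
 define c where "c = C_dim TYPE('n)"
 note n = sphere_space_norm
 have op: "open (- {x0})" by (simp add: open_Compl)
 have s0: "sphere x0 r \<subseteq> - {x0}" using r by auto
 have int: "integrable ?S (\<lambda>t. (t $ i - x0 $ i) / r * pd i (Gs x0 k) t)" for i
  by (intro sphere_integrable_continuous r continuous_on_subset[OF elem_continuous_on[OF _ op] s0]
    elementary.mult elem_divide elem_diff elementary.coord elementary.const elem_part_deriv[OF Gs_elem op])
 have ep: "elementary (- {x0}) (\<lambda>x. ((norm (x - x0))^2) powr b)" for b by (intro elementary.pow elem_norm2) simp
 have pd: "pd i (\<lambda>x. ((norm (x - x0))^2) powr b) t = b * (r^2) powr (b - 1) * (2 * (t $ i - x0 $ i))"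
  if "t \<in> space ?S" for b i t
  using part_deriv_powr[OF elem_UNIV_differentiable[OF elem_norm2[of UNIV x0]], where x=t and b=b and i=i] n[OF that] r
  by (simp add: part_deriv_norm2)
 have sq: "(\<Sum>i\<in>UNIV. (t $ i - x0 $ i)^2) = r^2" if "t \<in> space ?S" for t
  using norm_pow2_vec[of "t - x0"] n[OF that] by simp
 \<comment> \<open>On a fixed sphere the normal derivative is constant for \<open>None\<close> and
   proportional to \<open>t $ s - x0 $ s\<close> for \<open>Some s\<close>; all powers are evaluated
   at \<open>r^2\<close>.\<close>
 have *: "(\<Sum>i\<in>UNIV. (t $ i - x0 $ i) / r * pd i (Gs x0 k) t) =
   (case k of None \<Rightarrow> 2 * a * c * ((r^2) powr (a - 1) * r)
    | Some s \<Rightarrow> - (2 * a * c) * ((r^2) powr (a - 1) + 2 * (a - 1) * ((r^2) powr (a - 2) * r^2)) * ((t $ s - x0 $ s) / r))"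
  if t: "t \<in> space ?S" for t
 proof (cases k)
  case None
  have "t \<in> - {x0}" using n[OF t] r by auto
  then have "pd i (Gs x0 k) t = c * (a * (r^2) powr (a - 1) * (2 * (t $ i - x0 $ i)))" for i
   using part_deriv_cmult[OF elem_differentiable[OF ep op], of t i c a] pd[OF t]
   unfolding Gs_def[abs_def] None by (simp add: a_def[symmetric] c_def Let_def)
  then have "(t $ i - x0 $ i) / r * pd i (Gs x0 k) t = 2 * a * c * (r^2) powr (a - 1) / r * (t $ i - x0 $ i)^2" for i
   by (simp add: power2_eq_square)
  then have "(\<Sum>i\<in>UNIV. (t $ i - x0 $ i) / r * pd i (Gs x0 k) t) = 2 * a * c * (r^2) powr (a - 1) / r * r^2"
   by (simp only: sum_distrib_left[symmetric] sq[OF t])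
  then show ?thesis using r None by (simp add: power2_eq_square)
 next
  case (Some s)
  have tx: "t \<in> - {x0}" using n[OF t] r by auto
  note d = elem_differentiable[OF ep op tx]
  have dc: "(\<lambda>x. x $ s - x0 $ s) differentiable (at t)" by (intro elem_UNIV_differentiable elem_simps)
  have p1: "pd i (\<lambda>x. x $ s - x0 $ s) = (\<lambda>x. if i = s then 1 else 0)" for i
   by (subst pd_diff, intro elem_simps, intro elem_simps) (simp add: pd_coord pd_const)
  have "pd i (Gs x0 k) t = - (2 * a * c) * ((if i = s then 1 else 0) * (r^2) powr (a - 1)
    + (t $ s - x0 $ s) * ((a - 1) * (r^2) powr (a - 2) * (2 * (t $ i - x0 $ i))))" for i
  proof -
   have "(\<lambda>x. (x $ s - x0 $ s) * ((norm (x - x0))^2) powr (a - 1)) differentiable (at t)"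
    by (intro differentiable_mult dc d)
   then have "pd i (Gs x0 k) t = - (2 * a * c) * pd i (\<lambda>x. (x $ s - x0 $ s) * ((norm (x - x0))^2) powr (a - 1)) t"
    unfolding Gs_def[abs_def] Some Let_def option.case a_def[symmetric] c_def[symmetric] by (rule part_deriv_cmult)
   then show ?thesis unfolding part_deriv_mult[OF dc d] p1 pd[OF t] n[OF t] by simp
  qed
  note pdk = this
  have "(t $ i - x0 $ i) / r * pd i (Gs x0 k) t =
    (if i = s then - (2 * a * c) * (r^2) powr (a - 1) * ((t $ s - x0 $ s) / r) else 0) +
    (- (2 * a * c) * (2 * (a - 1)) * (r^2) powr (a - 2) * ((t $ s - x0 $ s) / r)) * (t $ i - x0 $ i)^2" for i
   unfolding pdk using r by (cases "i = s") (simp_all add: power2_eq_square[of "t $ _ - _"] field_simps)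
  then have "(\<Sum>i\<in>UNIV. (t $ i - x0 $ i) / r * pd i (Gs x0 k) t) =
    - (2 * a * c) * (r^2) powr (a - 1) * ((t $ s - x0 $ s) / r) +
    (- (2 * a * c) * (2 * (a - 1)) * (r^2) powr (a - 2) * ((t $ s - x0 $ s) / r)) * r^2"
   by (simp only: sum.distrib sum_distrib_left[symmetric] sq[OF t] sum.delta finite UNIV_I if_True)
  then show ?thesis using Some by (simp add: algebra_simps)
 qed
 have "(\<Sum>i\<in>UNIV. \<integral>t. (t $ i - x0 $ i) / r * pd i (Gs x0 k) t \<partial>?S) =
   (\<integral>t. (\<Sum>i\<in>UNIV. (t $ i - x0 $ i) / r * pd i (Gs x0 k) t) \<partial>?S)"
  by (rule Bochner_Integration.integral_sum[symmetric]) (rule int)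
 also have "\<dots> = (if k = None then 1 else 0)"
 proof (cases k)
  case None
  have "(\<integral>t. (\<Sum>i\<in>UNIV. (t $ i - x0 $ i) / r * pd i (Gs x0 k) t) \<partial>?S) = (\<integral>t. 2 * a * c * ((r^2) powr (a - 1) * r) * 1 \<partial>?S)"
   by (intro bochner_cong refl) (simp only: None *[unfolded None option.case] mult_1_right)
  also have "\<dots> = 2 * a * c * ((r^2) powr (a - 1) * r) * (real CARD('n) * r ^ (CARD('n) - 1) * measure lebesgue (ball (0::real^'n) 1))"
   by (subst integral_mult_right_zero, subst sphere_total[OF r]) simp
  also have "\<dots> = ((r^2) powr (a - 1) * (r * r ^ (CARD('n) - 1))) * (c * (2 * a * (real CARD('n) * measure lebesgue (ball (0::real^'n) 1))))"
   by simp
  also have "r * r ^ (CARD('n) - 1) = r ^ CARD('n)" by (simp add: power_eq_if)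
  also have "2 * a = 2 - real CARD('n)" by (simp add: a_def)
  finally show ?thesis using None radial_powr[OF r, of "CARD('n)", folded a_def] C_dim_vol[OF dim, folded c_def] by simp
 next
  case (Some s)
  have "(\<integral>t. (\<Sum>i\<in>UNIV. (t $ i - x0 $ i) / r * pd i (Gs x0 k) t) \<partial>?S) =
   (\<integral>t. (- (2 * a * c) * ((r^2) powr (a - 1) + 2 * (a - 1) * ((r^2) powr (a - 2) * r^2))) * ((t $ s - x0 $ s) / r) \<partial>?S)"
   by (intro bochner_cong refl) (simp only: Some *[unfolded Some option.case])
  then show ?thesis using Some by (simp only: integral_mult_right_zero sphere_moments(1)[OF r]) simp
 qed
 finally show ?thesis .
qed

text \<open>Absolute continuity of the integral: the balls shrink to the null set consisting of
  \<open>x0\<close>.\<close>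

lemma shrinking_ball_integral:
 fixes v :: "real^'n \<Rightarrow> complex"
 assumes x0: "x0 \<in> Om" and v: "v \<in> L2 (leb Om)"
 shows "((\<lambda>\<delta>. \<integral>x. v x \<partial>leb (ball x0 \<delta>)) \<longlongrightarrow> 0) (at_right 0)"
proof (rule tendsto_at_right_sequentially)
 let ?M = "leb (Om :: (real^'n) set)"
 have Oml: "Om \<in> sets (lebesgue :: (real^'n) measure)" by simp
 show "0 < 1 - norm x0" using x0 by simp
 fix S :: "nat \<Rightarrow> real"
 assume S: "\<And>n. 0 < S n" "\<And>n. S n < 1 - norm x0" "S \<longlonglongrightarrow> 0"
 have vi: "integrable ?M v" by (rule L2_integrable[OF finite_measure_lebesgue_on[OF lmeas_Om] v])
 have sub: "ball x0 (S n) \<subseteq> Om" for n using cball_subset_Om[OF S(2)[of n]] ball_subset_cball by blast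
 have eq: "(\<integral>x. v x \<partial>leb (ball x0 (S n))) = (\<integral>x. indicator (ball x0 (S n)) x *\<^sub>R v x \<partial>?M)" for n
 proof -
  have "(\<integral>x. v x \<partial>leb (ball x0 (S n))) = (\<integral>x. indicator (ball x0 (S n)) x *\<^sub>R v x \<partial>lebesgue)"
   by (rule lebesgue_on_indicator) simp
  also have "\<dots> = (\<integral>x. indicator Om x *\<^sub>R (indicator (ball x0 (S n)) x *\<^sub>R v x) \<partial>lebesgue)"
   using sub[of n] by (intro bochner_cong refl) (auto simp: indicator_def subset_eq)
  also have "\<dots> = (\<integral>x. indicator (ball x0 (S n)) x *\<^sub>R v x \<partial>?M)"
   by (rule lebesgue_on_indicator(1)[OF Oml, symmetric])
  finally show ?thesis .
 qed
 have m: "(\<lambda>x. indicator (ball x0 (S n)) x :: real) \<in> borel_measurable ?M" for n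
  by (intro borel_imp_lebesgue_on borel_measurable_indicator) simp
 have "(\<lambda>n. \<integral>x. indicator (ball x0 (S n)) x *\<^sub>R v x \<partial>?M) \<longlonglongrightarrow> (\<integral>x. 0 \<partial>?M)"
 proof (rule integral_dominated_convergence[where w="\<lambda>x. norm (v x)"])
  show "(\<lambda>x. indicator (ball x0 (S n)) x *\<^sub>R v x) \<in> borel_measurable ?M" for n
   using L2D(1)[OF v] m[of n] by (intro borel_measurable_scaleR)
  show "AE x in ?M. (\<lambda>n. indicator (ball x0 (S n)) x *\<^sub>R v x) \<longlonglongrightarrow> 0"
   using AE_neq[OF Oml, of x0]
  proof eventually_elim
   case (elim x)
   then have "eventually (\<lambda>n. S n < dist x0 x) sequentially" by (intro order_tendstoD(2)[OF S(3)]) simp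
   then show ?case by (intro tendsto_eventually) (auto elim!: eventually_mono)
  qed
  show "AE x in ?M. norm (indicator (ball x0 (S n)) x *\<^sub>R v x) \<le> norm (v x)" for n
   by (intro AE_I2) (auto simp: indicator_def)
 qed (use vi in auto)
 then show "(\<lambda>n. \<integral>x. v x \<partial>leb (ball x0 (S n))) \<longlonglongrightarrow> 0" unfolding eq by simp
qed

section \<open>Linear combinations of smooth functions and their traces\<close>

lemma comb_W2:
 fixes E :: "'k::finite \<Rightarrow> real^'n \<Rightarrow> real"
 assumes "open U" "\<And>k. elementary U (E k)" "open V" "compact (closure V)" "closure V \<subseteq> U"
 shows "(\<lambda>x. \<Sum>k\<in>UNIV. c k * of_real (E k x)) \<in> W2 m V"
 by (intro W2_sum W2_elem[where U=U] assms)

lemma comb_weak_deriv: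
 fixes E :: "'k::finite \<Rightarrow> real^'n \<Rightarrow> real"
 assumes "open U" "\<And>k. elementary U (E k)" "open V" "V \<subseteq> U"
 shows "has_weak_deriv V i (\<lambda>x. \<Sum>k\<in>UNIV. c k * of_real (E k x)) (\<lambda>x. \<Sum>k\<in>UNIV. c k * of_real (pd i (E k) x))"
 by (intro has_weak_deriv_subset[OF assms(1,3,4)] has_weak_deriv_sum has_weak_deriv_elem_cmult assms)

lemma comb_continuous:
 fixes E :: "'k::finite \<Rightarrow> real^'n \<Rightarrow> real"
 assumes "open U" "\<And>k. elementary U (E k)" "S \<subseteq> U"
 shows "continuous_on S (\<lambda>x. \<Sum>k\<in>UNIV. c k * complex_of_real (E k x))"
 by (intro continuous_intros continuous_on_subset[OF elem_continuous_on assms(3)] assms)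

lemma closure_punctured:
 fixes x0 :: "real^'n"
 assumes "r > 0"
 shows "closure (Om - cball x0 r) \<subseteq> cball 0 1 - {x0}" "compact (closure (Om - cball x0 r))"
proof -
 have "Om - cball x0 r \<subseteq> cball 0 1 - ball x0 r" using ball_subset_cball by fastforce
 then have "closure (Om - cball x0 r) \<subseteq> cball 0 1 - ball x0 r"
  by (rule closure_minimal) (simp add: closed_Diff)
 then show "closure (Om - cball x0 r) \<subseteq> cball 0 1 - {x0}" using assms by auto
 show "compact (closure (Om - cball x0 r))"
  by (simp add: compact_closure bounded_subset[OF bounded_ball Diff_subset])
qed

lemma trace_add_comb:
 fixes E :: "'k::finite \<Rightarrow> real^'n \<Rightarrow> real"
 assumes r: "r > 0" and U: "open U" "cball 0 1 - {x0} \<subseteq> U"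
  and E: "\<And>k. elementary U (E k)" and t: "has_trace (Om - cball x0 r) x0 r g T"
 shows "has_trace (Om - cball x0 r) x0 r (\<lambda>x. g x + (\<Sum>k\<in>UNIV. c k * of_real (E k x)))
  (\<lambda>x. T x + (\<Sum>k\<in>UNIV. c k * of_real (E k x)))"
proof (rule has_trace_add_smooth[OF _ t r open_UNIV])
 have c: "closure (Om - cball x0 r) \<subseteq> U" using closure_punctured(1)[OF r] U(2) by blast
 show "open (Om - cball x0 r)" by auto
 then show "(\<lambda>x. \<Sum>k\<in>UNIV. c k * of_real (E k x)) \<in> W2 1 ((Om - cball x0 r) \<inter> UNIV)"
  using closure_punctured(2)[OF r] c by (simp only: Int_UNIV_right) (rule comb_W2[OF U(1) E])
 show "continuous_on (closure ((Om - cball x0 r) \<inter> UNIV)) (\<lambda>x. \<Sum>k\<in>UNIV. c k * complex_of_real (E k x))"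
  using comb_continuous[OF U(1) E c] by simp
qed simp

lemma has_trace_L2: "has_trace U a r g T \<Longrightarrow> T \<in> L2 (sphere_measure a r)"
 unfolding has_trace_def by (elim conjE)

text \<open>Subtracting the explicit singular combination from any trace \<open>T\<close> leaves a
  trace of a function that is weakly differentiable across \<open>x0\<close>, to which
  \<open>interior_trace_integral\<close> applies; the combination itself is integrated
  directly.\<close>

lemma trace_moment:
 fixes E :: "'k::finite \<Rightarrow> real^'n \<Rightarrow> real"
 assumes r: "r > 0" "cball x0 r \<subseteq> Om"
  and g: "has_weak_deriv Om i g v" "v \<in> L2 (leb Om)" "g \<in> L2 (leb Om)"
  and E: "\<And>k. elementary (- {x0}) (E k)"
  and t: "has_trace (Om - cball x0 r) x0 r (\<lambda>x. g x + (\<Sum>k\<in>UNIV. c k * of_real (E k x))) T"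
 shows "(\<integral>t. ((t $ i - x0 $ i) / r) *\<^sub>R T t \<partial>sphere_measure x0 r) = (\<integral>x. v x \<partial>leb (ball x0 r))
  + (\<Sum>k\<in>UNIV. c k * of_real (\<integral>t. (t $ i - x0 $ i) / r * E k t \<partial>sphere_measure x0 r))"
proof -
 let ?S = "sphere_measure x0 r"
 define z where "z x = (\<Sum>k\<in>UNIV. c k * of_real (E k x))" for x
 have op: "open (- {x0})" "cball 0 1 - {x0} \<subseteq> - {x0}" by (auto simp: open_Compl)
 have "has_trace (Om - cball x0 r) x0 r (\<lambda>x. (g x + z x) + (\<Sum>k\<in>UNIV. - c k * of_real (E k x)))
  (\<lambda>x. T x + (\<Sum>k\<in>UNIV. - c k * of_real (E k x)))"
  by (rule trace_add_comb[OF r(1) op E t[folded z_def]])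
 moreover have "(\<Sum>k\<in>UNIV. - c k * of_real (E k x)) = - z x" for x by (simp add: z_def sum_negf)
 ultimately have "has_trace (Om - cball x0 r) x0 r g (\<lambda>x. T x + - z x)" by simp
 from interior_trace_integral[OF r g this]
 have 1: "(\<integral>t. ((t $ i - x0 $ i) / r) *\<^sub>R (T t + - z t) \<partial>?S) = (\<integral>x. v x \<partial>leb (ball x0 r))" .
 have sub: "sphere x0 r \<subseteq> - {x0}" using r by auto
 have ti: "integrable ?S (\<lambda>t. (t $ i - x0 $ i) / r * E k t)" for k
  by (intro sphere_integrable_continuous r continuous_intros continuous_on_subset[OF elem_continuous_on[OF E op(1)] sub]) (use r in auto)
 have zi: "((t $ i - x0 $ i) / r) *\<^sub>R z t = (\<Sum>k\<in>UNIV. c k * of_real ((t $ i - x0 $ i) / r * E k t))" for t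
  unfolding z_def scaleR_sum_right by (intro sum.cong refl) (simp add: scaleR_conv_of_real)
 have zint: "integrable ?S (\<lambda>t. ((t $ i - x0 $ i) / r) *\<^sub>R z t)"
  unfolding zi by (intro Bochner_Integration.integrable_sum integrable_mult_right integrable_of_real ti)
 have T: "integrable ?S T" by (rule L2_integrable[OF finite_sphere_measure[OF r(1)] has_trace_L2[OF t]])
 note Tint = normal_integrable[OF r(1) T, of i]
 have "(\<integral>t. ((t $ i - x0 $ i) / r) *\<^sub>R T t \<partial>?S) = (\<integral>x. v x \<partial>leb (ball x0 r)) + (\<integral>t. ((t $ i - x0 $ i) / r) *\<^sub>R z t \<partial>?S)"
  unfolding diff_eq_eq[symmetric] bochner_diff[OF Tint zint, symmetric]
  using 1 by (simp add: scaleR_diff_right)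
 also have "(\<integral>t. ((t $ i - x0 $ i) / r) *\<^sub>R z t \<partial>?S) = (\<Sum>k\<in>UNIV. c k * of_real (\<integral>t. (t $ i - x0 $ i) / r * E k t \<partial>?S))"
  unfolding zi by (subst Bochner_Integration.integral_sum, intro integrable_mult_right integrable_of_real ti)
   (simp only: integral_mult_right_zero integral_complex_of_real)
 finally show ?thesis .
qed

lemma sphere_trace_has_trace: "has_trace U a r g T \<Longrightarrow> has_trace U a r g (sphere_trace U a r g)"
 unfolding sphere_trace_def by (rule someI[of "has_trace U a r g"])

lemma sum_UNIV_option: "(\<Sum>k\<in>(UNIV::'n::finite option set). F k) = F None + (\<Sum>s\<in>UNIV. F (Some s))"
 for F :: "_ \<Rightarrow> 'a::comm_monoid_add"
 unfolding UNIV_option_conv by (subst sum.insert) (auto simp: sum.reindex)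

text \<open>The smooth approximations \<open>A\<close> and \<open>B\<close> are among the hypotheses
  because the traces of \<open>w\<close> and of its derivatives on small spheres are constructed
  from them.\<close>

lemma singular_moments:
 fixes x0 :: "real^'n" and c :: "'n option \<Rightarrow> complex"
 assumes dim: "CARD('n) \<ge> 3" and x0: "x0 \<in> Om"
  and w: "w \<in> L2 (leb Om)" "\<And>i. v i \<in> L2 (leb Om)" "\<And>i j. v2 i j \<in> L2 (leb Om)"
  and AB: "\<And>n. elem (A n)" "\<And>n. elem (B n)"
  and lim: "L2_lim (leb Om) (\<lambda>n. cx (A n) (B n)) w"
   "\<And>i. L2_lim (leb Om) (\<lambda>n. cx (pd i (A n)) (pd i (B n))) (v i)"
   "\<And>i j. L2_lim (leb Om) (\<lambda>n. cx (pd j (pd i (A n))) (pd j (pd i (B n)))) (v2 i j)"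
 defines "u \<equiv> \<lambda>x. w x + (\<Sum>k\<in>UNIV. c k * of_real (Gx x0 k x))"
 shows "(normal_flux x0 u \<longlongrightarrow> - c None) (at_right 0)"
  "(sphere_moment x0 s u \<longlongrightarrow> - c (Some s) / of_nat CARD('n)) (at_right 0)"
proof -
 let ?M = "leb (Om :: (real^'n) set)"
 let ?D = "Dx x0 - {x0}"
 have Oop: "open (Om0 x0)" "open (Om :: (real^'n) set)" by (auto intro: open_delete)
 have Dop: "open ?D" "open (- {x0})" by (auto intro: open_delete Dx_open simp: open_Compl)
 have OD: "Om \<subseteq> Dx x0" "closure Om \<subseteq> Dx x0" "cball 0 1 - {x0} \<subseteq> ?D" using Dx_ball[OF x0] by auto
 have Ocl: "compact (closure (Om :: (real^'n) set))" by simp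
 have dGh: "elementary (Dx x0) (pd i (Gh x0 k))" for i k by (rule elem_part_deriv[OF Gh_elem Dx_open])
 have ddGh: "elementary (Dx x0) (pd j (pd i (Gh x0 k)))" for i j k by (rule elem_part_deriv[OF dGh Dx_open])
 have dGs: "elementary (- {x0}) (pd i (Gs x0 k))" for i k by (rule elem_part_deriv[OF Gs_elem Dop(2)])
 have dGx: "elementary ?D (pd i (Gx x0 k))" for i k by (rule elem_part_deriv[OF Gx_elem Dop(1)])
 have hL2: "(\<lambda>x. \<Sum>k\<in>UNIV. c k * of_real (E k x)) \<in> L2 ?M" if "\<And>k. elementary (Dx x0) (E k)" for E
  using comb_W2[OF Dx_open that Oop(2) Ocl OD(2), where c=c and m=0] by simp
 have wd: "has_weak_deriv Om i w (v i)" for i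
  by (rule W21_approx(1)[OF Oop(2) order_refl w(1,2) AB lim(1,2)])
 have wd2: "has_weak_deriv Om j (v i) (v2 i j)" for i j
  by (rule W21_approx(1)[OF Oop(2) order_refl w(2,3) pd_elem[OF AB(1)] pd_elem[OF AB(2)] lim(2,3)])
 \<comment> \<open>The smooth parts \<open>Gh\<close> are merged with \<open>w\<close>, so that
   \<open>g\<close> has square integrable second weak derivatives across \<open>x0\<close> and only
   the explicit functions \<open>Gs\<close> are singular.\<close>
 define g where "g x = w x + (\<Sum>k\<in>UNIV. c k * of_real (Gh x0 k x))" for x
 define gv where "gv i x = v i x + (\<Sum>k\<in>UNIV. c k * of_real (pd i (Gh x0 k) x))" for i x
 define gv2 where "gv2 i x = v2 i i x + (\<Sum>k\<in>UNIV. c k * of_real (pd i (pd i (Gh x0 k)) x))" for i x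
 have gL: "g \<in> L2 ?M" "gv i \<in> L2 ?M" "gv2 i \<in> L2 ?M" for i
  unfolding g_def gv_def gv2_def by (intro L2_add w hL2 Gh_elem dGh ddGh)+
 have gd: "has_weak_deriv Om i g (gv i)" for i
  unfolding g_def gv_def by (intro has_weak_deriv_add Oop wd comb_weak_deriv[OF Dx_open Gh_elem Oop(2) OD(1)])
 have gd2: "has_weak_deriv Om i (gv i) (gv2 i)" for i
  unfolding gv_def gv2_def by (intro has_weak_deriv_add Oop wd2 comb_weak_deriv[OF Dx_open dGh Oop(2) OD(1)])
 have ug: "u x = g x + (\<Sum>k\<in>UNIV. c k * of_real (Gs x0 k x))" if "x \<in> Om0 x0" for x
  using that Gx_split[of x x0] OD(1) by (auto simp: u_def g_def sum.distrib[symmetric] algebra_simps subset_eq)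
 then have ugae: "AE x in leb (Om0 x0). u x = g x + (\<Sum>k\<in>UNIV. c k * of_real (Gs x0 k x))"
  by (intro AE_I2) simp
 \<comment> \<open>The weak derivative is described twice. The form with the full \<open>Gx\<close>
   shows that it has a trace, as a trace of \<open>v i\<close> plus continuous functions; the form
   with \<open>Gs\<close> separated is the one whose moments can be computed.\<close>
 have du1: "AE x in leb (Om0 x0). weak_deriv (Om0 x0) i u x = v i x + (\<Sum>k\<in>UNIV. c k * of_real (pd i (Gx x0 k) x))" for i
  unfolding u_def
  by (intro weak_deriv_AE has_weak_deriv_add Oop has_weak_deriv_subset[OF Oop(2,1) _ wd] comb_weak_deriv[OF Dop(1) Gx_elem]) (use OD in auto)
 have du2: "AE x in leb (Om0 x0). weak_deriv (Om0 x0) i u x = gv i x + (\<Sum>k\<in>UNIV. c k * of_real (pd i (Gs x0 k) x))" for i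
 proof (rule weak_deriv_AE[OF Oop(1)])
  have "has_weak_deriv (Om0 x0) i (\<lambda>x. g x + (\<Sum>k\<in>UNIV. c k * of_real (Gs x0 k x))) (\<lambda>x. gv i x + (\<Sum>k\<in>UNIV. c k * of_real (pd i (Gs x0 k) x)))"
   by (intro has_weak_deriv_add Oop has_weak_deriv_subset[OF Oop(2,1) _ gd] comb_weak_deriv[OF Dop(2) Gs_elem]) auto
  then show "has_weak_deriv (Om0 x0) i u (\<lambda>x. gv i x + (\<Sum>k\<in>UNIV. c k * of_real (pd i (Gs x0 k) x)))"
   by (rule has_weak_deriv_cong_AE[OF Oop(1)]) (auto intro!: AE_I2 simp: ug)
 qed
 have small: "eventually (\<lambda>r. r > 0 \<and> cball x0 r \<subseteq> Om) (at_right 0)"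
 proof -
  show ?thesis using x0 cball_subset_Om[of _ x0] by (intro eventually_at_rightI[of 0 "1 - norm x0"]) auto
 qed
 note n = sphere_space_norm[where a=x0]
 have aeU: "AE x in leb (Om - cball x0 r). P x" "open (Om - cball x0 r)" if "r > 0" "AE x in leb (Om0 x0). P x" for P r
 proof -
  show o: "open (Om - cball x0 r)" by auto
  show "AE x in leb (Om - cball x0 r). P x"
   by (rule AE_lebesgue_on_subset[OF open_lebesgue[OF Oop(1)] open_lebesgue[OF o] _ that(2)]) (use that in auto)
 qed
 \<comment> \<open>An identity for each small radius: the singular part contributes its constant
   exactly, and the only term depending on \<open>r\<close> is an integral over the shrinking
   ball.\<close>
 have mom: "sphere_moment x0 s u r = (\<integral>x. gv s x \<partial>leb (ball x0 r)) + - c (Some s) / of_nat CARD('n)"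
  if r: "r > 0" "cball x0 r \<subseteq> Om" for r
 proof -
  let ?T = "sphere_trace (Om - cball x0 r) x0 r u"
  obtain T0 where "has_trace (Om - cball x0 r) x0 r w T0"
   using trace_exists[OF r w(1,2) AB lim(1,2)] by blast
  from sphere_trace_has_trace[OF trace_add_comb[OF r(1) Dop(1) OD(3) Gx_elem this, of c]]
  have "has_trace (Om - cball x0 r) x0 r u ?T" unfolding u_def .
  then have "has_trace (Om - cball x0 r) x0 r (\<lambda>x. g x + (\<Sum>k\<in>UNIV. c k * of_real (Gs x0 k x))) ?T"
   by (rule has_trace_cong_AE[rotated 2]) (use aeU[OF r(1) ugae] in auto)
  from trace_moment[OF r gd gL(2,1) Gs_elem this]
  have "(\<integral>t. ((t $ s - x0 $ s) / r) *\<^sub>R ?T t \<partial>sphere_measure x0 r) = (\<integral>x. gv s x \<partial>leb (ball x0 r))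
    + (\<Sum>k\<in>UNIV. c k * of_real (if k = Some s then - 1 / real CARD('n) else 0))"
   by (simp only: Gs_moment[OF dim r(1)])
  moreover have "(\<Sum>k\<in>UNIV. c k * of_real (if k = Some s then - 1 / real CARD('n) else 0)) =
    (\<Sum>k\<in>UNIV. if k = Some s then - c k / of_nat CARD('n) else 0)"
   by (intro sum.cong refl) auto
  moreover have "sphere_moment x0 s u r = (\<integral>t. ((t $ s - x0 $ s) / r) *\<^sub>R ?T t \<partial>sphere_measure x0 r)"
   unfolding sphere_moment_def by (intro bochner_cong refl) (simp add: n)
  ultimately show ?thesis by simp
 qed
 have flux: "normal_flux x0 u r = - (\<Sum>i\<in>UNIV. \<integral>x. gv2 i x \<partial>leb (ball x0 r)) - c None"
  if r: "r > 0" "cball x0 r \<subseteq> Om" for r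
 proof -
  let ?S = "sphere_measure x0 r"
  define T where "T i = sphere_trace (Om - cball x0 r) x0 r (weak_deriv (Om0 x0) i u)" for i
  have T: "has_trace (Om - cball x0 r) x0 r (weak_deriv (Om0 x0) i u) (T i)" for i
  proof -
   obtain T0 where "has_trace (Om - cball x0 r) x0 r (v i) T0"
    using trace_exists[OF r w(2,3) pd_elem[OF AB(1)] pd_elem[OF AB(2)] lim(2,3)] by blast
   from trace_add_comb[OF r(1) Dop(1) OD(3) dGx this, of c]
   have "has_trace (Om - cball x0 r) x0 r (weak_deriv (Om0 x0) i u) (\<lambda>x. T0 x + (\<Sum>k\<in>UNIV. c k * of_real (pd i (Gx x0 k) x)))"
    by (rule has_trace_cong_AE[rotated 2]) (use aeU[OF r(1) du1[of i]] in \<open>auto elim: eventually_mono\<close>)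
   then show ?thesis unfolding T_def by (rule sphere_trace_has_trace)
  qed
  have "has_trace (Om - cball x0 r) x0 r (\<lambda>x. gv i x + (\<Sum>k\<in>UNIV. c k * of_real (pd i (Gs x0 k) x))) (T i)" for i
   by (rule has_trace_cong_AE[OF _ _ T]) (use aeU[OF r(1) du2[of i]] in auto)
  from trace_moment[OF r gd2 gL(3,2) dGs this]
  have 1: "(\<integral>t. ((t $ i - x0 $ i) / r) *\<^sub>R T i t \<partial>?S) = (\<integral>x. gv2 i x \<partial>leb (ball x0 r))
   + (\<Sum>k\<in>UNIV. c k * of_real (\<integral>t. (t $ i - x0 $ i) / r * pd i (Gs x0 k) t \<partial>?S))" for i .
  have Tint: "integrable ?S (\<lambda>t. ((t $ i - x0 $ i) / r) *\<^sub>R T i t)" for i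
   by (intro normal_integrable r L2_integrable[OF finite_sphere_measure[OF r(1)] has_trace_L2[OF T]])
  have "normal_flux x0 u r = (\<integral>t. - (\<Sum>i\<in>UNIV. ((t $ i - x0 $ i) / r) *\<^sub>R T i t) \<partial>?S)"
  proof -
   have "((x0 $ i - t $ i) / r) *\<^sub>R z = - (((t $ i - x0 $ i) / r) *\<^sub>R z)" for t i and z :: complex
    by (metis minus_diff_eq minus_divide_left scaleR_minus_left)
   then show ?thesis
    unfolding normal_flux_def T_def by (intro bochner_cong refl) (simp only: n sum_negf)
  qed
  also have "\<dots> = - (\<Sum>i\<in>UNIV. \<integral>t. ((t $ i - x0 $ i) / r) *\<^sub>R T i t \<partial>?S)"
   by (simp add: Bochner_Integration.integral_sum Tint del: scaleR_left_diff_distrib)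
  also have "\<dots> = - (\<Sum>i\<in>UNIV. \<integral>x. gv2 i x \<partial>leb (ball x0 r))
    - (\<Sum>i\<in>UNIV. \<Sum>k\<in>UNIV. c k * of_real (\<integral>t. (t $ i - x0 $ i) / r * pd i (Gs x0 k) t \<partial>?S))"
   unfolding 1 sum.distrib by simp
  also have "(\<Sum>i\<in>UNIV. \<Sum>k\<in>UNIV. c k * of_real (\<integral>t. (t $ i - x0 $ i) / r * pd i (Gs x0 k) t \<partial>?S)) =
    (\<Sum>k\<in>UNIV. c k * of_real (\<Sum>i\<in>UNIV. \<integral>t. (t $ i - x0 $ i) / r * pd i (Gs x0 k) t \<partial>?S))"
   unfolding of_real_sum sum_distrib_left by (rule sum.swap)
  also have "\<dots> = (\<Sum>k\<in>UNIV. if k = None then c k else 0)"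
   unfolding Gs_flux[OF dim r(1)] by (intro sum.cong refl) simp
  finally show ?thesis by simp
 qed
 have l1: "((\<lambda>r. - (\<Sum>i\<in>UNIV. \<integral>x. gv2 i x \<partial>leb (ball x0 r)) - c None) \<longlongrightarrow> - (\<Sum>i\<in>(UNIV::'n set). 0) - c None) (at_right 0)"
  by (intro tendsto_intros shrinking_ball_integral x0 gL)
 have "eventually (\<lambda>r. - (\<Sum>i\<in>UNIV. \<integral>x. gv2 i x \<partial>leb (ball x0 r)) - c None = normal_flux x0 u r) (at_right 0)"
  using small by eventually_elim (simp add: flux)
 from Lim_transform_eventually[OF l1 this] show "(normal_flux x0 u \<longlongrightarrow> - c None) (at_right 0)" by simp
 have l2: "((\<lambda>r. (\<integral>x. gv s x \<partial>leb (ball x0 r)) + - c (Some s) / of_nat CARD('n)) \<longlongrightarrow> 0 + - c (Some s) / of_nat CARD('n)) (at_right 0)"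
  by (intro tendsto_add tendsto_const shrinking_ball_integral x0 gL)
 have "eventually (\<lambda>r. (\<integral>x. gv s x \<partial>leb (ball x0 r)) + - c (Some s) / of_nat CARD('n) = sphere_moment x0 s u r) (at_right 0)"
  using small by eventually_elim (simp add: mom)
 from Lim_transform_eventually[OF l2 this] show "(sphere_moment x0 s u \<longlongrightarrow> - c (Some s) / of_nat CARD('n)) (at_right 0)" by simp
qed

section \<open>Invariance under null sets and solution of the problem\<close>

lemma AE_Om0: "(AE x in leb (Om0 x0). P x) \<longleftrightarrow> (AE x in leb Om. P (x::real^'n))"
proof -
 have l: "Om0 x0 \<in> sets lebesgue" "(Om :: (real^'n) set) \<in> sets lebesgue"
  by (intro open_lebesgue open_delete open_ball)+
 show ?thesis
 proof
  assume "AE x in leb (Om0 x0). P x"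
  then have "AE x in lebesgue. x \<in> Om0 x0 \<longrightarrow> P x" unfolding AE_lebesgue_on_iff[OF l(1)] .
  moreover have "AE x in lebesgue. x \<in> Om \<longrightarrow> x \<noteq> x0" using AE_neq[OF l(2), of x0] unfolding AE_lebesgue_on_iff[OF l(2)] .
  ultimately show "AE x in leb Om. P x" unfolding AE_lebesgue_on_iff[OF l(2)] by eventually_elim auto
 qed (rule AE_lebesgue_on_subset[OF l(2,1)], auto)
qed

lemma sphere_trace_cong_AE:
 assumes "open U" "AE x in leb U. g x = g' x"
 shows "sphere_trace U a r g = sphere_trace U a r g'"
proof -
 have "AE x in leb U. g' x = g x" using assms(2) by eventually_elim simp
 then have "has_trace U a r g = has_trace U a r g'"
  using has_trace_cong_AE[OF assms(1)] assms(2) by blast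
 then show ?thesis by (simp add: sphere_trace_def)
qed

text \<open>The functionals see \<open>u\<close> only through \<open>weak_deriv\<close> and
  \<open>sphere_trace\<close>, both chosen from predicates that a change on a null set leaves
  unaffected. Thus they are well defined on classes, as needed for values of
  \<open>K\<close>.\<close>

lemma gamma_cong_AE:
 fixes u u' :: "real^'n \<Rightarrow> complex"
 assumes ae: "AE x in leb Om. u x = u' x"
 shows "gamma0 x0 u = gamma0 x0 u'" "gamma x0 s u = gamma x0 s u'"
proof -
 have o: "open (Om0 x0)" by (intro open_delete open_ball)
 have wd: "weak_deriv (Om0 x0) i u = weak_deriv (Om0 x0) i u'" for i
  by (intro weak_deriv_cong_AE o) (simp add: AE_Om0 ae)
 have "normal_flux x0 u = normal_flux x0 u'" by (intro ext) (simp only: normal_flux_def wd)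
 then show "gamma0 x0 u = gamma0 x0 u'" by (simp add: gamma0_def)
 have st: "sphere_trace (Om - cball x0 \<delta>) x0 \<delta> u = sphere_trace (Om - cball x0 \<delta>) x0 \<delta> u'" for \<delta>
 proof (rule sphere_trace_cong_AE)
  show "open (Om - cball x0 \<delta>)" by auto
  from AE_lebesgue_on_subset[OF open_lebesgue[OF open_ball] open_lebesgue[OF this] _ ae]
  show "AE x in leb (Om - cball x0 \<delta>). u x = u' x" by auto
 qed
 have "sphere_moment x0 s u = sphere_moment x0 s u'" by (intro ext) (simp only: sphere_moment_def st)
 then show "gamma x0 s u = gamma x0 s u'" by (simp add: gamma_def)
qed

lemma has_trace_cong_sphere:
 assumes "has_trace U a r g T" "\<And>t. t \<in> sphere a r \<Longrightarrow> T t = T' t"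
 shows "has_trace U a r g T'"
proof -
 let ?S = "sphere_measure a r"
 have e: "T t = T' t" if "t \<in> space ?S" for t using that assms(2) by (simp add: sphere_measure_space)
 have "T \<in> L2 ?S \<longleftrightarrow> T' \<in> L2 ?S" unfolding L2_def
  using e by (simp cong: measurable_cong Bochner_Integration.integrable_cong)
 moreover have "L2_norm ?S (\<lambda>t. \<phi> t - T t) = L2_norm ?S (\<lambda>t. \<phi> t - T' t)" for \<phi> :: "_ \<Rightarrow> complex"
  unfolding L2_norm_def using e by (intro arg_cong[where f=sqrt] bochner_cong refl) simp
 ultimately show ?thesis using assms(1) unfolding has_trace_def by simp
qed

text \<open>The functions \<open>Gx\<close> are smooth away from \<open>x0\<close> up to the unit
  sphere and vanish on it, so passing between \<open>u\<close> and its regular part preserves the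
  zero trace.\<close>

lemma outer_trace_add_Gx:
 fixes x0 :: "real^'n" and c :: "'n option \<Rightarrow> complex"
 assumes x0: "x0 \<in> Om" and t: "has_trace (Om0 x0) 0 1 g (\<lambda>_. 0)"
 shows "has_trace (Om0 x0) 0 1 (\<lambda>x. g x + (\<Sum>k\<in>UNIV. c k * of_real (Gx x0 k x))) (\<lambda>_. 0)"
proof (rule has_trace_cong_sphere)
 let ?z = "\<lambda>x. \<Sum>k\<in>UNIV. c k * complex_of_real (Gx x0 k x)"
 define \<rho> where "\<rho> = (1 - norm x0) / 2"
 have \<rho>: "\<rho> > 0" "cball x0 \<rho> \<subseteq> Om" using x0 by (auto simp: \<rho>_def intro!: cball_subset_Om[THEN subsetD])
 have D: "open (Dx x0 - {x0})" by (intro open_delete Dx_open)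
 have e: "Om0 x0 \<inter> (- cball x0 \<rho>) = Om - cball x0 \<rho>" using \<rho> by auto
 have c: "closure (Om - cball x0 \<rho>) \<subseteq> Dx x0 - {x0}" using closure_punctured(1)[OF \<rho>(1)] Dx_ball[OF x0] by fastforce
 show "has_trace (Om0 x0) 0 1 (\<lambda>x. g x + ?z x) (\<lambda>x. 0 + ?z x)"
 proof (rule has_trace_add_smooth[OF _ t])
  show "open (Om0 x0)" by (intro open_delete open_ball)
  have "sphere 0 1 \<inter> Om = ({} :: (real^'n) set)" by auto
  then show "sphere 0 1 \<subseteq> - cball x0 \<rho>" using \<rho>(2) by blast
  show "?z \<in> W2 1 (Om0 x0 \<inter> - cball x0 \<rho>)" unfolding e
   by (rule comb_W2[OF D Gx_elem _ closure_punctured(2)[OF \<rho>(1)] c]) auto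
  show "continuous_on (closure (Om0 x0 \<inter> - cball x0 \<rho>)) ?z" unfolding e
   by (rule comb_continuous[OF D Gx_elem c])
 qed auto
qed (use Gx_boundary[OF x0] in simp)

lemma sphere_frontier_Om0: "x0 \<in> Om \<Longrightarrow> sphere 0 1 \<subseteq> frontier (Om0 (x0::real^'n))"
proof
 fix t :: "real^'n" assume x0: "x0 \<in> Om" and t: "t \<in> sphere 0 1"
 have o: "open (Om0 x0)" by (intro open_delete open_ball)
 have "t \<in> (- {x0}) \<inter> closure Om" using t x0 by auto
 then have "t \<in> closure ((- {x0}) \<inter> Om)" using open_Int_closure_subset[of "- {x0}" Om] by (auto simp: open_Compl)
 moreover have "(- {x0}) \<inter> Om = Om0 x0" by auto
 ultimately show "t \<in> frontier (Om0 x0)" using t by (simp add: frontier_def interior_open[OF o])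
qed

text \<open>\<open>weak_laplace\<close> iterates two arbitrary choices; the inner one may be
  replaced by \<open>v i\<close> because \<open>weak_deriv\<close> does not change under
  modification on null sets.\<close>

lemma weak_laplace_AE:
 assumes U: "open U" and "\<And>i. has_weak_deriv U i w (v i)" "\<And>i. has_weak_deriv U i (v i) (v2 i)"
 shows "AE x in leb U. weak_laplace U w x = (\<Sum>i\<in>UNIV. v2 i x)"
proof -
 have "AE x in leb U. weak_deriv U i (weak_deriv U i w) x = v2 i x" for i
  unfolding weak_deriv_cong_AE[OF U weak_deriv_AE[OF U assms(2)]] by (rule weak_deriv_AE[OF U assms(3)])
 then have "AE x in leb U. \<forall>i\<in>UNIV. weak_deriv U i (weak_deriv U i w) x = v2 i x"
  by (intro AE_finite_allI) auto
 then show ?thesis unfolding weak_laplace_def by eventually_elim simp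
qed

lemma regular_part_eq:
 "regular_part x0 u = (\<lambda>x. u x - (\<Sum>k\<in>UNIV. (case k of None \<Rightarrow> gamma0 x0 u | Some s \<Rightarrow> gamma x0 s u) * of_real (Gx x0 k x)))"
 unfolding regular_part_def sum_UNIV_option by (simp add: Gx_def algebra_simps)

text \<open>Right-hand side and coefficients are prescribed independently of each other: the
  functionals return \<open>c\<close>, so the regular part is exactly the solution \<open>w\<close>
  of the Dirichlet problem.\<close>

lemma singular_solution:
 fixes x0 :: "real^'n" and c :: "'n option \<Rightarrow> complex"
 assumes dim: "CARD('n) \<ge> 3" and x0: "x0 \<in> Om" and f: "f \<in> L2 (leb Om)"
 obtains u where "u \<in> W22_gamma x0" "gamma0 x0 u = c None" "\<And>s. gamma x0 s u = c (Some s)"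
  "AE x in leb Om. B_M x0 u x = f x"
proof -
 let ?M = "leb (Om :: (real^'n) set)"
 obtain a b :: "nat \<Rightarrow> real^'n \<Rightarrow> real" and w v v2 where
  ab: "\<And>n. rpoly (a n)" "\<And>n. rpoly (b n)"
  and ab0: "\<And>n x. norm x = 1 \<Longrightarrow> a n x = 0" "\<And>n x. norm x = 1 \<Longrightarrow> b n x = 0"
  and w: "w \<in> L2 ?M" "\<And>i. v i \<in> L2 ?M" "\<And>i j. v2 i j \<in> L2 ?M"
  and lim: "L2_lim ?M (\<lambda>n. cx (a n) (b n)) w"
   "\<And>i. L2_lim ?M (\<lambda>n. cx (pd i (a n)) (pd i (b n))) (v i)"
   "\<And>i j. L2_lim ?M (\<lambda>n. cx (pd j (pd i (a n))) (pd j (pd i (b n)))) (v2 i j)"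
  and eq: "AE x in ?M. (\<Sum>i\<in>UNIV. v2 i i x) = f x"
  using dirichlet_exists[OF f] by blast
 note AB = poly_elem[OF ab(1)] poly_elem[OF ab(2)]
 define u where "u x = w x + (\<Sum>k\<in>UNIV. c k * of_real (Gx x0 k x))" for x
 have o: "open (Om0 x0)" "Om0 x0 \<subseteq> Om" by (auto intro: open_delete)
 note lims = singular_moments[OF dim x0 w AB lim, where c=c, folded u_def]
 have g0: "gamma0 x0 u = c None"
  unfolding gamma0_def using tendsto_Lim[OF trivial_limit_at_right_real lims(1)] by simp
 have gs: "gamma x0 s u = c (Some s)" for s
  unfolding gamma_def using tendsto_Lim[OF trivial_limit_at_right_real lims(2)[of s]] by simp
 have reg: "regular_part x0 u = w"
  unfolding regular_part_eq sum_UNIV_option option.case g0 gs by (simp add: u_def sum_UNIV_option)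
 have wd: "has_weak_deriv Om i w (v i)" for i
  by (rule W21_approx(1)[OF open_ball order_refl w(1,2) AB lim(1,2)])
 have wd2: "has_weak_deriv Om j (v i) (v2 i j)" for i j
  by (rule W21_approx(1)[OF open_ball order_refl w(2,3) pd_elem[OF AB(1)] pd_elem[OF AB(2)] lim(2,3)])
 have v1: "v i \<in> W2 1 Om" for i by (rule W21I[OF w(2) wd2 w(3)])
 have "\<exists>v\<in>W2 (Suc 0) Om. has_weak_deriv Om i w v" for i using wd v1 unfolding One_nat_def by blast
 then have w2: "w \<in> W2 2 Om" unfolding numeral_2_eq_2 W2.simps(2)[of "Suc 0"] using w(1) by blast
 have "u \<in> W2_loc 2 (Om0 x0)" unfolding W2_loc_def
 proof (intro CollectI allI impI, elim conjE)
  fix V assume V: "open V" "compact (closure V)" "closure V \<subseteq> Om0 x0"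
  have "V \<subseteq> Om" "closure V \<subseteq> Dx x0 - {x0}" using V(3) closure_subset[of V] Dx_ball[OF x0] by (auto simp: subset_eq)
  then show "u \<in> W2 2 V" unfolding u_def
   by (intro W2_add V W2_subset[OF open_ball V(1) _ w2] comb_W2[OF _ Gx_elem V(1,2)] open_delete Dx_open)
 qed
 moreover have "gammas_exist x0 u" unfolding gammas_exist_def using lims by blast
 moreover have "has_trace (Om0 x0) 0 1 u (\<lambda>_. 0)" unfolding u_def
 proof (rule outer_trace_add_Gx[OF x0])
  note ap = W21_approx[OF o w(1,2) AB lim(1,2)]
  show "has_trace (Om0 x0) 0 1 w (\<lambda>_. 0)" unfolding has_trace_def
  proof (intro conjI exI[of _ UNIV] exI[of _ "\<lambda>n. cx (a n) (b n)"] allI)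
   show "sphere 0 1 \<subseteq> frontier (Om0 x0)" by (rule sphere_frontier_Om0[OF x0])
   show "(\<lambda>n. L2_norm (sphere_measure (0::real^'n) 1) (\<lambda>t. cx (a n) (b n) t - 0)) \<longlonglongrightarrow> 0"
   proof -
    have "L2_norm (sphere_measure (0::real^'n) 1) (\<lambda>t. cx (a n) (b n) t - 0) = sqrt (\<integral>t. 0 \<partial>sphere_measure (0::real^'n) 1)" for n
     unfolding L2_norm_def by (intro arg_cong[where f=sqrt] bochner_cong refl)
      (simp add: sphere_measure_space ab0)
    then show ?thesis by simp
   qed
   show "continuous_on (closure (Om0 x0 \<inter> UNIV)) (cx (a n) (b n))" for n
    by (intro continuous_intros elem_UNIV_continuous AB)
  qed (use ap(2-4) in \<open>simp_all only: Int_UNIV_right L2_zero open_UNIV subset_UNIV\<close>)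
 qed
 ultimately have "u \<in> W22_gamma x0" by (simp add: W22_gamma_def reg w2)
 moreover have "AE x in ?M. B_M x0 u x = f x"
  unfolding B_M_def reg using weak_laplace_AE[OF open_ball wd wd2] eq by eventually_elim simp
 ultimately show ?thesis using that g0 gs by blast
qed

text \<open>The regular part inherits the zero trace of \<open>u\<close>, since the functions
  \<open>Gx\<close> vanish on the unit sphere, and is therefore the Green potential of its
  Laplacian.\<close>

lemma W22_gamma_representation:
 fixes x0 :: "real^'n"
 assumes dim: "CARD('n) \<ge> 3" and x0: "x0 \<in> Om" and f: "f \<in> L2 (leb Om)"
  and u: "u \<in> W22_gamma x0" "AE x in leb Om. B_M x0 u x = f x"
 shows "AE x in leb Om. integrable (leb Om) (\<lambda>y. G x y *\<^sub>R f y) \<and>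
   u x = (\<integral>y. G x y *\<^sub>R f y \<partial>leb Om) + gamma0 x0 u * of_real (G x x0)
    + (\<Sum>i\<in>UNIV. gamma x0 i u * of_real (dG i x x0))"
proof -
 let ?M = "leb (Om :: (real^'n) set)"
 define c where "c k = (case k of None \<Rightarrow> gamma0 x0 u | Some s \<Rightarrow> gamma x0 s u)" for k
 define w where "w = regular_part x0 u"
 have w: "w x = u x + (\<Sum>k\<in>UNIV. - c k * of_real (Gx x0 k x))" for x
  by (simp add: w_def regular_part_eq c_def sum_negf)
 have "w \<in> W2 2 Om" and t: "has_trace (Om0 x0) 0 1 u (\<lambda>_. 0)" using u by (simp_all add: W22_gamma_def w_def)
 then have wL: "w \<in> L2 ?M" and ex: "\<forall>i. \<exists>v. v \<in> W2 (Suc 0) Om \<and> has_weak_deriv Om i w v"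
  unfolding numeral_2_eq_2 W2.simps(2)[of "Suc 0"] by blast+
 obtain v where v: "\<And>i. v i \<in> W2 (Suc 0) Om" "\<And>i. has_weak_deriv Om i w (v i)"
  using choice[OF ex] by blast
 note v1 = W21D[OF v(1)[folded One_nat_def] open_ball]
 have lap: "AE x in ?M. B_M x0 u x = (\<Sum>i\<in>UNIV. weak_deriv Om i (v i) x)"
  unfolding B_M_def w_def[symmetric] by (rule weak_laplace_AE[OF open_ball v(2) v1(2)])
 have "AE x in ?M. w x = (\<integral>y. G x y *\<^sub>R f y \<partial>?M)"
 proof (rule zero_trace_representation[OF dim x0 v(2) wL v1(1) v1(2) v1(3) _ _ f])
  show "has_trace (Om0 x0) 0 1 w (\<lambda>_. 0)" using outer_trace_add_Gx[OF x0 t, of "\<lambda>k. - c k"] unfolding w[symmetric] .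
  show "AE x in ?M. (\<Sum>i\<in>UNIV. weak_deriv Om i (v i) x) = f x" using lap u(2) by eventually_elim simp
 qed simp
 with Green_potential(1)[OF dim f] show ?thesis
 proof eventually_elim
  case (elim x)
  have "u x = w x + gamma0 x0 u * of_real (G x x0) + (\<Sum>i\<in>UNIV. gamma x0 i u * of_real (dG i x x0))"
   unfolding w_def regular_part_def by simp
  then show ?case using elim by simp
 qed
qed

theorem theorem4:
  fixes x0 :: "real^'n"
    and K :: "(real^'n \<Rightarrow> complex) \<Rightarrow> (real^'n \<Rightarrow> complex)"
    and f :: "real^'n \<Rightarrow> complex"
  assumes dim: "CARD('n) \<ge> 3"
    and x0: "x0 \<in> Om"
    and K_linear: "linear_L2_W22_gamma x0 K"
    and K_continuous: "gamma_continuous x0 K"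
    and f: "f \<in> L2 (lebesgue_on Om)"
  shows "(\<exists>u. solves_problem x0 K f u) \<and>
    (\<forall>u v. solves_problem x0 K f u \<and> solves_problem x0 K f v \<longrightarrow>
       (AE x in lebesgue_on Om. u x = v x)) \<and>
    (\<forall>u. solves_problem x0 K f u \<longrightarrow>
       (AE x in lebesgue_on Om.
          integrable (lebesgue_on Om) (\<lambda>\<xi>. G x \<xi> *\<^sub>R f \<xi>) \<and>
          u x = (\<integral>\<xi>. G x \<xi> *\<^sub>R f \<xi> \<partial>lebesgue_on Om)
            + gamma0 x0 (K f) * of_real (G x x0)
            + (\<Sum>i\<in>UNIV. gamma x0 i (K f) * of_real (dG i x x0))))"
proof -
 let ?M = "lebesgue_on (Om :: (real^'n) set)"
 \<comment> \<open>The equation gives \<open>B_M x0 u = f\<close> only almost everywhere, so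
   \<open>K\<close> may return different functions for the two arguments; these agree almost
   everywhere, and the functionals do not see the difference.\<close>
 have gK: "gamma0 x0 (K g) = gamma0 x0 (K f)" "gamma x0 s (K g) = gamma x0 s (K f)"
  if ae: "AE x in ?M. g x = f x" for g s
 proof -
  have "AE x in ?M. f x = g x" using ae by eventually_elim simp
  then have "g \<in> L2 ?M" by (intro L2_cong_AE[OF _ f]) simp_all
  then have "AE x in ?M. K g x = K f x"
   using K_linear f ae unfolding linear_L2_W22_gamma_def by blast
  then show "gamma0 x0 (K g) = gamma0 x0 (K f)" "gamma x0 s (K g) = gamma x0 s (K f)"
   by (rule gamma_cong_AE)+
 qed
 have rep: "AE x in ?M. integrable ?M (\<lambda>\<xi>. G x \<xi> *\<^sub>R f \<xi>) \<and>
   u x = (\<integral>\<xi>. G x \<xi> *\<^sub>R f \<xi> \<partial>?M) + gamma0 x0 (K f) * of_real (G x x0)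
    + (\<Sum>i\<in>UNIV. gamma x0 i (K f) * of_real (dG i x x0))"
  if "solves_problem x0 K f u" for u
 proof -
  have u: "u \<in> W22_gamma x0" "gamma0 x0 u = gamma0 x0 (K (B_M x0 u))"
   "\<And>s. gamma x0 s u = gamma x0 s (K (B_M x0 u))" "AE x in ?M. B_M x0 u x = f x"
   using that unfolding solves_problem_def AE_Om0 by blast+
  show ?thesis
   using W22_gamma_representation[OF dim x0 f u(1,4)] unfolding u(2,3) gK[OF u(4)] .
 qed
 \<comment> \<open>The coefficients are taken from \<open>K f\<close>, which is known before
   \<open>u\<close>, so the nonlocal conditions hold by construction.\<close>
 obtain u where u: "u \<in> W22_gamma x0" "gamma0 x0 u = gamma0 x0 (K f)" "\<And>s. gamma x0 s u = gamma x0 s (K f)"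
  "AE x in ?M. B_M x0 u x = f x"
  using singular_solution[OF dim x0 f, of "\<lambda>k. case k of None \<Rightarrow> gamma0 x0 (K f) | Some s \<Rightarrow> gamma x0 s (K f)"] by auto
 have "solves_problem x0 K f u"
  using u unfolding solves_problem_def AE_Om0 gK[OF u(4)] by (simp add: W22_gamma_def)
 \<comment> \<open>The right-hand side of the representation does not involve the solution, so any
   two solutions agree almost everywhere.\<close>
 moreover have "AE x in ?M. u x = v x" if "solves_problem x0 K f u" "solves_problem x0 K f v" for u v
  using rep[OF that(1)] rep[OF that(2)] by eventually_elim simp
 ultimately show ?thesis using rep by blast
qed

end
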